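(* Let $l\ge-\frac12$ and let $H=H_l+q$ on $(0,b)$ be the perturbed spherical Schrödinger operator with $q$ satisfying the integrability hypothesis stated in the context. Let $\phi(z,x)$ be the real entire solution which lies in the domain of $H$ near $0$ and satisfies, as $|z|\to\infty$, $$\phi(z,x)=z^{-\frac{l+1}{2}}\Big(\sin\big(\sqrt z\,x-\tfrac{l\pi}{2}\big)+o\big(e^{x|\operatorname{Im}\sqrt z|}\big)\Big),\qquad \phi'(z,x)=z^{-\frac l2}\Big(\cos\big(\sqrt z\,x-\tfrac{l\pi}{2}\big)+o\big(e^{x|\operatorname{Im}\sqrt z|}\big)\Big),$$ and let $\rho$ be the associated spectral measure. Then there is a choice of $\theta(z,x)$ such that $$M(z)=(1+z^2)^k\int_{\mathbb{R}}\left(\frac1{\lambda-z}-\frac{\lambda}{1+\lambda^2}\right)\frac{d\rho(\lambda)}{(1+\lambda^2)^k},\qquad k=\left\lceil\frac{l+1}{2}\right\rceil.$$ In particular, $M(z)\in N_\kappa^\infty$ for some $\kappa\le k$.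
   Context: $H_l=-\frac{d^2}{dx^2}+\frac{l(l+1)}{x^2}$ on $(0,b)$, $0<b\le\infty$, $l\ge-\frac12$, with boundary condition $\lim_{x\to0}x^l((l+1)f(x)-xf'(x))=0$ at $x=0$ for $l\in[-\frac12,\frac12)$. $H=H_l+q$ is a self-adjoint operator in $L^2(0,b)$ with the same boundary condition at $0$ as $H_l$ (and a boundary condition at $b$ if $b$ is limit circle). Hypothesis on $q$: $q\in L^1_{\mathrm{loc}}(0,\infty)$ is real-valued and $x\tilde q(x)\in L^1(0,1)$, where $\tilde q=|q|$ if $l>-\frac12$ and $\tilde q(x)=(1-\log x)|q(x)|$ if $l=-\frac12$. It is known that a real entire solution $\phi(z,x)$ of $-u''+\big(\frac{l(l+1)}{x^2}+q\big)u=zu$ as in the claim exists; it has growth order $\frac12$ in $z$. A solution lies in the domain of $H$ near an endpoint if it is square integrable near it and satisfies the boundary condition of $H$ there in the limit circle case. All branch cuts are along the negative real axis. A choice of $\theta(z,x)$ means a second solution, entire in $z$ and real for real $z$, with Wronskian $W(\theta(z),\phi(z))=\theta\phi'-\theta'\phi=1$. The singular Weyl $m$-function $M(z)$, analytic in $\mathbb{C}\setminus\mathbb{R}$, is defined by requiring that $\theta(z,x)+M(z)\phi(z,x)$ lie in the domain of $H$ near $b$. The spectral measure $\rho$ is the Borel measure with $\frac12\big(\rho((\lambda_0,\lambda_1))+\rho([\lambda_0,\lambda_1])\big)=\lim_{\varepsilon\downarrow0}\frac1\pi\int_{\lambda_0}^{\lambda_1}\operatorname{Im}M(\lambda+i\varepsilon)\,d\lambda$;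 it does not depend on the choice of $\theta$. $N_\kappa$, $\kappa\in\mathbb{N}_0$, is the set of functions $M$ meromorphic in $\mathbb{C}\setminus\mathbb{R}$ with $M(z)=M(z^* )^*$ on the domain of holomorphy $\mathcal{D}_M$, such that for all finite sets $z_1,\dots,z_n\in\mathcal{D}_M$ the matrix $\big(\frac{M(z_j)-M(z_k)^*}{z_j-z_k^*}\big)_{j,k}$ has at most $\kappa$ negative eigenvalues, and exactly $\kappa$ for some choice. For $M\in N_\kappa$, $\kappa\ge1$, $\lambda_0\in\mathbb{R}$ is a generalized pole of nonpositive type if $\limsup_{\varepsilon\downarrow0}\varepsilon|M(\lambda_0+i\varepsilon)|=\infty$ or $\lim_{\varepsilon\downarrow0}(-i\varepsilon)M(\lambda_0+i\varepsilon)$ exists and is finite and negative; $\infty$ is one if $\limsup_{y\uparrow\infty}|M(iy)|/y=\infty$ or $\lim_{y\uparrow\infty}M(iy)/(iy)$ exists and is finite and negative. $N_\kappa^\infty\subset N_\kappa$ is the subclass of functions with no nonreal poles and whose only generalized pole of nonpositive type is at $\infty$ ($N_0^\infty=N_0$, the Herglotz--Nevanlinna functions). *)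

theory Defs
  imports
    "HOL-Complex_Analysis.Complex_Analysis"
    "HOL-Library.Landau_Symbols"
    "Jordan_Normal_Form.Char_Poly"
begin

section \<open>The perturbed spherical Schroedinger operator\<close>

text \<open>
  Throughout, \<open>b :: ereal\<close> is the right endpoint (possibly \<open>\<infinity>\<close>), so that
  \<open>einterval 0 b\<close> is the interval (0,b).
\<close>

definition potential_ok :: "real \<Rightarrow> (real \<Rightarrow> real) \<Rightarrow> bool" where
  "potential_ok l q \<longleftrightarrow>
     (\<forall>c d. 0 < c \<and> c < d \<longrightarrow> q absolutely_integrable_on {c..d}) \<and>
     (\<lambda>x. x * (if l > -1/2 then \<bar>q x\<bar> else (1 - ln x) * \<bar>q x\<bar>))
        absolutely_integrable_on {0<..<1}"

abbreviation dx :: "(real \<Rightarrow> complex) \<Rightarrow> real \<Rightarrow> complex" where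
  "dx u x \<equiv> vector_derivative u (at x)"

text \<open>
  As \<open>q\<close> is only locally integrable, the equation -u'' + (l(l+1)/x^2 + q) u = z u is understood in
  the usual sense: \<open>u\<close> and \<open>u'\<close> are locally absolutely continuous and the equation holds almost
  everywhere. Equivalently, \<open>u\<close> is differentiable and \<open>u'\<close> is an indefinite integral of
  (l(l+1)/x^2 + q - z) u, a product of a locally integrable and a continuous function.
\<close>

definition solution ::
    "real \<Rightarrow> ereal \<Rightarrow> (real \<Rightarrow> real) \<Rightarrow> complex \<Rightarrow> (real \<Rightarrow> complex) \<Rightarrow> bool" where
  "solution l b q z u \<longleftrightarrow>
     (\<forall>x \<in> einterval 0 b. u differentiable (at x)) \<and>
     (\<forall>c \<in> einterval 0 b. \<forall>d \<in> einterval 0 b. c \<le> d \<longrightarrow>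
        ((\<lambda>x. (of_real (l * (l + 1) / x\<^sup>2 + q x) - z) * u x) has_integral (dx u d - dx u c)) {c..d})"

definition wronskian :: "(real \<Rightarrow> complex) \<Rightarrow> (real \<Rightarrow> complex) \<Rightarrow> real \<Rightarrow> complex" where
  "wronskian u v x = u x * dx v x - dx u x * v x"

definition sq_integrable_near_0 :: "ereal \<Rightarrow> (real \<Rightarrow> complex) \<Rightarrow> bool" where
  "sq_integrable_near_0 b u \<longleftrightarrow>
     (\<exists>c \<in> einterval 0 b. (\<lambda>x. (norm (u x))\<^sup>2) absolutely_integrable_on {0<..<c})"

definition sq_integrable_near_b :: "ereal \<Rightarrow> (real \<Rightarrow> complex) \<Rightarrow> bool" where
  "sq_integrable_near_b b u \<longleftrightarrow>
     (\<exists>c \<in> einterval 0 b. (\<lambda>x. (norm (u x))\<^sup>2) absolutely_integrable_on (einterval (ereal c) b))"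

text \<open>
  At 0 the operator is in the limit circle case exactly for l < 1/2, and the boundary condition is
  that of the unperturbed operator.
\<close>

definition in_domain_near_0 :: "real \<Rightarrow> ereal \<Rightarrow> (real \<Rightarrow> complex) \<Rightarrow> bool" where
  "in_domain_near_0 l b u \<longleftrightarrow>
     sq_integrable_near_0 b u \<and>
     (l < 1/2 \<longrightarrow>
       ((\<lambda>x. of_real (x powr l) * (of_real (l + 1) * u x - of_real x * dx u x)) \<longlongrightarrow> 0) (at_right 0))"

definition limit_circle_at_b :: "real \<Rightarrow> ereal \<Rightarrow> (real \<Rightarrow> real) \<Rightarrow> bool" where
  "limit_circle_at_b l b q \<longleftrightarrow> (\<forall>z u. solution l b q z u \<longrightarrow> sq_integrable_near_b b u)"

text \<open>
  In the limit circle case at \<open>b\<close>, the self-adjoint (separated) boundary conditions are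
  W(v,f)(b-) = 0, where \<open>v\<close> is a nontrivial real solution for some real spectral parameter. For a
  regular endpoint these are the conditions v(b) f'(b) - v'(b) f(b) = 0. The function \<open>v\<close> is thus
  the datum that, together with \<open>l\<close>, \<open>b\<close> and \<open>q\<close>, determines the self-adjoint operator H; in the
  limit point case it plays no role.
\<close>

definition boundary_datum_at_b ::
    "real \<Rightarrow> ereal \<Rightarrow> (real \<Rightarrow> real) \<Rightarrow> (real \<Rightarrow> real) \<Rightarrow> bool" where
  "boundary_datum_at_b l b q v \<longleftrightarrow>
     (limit_circle_at_b l b q \<longrightarrow>
        (\<exists>r::real. solution l b q (of_real r) (\<lambda>x. of_real (v x))) \<and>
        (\<exists>x \<in> einterval 0 b. v x \<noteq> 0))"

definition in_domain_near_b ::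
    "real \<Rightarrow> ereal \<Rightarrow> (real \<Rightarrow> real) \<Rightarrow> (real \<Rightarrow> real) \<Rightarrow> (real \<Rightarrow> complex) \<Rightarrow> bool" where
  "in_domain_near_b l b q v u \<longleftrightarrow>
     sq_integrable_near_b b u \<and>
     (limit_circle_at_b l b q \<longrightarrow>
       ((\<lambda>x. wronskian (\<lambda>y. of_real (v y)) u (real_of_ereal x)) \<longlongrightarrow> 0) (at_left b))"

section \<open>Entire solutions, the singular Weyl function and the spectral measure\<close>

definition real_entire_solution ::
    "real \<Rightarrow> ereal \<Rightarrow> (real \<Rightarrow> real) \<Rightarrow> (complex \<Rightarrow> real \<Rightarrow> complex) \<Rightarrow> bool" where
  "real_entire_solution l b q u \<longleftrightarrow>
     (\<forall>z. solution l b q z (u z)) \<and>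
     (\<forall>x \<in> einterval 0 b. (\<lambda>z. u z x) holomorphic_on UNIV) \<and>
     (\<forall>x \<in> einterval 0 b. \<forall>z \<in> \<real>. u z x \<in> \<real>)"

text \<open>
  In HOL, \<open>z powr a\<close> and \<open>csqrt z\<close> use the principal branch, cut along the negative real axis. The
  terms \<open>z\<^sup>a o(e)\<close> are written as \<open>o(z\<^sup>a e)\<close>.
\<close>

definition phi_asymptotics :: "real \<Rightarrow> ereal \<Rightarrow> (complex \<Rightarrow> real \<Rightarrow> complex) \<Rightarrow> bool" where
  "phi_asymptotics l b \<phi> \<longleftrightarrow>
     (\<forall>x \<in> einterval 0 b.
       (\<lambda>z. \<phi> z x
             - z powr of_real (- (l + 1) / 2) * sin (csqrt z * of_real x - of_real (l * pi / 2)))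
         \<in> o[at_infinity](\<lambda>z. z powr of_real (- (l + 1) / 2) * of_real (exp (x * \<bar>Im (csqrt z)\<bar>))) \<and>
       (\<lambda>z. dx (\<phi> z) x
             - z powr of_real (- l / 2) * cos (csqrt z * of_real x - of_real (l * pi / 2)))
         \<in> o[at_infinity](\<lambda>z. z powr of_real (- l / 2) * of_real (exp (x * \<bar>Im (csqrt z)\<bar>))))"

definition second_solution ::
    "real \<Rightarrow> ereal \<Rightarrow> (real \<Rightarrow> real) \<Rightarrow> (complex \<Rightarrow> real \<Rightarrow> complex) \<Rightarrow>
     (complex \<Rightarrow> real \<Rightarrow> complex) \<Rightarrow> bool" where
  "second_solution l b q \<phi> \<theta> \<longleftrightarrow>
     real_entire_solution l b q \<theta> \<and>
     (\<forall>z. \<forall>x \<in> einterval 0 b. wronskian (\<theta> z) (\<phi> z) x = 1)"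

text \<open>Only the values of \<open>M\<close> off the real axis are meaningful.\<close>

definition singular_weyl_function ::
    "real \<Rightarrow> ereal \<Rightarrow> (real \<Rightarrow> real) \<Rightarrow> (real \<Rightarrow> real) \<Rightarrow> (complex \<Rightarrow> real \<Rightarrow> complex) \<Rightarrow>
     (complex \<Rightarrow> real \<Rightarrow> complex) \<Rightarrow> (complex \<Rightarrow> complex) \<Rightarrow> bool" where
  "singular_weyl_function l b q v \<phi> \<theta> M \<longleftrightarrow>
     M holomorphic_on (- \<real>) \<and>
     (\<forall>z \<in> - \<real>. in_domain_near_b l b q v (\<lambda>x. \<theta> z x + M z * \<phi> z x))"

text \<open>
  Two choices of \<open>\<theta>\<close> differ by \<open>f(z) \<phi>\<close> with \<open>f\<close> real entire, so the measure does not depend on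
  the choice of \<open>\<theta>\<close> used to express it.
\<close>

definition spectral_measure ::
    "real \<Rightarrow> ereal \<Rightarrow> (real \<Rightarrow> real) \<Rightarrow> (real \<Rightarrow> real) \<Rightarrow> (complex \<Rightarrow> real \<Rightarrow> complex) \<Rightarrow>
     real measure \<Rightarrow> bool" where
  "spectral_measure l b q v \<phi> \<rho> \<longleftrightarrow>
     sets \<rho> = sets borel \<and>
     (\<forall>t0 t1. emeasure \<rho> {t0..t1} < \<infinity>) \<and>
     (\<exists>\<theta> M. second_solution l b q \<phi> \<theta> \<and> singular_weyl_function l b q v \<phi> \<theta> M \<and>
        (\<forall>t0 t1. t0 < t1 \<longrightarrow>
          ((\<lambda>\<epsilon>. 1 / pi * integral {t0..t1} (\<lambda>t. Im (M (Complex t \<epsilon>))))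
             \<longlongrightarrow> 1 / 2 * (measure \<rho> {t0<..<t1} + measure \<rho> {t0..t1})) (at_right 0)))"

section \<open>Generalized Nevanlinna functions\<close>

definition holomorphy_domain :: "(complex \<Rightarrow> complex) \<Rightarrow> complex set" where
  "holomorphy_domain M = {z \<in> - \<real>. M analytic_on {z}}"

definition num_neg_eigenvalues :: "complex mat \<Rightarrow> nat" where
  "num_neg_eigenvalues A =
     (\<Sum>e | eigenvalue A e \<and> e \<in> \<real> \<and> Re e < 0. Polynomial.order e (char_poly A))"

definition nevanlinna_matrix :: "(complex \<Rightarrow> complex) \<Rightarrow> complex list \<Rightarrow> complex mat" where
  "nevanlinna_matrix M zs = Matrix.mat (length zs) (length zs)
     (\<lambda>(j, k). (M (zs ! j) - cnj (M (zs ! k))) / (zs ! j - cnj (zs ! k)))"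

text \<open>
  The kernel (M(z) - M(w)^*)/(z - w^*) is defined only for z different from w^* (in HOL, 0/0 = 0),
  so the points are chosen such that all entries of the matrix make sense.
\<close>

definition admissible_points :: "(complex \<Rightarrow> complex) \<Rightarrow> complex list \<Rightarrow> bool" where
  "admissible_points M zs \<longleftrightarrow>
     distinct zs \<and> set zs \<subseteq> holomorphy_domain M \<and> (\<forall>z \<in> set zs. \<forall>w \<in> set zs. z \<noteq> cnj w)"

definition N_class :: "nat \<Rightarrow> (complex \<Rightarrow> complex) set" where
  "N_class \<kappa> = {M.
     M meromorphic_on (- \<real>) \<and>
     (\<forall>z \<in> holomorphy_domain M. M z = cnj (M (cnj z))) \<and>
     (\<forall>zs. admissible_points M zs \<longrightarrow> num_neg_eigenvalues (nevanlinna_matrix M zs) \<le> \<kappa>) \<and>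
     (\<exists>zs. admissible_points M zs \<and> num_neg_eigenvalues (nevanlinna_matrix M zs) = \<kappa>)}"

definition gen_pole_nonpos_type :: "(complex \<Rightarrow> complex) \<Rightarrow> real \<Rightarrow> bool" where
  "gen_pole_nonpos_type M t0 \<longleftrightarrow>
     Limsup (at_right 0) (\<lambda>\<epsilon>::real. ereal (\<epsilon> * norm (M (Complex t0 \<epsilon>)))) = \<infinity> \<or>
     (\<exists>c::real. c < 0 \<and>
        ((\<lambda>\<epsilon>::real. - \<i> * of_real \<epsilon> * M (Complex t0 \<epsilon>)) \<longlongrightarrow> of_real c) (at_right 0))"

definition gen_pole_nonpos_type_infinity :: "(complex \<Rightarrow> complex) \<Rightarrow> bool" where
  "gen_pole_nonpos_type_infinity M \<longleftrightarrow>
     Limsup at_top (\<lambda>y::real. ereal (norm (M (\<i> * of_real y)) / y)) = \<infinity> \<or>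
     (\<exists>c::real. c < 0 \<and>
        ((\<lambda>y::real. M (\<i> * of_real y) / (\<i> * of_real y)) \<longlongrightarrow> of_real c) at_top)"

definition N_class_infinity :: "nat \<Rightarrow> (complex \<Rightarrow> complex) set" where
  "N_class_infinity \<kappa> =
     (if \<kappa> = 0 then N_class 0
      else {M \<in> N_class \<kappa>.
              (\<forall>z \<in> - \<real>. \<not> is_pole M z) \<and>
              (\<forall>t0. \<not> gen_pole_nonpos_type M t0) \<and>
              gen_pole_nonpos_type_infinity M})"

end

theory Submission
  imports Defs "HOL-Real_Asymp.Real_Asymp" "Jordan_Normal_Form.Jordan_Normal_Form_Existence"
begin

text \<open>
  By Lagrange's identity, for every x the functions \<open>\<phi> (\<theta> + M \<phi>)\<close> and \<open>\<phi>' (\<theta>' + M \<phi>')\<close> are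
  Herglotz functions of z. The first has the form \<open>A + B\<^sup>2 M\<close> with A and \<open>B = \<phi>(z, x)\<close> real entire, so
  \<open>B\<^sup>2 / (1 + \<lambda>\<^sup>2)\<close> is integrable for the spectral measure, and likewise for \<open>\<phi>'\<close>. The asymptotics of
  \<open>\<phi>\<close> and \<open>\<phi>'\<close> give \<open>\<phi>\<^sup>2 + \<phi>'\<^sup>2 \<ge> c |\<lambda>|\<^bsup>-(l+1)\<^esup>\<close> for large real \<open>\<lambda>\<close>, because sine and cosine do
  not vanish simultaneously; hence \<open>(1 + \<lambda>\<^sup>2)\<^bsup>-k-1\<^esup>\<close> is integrable and the integral of the claim converges.
  It has the same Stieltjes inversion as M, so that the difference F of the two continues across the real axis
  to a real entire function, and \<open>\<theta> - F \<phi>\<close> is the required second solution.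
\<close>

text \<open>All signs come from one monotone quantity: for Im z > 0 the imaginary part of cnj u u'
  is nonincreasing along every solution u. For phi it starts at 0 at the left endpoint, for the Weyl
  solution psi = theta + M phi it ends at 0 at b, so it is nonpositive for phi and nonnegative for
  psi; with W(psi, phi) = 1 this makes phi psi and phi' psi' Herglotz. The analytic work lies in the
  two boundary limits: at 0 the potential q is only integrable against a weight, and at b only
  square integrability is known in the limit point case. Stieltjes inversion controls M only through
  limits of integrals of Im M. Near a real point phi or phi' is nonzero, and the Herglotz function
  then bounds M by a multiple of 1 / Im z; this a priori growth turns equal inversion limits into
  analytic continuation. The exponent k enters twice: l + 1 \<le> 2 k makes the integral converge,
  and the polynomial regularizing the kernel has degree at most 2 k, so that it disappears on a
  subspace of codimension at most k; hence \<kappa> \<le> k.\<close>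

section \<open>Integration by parts for indefinite integrals\<close>

lemma absolutely_integrable_mult_continuous:
  fixes f g :: "real \<Rightarrow> complex"
  assumes "continuous_on {c..d} f" "g absolutely_integrable_on {c..d}"
  shows "(\<lambda>x. f x * g x) absolutely_integrable_on {c..d}"
proof (rule absolutely_integrable_bounded_measurable_product[OF bilinear_times _ _ _ assms(2)])
  show "f \<in> borel_measurable (lebesgue_on {c..d})"
    by (intro continuous_imp_measurable_on_sets_lebesgue assms) auto
  show "bounded (f ` {c..d})"
    by (intro compact_imp_bounded compact_continuous_image assms) auto
qed auto

text \<open>\<open>V\<close> is only an indefinite integral of an integrable function, so
  \<open>U V\<close> need not have a derivative at a given point and the fundamental theorem does
  not apply. Instead, the defect of the formula is additive in the interval and bounded by the
  oscillation of \<open>U\<close> and \<open>V\<close> times an integral; subdivision makes it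
  arbitrarily small.\<close>

lemma product_rule_indefinite_integral:
  fixes U V U' g :: "real \<Rightarrow> complex"
  assumes cd: "c \<le> d"
    and U: "\<And>x. x \<in> {c..d} \<Longrightarrow> (U has_vector_derivative U' x) (at x within {c..d})"
    and U': "continuous_on {c..d} U'"
    and g: "g absolutely_integrable_on {c..d}"
    and V: "\<And>x. x \<in> {c..d} \<Longrightarrow> (g has_integral (V x - V c)) {c..x}"
  shows "((\<lambda>x. U x * g x + U' x * V x) has_integral (U d * V d - U c * V c)) {c..d}"
proof -
  have gi: "g integrable_on {c..d}" and ngi: "(\<lambda>x. norm (g x)) integrable_on {c..d}"
    using g by (auto simp: absolutely_integrable_on_def)
  have cU: "continuous_on {c..d} U"
    using U by (meson continuous_on_eq_continuous_within has_vector_derivative_continuous)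
  have cV: "continuous_on {c..d} V"
  proof -
    have "continuous_on {c..d} (\<lambda>x. integral {c..x} g + V c)"
      by (intro continuous_intros indefinite_integral_continuous_1 gi)
    moreover have "integral {c..x} g + V c = V x" if "x \<in> {c..d}" for x
      using V[OF that] by (simp add: integral_unique)
    ultimately show ?thesis by (rule continuous_on_eq)
  qed
  define h where "h = (\<lambda>x. U x * g x + U' x * V x)"
  define N where "N = (\<lambda>x. norm (g x) + norm (U' x))"
  have Ug: "(\<lambda>x. U x * g x) absolutely_integrable_on {c..d}"
    by (rule absolutely_integrable_mult_continuous[OF cU g])
  have UV: "(\<lambda>x. U' x * V x) integrable_on {c..d}"
    by (intro integrable_continuous_real continuous_intros U' cV)
  have hi: "h integrable_on {c..d}"
    unfolding h_def using Ug UV by (intro integrable_add) (auto simp: absolutely_integrable_on_def)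
  have Ni: "N integrable_on {c..d}"
    unfolding N_def
    by (intro integrable_add ngi integrable_continuous_real continuous_on_norm U')
  have sub: "f integrable_on {a..b}" if "f integrable_on {c..d}" "c \<le> a" "b \<le> d"
    for f :: "real \<Rightarrow> 'a::banach" and a b
    using integrable_subinterval_real[OF that(1)] that by auto
  \<comment> \<open>The defect of the claimed identity over [a, b].\<close>
  define E where "E = (\<lambda>a b. U b * V b - U a * V a - integral {a..b} h)"
  have loc: "norm (E a b) \<le> e * integral {a..b} N"
    if ab: "c \<le> a" "a \<le> b" "b \<le> d" and e: "\<And>t. t \<in> {a..b} \<Longrightarrow> norm (U b - U t) \<le> e"
      "\<And>t. t \<in> {a..b} \<Longrightarrow> norm (V a - V t) \<le> e" for a b e
  proof -
    have subs: "{a..b} \<subseteq> {c..d}" using ab by auto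
    have g1: "(g has_integral (V b - V a)) {a..b}"
    proof -
      have "integral {c..a} g + integral {a..b} g = integral {c..b} g"
        using ab by (intro Henstock_Kurzweil_Integration.integral_combine sub[OF gi]) auto
      then have "integral {a..b} g = V b - V a"
        using V[of a] V[of b] ab by (auto simp: integral_unique algebra_simps)
      then show ?thesis using sub[OF gi] ab by (metis has_integral_integral)
    qed
    have U1: "(U' has_integral (U b - U a)) {a..b}"
      using ab by (intro fundamental_theorem_of_calculus)
        (auto intro: has_vector_derivative_within_subset[OF U subs])
    have h1: "(h has_integral integral {a..b} h) {a..b}"
      using sub[OF hi] ab by auto
    \<comment> \<open>Freezing \<open>U\<close> at the right end and \<open>V\<close> at the left
      end gives an integrand whose integral over [a, b] is exactly
      \<open>U b * V b - U a * V a\<close>.\<close>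
    have "((\<lambda>t. U b * g t + U' t * V a - h t) has_integral (U b * (V b - V a) + (U b - U a) * V a - integral {a..b} h)) {a..b}"
      by (intro has_integral_add has_integral_diff has_integral_mult_right has_integral_mult_left g1 U1 h1)
    moreover have "U b * (V b - V a) + (U b - U a) * V a - integral {a..b} h = E a b"
      by (simp add: E_def algebra_simps)
    ultimately have *: "((\<lambda>t. U b * g t + U' t * V a - h t) has_integral E a b) {a..b}" by simp
    have "norm (integral {a..b} (\<lambda>t. U b * g t + U' t * V a - h t)) \<le> integral {a..b} (\<lambda>t. e * N t)"
    proof (rule integral_norm_bound_integral)
      show "(\<lambda>t. U b * g t + U' t * V a - h t) integrable_on {a..b}" using * by auto
      show "(\<lambda>t. e * N t) integrable_on {a..b}" using sub[OF Ni] ab by (auto intro: integrable_on_mult_right)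
      fix t assume t: "t \<in> {a..b}"
      have "norm (U b * g t + U' t * V a - h t) = norm ((U b - U t) * g t + U' t * (V a - V t))"
        by (simp add: h_def algebra_simps)
      also have "\<dots> \<le> norm (U b - U t) * norm (g t) + norm (U' t) * norm (V a - V t)"
        by (metis norm_mult norm_triangle_ineq)
      also have "\<dots> \<le> e * norm (g t) + norm (U' t) * e"
        by (intro add_mono mult_right_mono mult_left_mono e t) auto
      finally show "norm (U b * g t + U' t * V a - h t) \<le> e * N t" by (simp add: N_def algebra_simps)
    qed
    then show ?thesis using * by (simp add: integral_unique)
  qed
  have "norm (E c d) \<le> e * integral {c..d} N" if "e > 0" for e
  proof -
    have "uniformly_continuous_on {c..d} U" "uniformly_continuous_on {c..d} V"
      using cU cV by (auto intro: compact_uniformly_continuous)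
    then obtain d1 d2 where d1: "d1 > 0" "\<forall>x\<in>{c..d}. \<forall>y\<in>{c..d}. dist y x < d1 \<longrightarrow> dist (U y) (U x) < e"
      and d2: "d2 > 0" "\<forall>x\<in>{c..d}. \<forall>y\<in>{c..d}. dist y x < d2 \<longrightarrow> dist (V y) (V x) < e"
      unfolding uniformly_continuous_on_def using \<open>e > 0\<close> by metis
    define P where "P a b \<longleftrightarrow> (c \<le> a \<and> b \<le> d \<longrightarrow> norm (E a b) \<le> e * integral {a..b} N)" for a b
    \<comment> \<open>Bisection: the bound holds on all short intervals by uniform continuity and is
      inherited by unions of adjacent intervals.\<close>
    have "P c d"
      using cd
    proof (induct rule: Bolzano)
      case (trans x y z)
      show ?case unfolding P_def
      proof (intro impI)
        assume as: "c \<le> x \<and> z \<le> d"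
        have "integral {x..y} h + integral {y..z} h = integral {x..z} h"
             "integral {x..y} N + integral {y..z} N = integral {x..z} N"
          using as trans by (auto intro!: Henstock_Kurzweil_Integration.integral_combine sub[OF hi] sub[OF Ni])
        moreover from this have "E x z = E x y + E y z" unfolding E_def by (auto simp: algebra_simps)
        moreover have "norm (E x y) \<le> e * integral {x..y} N" "norm (E y z) \<le> e * integral {y..z} N"
          using as trans by (auto simp: P_def)
        ultimately show "norm (E x z) \<le> e * integral {x..z} N"
          by (metis add_mono distrib_left norm_triangle_mono)
      qed
    next
      case (local x)
      show ?case unfolding P_def
      proof (intro exI[of _ "min d1 d2"] conjI allI impI)
        fix a b assume ab: "a \<le> x \<and> x \<le> b \<and> b - a < min d1 d2" "c \<le> a \<and> b \<le> d"
        show "norm (E a b) \<le> e * integral {a..b} N"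
        proof (rule loc)
          fix t assume t: "t \<in> {a..b}"
          show "norm (U b - U t) \<le> e"
            using d1(2)[rule_format, of t b] ab t by (auto simp: dist_norm)
          show "norm (V a - V t) \<le> e"
            using d2(2)[rule_format, of t a] ab t by (auto simp: dist_norm)
        qed (use ab in auto)
      qed (use d1 d2 in auto)
    qed
    then show ?thesis by (simp add: P_def)
  qed
  then have *: "norm (E c d) \<le> e * integral {c..d} N" if "e > 0" for e using that by blast
  have "norm (E c d) \<le> 0"
  proof (rule field_le_epsilon)
    fix e :: real assume "e > 0"
    have N0: "integral {c..d} N \<ge> 0" by (intro integral_nonneg Ni) (auto simp: N_def)
    then have "norm (E c d) \<le> e / (integral {c..d} N + 1) * integral {c..d} N"
      using \<open>e > 0\<close> by (intro *) auto
    also have "\<dots> \<le> e" using N0 \<open>e > 0\<close> by (simp add: field_simps)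
    finally show "norm (E c d) \<le> 0 + e" by simp
  qed
  then have "E c d = 0" by (metis norm_le_zero_iff)
  then have "integral {c..d} h = U d * V d - U c * V c" unfolding E_def by (metis eq_iff_diff_eq_0)
  then show ?thesis using hi unfolding h_def by (metis has_integral_integral)
qed

section \<open>Sturm-Liouville equations\<close>

text \<open>The equation is u'' = A u with the spectral parameter absorbed into \<open>A\<close>, so
  that one Lagrange identity compares solutions for different parameters and different potentials.
  The regularity of \<open>I\<close> and \<open>A\<close> is carried along with the
  solution.\<close>

definition sl_solution :: "real set \<Rightarrow> (real \<Rightarrow> complex) \<Rightarrow> (real \<Rightarrow> complex) \<Rightarrow> bool" where
  "sl_solution I A u \<longleftrightarrow> open I \<and> is_interval I \<and> (\<forall>x\<in>I. u differentiable (at x)) \<and>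
     (\<forall>c\<in>I. \<forall>d\<in>I. c \<le> d \<longrightarrow> A absolutely_integrable_on {c..d} \<and>
        ((\<lambda>x. A x * u x) has_integral (dx u d - dx u c)) {c..d})"

lemma interval_Icc: "is_interval I \<Longrightarrow> c \<in> I \<Longrightarrow> d \<in> I \<Longrightarrow> x \<in> {c..d} \<Longrightarrow> x \<in> (I::real set)"
  by (meson atLeastAtMost_iff mem_is_interval_1_I)

lemma sl_solution_deriv:
  assumes "sl_solution I A u" "x \<in> I"
  shows "(u has_vector_derivative dx u x) (at x)"
  using assms by (auto simp: sl_solution_def vector_derivative_works)

lemma sl_solution_cont:
  assumes "sl_solution I A u"
  shows "continuous_on I u"
  using sl_solution_deriv[OF assms] by (meson continuous_at_imp_continuous_on has_vector_derivative_continuous)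

lemma sl_solution_cont_dx:
  assumes "sl_solution I A u"
  shows "continuous_on I (dx u)"
proof (rule continuous_at_imp_continuous_on, rule ballI)
  fix x assume "x \<in> I"
  have "open I" using assms by (auto simp: sl_solution_def)
  then obtain e where e: "e > 0" "cball x e \<subseteq> I" using \<open>x \<in> I\<close> open_contains_cball by blast
  define c d where "c = x - e" and "d = x + e"
  have cd: "c \<in> I" "d \<in> I" "x \<in> {c<..<d}" using e by (auto simp: c_def d_def subset_iff dist_real_def)
  have I: "is_interval I" using assms by (auto simp: sl_solution_def)
  have "continuous_on {c..d} (\<lambda>y. integral {c..y} (\<lambda>x. A x * u x) + dx u c)"
  proof (intro continuous_intros indefinite_integral_continuous_1)
    have "((\<lambda>x. A x * u x) has_integral (dx u d - dx u c)) {c..d}"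
      using assms cd I by (auto simp: sl_solution_def)
    then show "(\<lambda>x. A x * u x) integrable_on {c..d}" by blast
  qed
  moreover have "integral {c..y} (\<lambda>x. A x * u x) + dx u c = dx u y" if "y \<in> {c..d}" for y
  proof -
    have "y \<in> I" using interval_Icc[OF I cd(1,2) that] .
    then have "((\<lambda>x. A x * u x) has_integral (dx u y - dx u c)) {c..y}" using assms that cd by (auto simp: sl_solution_def)
    then show ?thesis by (simp add: integral_unique)
  qed
  ultimately have "continuous_on {c..d} (dx u)" by (rule continuous_on_eq)
  then show "isCont (dx u) x" using cd(3)
    by (metis continuous_on_interior interior_atLeastAtMost_real)
qed

text \<open>Integration by parts is applied to u v' and to v u'; the terms u' v' cancel in the
  difference.\<close>

lemma sl_solution_lagrange:
  assumes u: "sl_solution I A u" and v: "sl_solution I B v" and c: "c \<in> I" and d: "d \<in> I" and cd: "c \<le> d"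
  shows "((\<lambda>x. (B x - A x) * u x * v x) has_integral (wronskian u v d - wronskian u v c)) {c..d}"
proof -
  have I: "is_interval I" using u by (auto simp: sl_solution_def)
  have sub: "{c..d} \<subseteq> I" using interval_Icc[OF I c d] by blast
  have main: "((\<lambda>x. u x * (B x * v x) + dx u x * dx v x) has_integral (u d * dx v d - u c * dx v c)) {c..d}"
    if u: "sl_solution I A u" and v: "sl_solution I B v" for A B u v
  proof (rule product_rule_indefinite_integral[OF cd])
    show "(u has_vector_derivative dx u x) (at x within {c..d})" if "x \<in> {c..d}" for x
      using sl_solution_deriv[OF u] sub that has_vector_derivative_at_within by blast
    show "continuous_on {c..d} (dx u)" using sl_solution_cont_dx[OF u] sub continuous_on_subset by blast
    have "(\<lambda>x. v x * B x) absolutely_integrable_on {c..d}"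
      using v c d cd sub continuous_on_subset[OF sl_solution_cont[OF v] sub]
      by (intro absolutely_integrable_mult_continuous) (auto simp: sl_solution_def)
    then show "(\<lambda>x. B x * v x) absolutely_integrable_on {c..d}" by (simp add: mult.commute)
    show "((\<lambda>x. B x * v x) has_integral dx v x - dx v c) {c..x}" if "x \<in> {c..d}" for x
      using v c that sub by (auto simp: sl_solution_def)
  qed
  have "((\<lambda>x. (u x * (B x * v x) + dx u x * dx v x) - (v x * (A x * u x) + dx v x * dx u x)) has_integral
     ((u d * dx v d - u c * dx v c) - (v d * dx u d - v c * dx u c))) {c..d}"
    by (intro has_integral_diff main[OF u v] main[OF v u])
  then show ?thesis by (simp add: wronskian_def algebra_simps)
qed

abbreviation eigsol :: "real set \<Rightarrow> (real \<Rightarrow> real) \<Rightarrow> complex \<Rightarrow> (real \<Rightarrow> complex) \<Rightarrow> bool" where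
  "eigsol I V z \<equiv> sl_solution I (\<lambda>x. of_real (V x) - z)"

text \<open>
  Half the Wronskian W(u^*, u) divided by i. For an eigenfunction its derivative is - Im z |u|^2, so its
  vanishing at an endpoint is what self-adjointness of the boundary condition there provides.
\<close>

definition energy :: "(real \<Rightarrow> complex) \<Rightarrow> real \<Rightarrow> real" where
  "energy u x = Im (cnj (u x) * dx u x)"

lemma sl_solution_cnj:
  assumes "sl_solution I A u"
  shows "sl_solution I (\<lambda>x. cnj (A x)) (\<lambda>x. cnj (u x))" "\<And>x. x \<in> I \<Longrightarrow> dx (\<lambda>x. cnj (u x)) x = cnj (dx u x)"
proof -
  have d: "((\<lambda>x. cnj (u x)) has_vector_derivative cnj (dx u x)) (at x)" if "x \<in> I" for x
    using sl_solution_deriv[OF assms that] by (rule has_vector_derivative_cnj)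
  show dx: "\<And>x. x \<in> I \<Longrightarrow> dx (\<lambda>x. cnj (u x)) x = cnj (dx u x)"
    using d vector_derivative_at by blast
  show "sl_solution I (\<lambda>x. cnj (A x)) (\<lambda>x. cnj (u x))"
    unfolding sl_solution_def
  proof (intro conjI ballI impI)
    fix c d assume cd: "c \<in> I" "d \<in> I" "c \<le> d"
    have A: "A absolutely_integrable_on {c..d}" "((\<lambda>x. A x * u x) has_integral (dx u d - dx u c)) {c..d}"
      using assms cd by (auto simp: sl_solution_def)
    show "(\<lambda>x. cnj (A x)) absolutely_integrable_on {c..d}"
      using absolutely_integrable_linear[OF A(1) bounded_linear_cnj] by (simp add: o_def)
    show "((\<lambda>x. cnj (A x) * cnj (u x)) has_integral (dx (\<lambda>x. cnj (u x)) d - dx (\<lambda>x. cnj (u x)) c)) {c..d}"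
      using has_integral_linear[OF A(2) bounded_linear_cnj] cd by (simp add: o_def dx)
  qed (use assms d in \<open>auto simp: sl_solution_def dest: differentiableI_vector\<close>)
qed

lemma eigsol_cnj:
  assumes "eigsol I V z u"
  shows "eigsol I V (cnj z) (\<lambda>x. cnj (u x))"
  using sl_solution_cnj(1)[OF assms] by simp

lemma sl_solution_lincomb:
  assumes u: "sl_solution I A u" and v: "sl_solution I A v"
  shows "sl_solution I A (\<lambda>x. a * u x + c * v x)"
    "\<And>x. x \<in> I \<Longrightarrow> dx (\<lambda>x. a * u x + c * v x) x = a * dx u x + c * dx v x"
proof -
  have d: "((\<lambda>x. a * u x + c * v x) has_vector_derivative (a * dx u x + c * dx v x)) (at x)" if "x \<in> I" for x
    by (intro has_vector_derivative_add has_vector_derivative_mult_right sl_solution_deriv[OF u that] sl_solution_deriv[OF v that])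
  show dx: "\<And>x. x \<in> I \<Longrightarrow> dx (\<lambda>x. a * u x + c * v x) x = a * dx u x + c * dx v x"
    using d vector_derivative_at by blast
  show "sl_solution I A (\<lambda>x. a * u x + c * v x)"
    unfolding sl_solution_def
  proof (intro conjI ballI impI)
    fix e d assume cd: "e \<in> I" "d \<in> I" "e \<le> d"
    have "((\<lambda>x. a * (A x * u x) + c * (A x * v x)) has_integral a * (dx u d - dx u e) + c * (dx v d - dx v e)) {e..d}"
      using u v cd by (intro has_integral_add has_integral_mult_right) (auto simp: sl_solution_def)
    then show "((\<lambda>x. A x * (a * u x + c * v x)) has_integral (dx (\<lambda>x. a * u x + c * v x) d - dx (\<lambda>x. a * u x + c * v x) e)) {e..d}"
      using cd by (simp add: dx algebra_simps)
  qed (use u v d in \<open>auto simp: sl_solution_def dest: differentiableI_vector\<close>)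
qed

lemma wronskian_lincomb_right:
  assumes "sl_solution I A u" "sl_solution I A v" "x \<in> I"
  shows "wronskian f (\<lambda>x. a * u x + c * v x) x = a * wronskian f u x + c * wronskian f v x"
  using sl_solution_lincomb(2)[OF assms] by (simp add: wronskian_def algebra_simps)

lemma eigsol_lagrange:
  assumes "eigsol I V z u" "eigsol I V z' v" "c \<in> I" "d \<in> I" "c \<le> d"
  shows "wronskian u v d = wronskian u v c + (z - z') * integral {c..d} (\<lambda>x. u x * v x)"
proof -
  have eq: "(\<lambda>x. (of_real (V x) - z' - (of_real (V x) - z)) * u x * v x) = (\<lambda>x. (z - z') * (u x * v x))"
    by (auto simp: algebra_simps)
  have "wronskian u v d - wronskian u v c = integral {c..d} (\<lambda>x. (z - z') * (u x * v x))"
    using integral_unique[OF sl_solution_lagrange[OF assms]] unfolding eq by simp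
  then show ?thesis unfolding integral_mult_right by (metis add_diff_cancel_left' diff_add_cancel add.commute)
qed

lemma eigsol_interval: "sl_solution I A u \<Longrightarrow> is_interval I" "sl_solution I A u \<Longrightarrow> open I"
  by (auto simp: sl_solution_def)

lemma eigsol_cont_Icc:
  assumes "sl_solution I A u" "c \<in> I" "d \<in> I"
  shows "continuous_on {c..d} u"
  using sl_solution_cont[OF assms(1)] interval_Icc[OF eigsol_interval(1)[OF assms(1)] assms(2,3)]
  by (meson continuous_on_subset subsetI)

lemma energy_wronskian:
  assumes "sl_solution I A u" "x \<in> I"
  shows "wronskian (\<lambda>x. cnj (u x)) u x = 2 * \<i> * of_real (energy u x)"
  using sl_solution_cnj(2)[OF assms] by (simp add: wronskian_def energy_def complex_eq_iff)

lemma energy_diff: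
  assumes u: "eigsol I V z u" and "c \<in> I" "d \<in> I" "c \<le> d"
  shows "energy u d = energy u c - Im z * integral {c..d} (\<lambda>x. (norm (u x))\<^sup>2)"
proof -
  have "integral {c..d} (\<lambda>x. cnj (u x) * u x) = of_real (integral {c..d} (\<lambda>x. (norm (u x))\<^sup>2))"
  proof (rule integral_unique)
    have "((\<lambda>x. (norm (u x))\<^sup>2) has_integral integral {c..d} (\<lambda>x. (norm (u x))\<^sup>2)) {c..d}"
      by (intro integrable_integral integrable_continuous_real continuous_intros eigsol_cont_Icc[OF u assms(2,3)])
    from has_integral_linear[OF this bounded_linear_of_real[where 'a=complex]]
    show "((\<lambda>x. cnj (u x) * u x) has_integral of_real (integral {c..d} (\<lambda>x. (norm (u x))\<^sup>2))) {c..d}"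
      by (simp add: o_def complex_norm_square mult.commute flip: of_real_power)
  qed
  then have "2 * \<i> * of_real (energy u d) = 2 * \<i> * of_real (energy u c)
      + (cnj z - z) * of_real (integral {c..d} (\<lambda>x. (norm (u x))\<^sup>2))"
    using eigsol_lagrange[OF eigsol_cnj[OF u] u assms(2-4)] unfolding energy_wronskian[OF u assms(2)] energy_wronskian[OF u assms(3)]
    by simp
  from arg_cong[OF this, of Im] show ?thesis by simp
qed

lemma integral_Cauchy_Schwarz:
  fixes u w :: "real \<Rightarrow> complex"
  assumes u: "continuous_on {c..d} u" and w: "continuous_on {c..d} w"
  shows "(norm (integral {c..d} (\<lambda>x. u x * w x)))\<^sup>2 \<le>
    integral {c..d} (\<lambda>x. (norm (u x))\<^sup>2) * integral {c..d} (\<lambda>x. (norm (w x))\<^sup>2)"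
proof -
  define a b m where "a = integral {c..d} (\<lambda>x. (norm (u x))\<^sup>2)" and "b = integral {c..d} (\<lambda>x. (norm (w x))\<^sup>2)"
    and "m = integral {c..d} (\<lambda>x. norm (u x) * norm (w x))"
  have ia: "((\<lambda>x. (norm (u x))\<^sup>2) has_integral a) {c..d}" and ib: "((\<lambda>x. (norm (w x))\<^sup>2) has_integral b) {c..d}"
    and im: "((\<lambda>x. norm (u x) * norm (w x)) has_integral m) {c..d}"
    unfolding a_def b_def m_def
    by (intro integrable_integral integrable_continuous_real continuous_intros u w)+
  have ab: "a \<ge> 0" "b \<ge> 0" "m \<ge> 0" using has_integral_nonneg[OF ia] has_integral_nonneg[OF ib] has_integral_nonneg[OF im] by auto
  have le: "norm (integral {c..d} (\<lambda>x. u x * w x)) \<le> m"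
    unfolding m_def
    by (intro integral_norm_bound_integral integrable_continuous_real continuous_intros u w) (simp add: norm_mult)
  have q: "0 \<le> a - 2 * t * m + t\<^sup>2 * b" for t
  proof -
    have "((\<lambda>x. (norm (u x))\<^sup>2 - 2 * t * (norm (u x) * norm (w x)) + t\<^sup>2 * (norm (w x))\<^sup>2) has_integral (a - 2 * t * m + t\<^sup>2 * b)) {c..d}"
      by (intro has_integral_add has_integral_diff has_integral_mult_right ia ib im)
    moreover have "(norm (u x))\<^sup>2 - 2 * t * (norm (u x) * norm (w x)) + t\<^sup>2 * (norm (w x))\<^sup>2 \<ge> 0" for x
      using zero_le_power2[of "norm (u x) - t * norm (w x)"] by (simp add: power2_eq_square algebra_simps)
    ultimately show ?thesis using has_integral_nonneg by blast
  qed
  have "m\<^sup>2 \<le> a * b"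
  proof (cases "b = 0")
    case True
    have "m = 0"
    proof (rule ccontr)
      assume "m \<noteq> 0" then have "m > 0" using ab by auto
      \<comment> \<open>For b = 0 the quadratic is linear in t, and this t gives it the value
        -1.\<close>
      then show False using q[of "(a + 1) / (2 * m)"] True by (simp add: field_simps)
    qed
    then show ?thesis using ab by simp
  next
    case False
    \<comment> \<open>The minimum of the quadratic is attained at t = m / b.\<close>
    then show ?thesis using q[of "m / b"] ab by (simp add: field_simps power2_eq_square)
  qed
  then show ?thesis using power_mono[OF le, of 2] unfolding a_def b_def by auto
qed

section \<open>Square integrability near the right endpoint\<close>

text \<open>Square integrability near the right endpoint, expressed by a uniform bound over compact
  intervals. This needs no case distinction between finite and infinite endpoints; for continuous
  functions it is shown below to agree with \<open>sq_integrable_near_b\<close>.\<close>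

definition L2b :: "real set \<Rightarrow> (real \<Rightarrow> complex) \<Rightarrow> bool" where
  "L2b I u \<longleftrightarrow> (\<exists>K. \<exists>c\<in>I. \<forall>d\<in>I. c \<le> d \<longrightarrow> integral {c..d} (\<lambda>x. (norm (u x))\<^sup>2) \<le> K)"

text \<open>Convergence to 0 at the right endpoint of \<open>I\<close>, written without a filter on
  the extended reals.\<close>

definition vanishes_b :: "real set \<Rightarrow> (real \<Rightarrow> 'a::real_normed_vector) \<Rightarrow> bool" where
  "vanishes_b I f \<longleftrightarrow> (\<forall>e>0. \<exists>c\<in>I. \<forall>d\<in>I. c \<le> d \<longrightarrow> norm (f d) < e)"

lemma integral_norm2_combine:
  fixes u :: "real \<Rightarrow> complex"
  assumes u: "continuous_on I u" and I: "is_interval I" and cde: "c \<in> I" "d \<in> I" "e \<in> I" "c \<le> d" "d \<le> e"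
  shows "integral {c..e} (\<lambda>x. (norm (u x))\<^sup>2) = integral {c..d} (\<lambda>x. (norm (u x))\<^sup>2) + integral {d..e} (\<lambda>x. (norm (u x))\<^sup>2)"
proof -
  have "continuous_on {c..e} u" using u interval_Icc[OF I cde(1,3)] by (meson continuous_on_subset subsetI)
  then show ?thesis using cde
    by (intro Henstock_Kurzweil_Integration.integral_combine[symmetric] integrable_continuous_real continuous_intros) auto
qed

lemma integral_norm2_nonneg:
  fixes u :: "real \<Rightarrow> complex"
  shows "integral {c..d} (\<lambda>x. (norm (u x))\<^sup>2) \<ge> 0"
  by (metis (mono_tags, lifting) integral_nonneg not_integrable_integral order_refl zero_le_power2)

text \<open>The integrals from a fixed point increase and are bounded, so past a point where they
  come within \<open>e\<close> of their supremum no more than \<open>e\<close> is left. That point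
  may be chosen beyond any \<open>c0\<close>, which lets the tails of two functions be made small
  together.\<close>

lemma L2b_tail:
  assumes L: "L2b I u" and u: "continuous_on I u" and I: "is_interval I" and e: "e > 0" and c0: "c0 \<in> I"
  shows "\<exists>c\<in>I. c0 \<le> c \<and> (\<forall>a\<in>I. \<forall>d\<in>I. c \<le> a \<and> a \<le> d \<longrightarrow> integral {a..d} (\<lambda>x. (norm (u x))\<^sup>2) \<le> e)"
proof -
  define G where "G = (\<lambda>c d. integral {c..d} (\<lambda>x. (norm (u x))\<^sup>2))"
  obtain K c where c: "c \<in> I" and K: "\<And>d. d \<in> I \<Longrightarrow> c \<le> d \<Longrightarrow> G c d \<le> K"
    using L unfolding L2b_def G_def by blast
  define S where "S = (\<lambda>d. G c d) ` {d\<in>I. c \<le> d}"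
  have S: "S \<noteq> {}" "bdd_above S" using c K by (auto simp: S_def bdd_above_def)
  then obtain d where d: "d \<in> I" "c \<le> d" "Sup S - e < G c d"
    using less_cSup_iff[OF S, of "Sup S - e"] e by (auto simp: S_def)
  show ?thesis
  proof (intro bexI[of _ "max c0 d"] conjI ballI impI)
    fix a b assume ab: "a \<in> I" "b \<in> I" "max c0 d \<le> a \<and> a \<le> b"
    have "G c b = G c d + G d b" "G d b = G d a + G a b"
      unfolding G_def using d ab c by (auto intro!: integral_norm2_combine[OF u I])
    moreover have "G d a \<ge> 0" unfolding G_def by (rule integral_norm2_nonneg)
    moreover have "G c b \<le> Sup S" using ab d by (intro cSup_upper S) (auto simp: S_def)
    ultimately show "integral {a..b} (\<lambda>x. (norm (u x))\<^sup>2) \<le> e" using d unfolding G_def by linarith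
  qed (use c0 d in \<open>auto simp: max_def\<close>)
qed

lemma L2b_lincomb:
  assumes L: "L2b I u" "L2b I v" and u: "continuous_on I u" and v: "continuous_on I v" and I: "is_interval I"
  shows "L2b I (\<lambda>x. a * u x + c * v x)"
proof -
  obtain K1 c1 K2 c2 where c1: "c1 \<in> I" "\<And>d. d \<in> I \<Longrightarrow> c1 \<le> d \<Longrightarrow> integral {c1..d} (\<lambda>x. (norm (u x))\<^sup>2) \<le> K1"
    and c2: "c2 \<in> I" "\<And>d. d \<in> I \<Longrightarrow> c2 \<le> d \<Longrightarrow> integral {c2..d} (\<lambda>x. (norm (v x))\<^sup>2) \<le> K2"
    using L unfolding L2b_def by blast
  define e where "e = max c1 c2"
  have e: "e \<in> I" "c1 \<le> e" "c2 \<le> e" using c1 c2 by (auto simp: e_def max_def)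
  show ?thesis unfolding L2b_def
  proof (intro exI[of _ "2 * (norm a)\<^sup>2 * K1 + 2 * (norm c)\<^sup>2 * K2"] bexI[of _ e] ballI impI)
    fix d assume d: "d \<in> I" "e \<le> d"
    have sub: "{e..d} \<subseteq> I" using interval_Icc[OF I e(1) d(1)] by blast
    have cu: "continuous_on {e..d} u" "continuous_on {e..d} v" using u v sub continuous_on_subset by blast+
    have "integral {e..d} (\<lambda>x. (norm (a * u x + c * v x))\<^sup>2) \<le>
       integral {e..d} (\<lambda>x. 2 * (norm a)\<^sup>2 * (norm (u x))\<^sup>2 + 2 * (norm c)\<^sup>2 * (norm (v x))\<^sup>2)"
    proof (intro integral_le integrable_continuous_real continuous_intros cu)
      fix x
      have "norm (a * u x + c * v x) \<le> norm a * norm (u x) + norm c * norm (v x)"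
        by (metis norm_mult norm_triangle_ineq)
      then have "(norm (a * u x + c * v x))\<^sup>2 \<le> (norm a * norm (u x) + norm c * norm (v x))\<^sup>2"
        by (intro power_mono) auto
      also have "\<dots> \<le> 2 * (norm a)\<^sup>2 * (norm (u x))\<^sup>2 + 2 * (norm c)\<^sup>2 * (norm (v x))\<^sup>2"
        using zero_le_power2[of "norm a * norm (u x) - norm c * norm (v x)"] by (simp add: power2_eq_square algebra_simps)
      finally show "(norm (a * u x + c * v x))\<^sup>2 \<le> 2 * (norm a)\<^sup>2 * (norm (u x))\<^sup>2 + 2 * (norm c)\<^sup>2 * (norm (v x))\<^sup>2" .
    qed
    also have "\<dots> = 2 * (norm a)\<^sup>2 * integral {e..d} (\<lambda>x. (norm (u x))\<^sup>2) + 2 * (norm c)\<^sup>2 * integral {e..d} (\<lambda>x. (norm (v x))\<^sup>2)"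
    proof -
      have "((\<lambda>x. 2 * (norm a)\<^sup>2 * (norm (u x))\<^sup>2 + 2 * (norm c)\<^sup>2 * (norm (v x))\<^sup>2) has_integral
        (2 * (norm a)\<^sup>2 * integral {e..d} (\<lambda>x. (norm (u x))\<^sup>2) + 2 * (norm c)\<^sup>2 * integral {e..d} (\<lambda>x. (norm (v x))\<^sup>2))) {e..d}"
        by (intro has_integral_add has_integral_mult_right integrable_integral integrable_continuous_real continuous_intros cu)
      then show ?thesis by (rule integral_unique)
    qed
    also have "\<dots> \<le> 2 * (norm a)\<^sup>2 * K1 + 2 * (norm c)\<^sup>2 * K2"
    proof (intro add_mono mult_left_mono)
      have "integral {c1..d} (\<lambda>x. (norm (u x))\<^sup>2) = integral {c1..e} (\<lambda>x. (norm (u x))\<^sup>2) + integral {e..d} (\<lambda>x. (norm (u x))\<^sup>2)"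
        using c1 e d by (intro integral_norm2_combine[OF u I]) auto
      then show "integral {e..d} (\<lambda>x. (norm (u x))\<^sup>2) \<le> K1"
        using c1(2)[of d] e d integral_norm2_nonneg[of c1 e u] by auto
      have "integral {c2..d} (\<lambda>x. (norm (v x))\<^sup>2) = integral {c2..e} (\<lambda>x. (norm (v x))\<^sup>2) + integral {e..d} (\<lambda>x. (norm (v x))\<^sup>2)"
        using c2 e d by (intro integral_norm2_combine[OF v I]) auto
      then show "integral {e..d} (\<lambda>x. (norm (v x))\<^sup>2) \<le> K2"
        using c2(2)[of d] e d integral_norm2_nonneg[of c2 e v] by auto
    qed auto
    finally show "integral {e..d} (\<lambda>x. (norm (a * u x + c * v x))\<^sup>2) \<le> 2 * (norm a)\<^sup>2 * K1 + 2 * (norm c)\<^sup>2 * K2" .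
  qed (use e in auto)
qed

text \<open>The Pluecker relation for the four vectors (f, f') with f one of u, w and their
  conjugates. When W(u, w) = 1 it forces the mixed Wronskian on the left to be large wherever both
  energies are large and of equal sign.\<close>

lemma energy_pluecker:
  assumes u: "sl_solution I A u" and w: "sl_solution I A w" and x: "x \<in> I"
  shows "(norm (wronskian (\<lambda>x. cnj (w x)) u x))\<^sup>2 = 4 * energy u x * energy w x + (norm (wronskian u w x))\<^sup>2"
proof -
  have "(norm (cnj a * b - cnj c * d))\<^sup>2 = 4 * Im (cnj d * b) * Im (cnj a * c) + (norm (d * c - b * a))\<^sup>2" for a b c d :: complex
    unfolding cmod_power2 by (simp add: power2_eq_square algebra_simps)
  from this[of "w x" "dx u x" "dx w x" "u x"] show ?thesis
    using sl_solution_cnj(2)[OF w x] by (simp add: wronskian_def energy_def)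
qed

lemma norm_integral_mult_le:
  assumes u: "sl_solution I A u" and w: "sl_solution I B w" and c: "c \<in> I" "d \<in> I"
  shows "(norm (integral {c..d} (\<lambda>x. u x * w x)))\<^sup>2 \<le>
    integral {c..d} (\<lambda>x. (norm (u x))\<^sup>2) * integral {c..d} (\<lambda>x. (norm (w x))\<^sup>2)"
  by (rule integral_Cauchy_Schwarz[OF eigsol_cont_Icc[OF u c] eigsol_cont_Icc[OF w c]])

lemma norm_add_mult_power2: "(norm (a + k * b :: complex))\<^sup>2 \<le> 2 * (norm a)\<^sup>2 + 2 * (norm k)\<^sup>2 * (norm b)\<^sup>2"
proof -
  have "(norm (a + k * b))\<^sup>2 \<le> (norm a + norm k * norm b)\<^sup>2"
    by (intro power_mono) (metis norm_mult norm_triangle_ineq, simp)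
  also have "\<dots> \<le> 2 * (norm a)\<^sup>2 + 2 * (norm k)\<^sup>2 * (norm b)\<^sup>2"
    using zero_le_power2[of "norm a - norm k * norm b"] by (simp add: power2_eq_square algebra_simps)
  finally show ?thesis .
qed

text \<open>
  Weyl's alternative: if the energy of a nonreal square integrable solution does not vanish at b, then the
  Pluecker identity above controls a second solution, and b is in the limit circle case.
\<close>

lemma L2b_other_solution:
  assumes u: "eigsol I V z u" and w: "eigsol I V z w" and W: "\<And>x. x \<in> I \<Longrightarrow> wronskian u w x = 1"
    and z: "Im z \<noteq> 0" and L: "L2b I u" and nv: "\<not> vanishes_b I (energy u)"
  shows "L2b I w"
proof -
  have I: "is_interval I" using u by (auto simp: sl_solution_def)
  note cu = sl_solution_cont[OF u] and cw = sl_solution_cont[OF w]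
  define y where "y = \<bar>Im z\<bar>"
  have y: "y > 0" using z by (simp add: y_def)
  obtain e where e: "e > 0" "\<And>c. c \<in> I \<Longrightarrow> \<exists>d\<in>I. c \<le> d \<and> \<bar>energy u d\<bar> \<ge> e"
    using nv unfolding vanishes_b_def by (force simp: not_less)
  obtain i0 where i0: "i0 \<in> I" using L unfolding L2b_def by blast
  \<comment> \<open>Beyond \<open>c0\<close> the energy of u varies by at most m, and at
    \<open>d0\<close> its modulus is at least e = 2 m, so it stays at least m from there on.\<close>
  define m where "m = e / 2"
  have m: "m > 0" using e by (simp add: m_def)
  obtain c0 where c0: "c0 \<in> I" "\<And>a d. a \<in> I \<Longrightarrow> d \<in> I \<Longrightarrow> c0 \<le> a \<Longrightarrow> a \<le> d \<Longrightarrow> integral {a..d} (\<lambda>x. (norm (u x))\<^sup>2) \<le> m / y"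
    using L2b_tail[OF L cu I _ i0, of "m / y"] m y by auto
  obtain d0 where d0: "d0 \<in> I" "c0 \<le> d0" "\<bar>energy u d0\<bar> \<ge> e" using e(2)[OF c0(1)] by blast
  have big: "\<bar>energy u d\<bar> \<ge> m" if d: "d \<in> I" "d0 \<le> d" for d
  proof -
    have "\<bar>energy u d - energy u d0\<bar> = y * integral {d0..d} (\<lambda>x. (norm (u x))\<^sup>2)"
      using energy_diff[OF u d0(1) d] integral_norm2_nonneg[of d0 d u] by (simp add: y_def abs_mult)
    also have "\<dots> \<le> y * (m / y)" using c0(2)[OF d0(1) d(1) d0(2) d(2)] y by (intro mult_left_mono) auto
    also have "\<dots> = m" using y by simp
    finally show ?thesis using d0(3) m_def by linarith
  qed
  \<comment> \<open>With this tail the squared mixed Wronskian grows at most like 2 m y X, while the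
    Pluecker identity makes it grow like 4 m y X; the surplus bounds X.\<close>
  obtain c where c: "c \<in> I" "d0 \<le> c" "\<And>a d. a \<in> I \<Longrightarrow> d \<in> I \<Longrightarrow> c \<le> a \<Longrightarrow> a \<le> d \<Longrightarrow> integral {a..d} (\<lambda>x. (norm (u x))\<^sup>2) \<le> m / (4 * y)"
    using L2b_tail[OF L cu I _ d0(1), of "m / (4 * y)"] m y by auto
  define B0 where "B0 = (norm (wronskian (\<lambda>x. cnj (w x)) u c))\<^sup>2"
  show ?thesis unfolding L2b_def
  proof (intro exI[of _ "(2 * B0 + 1 + 4 * m * \<bar>energy w c\<bar>) / (2 * m * y) + \<bar>energy w c\<bar> / y"] bexI[OF _ c(1)] ballI impI)
    fix d assume d: "d \<in> I" "c \<le> d"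
    define X where "X = integral {c..d} (\<lambda>x. (norm (w x))\<^sup>2)"
    define U where "U = integral {c..d} (\<lambda>x. (norm (u x))\<^sup>2)"
    have X: "X \<ge> 0" and U: "U \<ge> 0" "U \<le> m / (4 * y)" unfolding X_def U_def
      using c(3)[OF c(1) d(1) _ d(2)] by (auto simp: integral_norm2_nonneg)
    show "X \<le> (2 * B0 + 1 + 4 * m * \<bar>energy w c\<bar>) / (2 * m * y) + \<bar>energy w c\<bar> / y"
    \<comment> \<open>Once y X exceeds the initial energy of w, the energy of w grows in modulus
      linearly in X.\<close>
    proof (cases "y * X \<le> \<bar>energy w c\<bar>")
      case True
      then have "X \<le> \<bar>energy w c\<bar> / y" using y by (simp add: field_simps)
      moreover have "(2 * B0 + 1 + 4 * m * \<bar>energy w c\<bar>) / (2 * m * y) \<ge> 0" using m y by (simp add: B0_def)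
      ultimately show ?thesis by linarith
    next
      case False
      define B where "B = (norm (wronskian (\<lambda>x. cnj (w x)) u d))\<^sup>2"
      have "wronskian (\<lambda>x. cnj (w x)) u d = wronskian (\<lambda>x. cnj (w x)) u c + (cnj z - z) * integral {c..d} (\<lambda>x. cnj (w x) * u x)"
        by (rule eigsol_lagrange[OF eigsol_cnj[OF w] u c(1) d])
      then have "B \<le> 2 * B0 + 2 * (norm (cnj z - z))\<^sup>2 * (norm (integral {c..d} (\<lambda>x. cnj (w x) * u x)))\<^sup>2"
        unfolding B_def B0_def using norm_add_mult_power2 by metis
      also have "(norm (integral {c..d} (\<lambda>x. cnj (w x) * u x)))\<^sup>2 \<le> X * U"
        using norm_integral_mult_le[OF eigsol_cnj[OF w] u c(1) d(1)] by (simp add: X_def U_def)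
      also have "X * U \<le> X * (m / (4 * y))" using X U by (intro mult_left_mono) auto
      finally have "B \<le> 2 * B0 + 2 * (norm (cnj z - z))\<^sup>2 * (X * (m / (4 * y)))" by (simp add: mult_left_mono)
      also have "(norm (cnj z - z))\<^sup>2 = 4 * y\<^sup>2" unfolding norm_minus_commute[of "cnj z"] complex_diff_cnj by (simp add: y_def norm_mult power_mult_distrib)
      also have "2 * B0 + 2 * (4 * y\<^sup>2) * (X * (m / (4 * y))) = 2 * B0 + 2 * m * y * X" using y by (simp add: field_simps power2_eq_square)
      finally have B: "B \<le> 2 * B0 + 2 * m * y * X" .
      have Ew: "energy w d = energy w c - Im z * X" using energy_diff[OF w c(1) d] by (simp add: X_def)
      have "\<bar>Im z * X\<bar> = y * X" using X by (simp add: y_def abs_mult)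
      then have E1: "\<bar>energy w d\<bar> \<ge> y * X - \<bar>energy w c\<bar>" using Ew by linarith
      have "m * (y * X - \<bar>energy w c\<bar>) \<le> \<bar>energy u d\<bar> * \<bar>energy w d\<bar>"
        using False big[OF d(1)] d c m E1 by (intro mult_mono) auto
      moreover have "4 * (energy u d * energy w d) = B - 1"
        using energy_pluecker[OF u w d(1)] W[OF d(1)] by (simp add: B_def)
      moreover have "B \<ge> 0" by (simp add: B_def)
      ultimately have "4 * (m * (y * X - \<bar>energy w c\<bar>)) \<le> B + 1" unfolding abs_mult[symmetric] by linarith
      then have "X * (2 * m * y) \<le> 2 * B0 + 1 + 4 * m * \<bar>energy w c\<bar>" using B by (simp add: algebra_simps)
      then have "X \<le> (2 * B0 + 1 + 4 * m * \<bar>energy w c\<bar>) / (2 * m * y)" using m y by (simp add: pos_le_divide_eq)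
      moreover have "\<bar>energy w c\<bar> / y \<ge> 0" using y by simp
      ultimately show ?thesis by linarith
    qed
  qed
qed

text \<open>Independence of the limit circle case from the spectral parameter. By variation of
  constants, f = W(f, w) u - W(f, u) w, and each coefficient changes by (z0 - z) times the integral
  of f u or f w. With small tails of u and w the integral of the square of f then bounds
  itself.\<close>

lemma L2b_all_solutions:
  assumes u: "eigsol I V z u" and w: "eigsol I V z w" and W: "\<And>x. x \<in> I \<Longrightarrow> wronskian u w x = 1"
    and L: "L2b I u" "L2b I w" and f: "eigsol I V z0 f"
  shows "L2b I f"
proof -
  have I: "is_interval I" using u by (auto simp: sl_solution_def)
  note cu = sl_solution_cont[OF u] and cw = sl_solution_cont[OF w]
  obtain i0 where i0: "i0 \<in> I" using L unfolding L2b_def by blast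
  define k where "k = (norm (z0 - z))\<^sup>2"
  \<comment> \<open>Chosen so that 8 k e^2 is at most 1/2, the fraction of the integral of f that is
    absorbed at the end.\<close>
  define e where "e = 1 / (4 * (k + 1))"
  have k: "k \<ge> 0" by (simp add: k_def)
  have e: "e > 0" using k by (simp add: e_def)
  have ke: "16 * k * e\<^sup>2 \<le> 1"
  proof -
    have "k \<le> (k + 1)\<^sup>2" using k by (simp add: power2_eq_square algebra_simps)
    moreover have "16 * k * e\<^sup>2 = k / (k + 1)\<^sup>2" unfolding e_def power_divide power_mult_distrib by simp
    ultimately show ?thesis using k by (simp add: divide_le_eq)
  qed
  obtain c1 where c1: "c1 \<in> I" "\<And>a d. a \<in> I \<Longrightarrow> d \<in> I \<Longrightarrow> c1 \<le> a \<Longrightarrow> a \<le> d \<Longrightarrow> integral {a..d} (\<lambda>x. (norm (u x))\<^sup>2) \<le> e"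
    using L2b_tail[OF L(1) cu I e i0] by auto
  obtain c where c: "c \<in> I" "c1 \<le> c" "\<And>a d. a \<in> I \<Longrightarrow> d \<in> I \<Longrightarrow> c \<le> a \<Longrightarrow> a \<le> d \<Longrightarrow> integral {a..d} (\<lambda>x. (norm (w x))\<^sup>2) \<le> e"
    using L2b_tail[OF L(2) cw I e c1(1)] by auto
  define G where "G = (\<lambda>v d. integral {c..d} (\<lambda>x. (norm (v x :: complex))\<^sup>2))"
  have G0: "G v d \<ge> 0" for v d unfolding G_def by (rule integral_norm2_nonneg)
  have Gu: "G u d \<le> e" "G w d \<le> e" if "d \<in> I" "c \<le> d" for d
    using c1(2)[OF c(1) that(1) c(2) that(2)] c(3)[OF c(1) that(1) _ that(2)] by (auto simp: G_def)
  have wr: "(norm (wronskian f v x))\<^sup>2 \<le> 2 * (norm (wronskian f v c))\<^sup>2 + 2 * k * (G f d * e)"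
    if v: "eigsol I V z v" and Gv: "G v x \<le> e" and x: "x \<in> I" "c \<le> x" "x \<le> d" and d: "d \<in> I" for v x d
  proof -
    have "wronskian f v x = wronskian f v c + (z0 - z) * integral {c..x} (\<lambda>x. f x * v x)"
      by (rule eigsol_lagrange[OF f v c(1) x(1,2)])
    then have "(norm (wronskian f v x))\<^sup>2 \<le> 2 * (norm (wronskian f v c))\<^sup>2 + 2 * k * (norm (integral {c..x} (\<lambda>x. f x * v x)))\<^sup>2"
      unfolding k_def using norm_add_mult_power2 by metis
    also have "(norm (integral {c..x} (\<lambda>x. f x * v x)))\<^sup>2 \<le> G f x * G v x"
      unfolding G_def by (rule norm_integral_mult_le[OF f v c(1) x(1)])
    also have "G f x * G v x \<le> G f d * e"
    proof (intro mult_mono Gv G0)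
      have "G f d = G f x + integral {x..d} (\<lambda>x. (norm (f x))\<^sup>2)"
        unfolding G_def using x d c by (intro integral_norm2_combine[OF sl_solution_cont[OF f] I]) auto
      then show "G f x \<le> G f d" using integral_norm2_nonneg[of x d f] by linarith
    qed
    finally show ?thesis using k by (simp add: mult_left_mono)
  qed
  define K where "K = (norm (wronskian f u c))\<^sup>2 + (norm (wronskian f w c))\<^sup>2"
  show ?thesis unfolding L2b_def
  proof (intro exI[of _ "8 * e * K"] bexI[OF _ c(1)] ballI impI)
    fix d assume d: "d \<in> I" "c \<le> d"
    define R where "R = G f d"
    define M1 where "M1 = 2 * (norm (wronskian f w c))\<^sup>2 + 2 * k * (R * e)"
    define M2 where "M2 = 2 * (norm (wronskian f u c))\<^sup>2 + 2 * k * (R * e)"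
    have R: "R \<ge> 0" using G0 by (simp add: R_def)
    have M: "M1 \<ge> 0" "M2 \<ge> 0" using R k e by (simp_all add: M1_def M2_def)
    have "R \<le> integral {c..d} (\<lambda>x. 2 * M1 * (norm (u x))\<^sup>2 + 2 * M2 * (norm (w x))\<^sup>2)"
      unfolding R_def G_def
    proof (intro integral_le integrable_continuous_real continuous_intros eigsol_cont_Icc[OF f c(1) d(1)] eigsol_cont_Icc[OF u c(1) d(1)] eigsol_cont_Icc[OF w c(1) d(1)])
      fix x assume x: "x \<in> {c..d}"
      then have xI: "x \<in> I" using interval_Icc[OF I c(1) d(1)] by blast
      have "f x * wronskian u w x = wronskian f w x * u x + (-1) * (wronskian f u x * w x)"
        by (simp add: wronskian_def algebra_simps)
      then have "f x = wronskian f w x * u x + (-1) * (wronskian f u x * w x)" using W[OF xI] by simp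
      then have "(norm (f x))\<^sup>2 \<le> 2 * (norm (wronskian f w x * u x))\<^sup>2 + 2 * (norm (-1::complex))\<^sup>2 * (norm (wronskian f u x * w x))\<^sup>2"
        using norm_add_mult_power2 by metis
      also have "\<dots> = 2 * (norm (wronskian f w x))\<^sup>2 * (norm (u x))\<^sup>2 + 2 * (norm (wronskian f u x))\<^sup>2 * (norm (w x))\<^sup>2"
        by (simp add: norm_mult power_mult_distrib)
      also have "\<dots> \<le> 2 * M1 * (norm (u x))\<^sup>2 + 2 * M2 * (norm (w x))\<^sup>2"
        using wr[OF w _ xI _ _ d(1)] wr[OF u _ xI _ _ d(1)] Gu[OF xI] x
        by (intro add_mono mult_right_mono mult_left_mono) (auto simp: M1_def M2_def R_def)
      finally show "(norm (f x))\<^sup>2 \<le> 2 * M1 * (norm (u x))\<^sup>2 + 2 * M2 * (norm (w x))\<^sup>2" .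
    qed
    also have "\<dots> = 2 * M1 * G u d + 2 * M2 * G w d"
      unfolding G_def
      by (intro integral_unique has_integral_add has_integral_mult_right integrable_integral integrable_continuous_real continuous_intros
        eigsol_cont_Icc[OF u c(1) d(1)] eigsol_cont_Icc[OF w c(1) d(1)])
    also have "\<dots> \<le> 2 * M1 * e + 2 * M2 * e" using Gu[OF d] M by (intro add_mono mult_left_mono) auto
    also have "\<dots> = 4 * e * K + R * (8 * k * e\<^sup>2)" by (simp add: M1_def M2_def K_def power2_eq_square algebra_simps)
    also have "\<dots> \<le> 4 * e * K + R * (1 / 2)" using R ke e by (intro add_mono mult_left_mono) auto
    finally show "integral {c..d} (\<lambda>x. (norm (f x))\<^sup>2) \<le> 8 * e * K" unfolding R_def G_def by simp
  qed
qed

text \<open>By Lagrange's identity the Wronskian changes by a multiple of the integral of w u, which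
  Cauchy-Schwarz bounds by the tails. The spectral parameters may differ, as is the case for the
  boundary datum and the Weyl solution.\<close>

lemma wronskian_bounded_near_b:
  assumes w: "eigsol I V z0 w" and u: "eigsol I V z u" and L: "L2b I u" "L2b I w" and i0: "i0 \<in> I"
  shows "\<exists>c\<in>I. \<exists>K\<ge>1. i0 \<le> c \<and> (\<forall>d\<in>I. c \<le> d \<longrightarrow> norm (wronskian w u d) \<le> K)"
proof -
  have I: "is_interval I" using u by (auto simp: sl_solution_def)
  obtain c1 where c1: "c1 \<in> I" "i0 \<le> c1" "\<And>a d. a \<in> I \<Longrightarrow> d \<in> I \<Longrightarrow> c1 \<le> a \<Longrightarrow> a \<le> d \<Longrightarrow> integral {a..d} (\<lambda>x. (norm (u x))\<^sup>2) \<le> 1"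
    using L2b_tail[OF L(1) sl_solution_cont[OF u] I _ i0, of 1] by auto
  obtain c where c: "c \<in> I" "c1 \<le> c" "\<And>a d. a \<in> I \<Longrightarrow> d \<in> I \<Longrightarrow> c \<le> a \<Longrightarrow> a \<le> d \<Longrightarrow> integral {a..d} (\<lambda>x. (norm (w x))\<^sup>2) \<le> 1"
    using L2b_tail[OF L(2) sl_solution_cont[OF w] I _ c1(1), of 1] by auto
  define K where "K = 2 * (norm (wronskian w u c))\<^sup>2 + 2 * (norm (z0 - z))\<^sup>2 + 1"
  have K: "K \<ge> 1" by (simp add: K_def)
  have bd: "norm (wronskian w u d) \<le> K" if d: "d \<in> I" "c \<le> d" for d
  proof -
    have "wronskian w u d = wronskian w u c + (z0 - z) * integral {c..d} (\<lambda>x. w x * u x)"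
      by (rule eigsol_lagrange[OF w u c(1) d])
    then have "(norm (wronskian w u d))\<^sup>2 \<le> 2 * (norm (wronskian w u c))\<^sup>2 + 2 * (norm (z0 - z))\<^sup>2 * (norm (integral {c..d} (\<lambda>x. w x * u x)))\<^sup>2"
      using norm_add_mult_power2 by metis
    also have "(norm (integral {c..d} (\<lambda>x. w x * u x)))\<^sup>2 \<le> 1 * 1"
    proof (rule order_trans[OF norm_integral_mult_le[OF w u c(1) d(1)]], rule mult_mono)
      show "integral {c..d} (\<lambda>x. (norm (w x))\<^sup>2) \<le> 1" using c(3)[OF c(1) d(1) _ d(2)] by simp
      show "integral {c..d} (\<lambda>x. (norm (u x))\<^sup>2) \<le> 1" by (rule c1(3)[OF c(1) d(1) c(2) d(2)])
    qed (auto simp: integral_norm2_nonneg)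
    finally have "(norm (wronskian w u d))\<^sup>2 \<le> K" by (simp add: mult_left_mono K_def)
    also have "K \<le> K\<^sup>2" using K by (simp add: power2_eq_square)
    finally show ?thesis using K by (simp add: power2_le_iff_abs_le)
  qed
  then show ?thesis using c c1(2) K by (intro bexI[OF _ c(1)] exI[of _ K]) auto
qed

lemma L2b_cnj: "L2b I u \<Longrightarrow> L2b I (\<lambda>x. cnj (u x))"
  by (simp add: L2b_def)

text \<open>A Pluecker relation writes the energy of u, up to a constant, as W(v, u) and its
  conjugate times bounded Wronskians with w; the boundary condition sends W(v, u) to 0.\<close>

lemma energy_vanishes_limit_circle:
  assumes v: "eigsol I V (of_real r) (\<lambda>x. of_real (v x))" and w: "eigsol I V (of_real r) w" and u: "eigsol I V z u"
    and W: "\<And>x. x \<in> I \<Longrightarrow> wronskian (\<lambda>x. of_real (v x)) w x = 1"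
    and L: "L2b I u" "L2b I w" and van: "vanishes_b I (wronskian (\<lambda>x. of_real (v x)) u)"
  shows "vanishes_b I (energy u)"
proof -
  have I: "is_interval I" using u by (auto simp: sl_solution_def)
  obtain i0 where i0: "i0 \<in> I" using L unfolding L2b_def by blast
  define v' where "v' = (\<lambda>x. complex_of_real (v x))"
  obtain c1 K1 where c1: "c1 \<in> I" "K1 \<ge> 1" "\<And>d. d \<in> I \<Longrightarrow> c1 \<le> d \<Longrightarrow> norm (wronskian w u d) \<le> K1"
    using wronskian_bounded_near_b[OF w u L i0] by blast
  obtain c K2 where c: "c \<in> I" "c1 \<le> c" "K2 \<ge> 1" "\<And>d. d \<in> I \<Longrightarrow> c \<le> d \<Longrightarrow> norm (wronskian w (\<lambda>x. cnj (u x)) d) \<le> K2"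
    using wronskian_bounded_near_b[OF w eigsol_cnj[OF u] L2b_cnj[OF L(1)] L(2) c1(1)] by blast
  define K where "K = K1 + K2"
  have K: "K > 0" using c1 c by (simp add: K_def)
  show ?thesis unfolding vanishes_b_def
  proof (intro allI impI)
    fix e :: real assume e: "e > 0"
    have "e / K > 0" using e K by simp
    then obtain c2 where c2: "c2 \<in> I" "\<And>d. d \<in> I \<Longrightarrow> c2 \<le> d \<Longrightarrow> norm (wronskian v' u d) < e / K"
      using van unfolding vanishes_b_def v'_def by blast
    show "\<exists>c\<in>I. \<forall>d\<in>I. c \<le> d \<longrightarrow> norm (energy u d) < e"
    proof (intro bexI[of _ "max c c2"] ballI impI)
      fix d assume d: "d \<in> I" "max c c2 \<le> d"
      have dv: "cnj (dx v' d) = dx v' d" unfolding v'_def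
        using sl_solution_cnj(2)[OF v d(1)] unfolding complex_cnj_complex_of_real by (rule sym)
      define A B where "A = wronskian v' u d" and "B = wronskian w (\<lambda>x. cnj (u x)) d"
      \<comment> \<open>Since v is real, W(v, cnj u) is the conjugate of A.\<close>
      have "wronskian v' w d * wronskian (\<lambda>x. cnj (u x)) u d = cnj A * wronskian w u d - A * B"
        using sl_solution_cnj(2)[OF u d(1)] unfolding A_def B_def wronskian_def
        by (simp add: dv) (simp add: v'_def algebra_simps)
      then have "2 * \<i> * of_real (energy u d) = cnj A * wronskian w u d - A * B"
        using W[OF d(1)] energy_wronskian[OF u d(1)] by (simp add: v'_def)
      then have "norm (2 * \<i> * of_real (energy u d)) \<le> norm (cnj A * wronskian w u d) + norm (A * B)"
        by (metis norm_triangle_ineq4)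
      then have "\<bar>energy u d\<bar> \<le> norm A * (norm (wronskian w u d) + norm B) / 2" by (simp add: norm_mult algebra_simps)
      also have "\<dots> \<le> norm A * K / 2" using c1(3)[OF d(1)] c(4)[OF d(1)] d c(2) unfolding B_def K_def
        by (intro divide_right_mono mult_left_mono add_mono) auto
      also have "\<dots> \<le> norm A * K" using K by simp
      also have "\<dots> < e" using c2(2)[OF d(1)] d K by (simp add: A_def field_simps)
      finally show "norm (energy u d) < e" by simp
    qed (use c c2 in \<open>auto simp: max_def\<close>)
  qed
qed

lemma norm_le_of_diff:
  fixes a b :: "'a::real_normed_vector"
  assumes "norm (a - b) \<le> K"
  shows "norm a \<le> norm b + K" "norm b \<le> norm a + K"
  using norm_triangle_sub[of a b] norm_triangle_sub[of b a] assms by (auto simp: norm_minus_commute)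

section \<open>Solutions near a singular endpoint\<close>

text \<open>An unperturbed equation with a small solution \<open>u1\<close> and a large solution
  \<open>u2\<close> at 0, perturbed by \<open>Q\<close>. The integrability of \<open>Q\<close>
  against the product \<open>u1 u2\<close> is what variation of constants requires; working with
  \<open>u1\<close> and \<open>u2\<close> abstractly treats the powers of x and the logarithmic case
  alike.\<close>

locale singular_end =
  fixes c0 :: real and A0 Q :: "real \<Rightarrow> complex" and u1 u2 :: "real \<Rightarrow> real"
  assumes c0: "c0 > 0"
    and s1: "sl_solution {0<..<c0} A0 (\<lambda>x. of_real (u1 x))"
    and s2: "sl_solution {0<..<c0} A0 (\<lambda>x. of_real (u2 x))"
    and pos: "\<And>x. x \<in> {0<..<c0} \<Longrightarrow> u1 x > 0" "\<And>x. x \<in> {0<..<c0} \<Longrightarrow> u2 x > 0"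
    and W21: "\<And>x. x \<in> {0<..<c0} \<Longrightarrow> wronskian (\<lambda>x. of_real (u2 x)) (\<lambda>x. of_real (u1 x)) x = 1"
    and ratio_antimono: "\<And>x y. 0 < x \<Longrightarrow> x \<le> y \<Longrightarrow> y < c0 \<Longrightarrow> u2 y / u1 y \<le> u2 x / u1 x"
    and Q_int: "\<And>x y. 0 < x \<Longrightarrow> x \<le> y \<Longrightarrow> y < c0 \<Longrightarrow> (\<lambda>t. norm (Q t) * (u1 t * u2 t)) integrable_on {x..y}"
    and Q_tail: "\<And>e. e > 0 \<Longrightarrow> \<exists>c. 0 < c \<and> c < c0 \<and> (\<forall>x y. 0 < x \<longrightarrow> x \<le> y \<longrightarrow> y \<le> c \<longrightarrow>
        integral {x..y} (\<lambda>t. norm (Q t) * (u1 t * u2 t)) \<le> e)"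
begin

definition ratio :: "real \<Rightarrow> real" where "ratio x = u2 x / u1 x"

context
  fixes f :: "real \<Rightarrow> complex"
  assumes f: "sl_solution {0<..<c0} (\<lambda>x. A0 x + Q x) f"
begin

text \<open>
  Variation of constants: the moduli of the coefficients of f with respect to u1 and u2.
\<close>

definition al :: "real \<Rightarrow> real" where "al x = norm (wronskian (\<lambda>x. of_real (u2 x)) f x)"
definition be :: "real \<Rightarrow> real" where "be x = norm (wronskian (\<lambda>x. of_real (u1 x)) f x)"

lemma ratio_pos: "x \<in> {0<..<c0} \<Longrightarrow> ratio x > 0"
  using pos by (simp add: ratio_def)

lemma al_be_nonneg [simp]: "al x \<ge> 0" "be x \<ge> 0"
  by (auto simp: al_def be_def)

lemma f_decomposition:
  assumes x: "x \<in> {0<..<c0}"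
  shows "f x = wronskian (\<lambda>x. of_real (u2 x)) f x * of_real (u1 x) - wronskian (\<lambda>x. of_real (u1 x)) f x * of_real (u2 x)"
proof -
  have "f x = f x * wronskian (\<lambda>x. of_real (u2 x)) (\<lambda>x. of_real (u1 x)) x" using W21[OF x] by simp
  then show ?thesis by (simp add: wronskian_def algebra_simps)
qed

lemma norm_f_le:
  assumes x: "x \<in> {0<..<c0}"
  shows "norm (f x) \<le> u1 x * (al x + be x * ratio x)"
proof -
  have "norm (f x) \<le> al x * u1 x + be x * u2 x"
    using norm_triangle_ineq4[of "wronskian (\<lambda>x. of_real (u2 x)) f x * of_real (u1 x)" "wronskian (\<lambda>x. of_real (u1 x)) f x * of_real (u2 x)"]
      pos[OF x] f_decomposition[OF x] by (simp add: norm_mult al_def be_def)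
  also have "\<dots> = u1 x * (al x + be x * ratio x)" using pos[OF x] by (simp add: ratio_def field_simps)
  finally show ?thesis .
qed

lemma norm_f_ge:
  assumes x: "x \<in> {0<..<c0}"
  shows "norm (f x) \<ge> be x * u2 x - al x * u1 x"
proof -
  have "norm (f x) \<ge> be x * u2 x - al x * u1 x"
    using norm_triangle_ineq2[of "wronskian (\<lambda>x. of_real (u1 x)) f x * of_real (u2 x)" "wronskian (\<lambda>x. of_real (u2 x)) f x * of_real (u1 x)"]
      pos[OF x] f_decomposition[OF x] by (simp add: norm_mult al_def be_def norm_minus_commute)
  then show ?thesis .
qed

text \<open>The derivative of W(w, f) is Q w f; the bound on w f is stated in the form that
  reproduces the weight \<open>u1 u2\<close>.\<close>

lemma wronskian_diff_le:
  assumes w: "sl_solution {0<..<c0} A0 (\<lambda>x. of_real (w x))" and xy: "0 < x" "x \<le> y" "y < c0"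
    and wp: "\<And>t. t \<in> {x..y} \<Longrightarrow> w t > 0"
    and le: "\<And>t. t \<in> {x..y} \<Longrightarrow> w t * norm (f t) \<le> C * (u1 t * u2 t)"
  shows "norm (wronskian (\<lambda>x. of_real (w x)) f y - wronskian (\<lambda>x. of_real (w x)) f x) \<le> C * integral {x..y} (\<lambda>t. norm (Q t) * (u1 t * u2 t))"
proof -
  have *: "((\<lambda>t. (A0 t + Q t - A0 t) * of_real (w t) * f t) has_integral
     (wronskian (\<lambda>x. of_real (w x)) f y - wronskian (\<lambda>x. of_real (w x)) f x)) {x..y}"
    using sl_solution_lagrange[OF w f, of x y] xy by simp
  have "norm (integral {x..y} (\<lambda>t. (A0 t + Q t - A0 t) * of_real (w t) * f t)) \<le> integral {x..y} (\<lambda>t. C * (norm (Q t) * (u1 t * u2 t)))"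
  proof (intro integral_norm_bound_integral)
    fix t assume t: "t \<in> {x..y}"
    have "norm ((A0 t + Q t - A0 t) * of_real (w t) * f t) = norm (Q t) * (w t * norm (f t))"
      using wp[OF t] by (simp add: norm_mult)
    also have "\<dots> \<le> norm (Q t) * (C * (u1 t * u2 t))" by (intro mult_left_mono le t) auto
    finally show "norm ((A0 t + Q t - A0 t) * of_real (w t) * f t) \<le> C * (norm (Q t) * (u1 t * u2 t))" by (simp add: algebra_simps)
  qed (use * Q_int[OF xy] in \<open>auto intro: integrable_on_mult_right\<close>)
  then show ?thesis using integral_unique[OF *] by simp
qed

lemma al_diff_le:
  assumes xy: "0 < x" "x \<le> y" "y < c0" and le: "\<And>t. t \<in> {x..y} \<Longrightarrow> al t + be t * ratio t \<le> C"
  shows "al x \<le> al y + C * integral {x..y} (\<lambda>t. norm (Q t) * (u1 t * u2 t))"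
proof -
  have "norm (wronskian (\<lambda>x. of_real (u2 x)) f y - wronskian (\<lambda>x. of_real (u2 x)) f x) \<le> C * integral {x..y} (\<lambda>t. norm (Q t) * (u1 t * u2 t))"
  proof (rule wronskian_diff_le[OF s2 xy])
    fix t assume t: "t \<in> {x..y}"
    then have t': "t \<in> {0<..<c0}" using xy by auto
    show "0 < u2 t" using pos t' by auto
    have "u2 t * norm (f t) \<le> u2 t * (u1 t * C)"
      using norm_f_le[OF t'] le[OF t] pos[OF t'] by (intro mult_left_mono) (auto intro: order_trans mult_left_mono)
    then show "u2 t * norm (f t) \<le> C * (u1 t * u2 t)" by (simp add: algebra_simps)
  qed
  then show ?thesis unfolding al_def by (rule norm_le_of_diff(2))
qed

text \<open>In contrast to \<open>al_diff_le\<close>, the size of f relative to \<open>u1\<close>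
  may grow like \<open>ratio\<close> here, because \<open>be\<close> is driven by Q u1 f and
  \<open>al\<close> by Q u2 f.\<close>

lemma be_diff_le:
  assumes xy: "0 < x" "x \<le> y" "y < c0" and le: "\<And>t. t \<in> {x..y} \<Longrightarrow> al t + be t * ratio t \<le> C * ratio t"
  shows "norm (wronskian (\<lambda>x. of_real (u1 x)) f y - wronskian (\<lambda>x. of_real (u1 x)) f x) \<le> C * integral {x..y} (\<lambda>t. norm (Q t) * (u1 t * u2 t))"
proof (rule wronskian_diff_le[OF s1 xy])
  fix t assume t: "t \<in> {x..y}"
  then have t': "t \<in> {0<..<c0}" using xy by auto
  show "0 < u1 t" using pos t' by auto
  have "u1 t * norm (f t) \<le> u1 t * (u1 t * (C * ratio t))"
    using norm_f_le[OF t'] le[OF t] pos[OF t'] by (intro mult_left_mono) (auto intro: order_trans mult_left_mono)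
  then show "u1 t * norm (f t) \<le> C * (u1 t * u2 t)" using pos[OF t'] by (simp add: ratio_def)
qed

lemma integral_Q_nonneg:
  assumes "0 < x" "y < c0"
  shows "integral {x..y} (\<lambda>t. norm (Q t) * (u1 t * u2 t)) \<ge> 0"
proof (cases "x \<le> y")
  case True
  show ?thesis
  proof (rule integral_nonneg[OF Q_int[OF assms(1) True assms(2)]])
    fix t assume "t \<in> {x..y}"
    then have "t \<in> {0<..<c0}" using assms by auto
    then show "0 \<le> norm (Q t) * (u1 t * u2 t)" using pos[of t] by simp
  qed
qed auto

lemma al_be_cont: "continuous_on {0<..<c0} al" "continuous_on {0<..<c0} be" "continuous_on {0<..<c0} ratio"
proof -
  note c = sl_solution_cont[OF f] sl_solution_cont_dx[OF f] sl_solution_cont[OF s1] sl_solution_cont[OF s2]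
     sl_solution_cont_dx[OF s1] sl_solution_cont_dx[OF s2]
  show "continuous_on {0<..<c0} al" unfolding al_def wronskian_def by (intro continuous_intros c)
  show "continuous_on {0<..<c0} be" unfolding be_def wronskian_def by (intro continuous_intros c)
  have "continuous_on {0<..<c0} (\<lambda>x. Re (of_real (u1 x)))" "continuous_on {0<..<c0} (\<lambda>x. Re (of_real (u2 x)))"
    by (intro continuous_intros c)+
  moreover have "u1 x \<noteq> 0" if "x \<in> {0<..<c0}" for x using pos(1)[OF that] by simp
  ultimately show "continuous_on {0<..<c0} ratio" unfolding ratio_def by (intro continuous_intros) auto
qed

text \<open>Absorption at a maximum point of \<open>al / ratio + be\<close>: going from there to c,
  each summand changes by at most a quarter of the maximum, the first one because
  \<open>ratio\<close> is decreasing. The maximum over [x, c] is thus at most twice the value at c,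
  uniformly in x.\<close>

lemma coefficients_bounded:
  shows "\<exists>c K. 0 < c \<and> c < c0 \<and> K > 0 \<and> (\<forall>x. 0 < x \<and> x \<le> c \<longrightarrow> al x + be x * ratio x \<le> K * ratio x)"
proof -
  obtain c where c: "0 < c" "c < c0" and tail: "\<And>x y. 0 < x \<Longrightarrow> x \<le> y \<Longrightarrow> y \<le> c \<Longrightarrow>
      integral {x..y} (\<lambda>t. norm (Q t) * (u1 t * u2 t)) \<le> 1 / 4"
    using Q_tail[of "1/4"] by auto
  define R where "R = (\<lambda>x. al x / ratio x + be x)"
  have R0: "R c \<ge> 0" using ratio_pos[of c] c by (simp add: R_def)
  have bound: "R x \<le> 2 * R c" if x: "0 < x" "x \<le> c" for x
  proof -
    have sub: "{x..c} \<subseteq> {0<..<c0}" using x c by auto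
    have "ratio x \<noteq> 0" if "x \<in> {0<..<c0}" for x using ratio_pos[OF that] by simp
    then have "continuous_on {0<..<c0} R" unfolding R_def
      by (intro continuous_intros al_be_cont) auto
    then have "continuous_on {x..c} R" using sub continuous_on_subset by blast
    then obtain xm where xm: "xm \<in> {x..c}" "\<And>t. t \<in> {x..c} \<Longrightarrow> R t \<le> R xm"
      using continuous_attains_sup[of "{x..c}" R] x by auto
    have xm': "xm \<in> {0<..<c0}" "0 < xm" "xm \<le> c" using xm sub x by auto
    have le: "al t + be t * ratio t \<le> R xm * ratio t" if t: "t \<in> {xm..c}" for t
    proof -
      have t': "ratio t > 0" using ratio_pos[of t] t sub xm' c by auto
      have "al t + be t * ratio t = R t * ratio t" using t' by (simp add: R_def field_simps)
      also have "\<dots> \<le> R xm * ratio t" using xm(2)[of t] t xm(1) t' by (intro mult_right_mono) auto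
      finally show ?thesis .
    qed
    define J where "J = integral {xm..c} (\<lambda>t. norm (Q t) * (u1 t * u2 t))"
    have J: "0 \<le> J" "J \<le> 1 / 4" unfolding J_def using integral_Q_nonneg[OF xm'(2) c(2)] tail[OF xm'(2,3)] by auto
    have Rm: "R xm \<ge> 0" using ratio_pos[OF xm'(1)] by (simp add: R_def)
    have "norm (wronskian (\<lambda>x. of_real (u1 x)) f c - wronskian (\<lambda>x. of_real (u1 x)) f xm) \<le> R xm * J"
      unfolding J_def by (rule be_diff_le[OF xm'(2,3) c(2) le])
    then have "be xm \<le> be c + R xm * J" unfolding be_def by (rule norm_le_of_diff(2))
    also have "R xm * J \<le> R xm * (1 / 4)" using J Rm by (intro mult_left_mono)
    finally have b: "be xm \<le> be c + R xm / 4" by simp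
    have "al xm \<le> al c + (R xm * ratio xm) * J"
      unfolding J_def
    proof (rule al_diff_le[OF xm'(2,3) c(2)])
      fix t assume t: "t \<in> {xm..c}"
      have "ratio t \<le> ratio xm" unfolding ratio_def using t xm' c by (intro ratio_antimono) auto
      then have "R xm * ratio t \<le> R xm * ratio xm" using Rm by (intro mult_left_mono)
      then show "al t + be t * ratio t \<le> R xm * ratio xm" using le[OF t] by linarith
    qed
    also have "(R xm * ratio xm) * J \<le> (R xm * ratio xm) * (1 / 4)"
      using J Rm ratio_pos[OF xm'(1)] by (intro mult_left_mono) auto
    finally have "al xm / ratio xm \<le> (al c + (R xm * ratio xm) * (1 / 4)) / ratio xm"
      using ratio_pos[OF xm'(1)] by (intro divide_right_mono) auto
    also have "\<dots> = al c / ratio xm + R xm / 4" using ratio_pos[OF xm'(1)] by (simp add: field_simps)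
    also have "al c / ratio xm \<le> al c / ratio c"
      using ratio_antimono[OF xm'(2,3) c(2)] ratio_pos[of c] ratio_pos[OF xm'(1)] c
      unfolding ratio_def[symmetric] by (intro divide_left_mono mult_pos_pos) auto
    finally have a: "al xm / ratio xm \<le> al c / ratio c + R xm / 4" by simp
    have "R xm = al xm / ratio xm + be xm" "R c = al c / ratio c + be c" by (simp_all add: R_def)
    then have "R xm \<le> R c + R xm / 2" using a b by linarith
    then show ?thesis using xm(2)[of x] x by auto
  qed
  \<comment> \<open>The summand 1 only makes the constant positive.\<close>
  have "al x + be x * ratio x \<le> (2 * R c + 1) * ratio x" if x: "0 < x" "x \<le> c" for x
  proof -
    have r: "ratio x > 0" using ratio_pos[of x] x c by auto
    have "al x + be x * ratio x = R x * ratio x" using r by (simp add: R_def field_simps)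
    also have "\<dots> \<le> (2 * R c + 1) * ratio x" using bound[of x] x r by (intro mult_right_mono) auto
    finally show ?thesis .
  qed
  moreover have "2 * R c + 1 > 0" using R0 by simp
  ultimately show ?thesis using c by blast
qed

text \<open>The energy is at most \<open>al be\<close>, so \<open>al\<close> has to be bounded near
  0, whereas the previous lemma only bounds it by a multiple of \<open>ratio\<close>. The weight 1 +
  e \<open>ratio\<close> interpolates: for each e > 0 the supremum against it is finite by that
  lemma, absorption then gives a bound independent of e, and e tends to 0.\<close>

lemma energy_vanishes_if_be_vanishes:
  assumes be0: "(be \<longlongrightarrow> 0) (at_right 0)"
  shows "(energy f \<longlongrightarrow> 0) (at_right 0)"
proof -
  obtain c1 K where c1: "0 < c1" "c1 < c0" "K > 0" and K: "\<And>x. 0 < x \<Longrightarrow> x \<le> c1 \<Longrightarrow> al x + be x * ratio x \<le> K * ratio x"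
    using coefficients_bounded by blast
  obtain c2 where c2: "0 < c2" "c2 < c0" and tail2: "\<And>x y. 0 < x \<Longrightarrow> x \<le> y \<Longrightarrow> y \<le> c2 \<Longrightarrow>
      integral {x..y} (\<lambda>t. norm (Q t) * (u1 t * u2 t)) \<le> 1 / 4"
    using Q_tail[of "1/4"] by auto
  define c where "c = min c1 c2"
  have c: "0 < c" "c \<le> c1" "c \<le> c2" "c < c0" using c1 c2 by (auto simp: c_def)
  have tail: "integral {x..y} (\<lambda>t. norm (Q t) * (u1 t * u2 t)) \<le> 1 / 4" if "0 < x" "x \<le> y" "y \<le> c" for x y
    using tail2 that c by auto
  have key: "al x + be x * ratio x \<le> 2 * al c * (1 + e * ratio x)" if e: "e > 0" and x: "0 < x" "x \<le> c" for e x
  proof -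
    define om where "om = (\<lambda>x. 1 + e * ratio x)"
    have om: "om t > 0" if "0 < t" "t \<le> c" for t using ratio_pos[of t] that c e by (simp add: om_def add_pos_pos)
    define S where "S = (\<lambda>t. (al t + be t * ratio t) / om t) ` {0<..c}"
    define N where "N = Sup S"
    have "bdd_above S"
    proof -
      have "(al t + be t * ratio t) / om t \<le> K / e" if t: "0 < t" "t \<le> c" for t
      proof -
        have r: "ratio t > 0" using ratio_pos[of t] t c by auto
        have "(al t + be t * ratio t) / om t \<le> (K * ratio t) / om t"
          using K[of t] t c om[OF t] by (intro divide_right_mono) auto
        also have "\<dots> \<le> (K * ratio t) / (e * ratio t)"
          using r e c1 om[OF t] by (intro divide_left_mono) (auto simp: om_def)
        also have "\<dots> = K / e" using r by simp
        finally show ?thesis .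
      qed
      then show ?thesis unfolding S_def bdd_above_def by (intro exI[of _ "K / e"]) auto
    qed
    then have N: "(al t + be t * ratio t) / om t \<le> N" if "0 < t" "t \<le> c" for t
      unfolding N_def using that by (intro cSup_upper) (auto simp: S_def)
    have N': "al t + be t * ratio t \<le> N * om t" if "0 < t" "t \<le> c" for t
      using N[OF that] om[OF that] by (simp add: pos_divide_le_eq)
    have N0: "N \<ge> 0"
    proof -
      have "(al c + be c * ratio c) / om c \<ge> 0" using om[of c] ratio_pos[of c] c by simp
      then show ?thesis using N[of c] c by linarith
    qed
    \<comment> \<open>Finiteness of the supremum N is essential here: the estimate has N / 2 on the
      right, which can be subtracted only from a finite N.\<close>
    have step: "al t + be t * ratio t \<le> (al c + N / 2) * om t" if t: "0 < t" "t \<le> c" for t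
    proof -
      have tc: "t < c0" using t c by auto
      have r: "ratio t > 0" using ratio_pos[of t] t tc by auto
      define J where "J = integral {t..c} (\<lambda>t. norm (Q t) * (u1 t * u2 t))"
      have J: "0 \<le> J" "J \<le> 1 / 4" unfolding J_def using integral_Q_nonneg[OF t(1) c(4)] tail[OF t] by auto
      have mono: "ratio x \<le> ratio y" if "0 < y" "y \<le> x" "x \<le> c" for x y
        unfolding ratio_def using that c by (intro ratio_antimono) auto
      have "al t \<le> al c + (N * om t) * J"
        unfolding J_def
      proof (rule al_diff_le[OF t c(4)])
        fix x assume x: "x \<in> {t..c}"
        have "om x \<le> om t" using mono[of t x] x t e by (auto simp: om_def)
        then have "N * om x \<le> N * om t" using N0 by (intro mult_left_mono)
        then show "al x + be x * ratio x \<le> N * om t" using N'[of x] x t by auto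
      qed
      also have "(N * om t) * J \<le> (N * om t) * (1 / 4)" using J N0 om[OF t] by (intro mult_left_mono) auto
      finally have a: "al t \<le> al c + N * om t / 4" by simp
      \<comment> \<open>Unlike \<open>al\<close>, which is compared with its value at c,
        \<open>be\<close> is integrated from 0, where it vanishes in the limit. This uses that
        \<open>om / ratio\<close> is nondecreasing.\<close>
      have b: "be t \<le> N * om t / ratio t / 4 + d" if d: "d > 0" for d
      proof -
        have "\<forall>\<^sub>F y in at_right 0. be y < d" using order_tendstoD(2)[OF be0 d] .
        moreover have "\<forall>\<^sub>F y in at_right 0. y \<in> {0<..<t}" using t eventually_at_right_real by blast
        ultimately have "\<forall>\<^sub>F y in at_right 0. be y < d \<and> y \<in> {0<..<t}" by eventually_elim auto
        then obtain y where y: "be y < d" "0 < y" "y < t"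
          using eventually_happens[of _ "at_right (0::real)"] by auto
        have "norm (wronskian (\<lambda>x. of_real (u1 x)) f t - wronskian (\<lambda>x. of_real (u1 x)) f y) \<le>
            (N * (om t / ratio t)) * integral {y..t} (\<lambda>t. norm (Q t) * (u1 t * u2 t))"
        proof (rule be_diff_le)
          fix x assume x: "x \<in> {y..t}"
          have rx: "ratio x > 0" using ratio_pos[of x] x y t c by auto
          have "om x / ratio x = 1 / ratio x + e" "om t / ratio t = 1 / ratio t + e"
            using rx r by (simp_all add: om_def field_simps)
          moreover have "1 / ratio x \<le> 1 / ratio t" using mono[of x t] x y t r by (intro divide_left_mono) (auto simp: rx)
          ultimately have "om x / ratio x \<le> om t / ratio t" by simp
          then have "N * (om x / ratio x) \<le> N * (om t / ratio t)" using N0 by (intro mult_left_mono)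
          then have "N * (om x / ratio x) * ratio x \<le> N * (om t / ratio t) * ratio x" using rx by (intro mult_right_mono) auto
          then have "N * om x \<le> N * (om t / ratio t) * ratio x" using rx by simp
          then show "al x + be x * ratio x \<le> N * (om t / ratio t) * ratio x" using N'[of x] x y t by auto
        qed (use y t tc in auto)
        also have "\<dots> \<le> (N * (om t / ratio t)) * (1 / 4)"
          using N0 om[OF t] r tail[of y t] y t by (intro mult_left_mono) auto
        finally have "be t \<le> be y + (N * (om t / ratio t)) * (1 / 4)" unfolding be_def by (rule norm_le_of_diff(1))
        then show ?thesis using y by simp
      qed
      have "be t \<le> N * om t / ratio t / 4" by (rule field_le_epsilon) (use b in auto)
      then have "be t * ratio t \<le> N * om t / 4" using r by (simp add: field_simps)
      moreover have "al c * 1 \<le> al c * om t" using r e by (intro mult_left_mono) (auto simp: om_def)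
      ultimately show ?thesis using a by (simp add: algebra_simps)
    qed
    have "N \<le> al c + N / 2" unfolding N_def
    proof (rule cSup_least)
      show "S \<noteq> {}" using c by (auto simp: S_def)
      fix y assume "y \<in> S"
      then obtain t where t: "0 < t" "t \<le> c" "y = (al t + be t * ratio t) / om t" by (auto simp: S_def)
      show "y \<le> al c + Sup S / 2" using step[OF t(1,2)] om[OF t(1,2)] t(3) by (simp add: pos_divide_le_eq N_def)
    qed
    then have "N \<le> 2 * al c" by simp
    then have "N * om x \<le> 2 * al c * om x" using om[OF x] by (intro mult_right_mono) auto
    then show ?thesis using N'[OF x] by (simp add: om_def)
  qed
  have al_le: "al x \<le> 2 * al c" if x: "0 < x" "x \<le> c" for x
  proof (rule field_le_epsilon)
    fix d :: real assume d: "d > 0"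
    have r: "ratio x > 0" using ratio_pos[of x] x c by auto
    \<comment> \<open>At the fixed point x this makes the e-dependent part of \<open>key\<close> at
      most d.\<close>
    define e where "e = d / ((2 * al c + 1) * ratio x)"
    have p: "2 * al c + 1 > 0" using al_be_nonneg(1)[of c] by linarith
    have e: "e > 0" using d r p by (simp add: e_def)
    have "2 * al c * (e * ratio x) \<le> (2 * al c + 1) * (e * ratio x)" using e r by (intro mult_right_mono) auto
    also have "\<dots> = d" using r p by (simp add: e_def)
    finally have "2 * al c * (e * ratio x) \<le> d" .
    moreover have "be x * ratio x \<ge> 0" using r by simp
    ultimately show "al x \<le> 2 * al c + d" using key[OF e x] by (simp add: algebra_simps)
  qed
  have en: "\<bar>energy f x\<bar> \<le> al x * be x" if x: "x \<in> {0<..<c0}" for x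
  proof -
    have r1: "cnj (dx (\<lambda>x. of_real (u1 x)) x) = dx (\<lambda>x. of_real (u1 x)) x"
      using sl_solution_cnj(2)[OF s1 x] unfolding complex_cnj_complex_of_real by (rule sym)
    have r2: "cnj (dx (\<lambda>x. of_real (u2 x)) x) = dx (\<lambda>x. of_real (u2 x)) x"
      using sl_solution_cnj(2)[OF s2 x] unfolding complex_cnj_complex_of_real by (rule sym)
    define a b where "a = wronskian (\<lambda>x. of_real (u2 x)) f x" and "b = wronskian (\<lambda>x. of_real (u1 x)) f x"
    \<comment> \<open>The Pluecker relation for \<open>u1\<close>, \<open>u2\<close>, f and the
      conjugate of f, where \<open>u1\<close> and \<open>u2\<close> are real.\<close>
    have "wronskian (\<lambda>x. of_real (u2 x)) (\<lambda>x. of_real (u1 x)) x * wronskian (\<lambda>x. cnj (f x)) f x = cnj a * b - a * cnj b"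
      using sl_solution_cnj(2)[OF f x] by (simp add: a_def b_def wronskian_def r1 r2 algebra_simps)
    then have "2 * \<i> * of_real (energy f x) = cnj a * b - a * cnj b"
      using W21[OF x] energy_wronskian[OF f x] by simp
    then have "norm (2 * \<i> * of_real (energy f x)) \<le> norm (cnj a * b) + norm (a * cnj b)"
      by (metis norm_triangle_ineq4)
    then show ?thesis by (simp add: norm_mult al_def be_def a_def b_def mult.commute)
  qed
  show ?thesis
  proof (rule Lim_null_comparison)
    show "((\<lambda>x. 2 * al c * be x) \<longlongrightarrow> 0) (at_right 0)" using tendsto_mult_right_zero[OF be0] by auto
    have "\<forall>\<^sub>F y in at_right 0. y \<in> {0<..<c}" using c eventually_at_right_real by blast
    then show "\<forall>\<^sub>F x in at_right 0. norm (energy f x) \<le> 2 * al c * be x"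
    proof eventually_elim
      case (elim x)
      have "\<bar>energy f x\<bar> \<le> al x * be x" using en[of x] elim c by auto
      also have "\<dots> \<le> 2 * al c * be x" using al_le[of x] elim by (intro mult_right_mono) auto
      finally show ?case by simp
    qed
  qed
qed

text \<open>If \<open>be\<close> does not tend to 0 it takes values at least e at points arbitrarily
  close to 0; past such a point its variation is at most e / 8. As \<open>ratio\<close> is
  unbounded, the \<open>u2\<close> part of f then dominates the \<open>u1\<close> part. This is the
  alternative that square integrability excludes when \<open>u2\<close> is not square
  integrable.\<close>

lemma be_vanishes_or_large:
  assumes ratio_inf: "filterlim ratio at_top (at_right 0)"
  shows "(be \<longlongrightarrow> 0) (at_right 0) \<or> (\<exists>m>0. \<forall>\<^sub>F x in at_right 0. m * u2 x \<le> norm (f x))"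
proof (cases "(be \<longlongrightarrow> 0) (at_right 0)")
  case False
  obtain c1 K where c1: "0 < c1" "c1 < c0" "K > 0" and K: "\<And>x. 0 < x \<Longrightarrow> x \<le> c1 \<Longrightarrow> al x + be x * ratio x \<le> K * ratio x"
    using coefficients_bounded by blast
  obtain e where e: "e > 0" "\<not> (\<forall>\<^sub>F x in at_right 0. be x < e)"
    using False by (auto simp: tendsto_iff dist_real_def)
  obtain c2 where c2: "0 < c2" "c2 < c0" and tail2: "\<And>x y. 0 < x \<Longrightarrow> x \<le> y \<Longrightarrow> y \<le> c2 \<Longrightarrow>
      integral {x..y} (\<lambda>t. norm (Q t) * (u1 t * u2 t)) \<le> e / (8 * K)"
    using Q_tail[of "e / (8 * K)"] e c1 by auto
  define c where "c = min c1 c2"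
  have c: "0 < c" "c \<le> c1" "c \<le> c2" "c < c0" using c1 c2 by (auto simp: c_def)
  have "\<exists>d. 0 < d \<and> d < c \<and> be d \<ge> e"
  proof (rule ccontr)
    assume "\<not> ?thesis"
    then have "be x < e" if "x \<in> {0<..<c}" for x using that by force
    moreover have "\<forall>\<^sub>F y in at_right 0. y \<in> {0<..<c}" using c eventually_at_right_real by blast
    ultimately have "\<forall>\<^sub>F y in at_right 0. be y < e" by (rule eventually_mono[rotated])
    then show False using e by simp
  qed
  then obtain d where d: "0 < d" "d < c" "be d \<ge> e" by blast
  have KJ: "K * integral {x..d} (\<lambda>t. norm (Q t) * (u1 t * u2 t)) \<le> e / 8" if "0 < x" "x \<le> d" for x
  proof -
    have "K * integral {x..d} (\<lambda>t. norm (Q t) * (u1 t * u2 t)) \<le> K * (e / (8 * K))"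
      using tail2[OF that] d c c1 by (intro mult_left_mono) auto
    then show ?thesis using c1 by simp
  qed
  have b: "be x \<ge> e / 2" if x: "0 < x" "x \<le> d" for x
  proof -
    have "norm (wronskian (\<lambda>x. of_real (u1 x)) f d - wronskian (\<lambda>x. of_real (u1 x)) f x) \<le> K * integral {x..d} (\<lambda>t. norm (Q t) * (u1 t * u2 t))"
      using x d c by (intro be_diff_le K) auto
    then have "be d \<le> be x + K * integral {x..d} (\<lambda>t. norm (Q t) * (u1 t * u2 t))" unfolding be_def by (rule norm_le_of_diff(1))
    then show ?thesis using KJ[OF x] d e by linarith
  qed
  have a: "al x \<le> al d + e / 8 * ratio x" if x: "0 < x" "x \<le> d" for x
  proof -
    have r: "ratio x > 0" using ratio_pos[of x] x d c by auto
    have "al x \<le> al d + (K * ratio x) * integral {x..d} (\<lambda>t. norm (Q t) * (u1 t * u2 t))"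
    proof (rule al_diff_le[OF x])
      fix t assume t: "t \<in> {x..d}"
      have "ratio t \<le> ratio x" unfolding ratio_def using t x d c by (intro ratio_antimono) auto
      then have "K * ratio t \<le> K * ratio x" using c1 by (intro mult_left_mono) auto
      then show "al t + be t * ratio t \<le> K * ratio x" using K[of t] t x d c by auto
    qed (use d c in auto)
    also have "\<dots> = al d + (K * integral {x..d} (\<lambda>t. norm (Q t) * (u1 t * u2 t))) * ratio x" by simp
    also have "\<dots> \<le> al d + e / 8 * ratio x" using KJ[OF x] r by (intro add_left_mono mult_right_mono) auto
    finally show ?thesis .
  qed
  have "\<forall>\<^sub>F x in at_right 0. e / 4 * u2 x \<le> norm (f x)"
  proof -
    have "\<forall>\<^sub>F x in at_right 0. ratio x \<ge> 8 * al d / e" using ratio_inf by (simp add: filterlim_at_top)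
    moreover have "\<forall>\<^sub>F y in at_right 0. y \<in> {0<..<d}" using d eventually_at_right_real by blast
    ultimately show ?thesis
    proof eventually_elim
      case (elim x)
      have x: "x \<in> {0<..<c0}" "0 < x" "x \<le> d" using elim d c by auto
      have u: "ratio x * u1 x = u2 x" using pos[OF x(1)] by (simp add: ratio_def)
      have "al d \<le> e / 8 * ratio x" using elim e by (simp add: field_simps)
      then have "al x \<le> e / 4 * ratio x" using a[OF x(2,3)] by simp
      then have "al x * u1 x \<le> e / 4 * ratio x * u1 x" using pos[OF x(1)] by (intro mult_right_mono) auto
      then have "al x * u1 x \<le> e / 4 * u2 x" using u by (simp add: mult.assoc)
      moreover have "be x * u2 x \<ge> e / 2 * u2 x" using b[OF x(2,3)] pos[OF x(1)] by (intro mult_right_mono) auto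
      ultimately show ?case using norm_f_ge[OF x(1)] by simp
    qed
  qed
  then show ?thesis using e by (intro disjI2 exI[of _ "e / 4"]) auto
qed auto

end
end

section \<open>Classical solutions and small integrals near 0\<close>

lemma sl_solution_classical:
  fixes u u' a :: "real \<Rightarrow> real"
  assumes J: "open J" "is_interval J"
    and u: "\<And>x. x \<in> J \<Longrightarrow> (u has_real_derivative u' x) (at x)"
    and u': "\<And>x. x \<in> J \<Longrightarrow> (u' has_real_derivative a x * u x) (at x)"
    and a: "continuous_on J a"
  shows "sl_solution J (\<lambda>x. of_real (a x)) (\<lambda>x. of_real (u x))"
    "\<And>x. x \<in> J \<Longrightarrow> dx (\<lambda>x. of_real (u x)) x = of_real (u' x)"
proof -
  have d1: "((\<lambda>x. complex_of_real (u x)) has_vector_derivative of_real (u' x)) (at x)" if "x \<in> J" for x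
    using u[OF that] by (intro has_vector_derivative_of_real) (simp add: has_real_derivative_iff_has_vector_derivative)
  show dx: "\<And>x. x \<in> J \<Longrightarrow> dx (\<lambda>x. of_real (u x)) x = of_real (u' x)"
    using d1 vector_derivative_at by blast
  show "sl_solution J (\<lambda>x. of_real (a x)) (\<lambda>x. of_real (u x))"
    unfolding sl_solution_def
  proof (intro conjI ballI impI J)
    fix c d assume cd: "c \<in> J" "d \<in> J" "c \<le> d"
    have sub: "{c..d} \<subseteq> J" using interval_Icc[OF J(2) cd(1,2)] by blast
    show "(\<lambda>x. complex_of_real (a x)) absolutely_integrable_on {c..d}"
      using continuous_on_subset[OF a sub] by (intro absolutely_integrable_continuous_real continuous_intros)
    have "((\<lambda>x. complex_of_real (a x * u x)) has_integral (of_real (u' d) - of_real (u' c))) {c..d}"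
    proof (rule fundamental_theorem_of_calculus[OF cd(3)])
      fix x assume "x \<in> {c..d}"
      then show "((\<lambda>x. complex_of_real (u' x)) has_vector_derivative of_real (a x * u x)) (at x within {c..d})"
        using u'[of x] sub by (intro has_vector_derivative_of_real has_vector_derivative_at_within)
          (auto simp: has_real_derivative_iff_has_vector_derivative)
    qed
    then show "((\<lambda>x. complex_of_real (a x) * complex_of_real (u x)) has_integral
        (dx (\<lambda>x. of_real (u x)) d - dx (\<lambda>x. of_real (u x)) c)) {c..d}"
      using dx cd by simp
  qed (use d1 in \<open>auto dest: differentiableI_vector\<close>)
qed

lemma sl_solution_subset:
  assumes "sl_solution I A u" "J \<subseteq> I" "open J" "is_interval J"
  shows "sl_solution J A u"
  using assms unfolding sl_solution_def by blast

lemma integral_tail_at_0: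
  fixes g :: "real \<Rightarrow> real"
  assumes g: "g integrable_on {0<..<1}" and g0: "\<And>x. 0 < x \<Longrightarrow> x < 1 \<Longrightarrow> 0 \<le> g x" and e: "e > 0"
  shows "\<exists>c. 0 < c \<and> c < 1 \<and> (\<forall>x y. 0 < x \<longrightarrow> x \<le> y \<longrightarrow> y \<le> c \<longrightarrow> integral {x..y} g \<le> e)"
proof -
  define G where "G = (\<lambda>x. integral {0..x} g)"
  have gi: "g integrable_on {0..1}" using g by (simp add: integrable_on_open_interval_real)
  have "continuous_on {0..1} G" unfolding G_def by (rule indefinite_integral_continuous_1[OF gi])
  then have "(G \<longlongrightarrow> G 0) (at 0 within {0..1})" by (simp add: continuous_on_def)
  then have "\<forall>\<^sub>F x in at 0 within {0..1}. G x < e" by (rule order_tendstoD) (use e in \<open>simp add: G_def\<close>)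
  then obtain d where d: "d > 0" "\<And>x. x \<in> {0..1} \<Longrightarrow> x \<noteq> 0 \<Longrightarrow> dist x 0 < d \<Longrightarrow> G x < e"
    unfolding eventually_at by blast
  define c where "c = min (d / 2) (1 / 2)"
  have c: "0 < c" "c < 1" "c < d" using d by (auto simp: c_def)
  have "integral {x..y} g \<le> e" if xy: "0 < x" "x \<le> y" "y \<le> c" for x y
  proof -
    have sub: "g integrable_on {s..t}" if "0 \<le> s" "t \<le> 1" for s t using integrable_subinterval_real[OF gi] that by auto
    have "G y = integral {0..x} g + integral {x..y} g"
      unfolding G_def using xy c by (intro Henstock_Kurzweil_Integration.integral_combine[symmetric] sub) auto
    moreover have "integral {0..x} g \<ge> 0"
    proof -
      have "integral {0<..<x} g \<ge> 0"
        using sub[of 0 x] xy c by (intro integral_nonneg) (auto simp: integrable_on_open_interval_real intro!: g0)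
      then show ?thesis by (simp add: integral_open_interval_real)
    qed
    moreover have "G y < e" using d(2)[of y] xy c by (auto simp: dist_real_def)
    ultimately show ?thesis by linarith
  qed
  then show ?thesis using c by blast
qed

section \<open>The singular endpoint 0\<close>

text \<open>The second solution of the unperturbed equation, normalized to have Wronskian 1 with
  x^(l+1). At l = -1/2 the powers x^(l+1) and x^(-l) coincide and a logarithm appears; the constant
  in 1 - ln x keeps the solution positive on (0, 1).\<close>

definition nonprincipal :: "real \<Rightarrow> real \<Rightarrow> real" where
  "nonprincipal l x = (if l > -1/2 then x powr (- l) / (2 * l + 1) else sqrt x * (1 - ln x))"

definition nonprincipal' :: "real \<Rightarrow> real \<Rightarrow> real" where
  "nonprincipal' l x = (if l > -1/2 then - l * x powr (- l - 1) / (2 * l + 1) else (- 1 - ln x) / (2 * sqrt x))"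

lemma nonprincipal_ratio:
  assumes "x > 0" "l \<ge> -1/2"
  shows "nonprincipal l x / x powr (l + 1) = (if l > -1/2 then x powr (- (2 * l + 1)) / (2 * l + 1) else 1 - ln x)"
proof (cases "l > -1/2")
  case True
  have "x powr (- l) / x powr (l + 1) = x powr (- (2 * l + 1))"
    by (simp add: powr_diff[symmetric])
  moreover have "x powr (- l) / (2 * l + 1) / x powr (l + 1) = x powr (- l) / x powr (l + 1) / (2 * l + 1)"
    by (simp add: mult.commute)
  ultimately show ?thesis using True by (simp add: nonprincipal_def)
next
  case False
  then have "l = -1/2" using assms by simp
  then show ?thesis using assms by (simp add: nonprincipal_def powr_half_sqrt)
qed

text \<open>Up to a constant factor this product is the weight in the integrability hypothesis on q;
  the factor 1 - ln x at l = -1/2 originates here.\<close>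

lemma nonprincipal_mult:
  assumes "x > 0" "l \<ge> -1/2"
  shows "x powr (l + 1) * nonprincipal l x = (if l > -1/2 then x / (2 * l + 1) else x * (1 - ln x))"
proof (cases "l > -1/2")
  case True
  have "x powr (l + 1) * x powr (- l) = x" using assms by (simp add: powr_add[symmetric])
  then show ?thesis using True by (simp add: nonprincipal_def)
next
  case False
  then have "l = -1/2" using assms by simp
  then show ?thesis using assms by (simp add: nonprincipal_def powr_half_sqrt)
qed

lemma principal_derivs:
  assumes "x > 0"
  shows "((\<lambda>x. x powr (l + 1)) has_real_derivative (l + 1) * x powr l) (at x)"
    "((\<lambda>x. (l + 1) * x powr l) has_real_derivative l * (l + 1) / x\<^sup>2 * x powr (l + 1)) (at x)"
proof -
  show "((\<lambda>x. x powr (l + 1)) has_real_derivative (l + 1) * x powr l) (at x)"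
    using assms by (auto intro!: derivative_eq_intros)
  have e: "x powr (l + 1) = x\<^sup>2 * x powr (l - 1)"
    using powr_add[of x 2 "l - 1"] assms by (simp add: powr_numeral add.commute)
  show "((\<lambda>x. (l + 1) * x powr l) has_real_derivative l * (l + 1) / x\<^sup>2 * x powr (l + 1)) (at x)"
    unfolding e using assms by (auto intro!: derivative_eq_intros simp: field_simps)
qed

lemma nonprincipal_derivs:
  assumes x: "x > 0" and l: "l \<ge> -1/2"
  shows "(nonprincipal l has_real_derivative nonprincipal' l x) (at x)"
    "(nonprincipal' l has_real_derivative l * (l + 1) / x\<^sup>2 * nonprincipal l x) (at x)"
proof -
  show "(nonprincipal l has_real_derivative nonprincipal' l x) (at x)"
  proof (cases "l > -1/2")
    case True
    have "((\<lambda>x. x powr (- l)) has_real_derivative - l * x powr (- l - 1)) (at x)"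
      using x by (auto intro!: derivative_eq_intros)
    from DERIV_cdivide[OF this, of "2 * l + 1"] show ?thesis using True by (simp add: nonprincipal_def[abs_def] nonprincipal'_def)
  next
    case False
    have "((\<lambda>x. sqrt x * (1 - ln x)) has_real_derivative (- 1 - ln x) / (2 * sqrt x)) (at x)"
      using x by (auto intro!: derivative_eq_intros simp: field_simps real_sqrt_mult[symmetric])
    then show ?thesis using False by (simp add: nonprincipal_def[abs_def] nonprincipal'_def)
  qed
  show "(nonprincipal' l has_real_derivative l * (l + 1) / x\<^sup>2 * nonprincipal l x) (at x)"
  proof (cases "l > -1/2")
    case True
    have e: "x powr (- l) = x\<^sup>2 * x powr (- l - 2)"
      using powr_add[of x 2 "- l - 2"] x by (simp add: powr_numeral)
    have "((\<lambda>x. x powr (- l - 1)) has_real_derivative (- l - 1) * x powr (- l - 2)) (at x)"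
    proof -
      have eq: "- l - 2 = - l - 1 - (1::real)" by simp
      show ?thesis unfolding eq by (rule has_real_derivative_powr[OF x])
    qed
    from DERIV_cdivide[OF DERIV_cmult[OF this, of "- l"], of "2 * l + 1"]
    have "((\<lambda>x. - l * x powr (- l - 1) / (2 * l + 1)) has_real_derivative - l * ((- l - 1) * x powr (- l - 2)) / (2 * l + 1)) (at x)" .
    moreover have "- l * ((- l - 1) * x powr (- l - 2)) / (2 * l + 1) = l * (l + 1) / x\<^sup>2 * (x powr (- l) / (2 * l + 1))"
    proof -
      have "- l * ((- l - 1) * p) / k = l * (l + 1) / x\<^sup>2 * (x\<^sup>2 * p / k)" for p k using x by (cases "k = 0") (auto simp: field_simps)
      then show ?thesis unfolding e .
    qed
    ultimately have "((\<lambda>x. - l * x powr (- l - 1) / (2 * l + 1)) has_real_derivative l * (l + 1) / x\<^sup>2 * (x powr (- l) / (2 * l + 1))) (at x)" by simp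
    then show ?thesis using True by (simp add: nonprincipal_def nonprincipal'_def[abs_def])
  next
    case False
    then have l2: "l = -1/2" using l by simp
    have "((\<lambda>x. (- 1 - ln x) / (2 * sqrt x)) has_real_derivative - (1 / 4) / x\<^sup>2 * (sqrt x * (1 - ln x))) (at x)"
    proof -
      have "((\<lambda>x. (- 1 - ln x) / (2 * sqrt x)) has_real_derivative
         ((- (1 / x)) * (2 * sqrt x) - (- 1 - ln x) * (2 * (inverse (sqrt x) / 2))) / (2 * sqrt x * (2 * sqrt x))) (at x)"
        using x by (intro DERIV_divide derivative_intros DERIV_real_sqrt) (auto intro!: derivative_eq_intros)
      also have "((- (1 / x)) * (2 * sqrt x) - (- 1 - ln x) * (2 * (inverse (sqrt x) / 2))) / (2 * sqrt x * (2 * sqrt x)) =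
         - (1 / 4) / x\<^sup>2 * (sqrt x * (1 - ln x))"
      proof -
        have "((- (1 / (r * r))) * (2 * r) - (- 1 - L) * (2 * (inverse r / 2))) / (2 * r * (2 * r)) =
           - (1 / 4) / (r * r)\<^sup>2 * (r * (1 - L))" if "r > 0" for r L :: real
          using that by (simp add: field_simps power2_eq_square)
        from this[of "sqrt x" "ln x"] show ?thesis using x by simp
      qed
      finally show ?thesis .
    qed
    then show ?thesis using l2 by (simp add: nonprincipal_def nonprincipal'_def[abs_def])
  qed
qed

lemma wronskian_nonprincipal:
  assumes x: "x > 0" and l: "l \<ge> -1/2"
  shows "nonprincipal l x * ((l + 1) * x powr l) - nonprincipal' l x * x powr (l + 1) = 1"
proof (cases "l > -1/2")
  case True
  have "x powr (- l) * x powr l = 1" "x powr (- l - 1) * x powr (l + 1) = 1" using x by (simp_all add: powr_add[symmetric])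
  moreover have "(a / k) * (c * b) - (- l * d / k) * e = (c * (a * b) + l * (d * e)) / k" for a b c d e k :: real
    by (simp add: add_divide_distrib algebra_simps)
  ultimately show ?thesis using True by (simp add: nonprincipal_def nonprincipal'_def)
next
  case False
  then have l2: "l = -1/2" using l by simp
  define r where "r = sqrt x"
  have r: "r > 0" "x = r * r" using x by (auto simp: r_def)
  have p: "x powr (1/2) = r" "x powr (- (1/2)) = 1 / r" using x by (simp_all add: powr_half_sqrt r_def powr_minus_divide)
  show ?thesis using r p unfolding nonprincipal_def nonprincipal'_def l2 r_def[symmetric] by (simp add: field_simps)
qed

text \<open>The integral of k / x diverges logarithmically at 0.\<close>

lemma not_L2_if_ge_inverse_sqrt:
  fixes f :: "real \<Rightarrow> complex"
  assumes f: "(\<lambda>x. (norm (f x))\<^sup>2) absolutely_integrable_on {0<..<c}" and c: "0 < c"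
    and ge: "\<forall>\<^sub>F x in at_right 0. k / x \<le> (norm (f x))\<^sup>2" and k: "k > 0"
  shows False
proof -
  obtain d1 where d1: "d1 > 0" "\<And>x. 0 < x \<Longrightarrow> x < d1 \<Longrightarrow> k / x \<le> (norm (f x))\<^sup>2"
    using ge unfolding eventually_at_right_field by auto
  define d where "d = min (d1 / 2) (c / 2)"
  have d: "0 < d" "d < d1" "d < c" using d1 c by (auto simp: d_def)
  define K where "K = integral {0<..<c} (\<lambda>x. (norm (f x))\<^sup>2)"
  have fi: "(\<lambda>x. (norm (f x))\<^sup>2) integrable_on {0<..<c}" using f by (simp add: absolutely_integrable_on_def)
  have K: "K \<ge> 0" unfolding K_def by (intro integral_nonneg fi) auto
  \<comment> \<open>The point at which the integral of k / t from x to d equals K + 1.\<close>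
  define x where "x = d * exp (- ((K + 1) / k))"
  have x: "0 < x" "x \<le> d" using d K k by (auto simp: x_def mult_le_cancel_left1)
  have "((\<lambda>t. k / t) has_integral (k * ln d - k * ln x)) {x..d}"
    using x by (intro fundamental_theorem_of_calculus)
      (auto intro!: derivative_eq_intros simp: has_real_derivative_iff_has_vector_derivative[symmetric])
  moreover have sub: "(\<lambda>x. (norm (f x))\<^sup>2) integrable_on {x..d}"
    by (rule integrable_on_subinterval[OF fi]) (use x d in auto)
  ultimately have "k * ln d - k * ln x \<le> integral {x..d} (\<lambda>x. (norm (f x))\<^sup>2)"
    using d1(2) x d by (intro has_integral_le[OF _ integrable_integral[OF sub]]) auto
  also have "\<dots> \<le> K" unfolding K_def using x d by (intro integral_subset_le sub fi) auto
  also have "k * ln d - k * ln x = K + 1"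
  proof -
    have "ln x = ln d - (K + 1) / k" using d by (simp add: x_def ln_mult)
    moreover have "k * ln d - k * (ln d - w) = k * w" for w by (simp add: algebra_simps)
    ultimately show ?thesis using k by simp
  qed
  finally show False by simp
qed

lemma filterlim_nonprincipal_ratio:
  assumes "l > -1/2"
  shows "filterlim (\<lambda>x. nonprincipal l x / x powr (l + 1)) at_top (at_right 0)"
proof -
  define p where "p = 2 * l + 1"
  have p: "p > 0" using assms by (simp add: p_def)
  have "filterlim (\<lambda>x. x powr (- p) / p) at_top (at_right 0)"
    using p by real_asymp
  moreover have "\<forall>\<^sub>F x in at_right 0. x powr (- p) / p = nonprincipal l x / x powr (l + 1)"
    using eventually_at_right_less[of 0] by eventually_elim (use assms in \<open>simp add: nonprincipal_ratio p_def\<close>)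
  ultimately show ?thesis by (rule filterlim_cong[THEN iffD1, rotated -1, OF _ refl refl])
qed

text \<open>The expression in the boundary condition is, up to sign, the Wronskian with x^(l+1),
  whose modulus is \<open>be\<close>. For l < 1/2 the condition says that it tends to 0; for l \<ge>
  1/2 the other alternative would make u at least a multiple of x^(-l), contradicting square
  integrability.\<close>

lemma energy_vanishes_at_0:
  assumes l: "l \<ge> -1/2" and b: "0 < b" and q: "potential_ok l q"
    and u: "eigsol (einterval 0 b) (\<lambda>x. l * (l + 1) / x\<^sup>2 + q x) z u"
    and dom: "in_domain_near_0 l b u"
  shows "(energy u \<longlongrightarrow> 0) (at_right 0)"
proof -
  obtain b' :: real where b': "0 < b'" "ereal b' < b"
    using ereal_dense2[of 0 b] b by (metis ereal_less(2))
  \<comment> \<open>Below 1 the hypothesis on q applies and 1 - ln x is positive.\<close>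
  define c0 where "c0 = min b' 1"
  have cc: "0 < c0" "c0 \<le> 1" "c0 \<le> b'" using b' by (auto simp: c0_def)
  have sub: "{0<..<c0} \<subseteq> einterval 0 b"
  proof
    fix x assume "x \<in> {0<..<c0}"
    then have "0 < x" "ereal x < ereal b'" using cc by auto
    then show "x \<in> einterval 0 b" using less_trans[OF _ b'(2), of "ereal x"] by (auto simp: einterval_def)
  qed
  define A0 where "A0 = (\<lambda>x. complex_of_real (l * (l + 1) / x\<^sup>2))"
  \<comment> \<open>The spectral parameter counts as part of the perturbation; this is harmless
    because \<open>u1 u2\<close> is bounded on (0, c0).\<close>
  define Q where "Q = (\<lambda>x. of_real (q x) - z)"
  define u1 where "u1 = (\<lambda>x::real. x powr (l + 1))"
  define u2 where "u2 = nonprincipal l"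
  have J: "open {0<..<c0}" "is_interval {0<..<c0}" by (auto simp: is_interval_oo)
  have ca: "continuous_on {0<..<c0} (\<lambda>x. l * (l + 1) / x\<^sup>2)" by (intro continuous_intros) auto
  have t1: "sl_solution {0<..<c0} A0 (\<lambda>x. of_real (u1 x))" "\<And>x. x \<in> {0<..<c0} \<Longrightarrow> dx (\<lambda>x. of_real (u1 x)) x = of_real ((l + 1) * x powr l)"
    unfolding A0_def u1_def using principal_derivs by (intro sl_solution_classical[OF J _ _ ca]; force)+
  have t2: "sl_solution {0<..<c0} A0 (\<lambda>x. of_real (u2 x))" "\<And>x. x \<in> {0<..<c0} \<Longrightarrow> dx (\<lambda>x. of_real (u2 x)) x = of_real (nonprincipal' l x)"
    unfolding A0_def u2_def using nonprincipal_derivs[OF _ l] by (intro sl_solution_classical[OF J _ _ ca]; force)+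
  have pos1: "u1 x > 0" if "x \<in> {0<..<c0}" for x using that by (simp add: u1_def)
  have ratio_eq: "u2 x / u1 x = (if l > -1/2 then x powr (- (2 * l + 1)) / (2 * l + 1) else 1 - ln x)" if "x > 0" for x
    unfolding u1_def u2_def by (rule nonprincipal_ratio[OF that l])
  have prod_eq: "u1 x * u2 x = (if l > -1/2 then x / (2 * l + 1) else x * (1 - ln x))" if "x > 0" for x
    unfolding u1_def u2_def by (rule nonprincipal_mult[OF that l])
  have prod_pos: "u1 x * u2 x > 0" if x: "x \<in> {0<..<c0}" for x
  proof -
    have "ln x < 1" using x cc ln_le_minus_one[of x] by auto
    then show ?thesis using x prod_eq[of x] by simp
  qed
  have pos2: "u2 x > 0" if "x \<in> {0<..<c0}" for x using prod_pos[OF that] pos1[OF that] by (simp add: zero_less_mult_iff)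
  have prod_le: "u1 x * u2 x \<le> (if l > -1/2 then 1 / (2 * l + 1) else 1)" if x: "x \<in> {0<..<c0}" for x
  proof (cases "l > -1/2")
    case True then show ?thesis using prod_eq[of x] x cc by (simp add: divide_right_mono)
  next
    case False
    have "ln (1 / x) \<le> 1 / x - 1" using x by (intro ln_le_minus_one) auto
    then have "x * (1 - ln x) \<le> x * (1 / x)" using x by (intro mult_left_mono) (auto simp: ln_div)
    then show ?thesis using False prod_eq[of x] x by simp
  qed
  define C where "C = (if l > -1/2 then 1 / (2 * l + 1) else 1)"
  have C: "C > 0" by (simp add: C_def)
  define h where "h = (\<lambda>x. x * (if l > -1/2 then \<bar>q x\<bar> else (1 - ln x) * \<bar>q x\<bar>))"
  have hi: "h integrable_on {0<..<1}" using q unfolding potential_ok_def h_def by (auto simp: absolutely_integrable_on_def)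
  have prod_h: "\<bar>q x\<bar> * (u1 x * u2 x) = C * h x" if "x > 0" for x
    using prod_eq[OF that] by (simp add: C_def h_def)
  have h0: "h x \<ge> 0" if "0 < x" "x < 1" for x
  proof -
    have "ln x < 1" using that ln_le_minus_one[of x] by auto
    then show ?thesis using that by (simp add: h_def)
  qed
  have uQ: "sl_solution {0<..<c0} (\<lambda>x. A0 x + Q x) u"
    using sl_solution_subset[OF u sub J] by (simp add: A0_def Q_def algebra_simps)
  have Qint: "(\<lambda>t. norm (Q t) * (u1 t * u2 t)) integrable_on {x..y}" if xy: "0 < x" "x \<le> y" "y < c0" for x y
  proof -
    have "q absolutely_integrable_on {x..y}"
    proof (cases "x < y")
      case True then show ?thesis using q xy by (auto simp: potential_ok_def)
    next
      case False then have "x = y" using xy by simp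
      then show ?thesis using absolutely_integrable_negligible[of "{y}" q] by simp
    qed
    from absolutely_integrable_linear[OF this bounded_linear_of_real[where 'a=complex]]
    have "(\<lambda>t. complex_of_real (q t)) absolutely_integrable_on {x..y}" by (simp add: o_def)
    then have Qa: "Q absolutely_integrable_on {x..y}" unfolding Q_def
      by (rule set_integral_diff(1)) (intro absolutely_integrable_continuous_real continuous_intros)
    have sub': "{x..y} \<subseteq> {0<..<c0}" using xy by auto
    have "continuous_on {x..y} (\<lambda>t. complex_of_real (u1 t) * complex_of_real (u2 t))"
      by (intro continuous_intros continuous_on_subset[OF sl_solution_cont[OF t1(1)] sub'] continuous_on_subset[OF sl_solution_cont[OF t2(1)] sub'])
    from absolutely_integrable_mult_continuous[OF this Qa]
    have "(\<lambda>t. norm (complex_of_real (u1 t) * complex_of_real (u2 t) * Q t)) integrable_on {x..y}"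
      by (simp add: absolutely_integrable_on_def)
    then show ?thesis
    proof (rule integrable_eq)
      fix t assume "t \<in> {x..y}"
      then have "u1 t > 0" "u2 t > 0" using pos1 pos2 sub' by auto
      then show "norm (complex_of_real (u1 t) * complex_of_real (u2 t) * Q t) = norm (Q t) * (u1 t * u2 t)"
        by (simp add: norm_mult)
    qed
  qed
  interpret singular_end c0 A0 Q u1 u2
  proof
    show "wronskian (\<lambda>x. complex_of_real (u2 x)) (\<lambda>x. complex_of_real (u1 x)) x = 1" if "x \<in> {0<..<c0}" for x
    proof -
      have "u2 x * ((l + 1) * x powr l) - nonprincipal' l x * u1 x = 1"
        unfolding u1_def u2_def using that by (intro wronskian_nonprincipal l) auto
      then have "complex_of_real (u2 x * ((l + 1) * x powr l) - nonprincipal' l x * u1 x) = 1" by simp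
      then show ?thesis unfolding wronskian_def t1(2)[OF that] t2(2)[OF that] by simp
    qed
    show "u2 y / u1 y \<le> u2 x / u1 x" if "0 < x" "x \<le> y" "y < c0" for x y
    proof -
      have "y powr (- (2 * l + 1)) \<le> x powr (- (2 * l + 1))" if "l > -1/2"
        using \<open>0 < x\<close> \<open>x \<le> y\<close> that by (intro powr_mono2') auto
      then show ?thesis using that ratio_eq[of x] ratio_eq[of y] by (auto intro: divide_right_mono)
    qed
    show "\<exists>c. 0 < c \<and> c < c0 \<and> (\<forall>x y. 0 < x \<longrightarrow> x \<le> y \<longrightarrow> y \<le> c \<longrightarrow>
        integral {x..y} (\<lambda>t. norm (Q t) * (u1 t * u2 t)) \<le> e)" if e: "e > 0" for e
    proof -
      obtain c1 where c1: "0 < c1" "c1 < 1" "\<And>x y. 0 < x \<Longrightarrow> x \<le> y \<Longrightarrow> y \<le> c1 \<Longrightarrow> integral {x..y} h \<le> e / (2 * C)"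
        using integral_tail_at_0[OF hi h0, of "e / (2 * C)"] e C by auto
      \<comment> \<open>One half of e is spent on q through \<open>c1\<close>, the other half on the
        constant z through the length of the interval.\<close>
      define c where "c = min (min c1 (c0 / 2)) (e / (2 * C * (norm z + 1)))"
      have nz: "norm z + 1 > 0" by (simp add: add_nonneg_pos)
      have c: "0 < c" "c \<le> c1" "c < c0" "c \<le> e / (2 * C * (norm z + 1))" using c1 cc e C nz by (auto simp: c_def)
      have "integral {x..y} (\<lambda>t. norm (Q t) * (u1 t * u2 t)) \<le> e" if xy: "0 < x" "x \<le> y" "y \<le> c" for x y
      proof -
        have hxy: "h integrable_on {x..y}"
          by (rule integrable_on_subinterval[OF hi]) (use xy c c1 in auto)
        have "integral {x..y} (\<lambda>t. norm (Q t) * (u1 t * u2 t)) \<le> integral {x..y} (\<lambda>t. C * h t + norm z * C)"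
        proof (intro integral_le Qint integrable_add integrable_const_ivl)
          show "(\<lambda>t. C * h t) integrable_on {x..y}" using hxy by (rule integrable_on_mult_right)
          fix t assume t: "t \<in> {x..y}"
          then have t': "t \<in> {0<..<c0}" "t > 0" using xy c by auto
          have "norm (Q t) \<le> \<bar>q t\<bar> + norm z" unfolding Q_def using norm_triangle_ineq4[of "of_real (q t)" z] by simp
          then have "norm (Q t) * (u1 t * u2 t) \<le> (\<bar>q t\<bar> + norm z) * (u1 t * u2 t)"
            using prod_pos[OF t'(1)] by (intro mult_right_mono) auto
          also have "\<dots> \<le> C * h t + norm z * C"
            using prod_h[OF t'(2)] prod_le[OF t'(1)] by (simp add: distrib_right mult_left_mono C_def)
          finally show "norm (Q t) * (u1 t * u2 t) \<le> C * h t + norm z * C" .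
        qed (use xy c in auto)
        also have "\<dots> = C * integral {x..y} h + (y - x) * (norm z * C)"
          using hxy xy by (subst Henstock_Kurzweil_Integration.integral_add) (auto intro: integrable_on_mult_right)
        also have "\<dots> \<le> C * (e / (2 * C)) + (e / (2 * C * (norm z + 1))) * ((norm z + 1) * C)"
          using c1(3)[of x y] xy c C e nz by (intro add_mono mult_left_mono mult_mono) auto
        also have "\<dots> = e"
        proof -
          have "C * (e / (2 * C)) + (e / (2 * C * n)) * (n * C) = e" if "n > 0" for n
            using C that by (simp add: field_simps)
          then show ?thesis using nz .
        qed
        finally show ?thesis .
      qed
      then show ?thesis using c by blast
    qed
  qed (use cc t1 t2 pos1 pos2 Qint in auto)
  have be_eq: "be u x = norm (of_real (x powr l) * (of_real (l + 1) * u x - of_real x * dx u x))" if x: "x \<in> {0<..<c0}" for x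
  proof -
    have "x powr (l + 1) = x powr l * x" using x by (simp add: powr_add)
    then have "wronskian (\<lambda>x. complex_of_real (u1 x)) u x = - (of_real (x powr l) * (of_real (l + 1) * u x - of_real x * dx u x))"
      unfolding wronskian_def t1(2)[OF x] by (simp add: u1_def algebra_simps)
    then show ?thesis by (simp add: be_def[OF uQ])
  qed
  have ev: "\<forall>\<^sub>F x in at_right 0. x \<in> {0<..<c0}" using cc eventually_at_right_real by blast
  have "(be u \<longlongrightarrow> 0) (at_right 0)"
  proof (cases "l < 1/2")
    case True
    then have "((\<lambda>x. norm (of_real (x powr l) * (of_real (l + 1) * u x - of_real x * dx u x))) \<longlongrightarrow> 0) (at_right 0)"
      using dom unfolding in_domain_near_0_def by (intro tendsto_norm_zero) auto
    moreover have "\<forall>\<^sub>F x in at_right 0. norm (of_real (x powr l) * (of_real (l + 1) * u x - of_real x * dx u x)) = be u x"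
      using ev by eventually_elim (simp add: be_eq)
    ultimately show ?thesis by (rule Lim_transform_eventually)
  next
    case False
    then have l1: "l \<ge> 1/2" by simp
    have "ratio = (\<lambda>x. nonprincipal l x / x powr (l + 1))" by (rule ext) (simp only: ratio_def, simp only: u1_def u2_def)
    then have "filterlim ratio at_top (at_right 0)" using filterlim_nonprincipal_ratio[of l] l1 by simp
    from be_vanishes_or_large[OF uQ this] show ?thesis
    proof
      assume "\<exists>m>0. \<forall>\<^sub>F x in at_right 0. m * u2 x \<le> norm (u x)"
      then obtain m where m: "m > 0" "\<forall>\<^sub>F x in at_right 0. m * u2 x \<le> norm (u x)" by blast
      obtain c where c: "c \<in> einterval 0 b" "(\<lambda>x. (norm (u x))\<^sup>2) absolutely_integrable_on {0<..<c}"
        using dom unfolding in_domain_near_0_def sq_integrable_near_0_def by auto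
      have "\<forall>\<^sub>F x in at_right 0. (m / (2 * l + 1))\<^sup>2 / x \<le> (norm (u x))\<^sup>2"
        using m(2) ev
      proof eventually_elim
        case (elim x)
        \<comment> \<open>Here x < 1 and 2 l \<ge> 1, so that x^(-2 l) is not integrable at
          0.\<close>
        have "1 / x = x powr (-1)" using elim by (simp add: powr_minus_divide)
        also have "\<dots> \<le> x powr (- 2 * l)" using elim l1 cc by (intro powr_mono') auto
        also have "\<dots> = (x powr (- l))\<^sup>2" using elim by (simp add: powr_power)
        finally have 1: "1 / x \<le> (x powr (- l))\<^sup>2" .
        have "(m / (2 * l + 1))\<^sup>2 * (1 / x) \<le> (m / (2 * l + 1))\<^sup>2 * (x powr (- l))\<^sup>2"
          using 1 by (intro mult_left_mono) auto
        also have "\<dots> = (m * u2 x)\<^sup>2" using l1 by (simp add: u2_def nonprincipal_def power_mult_distrib power_divide)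
        also have "\<dots> \<le> (norm (u x))\<^sup>2" using elim m pos2[of x] by (intro power_mono) auto
        finally show ?case by simp
      qed
      moreover have "(m / (2 * l + 1))\<^sup>2 > 0" using m l1 by simp
      moreover have "0 < c" using c(1) by (auto simp: einterval_def)
      ultimately have False using not_L2_if_ge_inverse_sqrt[OF c(2)] by blast
      then show ?thesis ..
    qed
  qed
  then show ?thesis by (rule energy_vanishes_if_be_vanishes[OF uQ])
qed

section \<open>Translation of the notions at the endpoints to compact intervals\<close>

definition full_potential :: "real \<Rightarrow> (real \<Rightarrow> real) \<Rightarrow> real \<Rightarrow> real" where
  "full_potential l q x = l * (l + 1) / x\<^sup>2 + q x"

lemma einterval_0_downward:
  assumes "t \<in> einterval 0 b" "0 < x" "x \<le> t"
  shows "x \<in> einterval 0 b"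
proof -
  have "ereal x \<le> ereal t" "ereal t < b" using assms by (auto simp: einterval_def)
  then have "ereal x < b" by (rule le_less_trans)
  then show ?thesis using assms by (simp add: einterval_def)
qed

lemma einterval_0: "open (einterval 0 b)" "is_interval (einterval 0 b)"
proof -
  show "is_interval (einterval 0 b)"
    unfolding is_interval_1
  proof (intro ballI allI impI)
    fix s t x assume a: "s \<in> einterval 0 b" "t \<in> einterval 0 b" "s \<le> x \<and> x \<le> t"
    show "x \<in> einterval 0 b" by (rule einterval_0_downward[OF a(2)]) (use a in \<open>auto simp: einterval_def\<close>)
  qed
qed simp

lemma solution_iff_eigsol:
  assumes q: "potential_ok l q"
  shows "solution l b q z u \<longleftrightarrow> eigsol (einterval 0 b) (full_potential l q) z u"
proof -
  have "(\<lambda>x. complex_of_real (full_potential l q x) - z) absolutely_integrable_on {c..d}"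
    if cd: "c \<in> einterval 0 b" "d \<in> einterval 0 b" "c \<le> d" for c d
  proof -
    have c: "c > 0" using cd by (simp add: einterval_def)
    have "q absolutely_integrable_on {c..d}"
    proof (cases "c < d")
      case True then show ?thesis using q c by (auto simp: potential_ok_def)
    next
      case False then have "c = d" using cd by simp
      then show ?thesis using absolutely_integrable_negligible[of "{d}" q] by simp
    qed
    from absolutely_integrable_linear[OF this bounded_linear_of_real[where 'a=complex]]
    have 1: "(\<lambda>t. complex_of_real (q t)) absolutely_integrable_on {c..d}" by (simp add: o_def)
    have 2: "(\<lambda>x. complex_of_real (l * (l + 1) / x\<^sup>2) - z) absolutely_integrable_on {c..d}"
      using c by (intro absolutely_integrable_continuous_real continuous_intros) auto
    from set_integral_add(1)[OF 2 1] show ?thesis by (simp add: full_potential_def algebra_simps)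
  qed
  then show ?thesis unfolding solution_def sl_solution_def full_potential_def[symmetric] using einterval_0 by auto
qed

lemma L2b_if_sq_integrable:
  assumes u: "continuous_on (einterval 0 b) u" and s: "sq_integrable_near_b b u"
  shows "L2b (einterval 0 b) u"
proof -
  obtain c where c: "c \<in> einterval 0 b" "(\<lambda>x. (norm (u x))\<^sup>2) absolutely_integrable_on (einterval (ereal c) b)"
    using s unfolding sq_integrable_near_b_def by blast
  have ci: "(\<lambda>x. (norm (u x))\<^sup>2) integrable_on einterval (ereal c) b" using c by (simp add: absolutely_integrable_on_def)
  \<comment> \<open>The closed intervals of \<open>L2b\<close> start at a point strictly inside the
    open interval on which the square is integrable.\<close>
  obtain c1 where c1: "ereal c < ereal c1" "ereal c1 < b" using ereal_dense2[of "ereal c" b] c by (auto simp: einterval_def)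
  have c1I: "c1 \<in> einterval 0 b" using c1 c by (auto simp: einterval_def)
  show ?thesis unfolding L2b_def
  proof (intro exI bexI[OF _ c1I] ballI impI)
    fix d assume d: "d \<in> einterval 0 b" "c1 \<le> d"
    have sub: "{c1..d} \<subseteq> einterval (ereal c) b"
    proof
      fix t assume t: "t \<in> {c1..d}"
      then have "ereal c < ereal t" "t \<in> einterval 0 b"
        using c1 c1I einterval_0_downward[OF d(1), of t] by (auto simp: einterval_def)
      then show "t \<in> einterval (ereal c) b" by (simp add: einterval_def)
    qed
    show "integral {c1..d} (\<lambda>x. (norm (u x))\<^sup>2) \<le> integral (einterval (ereal c) b) (\<lambda>x. (norm (u x))\<^sup>2)"
      by (intro integral_subset_le sub ci integrable_on_subinterval[OF ci sub]) auto
  qed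
qed

text \<open>Monotone convergence along compact intervals exhausting (c, b).\<close>

lemma sq_integrable_if_L2b:
  assumes u: "continuous_on (einterval 0 b) u" and L: "L2b (einterval 0 b) u"
  shows "sq_integrable_near_b b u"
proof -
  obtain K c where c: "c \<in> einterval 0 b" "\<And>d. d \<in> einterval 0 b \<Longrightarrow> c \<le> d \<Longrightarrow> integral {c..d} (\<lambda>x. (norm (u x))\<^sup>2) \<le> K"
    using L unfolding L2b_def by blast
  have cb: "ereal c < b" using c by (simp add: einterval_def)
  obtain uu ll :: "nat \<Rightarrow> real"
    where a: "einterval (ereal c) b = (\<Union>i. {ll i..uu i})" "incseq uu" "decseq ll" "\<And>i. ll i < uu i"
      "\<And>i. ereal c < ereal (ll i)" "\<And>i. ereal (uu i) < b"
      "(\<lambda>i. ereal (ll i)) \<longlonglongrightarrow> ereal c" "(\<lambda>i. ereal (uu i)) \<longlonglongrightarrow> b"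
    by (rule einterval_Icc_approximation[OF cb]) (rule that)
  define f where "f = (\<lambda>k x. if x \<in> {ll k..uu k} then (norm (u x))\<^sup>2 else 0)"
  have inI: "ll k \<in> einterval 0 b" "uu k \<in> einterval 0 b" for k
  proof -
    have "0 < c" "c < ll k" "ll k < uu k" "ereal (uu k) < b" using a(4,5,6)[of k] c by (auto simp: einterval_def)
    then show "uu k \<in> einterval 0 b" by (simp add: einterval_def)
    then show "ll k \<in> einterval 0 b"
      by (rule einterval_0_downward) (use \<open>0 < c\<close> \<open>c < ll k\<close> \<open>ll k < uu k\<close> in auto)
  qed
  have cu: "continuous_on {s..t} u" if "s \<in> einterval 0 b" "t \<in> einterval 0 b" for s t
    using continuous_on_subset[OF u] interval_Icc[OF einterval_0(2) that] by blast
  have sub: "{ll k..uu k} \<subseteq> einterval (ereal c) b" for k using a(1) by auto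
  have fi: "f k integrable_on einterval (ereal c) b" "integral (einterval (ereal c) b) (f k) = integral {ll k..uu k} (\<lambda>x. (norm (u x))\<^sup>2)" for k
  proof -
    have "(\<lambda>x. (norm (u x))\<^sup>2) integrable_on {ll k..uu k}"
      by (intro integrable_continuous_real continuous_intros cu inI)
    then have h: "((\<lambda>x. (norm (u x))\<^sup>2) has_integral integral {ll k..uu k} (\<lambda>x. (norm (u x))\<^sup>2)) {ll k..uu k}" by blast
    have "(f k has_integral integral {ll k..uu k} (\<lambda>x. (norm (u x))\<^sup>2)) (einterval (ereal c) b)"
      unfolding f_def by (rule has_integral_restrict[OF sub, THEN iffD2, OF h])
    then show "f k integrable_on einterval (ereal c) b" "integral (einterval (ereal c) b) (f k) = integral {ll k..uu k} (\<lambda>x. (norm (u x))\<^sup>2)"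
      by (auto simp: integral_unique)
  qed
  have "(\<lambda>x. (norm (u x))\<^sup>2) integrable_on einterval (ereal c) b \<and>
     (\<lambda>k. integral (einterval (ereal c) b) (f k)) \<longlonglongrightarrow> integral (einterval (ereal c) b) (\<lambda>x. (norm (u x))\<^sup>2)"
  proof (rule monotone_convergence_increasing[OF fi(1)])
    show "f k x \<le> f (Suc k) x" for k x
    proof -
      have "ll (Suc k) \<le> ll k" "uu k \<le> uu (Suc k)" using a by (auto simp: incseq_def decseq_def)
      then show ?thesis by (auto simp: f_def)
    qed
    show "(\<lambda>k. f k x) \<longlonglongrightarrow> (norm (u x))\<^sup>2" if x: "x \<in> einterval (ereal c) b" for x
    proof (rule tendsto_eventually)
      obtain i where i: "x \<in> {ll i..uu i}" using x a(1) by auto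
      show "\<forall>\<^sub>F k in sequentially. f k x = (norm (u x))\<^sup>2"
        unfolding eventually_sequentially
      proof (intro exI[of _ i] allI impI)
        fix k assume "i \<le> k"
        then have "ll k \<le> ll i" "uu i \<le> uu k" using a by (auto simp: incseq_def decseq_def)
        then show "f k x = (norm (u x))\<^sup>2" using i by (auto simp: f_def)
      qed
    qed
    have "norm (integral (einterval (ereal c) b) (f k)) \<le> K" for k
    proof -
      have "integral {ll k..uu k} (\<lambda>x. (norm (u x))\<^sup>2) \<le> integral {c..uu k} (\<lambda>x. (norm (u x))\<^sup>2)"
        using a(5)[of k] by (intro integral_subset_le integrable_continuous_real continuous_intros cu inI c(1)) auto
      also have "\<dots> \<le> K" using c(2)[OF inI(2)[of k]] a(4,5)[of k] by auto
      finally show ?thesis unfolding fi(2) using integral_norm2_nonneg by auto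
    qed
    then show "bounded (range (\<lambda>k. integral (einterval (ereal c) b) (f k)))" by (auto simp: bounded_iff)
  qed
  then have "(\<lambda>x. (norm (u x))\<^sup>2) absolutely_integrable_on einterval (ereal c) b"
    by (auto simp: absolutely_integrable_on_iff_nonneg)
  then show ?thesis unfolding sq_integrable_near_b_def using c(1) by blast
qed

lemma vanishes_b_if_tendsto:
  assumes "((\<lambda>x. f (real_of_ereal x)) \<longlongrightarrow> 0) (at_left b)" and b: "0 < b"
  shows "vanishes_b (einterval 0 b) f"
  unfolding vanishes_b_def
proof (intro allI impI)
  fix e :: real assume "e > 0"
  then have "\<forall>\<^sub>F x in at_left b. norm (f (real_of_ereal x)) < e"
    using assms(1) by (auto simp: tendsto_iff)
  then obtain y where y: "y < b" "\<And>x. y < x \<Longrightarrow> x < b \<Longrightarrow> norm (f (real_of_ereal x)) < e"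
    unfolding eventually_at_left[OF b] by blast
  obtain c where c: "max 0 y < ereal c" "ereal c < b" using ereal_dense2[of "max 0 y" b] y b by auto
  show "\<exists>c\<in>einterval 0 b. \<forall>d\<in>einterval 0 b. c \<le> d \<longrightarrow> norm (f d) < e"
  proof (intro bexI[of _ c] ballI impI)
    fix d assume d: "d \<in> einterval 0 b" "c \<le> d"
    have "y < ereal d" using c(1) d(2) by (meson ereal_less_eq(3) less_le_trans max_less_iff_conj)
    then show "norm (f d) < e" using y(2)[of "ereal d"] d by (simp add: einterval_def)
  qed (use c in \<open>auto simp: einterval_def\<close>)
qed

lemma wronskian_constant:
  assumes "eigsol I V z u" "eigsol I V z v" "x \<in> I" "y \<in> I"
  shows "wronskian u v x = wronskian u v y"
  using eigsol_lagrange[OF assms(1,2) assms(3,4)] eigsol_lagrange[OF assms(1,2) assms(4,3)] by (cases "x \<le> y") auto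

lemma eigsol_expansion:
  assumes "wronskian u1 u2 x = 1"
  shows "f x = wronskian f u2 x * u1 x - wronskian f u1 x * u2 x"
proof -
  have "f x = f x * wronskian u1 u2 x" using assms by simp
  then show ?thesis by (simp add: wronskian_def algebra_simps)
qed

lemma eigsol_scale: "eigsol I V z u \<Longrightarrow> eigsol I V z (\<lambda>x. a * u x)"
  using sl_solution_lincomb(1)[of I _ u u a 0] by simp

text \<open>A solution that is nonzero somewhere has a nonzero coefficient in the basis
  \<open>th\<close>, \<open>ph\<close>; the other basis element divided by that coefficient has
  Wronskian 1 with it.\<close>

lemma exists_conjugate_solution:
  assumes th: "eigsol I V z th" and ph: "eigsol I V z ph" and W: "\<And>x. x \<in> I \<Longrightarrow> wronskian th ph x = 1"
    and u: "eigsol I V z u" and x0: "x0 \<in> I" "u x0 \<noteq> 0"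
  shows "\<exists>w. eigsol I V z w \<and> (\<forall>x\<in>I. wronskian u w x = 1)"
proof -
  define a c where "a = wronskian u ph x0" and "c = wronskian u th x0"
  have "u x0 = a * th x0 - c * ph x0" unfolding a_def c_def by (rule eigsol_expansion[OF W[OF x0(1)]])
  then have "a \<noteq> 0 \<or> c \<noteq> 0" using x0 by auto
  then consider "a \<noteq> 0" | "c \<noteq> 0" by blast
  then show ?thesis
  proof cases
    case 1
    have "wronskian u (\<lambda>x. 1 / a * ph x) x = 1" if "x \<in> I" for x
      using wronskian_lincomb_right[OF ph ph that, of u "1/a" 0] wronskian_constant[OF u ph that x0(1)] 1 by (simp add: a_def)
    then show ?thesis using eigsol_scale[OF ph] by blast
  next
    case 2
    have "wronskian u (\<lambda>x. 1 / c * th x) x = 1" if "x \<in> I" for x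
      using wronskian_lincomb_right[OF th th that, of u "1/c" 0] wronskian_constant[OF u th that x0(1)] 2 by (simp add: c_def)
    then show ?thesis using eigsol_scale[OF th] by blast
  qed
qed

section \<open>Weyl solutions\<close>

locale sl_setting =
  fixes l :: real and b :: ereal and q v :: "real \<Rightarrow> real"
    and \<phi> \<theta> :: "complex \<Rightarrow> real \<Rightarrow> complex"
  assumes l: "l \<ge> -1/2" and b: "0 < b" and q: "potential_ok l q"
    and v: "boundary_datum_at_b l b q v"
    and \<phi>_sol: "real_entire_solution l b q \<phi>"
    and \<phi>_dom: "\<And>z. in_domain_near_0 l b (\<phi> z)"
    and \<theta>: "second_solution l b q \<phi> \<theta>"
begin

abbreviation "I \<equiv> einterval 0 b"
abbreviation "V \<equiv> full_potential l q"

lemma eig: "solution l b q z u \<Longrightarrow> eigsol I V z u"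
  using solution_iff_eigsol[OF q] by simp

lemma \<phi>_eig: "eigsol I V z (\<phi> z)" and \<theta>_eig: "eigsol I V z (\<theta> z)"
  using \<phi>_sol \<theta> by (auto intro!: eig simp: real_entire_solution_def second_solution_def)

lemma W\<theta>\<phi>: "x \<in> I \<Longrightarrow> wronskian (\<theta> z) (\<phi> z) x = 1"
  using \<theta> by (auto simp: second_solution_def)

lemma I_nonempty: obtains i0 where "i0 \<in> I"
  using ereal_dense2[of 0 b] b by (auto simp: einterval_def)

text \<open>The consequence of \<open>in_domain_near_b\<close> used in all estimates; it is stable
  under linear combinations and conjugation of solutions with one parameter.\<close>

definition dom_b :: "(real \<Rightarrow> complex) \<Rightarrow> bool" where
  "dom_b u \<longleftrightarrow> L2b I u \<and> (limit_circle_at_b l b q \<longrightarrow> vanishes_b I (wronskian (\<lambda>x. of_real (v x)) u))"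

lemma dom_b_if_in_domain:
  assumes u: "eigsol I V z u" and d: "in_domain_near_b l b q v u"
  shows "dom_b u"
  using d L2b_if_sq_integrable[OF sl_solution_cont[OF u]] vanishes_b_if_tendsto[OF _ b]
  unfolding in_domain_near_b_def dom_b_def by auto

text \<open>In the limit circle case the boundary condition decides. In the limit point case a
  nonvanishing energy would make a second solution square integrable, hence all solutions for all
  parameters, which is the limit circle case.\<close>

lemma energy_vanishes_at_b:
  assumes u: "eigsol I V z u" and d: "dom_b u" and z: "Im z \<noteq> 0"
  shows "vanishes_b I (energy u)"
\<comment> \<open>The zero solution is treated apart, as it has no conjugate solution with Wronskian
  1.\<close>
proof (cases "\<forall>x\<in>I. u x = 0")
  case True
  obtain i0 where "i0 \<in> I" by (rule I_nonempty)
  moreover have "energy u x = 0" if "x \<in> I" for x using True that by (simp add: energy_def)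
  ultimately show ?thesis unfolding vanishes_b_def by (intro allI impI bexI[of _ i0]) auto
next
  case False
  then obtain x0 where x0: "x0 \<in> I" "u x0 \<noteq> 0" by blast
  show ?thesis
  proof (cases "limit_circle_at_b l b q")
    case True
    obtain r x1 where r: "solution l b q (of_real r) (\<lambda>x. of_real (v x))" and x1: "x1 \<in> I" "v x1 \<noteq> 0"
      using v True unfolding boundary_datum_at_b_def by blast
    have vs: "eigsol I V (of_real r) (\<lambda>x. of_real (v x))" by (rule eig[OF r])
    obtain w where w: "eigsol I V (of_real r) w" "\<forall>x\<in>I. wronskian (\<lambda>x. of_real (v x)) w x = 1"
      using exists_conjugate_solution[OF \<theta>_eig \<phi>_eig W\<theta>\<phi> vs x1(1)] x1(2) by auto
    have "solution l b q (of_real r) w" using w(1) solution_iff_eigsol[OF q] by simp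
    then have "sq_integrable_near_b b w" using True unfolding limit_circle_at_b_def by blast
    then have "L2b I w" by (rule L2b_if_sq_integrable[OF sl_solution_cont[OF w(1)]])
    then show ?thesis using energy_vanishes_limit_circle[OF vs w(1) u] w(2) d True by (auto simp: dom_b_def)
  next
    case False
    then obtain z0 f where f: "solution l b q z0 f" "\<not> sq_integrable_near_b b f" unfolding limit_circle_at_b_def by blast
    have fe: "eigsol I V z0 f" by (rule eig[OF f(1)])
    have nL: "\<not> L2b I f" using sq_integrable_if_L2b[OF sl_solution_cont[OF fe]] f(2) by blast
    obtain w where w: "eigsol I V z w" "\<forall>x\<in>I. wronskian u w x = 1"
      using exists_conjugate_solution[OF \<theta>_eig \<phi>_eig W\<theta>\<phi> u x0] by auto
    have L: "L2b I u" using d by (simp add: dom_b_def)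
    show ?thesis
    proof (rule ccontr)
      assume "\<not> vanishes_b I (energy u)"
      then have "L2b I w" using L2b_other_solution[OF u w(1) _ z L] w(2) by auto
      then have "L2b I f" using L2b_all_solutions[OF u w(1) _ L _ fe] w(2) by auto
      then show False using nL by simp
    qed
  qed
qed

lemma energy_vanishes_near_0: "(energy (\<phi> z) \<longlongrightarrow> 0) (at_right 0)"
  using energy_vanishes_at_0[OF l b q _ \<phi>_dom, of z z] \<phi>_eig[of z] unfolding full_potential_def by blast

lemma energy_\<phi>_nonpos:
  assumes x: "x \<in> I" and z: "Im z \<ge> 0"
  shows "energy (\<phi> z) x \<le> 0"
proof -
  have "\<forall>\<^sub>F y in at_right 0. y \<in> {0<..<x}" using x eventually_at_right_real by (auto simp: einterval_def)
  then have "\<forall>\<^sub>F y in at_right 0. energy (\<phi> z) x \<le> energy (\<phi> z) y"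
  proof eventually_elim
    case (elim y)
    then have y: "y \<in> I" "y \<le> x" using einterval_0_downward[OF x] by auto
    show ?case using energy_diff[OF \<phi>_eig y(1) x y(2), of z] z integral_norm2_nonneg[of y x "\<phi> z"] by simp
  qed
  then show ?thesis by (rule tendsto_lowerbound[OF energy_vanishes_near_0]) simp
qed

lemma energy_nonneg_if_dom_b:
  assumes u: "eigsol I V z u" and d: "dom_b u" and z: "Im z > 0" and x: "x \<in> I"
  shows "energy u x \<ge> 0"
proof (rule field_le_epsilon)
  fix e :: real assume "e > 0"
  then obtain c where c: "c \<in> I" "\<And>d. d \<in> I \<Longrightarrow> c \<le> d \<Longrightarrow> \<bar>energy u d\<bar> < e"
    using energy_vanishes_at_b[OF u d] z unfolding vanishes_b_def by auto
  define d where "d = max c x"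
  have d: "d \<in> I" "c \<le> d" "x \<le> d" using c x by (auto simp: d_def max_def)
  have "energy u d \<le> energy u x" using energy_diff[OF u x d(1,3)] z integral_norm2_nonneg[of x d u] by simp
  then show "0 \<le> energy u x + e" using c(2)[OF d(1,2)] by linarith
qed

text \<open>Multiplying cnj (p s) by the Wronskian 1 = s p' - s' p writes it as a combination of cnj
  p p' and cnj s s' with coefficients of known sign; likewise for cnj (p' s').\<close>

lemma herglotz_of_energies:
  fixes p p' s s' :: complex
  assumes "s * p' - s' * p = 1" "Im (cnj p * p') \<le> 0" "Im (cnj s * s') \<ge> 0"
  shows "Im (p * s) \<ge> 0" "Im (p' * s') \<ge> 0"
proof -
  have im: "- Im G = A * Im X - B * Im Y" if "cnj G = of_real A * X - of_real B * Y" for G X Y A B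
    using arg_cong[OF that, of Im] by simp
  have "cnj (p * s) * (s * p' - s' * p) = of_real ((norm s)\<^sup>2) * (cnj p * p') - of_real ((norm p)\<^sup>2) * (cnj s * s')"
    by (simp add: complex_norm_square algebra_simps flip: of_real_power)
  then have e: "cnj (p * s) = of_real ((norm s)\<^sup>2) * (cnj p * p') - of_real ((norm p)\<^sup>2) * (cnj s * s')" using assms(1) by simp
  have "- Im (p * s) = (norm s)\<^sup>2 * Im (cnj p * p') - (norm p)\<^sup>2 * Im (cnj s * s')"
    by (rule im[OF e])
  moreover have "(norm s)\<^sup>2 * Im (cnj p * p') \<le> 0" using assms(2) by (simp add: mult_nonneg_nonpos)
  moreover have "(norm p)\<^sup>2 * Im (cnj s * s') \<ge> 0" using assms(3) by simp
  ultimately show "Im (p * s) \<ge> 0" by linarith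
  have "cnj (p' * s') * (s * p' - s' * p) = of_real ((norm p')\<^sup>2) * cnj (cnj s * s') - of_real ((norm s')\<^sup>2) * cnj (cnj p * p')"
    by (simp add: complex_norm_square algebra_simps flip: of_real_power)
  then have e: "cnj (p' * s') = of_real ((norm p')\<^sup>2) * cnj (cnj s * s') - of_real ((norm s')\<^sup>2) * cnj (cnj p * p')" using assms(1) by simp
  have "- Im (p' * s') = - ((norm p')\<^sup>2 * Im (cnj s * s')) + (norm s')\<^sup>2 * Im (cnj p * p')"
    using im[OF e] unfolding cnj.sel mult_minus_right by linarith
  moreover have "(norm s')\<^sup>2 * Im (cnj p * p') \<le> 0" using assms(2) by (simp add: mult_nonneg_nonpos)
  moreover have "(norm p')\<^sup>2 * Im (cnj s * s') \<ge> 0" using assms(3) by simp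
  ultimately show "Im (p' * s') \<ge> 0" by linarith
qed

text \<open>A nonreal z is not an eigenvalue: the two sign statements would make the energy of phi
  vanish identically, hence phi itself on an interval, against the Wronskian with theta.\<close>

lemma \<phi>_not_dom_b:
  assumes z: "Im z > 0"
  shows "\<not> dom_b (\<phi> z)"
proof
  assume d: "dom_b (\<phi> z)"
  have E0: "energy (\<phi> z) x = 0" if "x \<in> I" for x
    using energy_\<phi>_nonpos[OF that, of z] energy_nonneg_if_dom_b[OF \<phi>_eig d z that] z by simp
  obtain x where x: "x \<in> I" by (rule I_nonempty)
  obtain y where "ereal x < ereal y" "ereal y < b" using ereal_dense2[of "ereal x" b] x by (auto simp: einterval_def)
  then have y: "y \<in> I" "x < y" using x by (auto simp: einterval_def)
  have c2: "continuous_on {x..y} (\<lambda>x. (norm (\<phi> z x))\<^sup>2)" by (intro continuous_intros eigsol_cont_Icc[OF \<phi>_eig x y(1)])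
  have "Im z * integral {x..y} (\<lambda>x. (norm (\<phi> z x))\<^sup>2) = 0" using energy_diff[OF \<phi>_eig x y(1), of z] E0 x y by simp
  then have "integral {x..y} (\<lambda>x. (norm (\<phi> z x))\<^sup>2) = 0" using z by simp
  then have h: "((\<lambda>x. (norm (\<phi> z x))\<^sup>2) has_integral 0) (cbox x y)"
    using integrable_integral[OF integrable_continuous_real[OF c2]] by (simp add: cbox_interval)
  have z0: "\<phi> z t = 0" if t: "t \<in> {x<..<y}" for t
  proof -
    have "(norm (\<phi> z t))\<^sup>2 = 0"
      by (rule has_integral_0_cbox_imp_0[OF _ _ h]) (use c2 t in \<open>auto simp: cbox_interval box_real\<close>)
    then show ?thesis by simp
  qed
  define m where "m = (x + y) / 2"
  have m: "m \<in> {x<..<y}" "m \<in> I" using y interval_Icc[OF einterval_0(2) x y(1), of m] by (auto simp: m_def)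
  have "dx (\<phi> z) m = 0"
  proof -
    have "(\<phi> z has_vector_derivative 0) (at m)"
      by (rule has_vector_derivative_transform_within_open[of "\<lambda>_. 0" 0 m "{x<..<y}"]) (use m z0 in auto)
    then show ?thesis by (rule vector_derivative_at)
  qed
  then show False using W\<theta>\<phi>[OF m(2), of z] z0[OF m(1)] by (simp add: wronskian_def)
qed

end

section \<open>Analytic dependence on the spectral parameter\<close>

text \<open>The difference of f and its reflection is entire and vanishes on the real line.\<close>

lemma real_entire_cnj:
  assumes f: "f holomorphic_on UNIV" and r: "\<And>z. z \<in> \<real> \<Longrightarrow> f z \<in> \<real>"
  shows "f (cnj z) = cnj (f z)"
proof -
  define g where "g = (\<lambda>z. f z - (cnj \<circ> f \<circ> cnj) z)"
  have "g holomorphic_on UNIV" unfolding g_def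
  proof (intro holomorphic_intros f)
    have "range cnj = UNIV" by (metis complex_cnj_cnj surjI)
    then show "(cnj \<circ> f \<circ> cnj) holomorphic_on UNIV" using holomorphic_on_compose_cnj_cnj[of f UNIV] f by simp
  qed
  moreover have "(0::complex) islimpt \<real>"
  proof (rule islimptI)
    fix T :: "complex set" assume "0 \<in> T" "open T"
    then obtain e where e: "e > 0" "ball 0 e \<subseteq> T" using open_contains_ball by blast
    have "complex_of_real (e / 2) \<in> ball 0 e" using e by simp
    then show "\<exists>y\<in>\<real>. y \<in> T \<and> y \<noteq> 0" using e by (intro bexI[of _ "of_real (e / 2)"]) auto
  qed
  moreover have "g z = 0" if "z \<in> \<real>" for z
    using r[OF that] that by (auto simp: g_def Reals_cnj_iff)
  ultimately have "g (cnj z) = 0"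
    using analytic_continuation[of g UNIV \<real> 0 "cnj z"] convex_connected[OF convex_UNIV] by simp
  then show ?thesis by (simp add: g_def)
qed

text \<open>The arithmetic of the absorption step in \<open>holomorphic_on_dx\<close>: S is the
  maximum of the modulus on an interval, m and m' are its values at the endpoints, and p is the size
  of the linear part.\<close>

lemma sup_absorb:
  fixes S m m' p K :: real
  assumes "S \<le> m + (p + S / 4)" "p \<le> m' + m + S / 4" "2 * (2 * m + m') \<le> K"
  shows "S \<le> K"
  using assms by argo

text \<open>The difference quotients in x are entire in z and converge locally uniformly. The rate
  of convergence depends on a bound for u near x that is uniform in z; it is extracted from the
  values at two points, which are entire in z, by means of the equation on a short interval.\<close>

lemma holomorphic_on_dx:
  fixes V :: "real \<Rightarrow> real"
  assumes u: "\<And>z. eigsol I V z (u z)" and hol: "\<And>x. x \<in> I \<Longrightarrow> (\<lambda>z. u z x) holomorphic_on UNIV" and x: "x \<in> I"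
  shows "(\<lambda>z. dx (u z) x) holomorphic_on UNIV"
proof -
  have I: "open I" "is_interval I" using u by (auto simp: sl_solution_def)
  obtain d where d: "d > 0" "cball x d \<subseteq> I" using I(1) x open_contains_cball by blast
  have sub: "{x..x + d} \<subseteq> I" using d by (auto simp: subset_iff dist_real_def)
  have xd: "x + d \<in> I" using sub d by auto
  define h where "h = (\<lambda>n. d / (real n + 1))"
  have h: "0 < h n" "h n \<le> d" for n using d by (auto simp: h_def field_simps)
  have h_lim: "h \<longlonglongrightarrow> 0" unfolding h_def by real_asymp
  have h_mono: "h n \<le> h m" if "m \<le> n" for m n
    using that d unfolding h_def by (intro divide_left_mono) auto
  show ?thesis
  proof (rule holomorphic_uniform_sequence[of UNIV "\<lambda>n z. (u z (x + h n) - u z x) / of_real (h n)"])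
    show "(\<lambda>z. (u z (x + h n) - u z x) / of_real (h n)) holomorphic_on UNIV" for n
    proof -
      have "x + h n \<in> I" using sub h[of n] by auto
      then show ?thesis using h[of n] by (intro holomorphic_intros hol x) auto
    qed
    fix z0 :: complex
    define R where "R = norm z0 + 1"
    define N where "N = (\<lambda>t. \<bar>V t\<bar> + R)"
    have Rz: "norm z \<le> R" if "z \<in> cball z0 1" for z
      using that norm_triangle_sub[of z z0] by (simp add: R_def dist_norm norm_minus_commute)
    have "(\<lambda>x. complex_of_real (V x) - 0) absolutely_integrable_on {x..x + d}"
      using u[of 0] x xd d unfolding sl_solution_def by auto
    then have "(\<lambda>t. \<bar>V t\<bar>) integrable_on {x..x + d}" by (simp add: absolutely_integrable_on_def)
    then have Ni: "N integrable_on {x..x + d}" unfolding N_def by (intro integrable_add integrable_const_ivl)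
    have N0: "N t \<ge> 0" for t by (simp add: N_def R_def)
    define J where "J = (\<lambda>t. integral {x..t} N)"
    have Nsub: "N integrable_on {x..t}" if "t \<le> x + d" for t using integrable_subinterval_real[OF Ni, of x t] that by auto
    have J0: "J t \<ge> 0" if "t \<le> x + d" for t unfolding J_def by (intro integral_nonneg Nsub that N0)
    have Jmono: "J s \<le> J t" if "s \<le> t" "t \<le> x + d" for s t
      unfolding J_def using that by (intro integral_subset_le Nsub) (auto simp: N0)
    have "continuous_on {x..x + d} J" unfolding J_def by (rule indefinite_integral_continuous_1[OF Ni])
    moreover have "(\<lambda>n. x + h n) \<longlonglongrightarrow> x + 0" by (intro tendsto_intros h_lim)
    ultimately have J_lim: "(\<lambda>n. J (x + h n)) \<longlonglongrightarrow> J x"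
      using h d by (intro continuous_on_tendsto_compose[of "{x..x + d}" J]) (auto intro!: always_eventually less_imp_le)
    have Jx: "J x = 0" by (simp add: J_def)
    have "(\<lambda>n. h n * J (x + h n)) \<longlonglongrightarrow> 0 * J x" by (intro tendsto_intros h_lim J_lim)
    then have "\<forall>\<^sub>F n in sequentially. h n * J (x + h n) < 1 / 4" by (rule order_tendstoD) simp
    \<comment> \<open>A step so short that the error of linearization is at most a quarter of the
      maximum of u.\<close>
    then obtain m where m: "h m * J (x + h m) < 1 / 4" using eventually_happens'[OF sequentially_bot] by blast
    define y where "y = x + h m"
    have y: "y \<in> I" "x < y" "y \<le> x + d" using sub h[of m] by (auto simp: y_def)
    have "continuous_on (cball z0 1) (\<lambda>z. 2 * (2 * norm (u z x) + norm (u z y)))"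
      by (intro continuous_intros holomorphic_on_imp_continuous_on holomorphic_on_subset[OF hol] x y) auto
    then have "bounded ((\<lambda>z. 2 * (2 * norm (u z x) + norm (u z y))) ` cball z0 1)"
      by (intro compact_imp_bounded compact_continuous_image) auto
    then obtain K where K: "\<And>z. z \<in> cball z0 1 \<Longrightarrow> 2 * (2 * norm (u z x) + norm (u z y)) \<le> K"
      by (force simp: bounded_iff)
    \<comment> \<open>\<open>J\<close> bounds the variation of the derivative of u through the
      integral of the coefficient of the equation.\<close>
    have lin: "norm (u z t - u z x - (t - x) *\<^sub>R dx (u z) x) \<le> (t - x) * (S * J t)"
      if z: "z \<in> cball z0 1" and t: "x \<le> t" "t \<le> y" and S: "\<And>s. s \<in> {x..y} \<Longrightarrow> norm (u z s) \<le> S" for z t S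
    proof -
      have S0: "S \<ge> 0" using S[of x] y order_trans[OF norm_ge_zero] by auto
      have "norm (u z t - u z x - (t - x) *\<^sub>R dx (u z) x) \<le> norm (t - x) * (S * J t)"
      proof (rule vector_differentiable_bound_linearization[where S = "{x..t}"])
        fix s assume s: "s \<in> {x..t}"
        have sI: "s \<in> I" using s sub t y by auto
        show "(u z has_vector_derivative dx (u z) s) (at s within {x..t})"
          by (rule has_vector_derivative_at_within[OF sl_solution_deriv[OF u sI]])
        have i: "((\<lambda>x. (complex_of_real (V x) - z) * u z x) has_integral (dx (u z) s - dx (u z) x)) {x..s}"
          using u[of z] x sI s unfolding sl_solution_def by auto
        have "norm (integral {x..s} (\<lambda>x. (complex_of_real (V x) - z) * u z x)) \<le> integral {x..s} (\<lambda>t. N t * S)"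
        proof (intro integral_norm_bound_integral)
          show "(\<lambda>t. N t * S) integrable_on {x..s}" using s t y by (intro integrable_on_mult_left Nsub) auto
          fix r assume r: "r \<in> {x..s}"
          have "norm (complex_of_real (V r) - z) \<le> N r"
            using norm_triangle_ineq4[of "of_real (V r)" z] Rz[OF z] by (simp add: N_def)
          then show "norm ((complex_of_real (V r) - z) * u z r) \<le> N r * S"
            unfolding norm_mult using S[of r] r s t N0 by (intro mult_mono) auto
        qed (use i in auto)
        then have "norm (dx (u z) s - dx (u z) x) \<le> J s * S" using integral_unique[OF i] by (simp add: J_def)
        also have "\<dots> \<le> J t * S" using Jmono[of s t] s t y S0 by (intro mult_right_mono) auto
        finally show "norm (dx (u z) s - dx (u z) x) \<le> S * J t" by (simp add: mult.commute)
      qed (use t in \<open>auto simp: closed_segment_eq_real_ivl\<close>)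
      then show ?thesis using t by simp
    qed
    \<comment> \<open>Linearizing on [x, y] bounds the slope at x by the two end values and S / 4;
      linearizing again at the maximum point bounds S.\<close>
    have sup: "norm (u z s) \<le> K" if z: "z \<in> cball z0 1" and s: "s \<in> {x..y}" for z s
    proof -
      have "continuous_on {x..y} (\<lambda>s. norm (u z s))"
        by (intro continuous_intros eigsol_cont_Icc[OF u x y(1)])
      then obtain t where t: "t \<in> {x..y}" "\<And>s. s \<in> {x..y} \<Longrightarrow> norm (u z s) \<le> norm (u z t)"
        using continuous_attains_sup[of "{x..y}" "\<lambda>s. norm (u z s)"] y by auto
      define S where "S = norm (u z t)"
      define D where "D = dx (u z) x"
      have e1: "(y - x) * (S * J y) \<le> S / 4"
      proof -
        have "S * (h m * J (x + h m)) \<le> S * (1 / 4)" using m by (intro mult_left_mono) (auto simp: S_def)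
        then show ?thesis by (simp add: y_def algebra_simps)
      qed
      have "norm (u z y - u z x - (y - x) *\<^sub>R D) \<le> S / 4"
        using lin[OF z _ _ t(2), of y] y e1 by (simp add: S_def D_def)
      then have "norm ((y - x) *\<^sub>R D) \<le> norm (u z y - u z x) + S / 4" by (rule norm_le_of_diff(2))
      also have "norm (u z y - u z x) \<le> norm (u z y) + norm (u z x)" by (rule norm_triangle_ineq4)
      finally have D: "norm ((y - x) *\<^sub>R D) \<le> norm (u z y) + norm (u z x) + S / 4" by simp
      have "norm ((t - x) *\<^sub>R D) \<le> norm ((y - x) *\<^sub>R D)" using t(1) by (simp add: mult_right_mono)
      then have D2: "norm ((t - x) *\<^sub>R D) \<le> norm (u z y) + norm (u z x) + S / 4" using D by linarith
      have "norm (u z t - u z x - (t - x) *\<^sub>R D) \<le> (t - x) * (S * J t)"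
        using lin[OF z _ _ t(2), of t] t(1) by (simp add: S_def D_def)
      also have "\<dots> \<le> (y - x) * (S * J y)"
        using t(1) y Jmono[of t y] J0[of t] by (intro mult_mono) (auto simp: S_def)
      also have "\<dots> \<le> S / 4" by (rule e1)
      finally have "norm (u z t - u z x) \<le> norm ((t - x) *\<^sub>R D) + S / 4" by (rule norm_le_of_diff(1))
      then have "norm (u z t) \<le> norm (u z x) + (norm ((t - x) *\<^sub>R D) + S / 4)" by (rule norm_le_of_diff(1))
      moreover define p where "p = norm ((t - x) *\<^sub>R D)"
      ultimately have "S \<le> norm (u z x) + (p + S / 4)" "p \<le> norm (u z y) + norm (u z x) + S / 4"
        using D2 by (simp_all add: S_def)
      then have "S \<le> K" using K[OF z] by (rule sup_absorb)
      then show ?thesis using t(2)[OF s] by (simp add: S_def)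
    qed
    have "uniform_limit (cball z0 1) (\<lambda>n z. (u z (x + h n) - u z x) / of_real (h n)) (\<lambda>z. dx (u z) x) sequentially"
    proof (rule uniform_limitI)
      fix e :: real assume e: "e > 0"
      have "(\<lambda>n. K * J (x + h n)) \<longlonglongrightarrow> K * J x" by (intro tendsto_intros J_lim)
      then have "\<forall>\<^sub>F n in sequentially. K * J (x + h n) < e" by (rule order_tendstoD) (use e Jx in auto)
      then show "\<forall>\<^sub>F n in sequentially. \<forall>z\<in>cball z0 1. dist ((u z (x + h n) - u z x) / of_real (h n)) (dx (u z) x) < e"
        using eventually_ge_at_top[of m]
      proof eventually_elim
        case (elim n)
        show ?case
        proof
          fix z assume z: "z \<in> cball z0 1"
          define D where "D = dx (u z) x"
          have "norm (u z (x + h n) - u z x - (x + h n - x) *\<^sub>R D) \<le> (x + h n - x) * (K * J (x + h n))"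
            unfolding D_def using h_mono[OF elim(2)] h[of n] by (intro lin[OF z _ _ sup[OF z]]) (auto simp: y_def)
          then have *: "norm (u z (x + h n) - u z x - of_real (h n) * D) \<le> h n * (K * J (x + h n))"
            by (simp add: scaleR_conv_of_real)
          have "(u z (x + h n) - u z x) / of_real (h n) - D = (u z (x + h n) - u z x - of_real (h n) * D) / of_real (h n)"
            using h[of n] by (simp add: field_simps)
          then have "norm ((u z (x + h n) - u z x) / of_real (h n) - D) = norm (u z (x + h n) - u z x - of_real (h n) * D) / h n"
            using h[of n] by (simp add: norm_divide)
          also have "\<dots> \<le> K * J (x + h n)" using * h[of n] by (simp add: field_simps)
          also have "\<dots> < e" by (rule elim(1))
          finally show "dist ((u z (x + h n) - u z x) / of_real (h n)) (dx (u z) x) < e" by (simp add: dist_norm D_def)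
        qed
      qed
    qed
    then show "\<exists>d>0. cball z0 d \<subseteq> UNIV \<and> uniform_limit (cball z0 d) (\<lambda>n z. (u z (x + h n) - u z x) / of_real (h n)) (\<lambda>z. dx (u z) x) sequentially"
      by (intro exI[of _ 1]) auto
  qed auto
qed

context sl_setting
begin

lemma real_entire:
  assumes u: "real_entire_solution l b q u" and x: "x \<in> I"
  shows "(\<lambda>z. u z x) holomorphic_on UNIV" "(\<lambda>z. dx (u z) x) holomorphic_on UNIV"
    "u (cnj z) x = cnj (u z x)" "dx (u (cnj z)) x = cnj (dx (u z) x)"
proof -
  have ue: "eigsol I V z (u z)" for z using u by (intro eig) (auto simp: real_entire_solution_def)
  show h: "(\<lambda>z. u z x) holomorphic_on UNIV" using u x by (auto simp: real_entire_solution_def)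
  show "(\<lambda>z. dx (u z) x) holomorphic_on UNIV"
    by (rule holomorphic_on_dx[OF ue _ x]) (use u in \<open>auto simp: real_entire_solution_def\<close>)
  have sym: "u (cnj z) x = cnj (u z x)" if "x \<in> I" for x z
    by (rule real_entire_cnj) (use u that in \<open>auto simp: real_entire_solution_def\<close>)
  then show "u (cnj z) x = cnj (u z x)" using x .
  have "((\<lambda>x. cnj (u z x)) has_vector_derivative cnj (dx (u z) x)) (at x)"
    by (intro has_vector_derivative_cnj sl_solution_deriv[OF ue x])
  then have "(u (cnj z) has_vector_derivative cnj (dx (u z) x)) (at x)"
    by (rule has_vector_derivative_transform_within_open[OF _ einterval_0(1) x]) (use sym in auto)
  then show "dx (u (cnj z)) x = cnj (dx (u z) x)" by (rule vector_derivative_at)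
qed

lemma \<theta>_entire: "real_entire_solution l b q \<theta>"
  using \<theta> by (simp add: second_solution_def)

lemma dom_b_lincomb:
  assumes u: "eigsol I V z u" "dom_b u" and w: "eigsol I V z w" "dom_b w"
  shows "dom_b (\<lambda>x. a * u x + c * w x)"
proof -
  have "L2b I (\<lambda>x. a * u x + c * w x)"
    using u w by (intro L2b_lincomb sl_solution_cont[OF u(1)] sl_solution_cont[OF w(1)] einterval_0(2)) (auto simp: dom_b_def)
  moreover have "vanishes_b I (wronskian (\<lambda>x. of_real (v x)) (\<lambda>x. a * u x + c * w x))" if lc: "limit_circle_at_b l b q"
    unfolding vanishes_b_def
  proof (intro allI impI)
    fix e :: real assume e: "e > 0"
    define k where "k = norm a + norm c + 1"
    have k: "k > 0" by (simp add: k_def add_nonneg_pos)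
    let ?W = "wronskian (\<lambda>x. complex_of_real (v x))"
    obtain c1 where c1: "c1 \<in> I" "\<And>d. d \<in> I \<Longrightarrow> c1 \<le> d \<Longrightarrow> norm (?W u d) < e / k"
      using u(2) lc e k unfolding dom_b_def vanishes_b_def by (meson divide_pos_pos)
    obtain c2 where c2: "c2 \<in> I" "\<And>d. d \<in> I \<Longrightarrow> c2 \<le> d \<Longrightarrow> norm (?W w d) < e / k"
      using w(2) lc e k unfolding dom_b_def vanishes_b_def by (meson divide_pos_pos)
    show "\<exists>c'\<in>I. \<forall>d\<in>I. c' \<le> d \<longrightarrow> norm (?W (\<lambda>x. a * u x + c * w x) d) < e"
    proof (intro bexI[of _ "max c1 c2"] ballI impI)
      fix d assume d: "d \<in> I" "max c1 c2 \<le> d"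
      have "norm (?W (\<lambda>x. a * u x + c * w x) d) \<le> norm a * norm (?W u d) + norm c * norm (?W w d)"
        unfolding wronskian_lincomb_right[OF u(1) w(1) d(1)] norm_mult[symmetric] by (rule norm_triangle_ineq)
      also have "\<dots> \<le> norm a * (e / k) + norm c * (e / k)"
        using c1(2)[OF d(1)] c2(2)[OF d(1)] d(2) by (intro add_mono mult_left_mono) auto
      also have "\<dots> = (norm a + norm c) * (e / k)" by (simp add: algebra_simps)
      also have "\<dots> < k * (e / k)" using e k by (intro mult_strict_right_mono) (auto simp: k_def)
      also have "\<dots> = e" using k by simp
      finally show "norm (?W (\<lambda>x. a * u x + c * w x) d) < e" .
    qed (use c1 c2 in \<open>auto simp: max_def\<close>)
  qed
  ultimately show ?thesis by (simp add: dom_b_def)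
qed

lemma dom_b_cnj:
  assumes u: "eigsol I V z u" "dom_b u"
  shows "dom_b (\<lambda>x. cnj (u x))"
proof -
  have "vanishes_b I (wronskian (\<lambda>x. of_real (v x)) (\<lambda>x. cnj (u x)))" if lc: "limit_circle_at_b l b q"
  proof -
    obtain r where "solution l b q (of_real r) (\<lambda>x. of_real (v x))"
      using v lc unfolding boundary_datum_at_b_def by blast
    then have vs: "eigsol I V (of_real r) (\<lambda>x. of_real (v x))" by (rule eig)
    have "norm (wronskian (\<lambda>x. of_real (v x)) (\<lambda>x. cnj (u x)) d) = norm (wronskian (\<lambda>x. of_real (v x)) u d)" if d: "d \<in> I" for d
    proof -
      have "cnj (dx (\<lambda>x. of_real (v x)) d) = dx (\<lambda>x. of_real (v x)) d"
        using sl_solution_cnj(2)[OF vs d] unfolding complex_cnj_complex_of_real by (rule sym)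
      then have "wronskian (\<lambda>x. of_real (v x)) (\<lambda>x. cnj (u x)) d = cnj (wronskian (\<lambda>x. of_real (v x)) u d)"
        using sl_solution_cnj(2)[OF u(1) d] by (simp add: wronskian_def)
      then show ?thesis by simp
    qed
    moreover have "vanishes_b I (wronskian (\<lambda>x. of_real (v x)) u)" using u(2) lc by (simp add: dom_b_def)
    ultimately show ?thesis unfolding vanishes_b_def by auto
  qed
  then show ?thesis using u(2) by (simp add: dom_b_def L2b_cnj)
qed

end

section \<open>The Weyl solution and its Herglotz property\<close>

locale weyl_setting = sl_setting +
  fixes M :: "complex \<Rightarrow> complex"
  assumes M: "singular_weyl_function l b q v \<phi> \<theta> M"
begin

definition \<psi> :: "complex \<Rightarrow> real \<Rightarrow> complex" where "\<psi> z x = \<theta> z x + M z * \<phi> z x"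

lemma \<psi>_eq: "\<psi> z = (\<lambda>x. \<theta> z x + M z * \<phi> z x)"
  by (auto simp: \<psi>_def)

lemma \<psi>_eig: "eigsol I V z (\<psi> z)"
  using sl_solution_lincomb(1)[OF \<theta>_eig[of z] \<phi>_eig[of z], of 1 "M z"] by (simp add: \<psi>_eq)

lemma dx_\<psi>: "x \<in> I \<Longrightarrow> dx (\<psi> z) x = dx (\<theta> z) x + M z * dx (\<phi> z) x"
  using sl_solution_lincomb(2)[OF \<theta>_eig[of z] \<phi>_eig[of z], of x 1 "M z"] by (simp add: \<psi>_eq)

lemma \<psi>_dom_b: "z \<notin> \<real> \<Longrightarrow> dom_b (\<psi> z)"
  using M by (intro dom_b_if_in_domain[OF \<psi>_eig]) (auto simp: singular_weyl_function_def \<psi>_eq)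

text \<open>Uniqueness of the Weyl solution: the reflected solution at the conjugate parameter also
  satisfies the condition at b, and the difference of the two is a multiple of phi, which does not
  satisfy it for nonreal z.\<close>

lemma M_cnj:
  assumes z: "z \<notin> \<real>"
  shows "M (cnj z) = cnj (M z)"
proof -
  have pos: "M (cnj z) = cnj (M z)" if z: "Im z > 0" for z
  proof (rule ccontr)
    assume ne: "M (cnj z) \<noteq> cnj (M z)"
    have zR: "z \<notin> \<real>" "cnj z \<notin> \<real>" using z by (auto simp: complex_is_Real_iff)
    define d where "d = cnj (M z) - M (cnj z)"
    have chi: "eigsol I V z (\<lambda>x. cnj (\<psi> (cnj z) x))" "dom_b (\<lambda>x. cnj (\<psi> (cnj z) x))"
      using eigsol_cnj[OF \<psi>_eig[of "cnj z"]] dom_b_cnj[OF \<psi>_eig \<psi>_dom_b[OF zR(2)]] by auto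
    \<comment> \<open>The difference of the two Weyl solutions divided by the difference of their
      coefficients, which equals phi on \<open>I\<close>.\<close>
    define f where "f = (\<lambda>x. (1 / cnj d) * \<psi> z x + (- 1 / cnj d) * cnj (\<psi> (cnj z) x))"
    have f: "dom_b f" unfolding f_def by (rule dom_b_lincomb[OF \<psi>_eig \<psi>_dom_b[OF zR(1)] chi])
    have fe: "eigsol I V z f" unfolding f_def by (rule sl_solution_lincomb(1)[OF \<psi>_eig chi(1)])
    have f\<phi>: "f x = \<phi> z x" if x: "x \<in> I" for x
    proof -
      have e: "cnj (\<psi> (cnj z) x) = \<theta> z x + cnj (M (cnj z)) * \<phi> z x"
        using real_entire(3)[OF \<theta>_entire x, of z] real_entire(3)[OF \<phi>_sol x, of z] by (simp add: \<psi>_def)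
      have "f x = (1 / cnj d) * ((M z - cnj (M (cnj z))) * \<phi> z x)"
        unfolding f_def e by (simp add: \<psi>_def algebra_simps diff_divide_distrib add_divide_distrib)
      also have "M z - cnj (M (cnj z)) = cnj d" by (simp add: d_def)
      finally have "f x = (1 / cnj d) * (cnj d * \<phi> z x)" .
      moreover have "cnj d \<noteq> 0" using ne by (auto simp: d_def)
      ultimately show ?thesis by simp
    qed
    have "dom_b (\<phi> z)"
    proof -
      have dxeq: "dx (\<phi> z) x = dx f x" if x: "x \<in> I" for x
      proof -
        have "(\<phi> z has_vector_derivative dx f x) (at x)"
          by (rule has_vector_derivative_transform_within_open[OF sl_solution_deriv[OF fe x] einterval_0(1) x]) (use f\<phi> in auto)
        then show ?thesis by (rule vector_derivative_at)
      qed
      have "L2b I (\<phi> z)"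
      proof -
        obtain K c where c: "c \<in> I" "\<And>d. d \<in> I \<Longrightarrow> c \<le> d \<Longrightarrow> integral {c..d} (\<lambda>x. (norm (f x))\<^sup>2) \<le> K"
          using f unfolding dom_b_def L2b_def by blast
        have "integral {c..d} (\<lambda>x. (norm (\<phi> z x))\<^sup>2) = integral {c..d} (\<lambda>x. (norm (f x))\<^sup>2)" if "d \<in> I" for d
          by (rule Henstock_Kurzweil_Integration.integral_cong) (use interval_Icc[OF einterval_0(2) c(1) that] f\<phi> in auto)
        then show ?thesis unfolding L2b_def
          by (intro exI[of _ K] bexI[OF _ c(1)] ballI impI) (simp add: c(2))
      qed
      moreover have "wronskian (\<lambda>x. of_real (v x)) (\<phi> z) x = wronskian (\<lambda>x. of_real (v x)) f x" if "x \<in> I" for x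
        using f\<phi>[OF that] dxeq[OF that] by (simp add: wronskian_def)
      ultimately show ?thesis using f unfolding dom_b_def vanishes_b_def by auto
    qed
    then show False using \<phi>_not_dom_b[OF z] by simp
  qed
  show ?thesis
  proof (cases "Im z > 0")
    case False
    then have "Im (cnj z) > 0" using z by (auto simp: complex_is_Real_iff)
    from pos[OF this] show ?thesis by (metis complex_cnj_cnj)
  qed (rule pos)
qed

text \<open>The second inequality serves at zeros of phi, where the factor in front of M in the
  first one degenerates; phi and phi' have no common zero.\<close>

lemma herglotz:
  assumes x: "x \<in> I" and z: "Im z > 0"
  shows "Im (\<phi> z x * (\<theta> z x + M z * \<phi> z x)) \<ge> 0"
    "Im (dx (\<phi> z) x * (dx (\<theta> z) x + M z * dx (\<phi> z) x)) \<ge> 0"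
proof -
  have zR: "z \<notin> \<real>" using z by (auto simp: complex_is_Real_iff)
  have "\<psi> z x * dx (\<phi> z) x - dx (\<psi> z) x * \<phi> z x = 1"
    using W\<theta>\<phi>[OF x, of z] unfolding dx_\<psi>[OF x] by (simp add: \<psi>_def wronskian_def algebra_simps)
  note h = herglotz_of_energies[OF this energy_\<phi>_nonpos[OF x, of z, unfolded energy_def]
    energy_nonneg_if_dom_b[OF \<psi>_eig \<psi>_dom_b[OF zR] z x, unfolded energy_def]]
  show "Im (\<phi> z x * (\<theta> z x + M z * \<phi> z x)) \<ge> 0" "Im (dx (\<phi> z) x * (dx (\<theta> z) x + M z * dx (\<phi> z) x)) \<ge> 0"
    using h z unfolding dx_\<psi>[OF x] by (simp_all add: \<psi>_def)
qed

end

section \<open>Continuation across the real axis\<close>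

text \<open>The Schwarz lemma for the Cayley transform of G on the unit disc around x + i, evaluated
  straight below the centre at height Im z.\<close>

lemma herglotz_growth:
  assumes G: "G holomorphic_on {z. Im z > 0}" and pos: "\<And>z. Im z > 0 \<Longrightarrow> Im (G z) \<ge> 0"
    and z: "0 < Im z" "Im z \<le> 1"
  shows "norm (G z) \<le> 2 * (norm (G (Complex (Re z) 1)) + 1) / Im z + 1"
proof -
  define c where "c = Complex (Re z) 1"
  \<comment> \<open>The shift makes the imaginary part at least 1, so the Cayley transform is well
    defined and strictly contracting even if G is a real constant.\<close>
  define H where "H = (\<lambda>z. G z + \<i>)"
  define f where "f = (\<lambda>w. (H (c + w) - H c) / (H (c + w) - cnj (H c)))"
  have Hpos: "Im (H w) \<ge> 1" if "Im w > 0" for w using pos[OF that] by (simp add: H_def)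
  have up: "Im (c + w) > 0" if "norm w < 1" for w
    using abs_Im_le_cmod[of w] that by (simp add: c_def)
  have lt: "norm (a - b) < norm (a - cnj b)" if "Im a \<ge> 1" "Im b \<ge> 1" for a b
  proof -
    have "(norm (a - cnj b))\<^sup>2 - (norm (a - b))\<^sup>2 = 4 * Im a * Im b" unfolding cmod_power2 by (simp add: power2_eq_square algebra_simps)
    moreover have "4 * Im a * Im b > 0" using that by simp
    ultimately have "(norm (a - b))\<^sup>2 < (norm (a - cnj b))\<^sup>2" by linarith
    then show ?thesis by (rule power2_less_imp_less) simp
  qed
  have lt': "norm (H (c + w) - H c) < norm (H (c + w) - cnj (H c))" if "norm w < 1" for w
    by (intro lt Hpos up[OF that]) (simp add: c_def)
  have "H holomorphic_on {z. Im z > 0}" unfolding H_def by (intro holomorphic_intros G)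
  then have "(H \<circ> (\<lambda>w. c + w)) holomorphic_on ball 0 1"
  proof (intro holomorphic_on_compose_gen[of "\<lambda>w. c + w" _ H "{z. Im z > 0}"] holomorphic_intros image_subsetI)
    fix w :: complex assume "w \<in> ball 0 1"
    then show "c + w \<in> {z. Im z > 0}" using up[of w] by simp
  qed
  then have Hc: "(\<lambda>w. H (c + w)) holomorphic_on ball 0 1" by (simp add: o_def)
  have "f holomorphic_on ball 0 1" unfolding f_def
  proof (intro holomorphic_intros Hc)
    fix w :: complex assume "w \<in> ball 0 1"
    then show "H (c + w) - cnj (H c) \<noteq> 0" using lt'[of w] by auto
  qed
  moreover have "f 0 = 0" by (simp add: f_def)
  moreover have "norm (f w) < 1" if "norm w < 1" for w
    using lt'[OF that] norm_ge_zero[of "H (c + w) - H c"] by (simp add: f_def norm_divide divide_less_eq)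
  ultimately have S: "norm (f w) \<le> norm w" if "norm w < 1" for w using Schwarz_Lemma[of f] that by blast
  define w where "w = z - c"
  have w: "w = - \<i> * of_real (1 - Im z)" by (simp add: w_def c_def complex_eq_iff)
  have nw: "norm w = 1 - Im z" using z by (simp add: w norm_mult del: of_real_diff)
  have "norm (f w) \<le> 1 - Im z" using S[of w] z by (simp add: nw)
  moreover have "f w = (H z - H c) / (H z - cnj (H c))" by (simp add: f_def w_def)
  moreover have "norm (H z - cnj (H c)) > 0" using lt'[of w] norm_ge_zero[of "H z - H c"] z by (simp add: nw) (auto simp: w_def)
  ultimately have "norm (H z - H c) \<le> (1 - Im z) * norm (H z - cnj (H c))" by (simp add: norm_divide divide_le_eq)
  also have "\<dots> \<le> (1 - Im z) * (norm (H z) + norm (H c))"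
    using norm_triangle_ineq4[of "H z" "cnj (H c)"] z by (intro mult_left_mono) auto
  \<comment> \<open>The factor 1 - Im z leaves Im z times the norm of H z after absorption, which is
    the origin of the bound K / Im z.\<close>
  finally have "norm (H z) \<le> norm (H c) + (1 - Im z) * (norm (H z) + norm (H c))"
    using norm_le_of_diff(1) by blast
  then have "Im z * norm (H z) \<le> (2 - Im z) * norm (H c)" by (simp add: algebra_simps)
  also have "\<dots> \<le> 2 * norm (H c)" using z by (intro mult_right_mono) auto
  finally have "norm (H z) \<le> 2 * norm (H c) / Im z" using z by (simp add: pos_le_divide_eq mult.commute)
  also have "\<dots> \<le> 2 * (norm (G c) + 1) / Im z"
    using norm_triangle_ineq[of "G c" \<i>] z by (intro divide_right_mono) (auto simp: H_def)
  finally have "norm (H z) \<le> 2 * (norm (G c) + 1) / Im z" .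
  moreover have "norm (G z) \<le> norm (H z) + 1" using norm_triangle_ineq4[of "H z" \<i>] by (simp add: H_def)
  ultimately show ?thesis by (simp add: c_def)
qed

text \<open>Integration down a vertical segment with a majorant given by its primitive: a bound K /
  s for a function becomes logarithmic for its primitive and constant for the next one.\<close>

lemma vertical_bound:
  fixes F f :: "complex \<Rightarrow> complex" and \<Phi> \<Phi>' :: "real \<Rightarrow> real"
  assumes F: "\<And>s. s \<in> {y..h} \<Longrightarrow> (F has_field_derivative f (Complex x s)) (at (Complex x s))"
    and Phi: "\<And>s. s \<in> {y..h} \<Longrightarrow> (\<Phi> has_real_derivative \<Phi>' s) (at s)"
    and le: "\<And>s. s \<in> {y..h} \<Longrightarrow> norm (f (Complex x s)) \<le> \<Phi>' s" and yh: "y \<le> h"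
  shows "norm (F (Complex x y)) \<le> norm (F (Complex x h)) + (\<Phi> h - \<Phi> y)"
proof (cases "y < h")
  case True
  have d: "((\<lambda>s. F (Complex x s)) has_vector_derivative (\<i> * f (Complex x s))) (at s)" if s: "s \<in> {y..h}" for s
  proof -
    have "((\<lambda>s. of_real x + \<i> * of_real s) has_vector_derivative \<i> * 1) (at s)"
      by (auto intro!: derivative_eq_intros)
    moreover have "(\<lambda>s. of_real x + \<i> * of_real s) = Complex x" by (auto simp: complex_eq_iff)
    ultimately have "(Complex x has_vector_derivative \<i>) (at s)" by simp
    from field_vector_diff_chain_at[OF this F[OF s]] show ?thesis by (simp add: o_def)
  qed
  have "norm (F (Complex x h) - F (Complex x y)) \<le> \<Phi> h - \<Phi> y"
  proof (rule differentiable_bound_general[OF True])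
    show "continuous_on {y..h} (\<lambda>s. F (Complex x s))"
      by (intro continuous_at_imp_continuous_on ballI) (use d has_vector_derivative_continuous in blast)
    show "continuous_on {y..h} \<Phi>"
      by (intro continuous_at_imp_continuous_on ballI) (use Phi DERIV_isCont in blast)
    show "((\<lambda>s. F (Complex x s)) has_vector_derivative (\<i> * f (Complex x s))) (at s)" if "y < s" "s < h" for s using d that by auto
    show "(\<Phi> has_vector_derivative \<Phi>' s) (at s)" if "y < s" "s < h" for s
      using Phi[of s] that by (simp add: has_real_derivative_iff_has_vector_derivative)
    show "norm (\<i> * f (Complex x s)) \<le> \<Phi>' s" if "y < s" "s < h" for s using le[of s] that by (simp add: norm_mult)
  qed
  then show ?thesis by (rule norm_le_of_diff(2))
qed (use yh in simp)

text \<open>The coefficients are not assumed to converge; differences of the values at a, a + d and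
  a + 2 d recover them, so that they do.\<close>

lemma quadratic_limit:
  fixes \<alpha> \<beta> \<gamma> :: "nat \<Rightarrow> real" and p :: "real \<Rightarrow> real"
  assumes ab: "a < b" and lim: "\<And>x. x \<in> {a..b} \<Longrightarrow> (\<lambda>n. \<alpha> n + (x - a) * \<beta> n + (x - a)\<^sup>2 / 2 * \<gamma> n) \<longlonglongrightarrow> p x"
  shows "\<exists>A B C. \<forall>x\<in>{a..b}. p x = A + (x - a) * B + (x - a)\<^sup>2 / 2 * C"
proof -
  define d where "d = (b - a) / 2"
  have d: "d > 0" "a + d \<in> {a..b}" "a + 2 * d \<in> {a..b}" using ab by (auto simp: d_def field_simps)
  have l0: "\<alpha> \<longlonglongrightarrow> p a" using lim[of a] ab by simp
  have l1: "(\<lambda>n. \<alpha> n + d * \<beta> n + d\<^sup>2 / 2 * \<gamma> n) \<longlonglongrightarrow> p (a + d)" using lim[OF d(2)] by simp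
  have l2: "(\<lambda>n. \<alpha> n + 2 * d * \<beta> n + 2 * d\<^sup>2 * \<gamma> n) \<longlonglongrightarrow> p (a + 2 * d)" using lim[OF d(3)] by (simp add: power_mult_distrib)
  have "(\<lambda>n. ((\<alpha> n + 2 * d * \<beta> n + 2 * d\<^sup>2 * \<gamma> n) - 2 * (\<alpha> n + d * \<beta> n + d\<^sup>2 / 2 * \<gamma> n) + \<alpha> n) / d\<^sup>2) \<longlonglongrightarrow> (p (a + 2 * d) - 2 * p (a + d) + p a) / d\<^sup>2"
    using d by (intro tendsto_intros l0 l1 l2) auto
  moreover have "((\<alpha> n + 2 * d * \<beta> n + 2 * d\<^sup>2 * \<gamma> n) - 2 * (\<alpha> n + d * \<beta> n + d\<^sup>2 / 2 * \<gamma> n) + \<alpha> n) / d\<^sup>2 = \<gamma> n" for n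
    using d by (simp add: field_simps)
  ultimately obtain C where C: "\<gamma> \<longlonglongrightarrow> C" by auto
  have "(\<lambda>n. ((\<alpha> n + d * \<beta> n + d\<^sup>2 / 2 * \<gamma> n) - \<alpha> n - d\<^sup>2 / 2 * \<gamma> n) / d) \<longlonglongrightarrow> (p (a + d) - p a - d\<^sup>2 / 2 * C) / d"
    using d by (intro tendsto_intros l0 l1 C) auto
  moreover have "((\<alpha> n + d * \<beta> n + d\<^sup>2 / 2 * \<gamma> n) - \<alpha> n - d\<^sup>2 / 2 * \<gamma> n) / d = \<beta> n" for n
    using d by (simp add: field_simps)
  ultimately obtain B where B: "\<beta> \<longlonglongrightarrow> B" by auto
  have "p x = p a + (x - a) * B + (x - a)\<^sup>2 / 2 * C" if x: "x \<in> {a..b}" for x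
  proof -
    have "(\<lambda>n. \<alpha> n + (x - a) * \<beta> n + (x - a)\<^sup>2 / 2 * \<gamma> n) \<longlonglongrightarrow> p a + (x - a) * B + (x - a)\<^sup>2 / 2 * C"
      by (intro tendsto_intros l0 B C)
    then show ?thesis using lim[OF x] LIMSEQ_unique by blast
  qed
  then show ?thesis by blast
qed

lemma bounded_convergence_integral_0:
  fixes h :: "nat \<Rightarrow> real \<Rightarrow> real"
  assumes int: "\<And>n. h n integrable_on {a..x}" and bd: "\<And>n t. t \<in> {a..x} \<Longrightarrow> \<bar>h n t\<bar> \<le> B"
    and lim: "\<And>t. t \<in> {a..x} \<Longrightarrow> (\<lambda>n. h n t) \<longlonglongrightarrow> 0"
  shows "(\<lambda>n. integral {a..x} (h n)) \<longlonglongrightarrow> 0"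
proof -
  have "(\<lambda>n. integral {a..x} (h n)) \<longlonglongrightarrow> integral {a..x} (\<lambda>_. 0)"
    by (rule dominated_convergence(2)[where h = "\<lambda>_. B"]) (use int bd lim in \<open>auto\<close>)
  then show ?thesis by simp
qed

lemma integral_horizontal:
  fixes F f :: "complex \<Rightarrow> complex"
  assumes F: "\<And>s. s \<in> {a..x} \<Longrightarrow> (F has_field_derivative f (Complex s e)) (at (Complex s e))" and ax: "a \<le> x"
  shows "((\<lambda>s. Im (f (Complex s e))) has_integral (Im (F (Complex x e)) - Im (F (Complex a e)))) {a..x}"
proof (rule fundamental_theorem_of_calculus[OF ax])
  fix s assume s: "s \<in> {a..x}"
  have "((\<lambda>s. of_real s + \<i> * of_real e) has_vector_derivative 1) (at s)"
    by (auto intro!: derivative_eq_intros)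
  moreover have "(\<lambda>s. of_real s + \<i> * of_real e) = (\<lambda>s. Complex s e)" by (auto simp: complex_eq_iff)
  ultimately have "((\<lambda>s. Complex s e) has_vector_derivative 1) (at s)" by simp
  from field_vector_diff_chain_at[OF this F[OF s]] have "((\<lambda>s. F (Complex s e)) has_vector_derivative f (Complex s e)) (at s)" by (simp add: o_def)
  from bounded_linear.has_vector_derivative[OF bounded_linear_Im this]
  show "((\<lambda>s. Im (F (Complex s e))) has_vector_derivative Im (f (Complex s e))) (at s within {a..x})"
    by (rule has_vector_derivative_at_within)
qed

lemma deriv_cnj_symmetric:
  assumes S: "open S" "cnj ` S \<subseteq> S" and h: "h holomorphic_on S" and sym: "\<And>z. z \<in> S \<Longrightarrow> h (cnj z) = cnj (h z)" and z: "z \<in> S"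
  shows "deriv h (cnj z) = cnj (deriv h z)"
proof -
  have "(h has_field_derivative deriv h z) (at z)" using holomorphic_derivI[OF h S(1) z] .
  then have "((cnj \<circ> h \<circ> cnj) has_field_derivative cnj (deriv h z)) (at (cnj z))"
    using has_field_derivative_cnj_cnj[of h "deriv h z" "cnj z"] by simp
  then have "(h has_field_derivative cnj (deriv h z)) (at (cnj z))"
  proof (rule DERIV_cong_ev[THEN iffD1, rotated -1, OF _ refl _ refl])
    have "cnj z \<in> S" using S(2) z by blast
    then have "\<forall>\<^sub>F w in nhds (cnj z). w \<in> S" using S(1) eventually_nhds by blast
    then show "\<forall>\<^sub>F w in nhds (cnj z). (cnj \<circ> h \<circ> cnj) w = h w"
      by eventually_elim (use sym in \<open>simp\<close>)
  qed
  then show ?thesis by (rule DERIV_imp_deriv)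
qed

definition rect :: "real \<Rightarrow> real \<Rightarrow> complex set" where
  "rect t r = {z. \<bar>Re z - t\<bar> < r \<and> 0 < Im z \<and> Im z < r}"

lemma rect_open_convex: "open (rect t r)" "convex (rect t r)"
proof -
  have eq: "rect t r = {z. Re z > t - r} \<inter> {z. Re z < t + r} \<inter> {z. Im z > 0} \<inter> {z. Im z < r}"
    by (auto simp: rect_def abs_less_iff)
  show "open (rect t r)" unfolding eq
    by (intro open_Int open_halfspace_Re_gt open_halfspace_Re_lt open_halfspace_Im_gt open_halfspace_Im_lt)
  show "convex (rect t r)" unfolding eq
    by (intro convex_Int convex_halfspace_Re_gt convex_halfspace_Re_lt convex_halfspace_Im_gt convex_halfspace_Im_lt)
qed

lemma mult_ln_le: "0 < y \<Longrightarrow> y \<le> 1 \<Longrightarrow> y * ln y \<le> (0::real)"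
  by (simp add: mult_nonneg_nonpos)

text \<open>
  The bound K / Im z is integrated away by passing to a triple primitive, which extends continuously to
  the real axis. There the convergence to 0 of the integrals forces its imaginary part to be a quadratic
  polynomial, so that the reflection principle applies.
\<close>

lemma extension_across_real_axis:
  fixes f :: "complex \<Rightarrow> complex" and e :: "nat \<Rightarrow> real"
  assumes r: "0 < r" "r \<le> 1" and f: "f holomorphic_on rect t0 r"
    and growth: "\<And>z. z \<in> rect t0 r \<Longrightarrow> norm (f z) \<le> K / Im z"
    and e: "\<And>n. 0 < e n" "\<And>n. e n < r / 2" "e \<longlonglongrightarrow> 0"
    and bd: "\<And>n s t. t0 - r < s \<Longrightarrow> s \<le> t \<Longrightarrow> t < t0 + r \<Longrightarrow> \<bar>integral {s..t} (\<lambda>x. Im (f (Complex x (e n))))\<bar> \<le> B"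
    and lim: "\<And>s t. t0 - r < s \<Longrightarrow> s < t \<Longrightarrow> t < t0 + r \<Longrightarrow> (\<lambda>n. integral {s..t} (\<lambda>x. Im (f (Complex x (e n))))) \<longlonglongrightarrow> 0"
  shows "\<exists>g. \<exists>d>0. g holomorphic_on ball (of_real t0) d \<and> (\<forall>z\<in>ball (of_real t0) d. g (cnj z) = cnj (g z) \<and> (Im z > 0 \<longrightarrow> g z = f z))"
proof -
  define S where "S = rect t0 r"
  note oc = rect_open_convex[of t0 r, folded S_def]
  obtain F1 where F1: "\<And>z. z \<in> S \<Longrightarrow> (F1 has_field_derivative f z) (at z within S)"
    using holomorphic_convex_primitive'[OF oc(2,1) f[folded S_def]] by blast
  have h1: "F1 holomorphic_on S" using F1 oc(1) by (auto simp: holomorphic_on_def field_differentiable_def)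
  obtain F2 where F2: "\<And>z. z \<in> S \<Longrightarrow> (F2 has_field_derivative F1 z) (at z within S)"
    using holomorphic_convex_primitive'[OF oc(2,1) h1] by blast
  have h2: "F2 holomorphic_on S" using F2 oc(1) by (auto simp: holomorphic_on_def field_differentiable_def)
  obtain F3 where F3: "\<And>z. z \<in> S \<Longrightarrow> (F3 has_field_derivative F2 z) (at z within S)"
    using holomorphic_convex_primitive'[OF oc(2,1) h2] by blast
  have h3: "F3 holomorphic_on S" using F3 oc(1) by (auto simp: holomorphic_on_def field_differentiable_def)
  have F1: "(F1 has_field_derivative f z) (at z)" and F2: "(F2 has_field_derivative F1 z) (at z)"
    and F3: "(F3 has_field_derivative F2 z) (at z)" if "z \<in> S" for z
    using F1[OF that] F2[OF that] F3[OF that] at_within_open[OF that oc(1)] by auto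
  \<comment> \<open>The smaller rectangle keeps its sides and its top inside the open set where f is
    given.\<close>
  define h where "h = r / 2"
  have hh: "0 < h" "h < r" "h \<le> 1 / 2" using r by (auto simp: h_def)
  define T where "T = {t0 - h..t0 + h}"
  have inS: "Complex x y \<in> S" if "x \<in> T" "0 < y" "y \<le> h" for x y
    using that hh by (auto simp: S_def rect_def T_def abs_less_iff)
  have top: "\<exists>L\<ge>0. \<forall>x\<in>T. norm (F (Complex x h)) \<le> L" if F: "F holomorphic_on S" for F
  proof -
    have "continuous_on T (\<lambda>x. F (of_real x + \<i> * of_real h))"
    proof (rule continuous_on_compose2[OF holomorphic_on_imp_continuous_on[OF F]])
      show "(\<lambda>x. complex_of_real x + \<i> * complex_of_real h) ` T \<subseteq> S"
      proof (rule image_subsetI)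
        fix x assume "x \<in> T"
        have "complex_of_real x + \<i> * of_real h = Complex x h" by (simp add: complex_eq_iff)
        then show "complex_of_real x + \<i> * of_real h \<in> S" using inS[OF \<open>x \<in> T\<close>, of h] hh by simp
      qed
    qed (intro continuous_intros)
    then have "bounded ((\<lambda>x. F (of_real x + \<i> * of_real h)) ` T)"
      by (intro compact_imp_bounded compact_continuous_image) (simp_all add: T_def)
    then obtain L where L: "\<And>x. x \<in> T \<Longrightarrow> norm (F (of_real x + \<i> * of_real h)) \<le> L" by (auto simp: bounded_iff)
    have "complex_of_real x + \<i> * of_real h = Complex x h" for x by (simp add: complex_eq_iff)
    then have L': "\<And>x. x \<in> T \<Longrightarrow> norm (F (Complex x h)) \<le> L" using L by simp
    moreover have "t0 \<in> T" using hh by (simp add: T_def)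
    ultimately have "L \<ge> 0" using order_trans[OF norm_ge_zero, of "F (Complex t0 h)" L] by blast
    then show ?thesis using L' by blast
  qed
  obtain L1 where L1: "L1 \<ge> 0" "\<And>x. x \<in> T \<Longrightarrow> norm (F1 (Complex x h)) \<le> L1" using top[OF h1] by blast
  obtain L2 where L2: "L2 \<ge> 0" "\<And>x. x \<in> T \<Longrightarrow> norm (F2 (Complex x h)) \<le> L2" using top[OF h2] by blast
  have "Complex t0 h \<in> rect t0 r" using hh by (simp add: rect_def)
  from order_trans[OF norm_ge_zero growth[OF this]] have "0 \<le> K / h" by simp
  then have K: "K \<ge> 0" using hh by (simp add: zero_le_divide_iff)
  \<comment> \<open>The first primitive of a function bounded by K / Im z grows at most
    logarithmically.\<close>
  have b1: "norm (F1 (Complex x y)) \<le> L1 - K * ln y" if x: "x \<in> T" and y: "0 < y" "y \<le> h" for x y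
  proof -
    have "norm (F1 (Complex x y)) \<le> norm (F1 (Complex x h)) + (K * ln h - K * ln y)"
    proof (rule vertical_bound)
      fix s assume s: "s \<in> {y..h}"
      have sS: "Complex x s \<in> S" using inS[OF x] s y by auto
      show "(F1 has_field_derivative f (Complex x s)) (at (Complex x s))" by (rule F1[OF sS])
      show "((\<lambda>s. K * ln s) has_real_derivative K / s) (at s)" using s y by (auto intro!: derivative_eq_intros)
      show "norm (f (Complex x s)) \<le> K / s" using growth[of "Complex x s"] sS by (simp add: S_def)
    qed (rule y)
    moreover have "K * ln h \<le> 0" using K hh by (simp add: mult_nonneg_nonpos)
    ultimately show ?thesis using L1(2)[OF x] by linarith
  qed
  define L3 where "L3 = L2 + L1 + 2 * K"
  have L3: "L3 \<ge> 0" using L1 L2 K by (simp add: L3_def)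
  \<comment> \<open>A logarithm is integrable, so the second primitive is bounded and the third is
    Lipschitz.\<close>
  have b2: "norm (F2 (Complex x y)) \<le> L3" if x: "x \<in> T" and y: "0 < y" "y \<le> h" for x y
  proof -
    define \<Phi> where "\<Phi> = (\<lambda>s. L1 * s - K * (s * ln s - s))"
    have "norm (F2 (Complex x y)) \<le> norm (F2 (Complex x h)) + (\<Phi> h - \<Phi> y)"
    proof (rule vertical_bound)
      fix s assume s: "s \<in> {y..h}"
      have sS: "Complex x s \<in> S" using inS[OF x] s y by auto
      show "(F2 has_field_derivative F1 (Complex x s)) (at (Complex x s))" by (rule F2[OF sS])
      show "(\<Phi> has_real_derivative (L1 - K * ln s)) (at s)" unfolding \<Phi>_def using s y by (auto intro!: derivative_eq_intros)
      show "norm (F1 (Complex x s)) \<le> L1 - K * ln s" using b1[OF x, of s] s y by auto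
    qed (rule y)
    moreover have "\<Phi> h \<le> L1 + 2 * K"
    proof -
      have "- (h * ln h) \<le> 1"
      proof -
        have "ln (1 / h) \<le> 1 / h - 1" using hh by (intro ln_le_minus_one) auto
        then have "h * ln (1 / h) \<le> h * (1 / h - 1)" using hh by (intro mult_left_mono) auto
        also have "\<dots> \<le> 1" using hh by (simp add: algebra_simps)
        finally show ?thesis using hh by (simp add: ln_div)
      qed
      then have "h - h * ln h \<le> 2" using hh by linarith
      then have "K * (h - h * ln h) \<le> K * 2" using K by (intro mult_left_mono)
      moreover have "L1 * h \<le> L1 * 1" using L1 hh by (intro mult_left_mono) auto
      ultimately show ?thesis by (simp add: \<Phi>_def algebra_simps)
    qed
    moreover have "\<Phi> y \<ge> 0"
    proof -
      have "y * ln y - y \<le> 0" using mult_ln_le[of y] y hh by linarith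
      with K have "K * (y * ln y - y) \<le> 0" by (rule mult_nonneg_nonpos)
      moreover have "L1 * y \<ge> 0" using L1 y by simp
      ultimately show ?thesis unfolding \<Phi>_def by linarith
    qed
    ultimately show ?thesis using L2(2)[OF x] by (simp add: L3_def)
  qed
  define Q where "Q = {z. Re z \<ge> t0 - h} \<inter> {z. Re z \<le> t0 + h} \<inter> {z. Im z > 0} \<inter> {z. Im z \<le> h}"
  have Qin: "Re z \<in> T" "0 < Im z" "Im z \<le> h" "z \<in> S" if "z \<in> Q" for z
    using that inS[of "Re z" "Im z"] by (auto simp: Q_def T_def)
  have cQ: "convex Q" unfolding Q_def
    by (intro convex_Int convex_halfspace_Re_ge convex_halfspace_Re_le convex_halfspace_Im_gt convex_halfspace_Im_le)
  have lip: "norm (F3 z - F3 w) \<le> L3 * norm (z - w)" if "z \<in> Q" "w \<in> Q" for z w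
  proof (rule field_differentiable_bound[OF cQ _ _ that])
    fix x assume x: "x \<in> Q"
    show "(F3 has_field_derivative F2 x) (at x within Q)" using F3[OF Qin(4)[OF x]] by (rule has_field_derivative_at_within)
    show "norm (F2 x) \<le> L3" using b2[OF Qin(1-3)[OF x]] by simp
  qed
  have "uniformly_continuous_on Q F3"
    unfolding uniformly_continuous_on_def
  proof (intro allI impI)
    fix d :: real assume d: "d > 0"
    show "\<exists>da>0. \<forall>x\<in>Q. \<forall>x'\<in>Q. dist x' x < da \<longrightarrow> dist (F3 x') (F3 x) < d"
    proof (intro exI[of _ "d / (L3 + 1)"] conjI ballI impI)
      fix x x' assume x: "x \<in> Q" "x' \<in> Q" "dist x' x < d / (L3 + 1)"
      have "dist (F3 x') (F3 x) \<le> L3 * dist x' x" using lip[OF x(2,1)] by (simp add: dist_norm)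
      also have "\<dots> \<le> (L3 + 1) * dist x' x" by (intro mult_right_mono) auto
      also have "\<dots> < d" using x(3) L3 by (simp add: field_simps)
      finally show "dist (F3 x') (F3 x) < d" .
    qed (use d L3 in simp)
  qed
  \<comment> \<open>A uniformly continuous function extends to the closure, which contains the real
    segment.\<close>
  then obtain G where Gu: "uniformly_continuous_on (closure Q) G" and G: "\<And>z. z \<in> Q \<Longrightarrow> F3 z = G z"
    using uniformly_continuous_on_extension_on_closure[of Q F3] by metis
  have contG: "continuous_on (closure Q) G" by (rule uniformly_continuous_imp_continuous[OF Gu])
  have seq: "(\<lambda>n. Complex x (e n)) \<longlonglongrightarrow> of_real x" for x
  proof -
    have "(\<lambda>n. of_real x + \<i> * of_real (e n)) \<longlonglongrightarrow> of_real x + \<i> * of_real 0"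
      by (intro tendsto_intros e(3))
    moreover have "of_real x + \<i> * of_real (e n) = Complex x (e n)" for n by (simp add: complex_eq_iff)
    ultimately show ?thesis by simp
  qed
  have eQ: "Complex x (e n) \<in> Q" if "x \<in> T" for x n
    using that e(1)[of n] e(2)[of n] by (auto simp: Q_def T_def h_def)
  have clQ: "of_real x \<in> closure Q" if "x \<in> T" for x
    unfolding closure_sequential by (intro exI[of _ "\<lambda>n. Complex x (e n)"] conjI allI eQ that seq)
  have limG: "(\<lambda>n. F3 (Complex x (e n))) \<longlonglongrightarrow> G (of_real x)" if x: "x \<in> T" for x
  proof -
    have "(\<lambda>n. G (Complex x (e n))) \<longlonglongrightarrow> G (of_real x)"
      by (rule continuous_on_tendsto_compose[OF contG seq clQ[OF x]])
        (use eQ[OF x] closure_subset in \<open>auto intro!: always_eventually\<close>)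
    then show ?thesis using G[OF eQ[OF x]] by simp
  qed
  define a where "a = t0 - h"
  \<comment> \<open>The constants of integration at the left end. No limit of these is known yet,
    and \<open>\<gamma>\<close> might a priori be unbounded; \<open>quadratic_limit\<close> deals
    with this.\<close>
  define \<alpha> \<beta> \<gamma> where "\<alpha> = (\<lambda>n. Im (F3 (Complex a (e n))))" and "\<beta> = (\<lambda>n. Im (F2 (Complex a (e n))))" and "\<gamma> = (\<lambda>n. Im (F1 (Complex a (e n))))"
  have aT: "a \<in> T" using hh by (auto simp: a_def T_def)
  have inS': "Complex s (e n) \<in> S" if "s \<in> {a..x}" "x \<in> T" for s x n
    using that by (intro Qin(4) eQ) (auto simp: a_def T_def)
  have int1: "((\<lambda>s. Im (f (Complex s (e n)))) has_integral (Im (F1 (Complex x (e n))) - \<gamma> n)) {a..x}" if x: "x \<in> T" for x n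
    unfolding \<gamma>_def by (rule integral_horizontal) (use F1 inS'[OF _ x] x in \<open>auto simp: a_def T_def\<close>)
  have int2: "((\<lambda>s. Im (F1 (Complex s (e n)))) has_integral (Im (F2 (Complex x (e n))) - \<beta> n)) {a..x}" if x: "x \<in> T" for x n
    unfolding \<beta>_def by (rule integral_horizontal) (use F2 inS'[OF _ x] x in \<open>auto simp: a_def T_def\<close>)
  have int3: "((\<lambda>s. Im (F2 (Complex s (e n)))) has_integral (Im (F3 (Complex x (e n))) - \<alpha> n)) {a..x}" if x: "x \<in> T" for x n
    unfolding \<alpha>_def by (rule integral_horizontal) (use F3 inS'[OF _ x] x in \<open>auto simp: a_def T_def\<close>)
  \<comment> \<open>With these subtractions each function is the integral of the previous one from
    a, starting from the integral of Im f, so that convergence to 0 passes along by bounded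
    convergence.\<close>
  define h1 where "h1 = (\<lambda>n x. Im (F1 (Complex x (e n))) - \<gamma> n)"
  define h2 where "h2 = (\<lambda>n x. Im (F2 (Complex x (e n))) - \<beta> n - (x - a) * \<gamma> n)"
  define h3 where "h3 = (\<lambda>n x. Im (F3 (Complex x (e n))) - \<alpha> n - (x - a) * \<beta> n - (x - a)\<^sup>2 / 2 * \<gamma> n)"
  have Tint: "t0 - r < a" "x < t0 + r" "a \<le> x" if "x \<in> T" for x using that hh by (auto simp: a_def T_def)
  have h1B: "\<bar>h1 n x\<bar> \<le> B" if x: "x \<in> T" for n x
    using bd[OF Tint(1,3,2)[OF x], of n] integral_unique[OF int1[OF x]] by (simp add: h1_def)
  have h1_lim: "(\<lambda>n. h1 n x) \<longlonglongrightarrow> 0" if x: "x \<in> T" for x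
  proof (cases "x = a")
    case False
    then show ?thesis using lim[OF Tint(1)[OF x] _ Tint(2)[OF x]] Tint(3)[OF x] integral_unique[OF int1[OF x]] by (simp add: h1_def)
  qed (simp add: h1_def \<gamma>_def)
  have c1: "((\<lambda>s. 1) has_integral (x - a)) {a..x}" and c2: "((\<lambda>s. s - a) has_integral (x - a)\<^sup>2 / 2) {a..x}" if x: "x \<in> T" for x
  proof -
    show "((\<lambda>s. 1::real) has_integral (x - a)) {a..x}" using has_integral_const_real[of "1::real" a x] Tint(3)[OF x] by simp
    have "((\<lambda>s. s - a) has_integral ((x - a)\<^sup>2 / 2 - (a - a)\<^sup>2 / 2)) {a..x}"
      by (rule fundamental_theorem_of_calculus[OF Tint(3)[OF x]])
        (auto intro!: derivative_eq_intros simp: has_real_derivative_iff_has_vector_derivative[symmetric])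
    then show "((\<lambda>s. s - a) has_integral (x - a)\<^sup>2 / 2) {a..x}" by simp
  qed
  have sub: "s \<in> T" if "s \<in> {a..x}" "x \<in> T" for s x using that by (auto simp: a_def T_def)
  have i1: "(h1 n has_integral h2 n x) {a..x}" if x: "x \<in> T" for n x
    using has_integral_diff[OF int2[OF x] has_integral_mult_left[OF c1[OF x], of "\<gamma> n"]] by (simp add: h1_def[abs_def] h2_def algebra_simps)
  have i2: "(h2 n has_integral h3 n x) {a..x}" if x: "x \<in> T" for n x
    using has_integral_diff[OF has_integral_diff[OF int3[OF x] has_integral_mult_left[OF c1[OF x], of "\<beta> n"]] has_integral_mult_left[OF c2[OF x], of "\<gamma> n"]]
    by (simp add: h2_def[abs_def] h3_def algebra_simps)
  have h2_lim: "(\<lambda>n. h2 n x) \<longlonglongrightarrow> 0" if x: "x \<in> T" for x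
    using bounded_convergence_integral_0[of h1 a x B] i1[OF x] h1B h1_lim sub[OF _ x]
    by (simp add: integral_unique[OF i1[OF x]] has_integral_integrable) blast
  have B0: "B \<ge> 0" using h1B[OF aT, of 0] by linarith
  have h2B: "\<bar>h2 n x\<bar> \<le> B" if x: "x \<in> T" for n x
  proof -
    have "norm (integral {a..x} (h1 n)) \<le> integral {a..x} (\<lambda>_. B)"
      by (rule integral_norm_bound_integral) (use i1[OF x] h1B sub[OF _ x] in auto)
    then have "\<bar>h2 n x\<bar> \<le> (x - a) * B" using integral_unique[OF i1[OF x]] Tint(3)[OF x] by simp
    also have "\<dots> \<le> 1 * B" using x hh B0 by (intro mult_right_mono) (auto simp: a_def T_def)
    finally show ?thesis by simp
  qed
  have h3_lim: "(\<lambda>n. h3 n x) \<longlonglongrightarrow> 0" if x: "x \<in> T" for x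
    using bounded_convergence_integral_0[of h2 a x B] i2[OF x] h2B h2_lim sub[OF _ x]
    by (simp add: integral_unique[OF i2[OF x]] has_integral_integrable) blast
  have qlim: "(\<lambda>n. \<alpha> n + (x - a) * \<beta> n + (x - a)\<^sup>2 / 2 * \<gamma> n) \<longlonglongrightarrow> Im (G (of_real x))" if x: "x \<in> {a..t0 + h}" for x
  proof -
    have xT: "x \<in> T" using x by (simp add: a_def T_def)
    have "(\<lambda>n. Im (F3 (Complex x (e n))) - h3 n x) \<longlonglongrightarrow> Im (G (of_real x)) - 0"
      by (intro tendsto_intros limG[OF xT] h3_lim[OF xT])
    moreover have "Im (F3 (Complex x (e n))) - h3 n x = \<alpha> n + (x - a) * \<beta> n + (x - a)\<^sup>2 / 2 * \<gamma> n" for n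
      unfolding h3_def by linarith
    ultimately show ?thesis by simp
  qed
  have ah: "a < t0 + h" and Ta: "T = {a..t0 + h}" using hh by (auto simp: a_def T_def)
  obtain A B1 C where ABC: "\<And>x. x \<in> T \<Longrightarrow> Im (G (of_real x)) = A + (x - a) * B1 + (x - a)\<^sup>2 / 2 * C"
    using quadratic_limit[OF ah qlim] unfolding Ta by blast
  \<comment> \<open>The real polynomial that gives Im G on the segment, so that G - i P is real
    there.\<close>
  define P where "P = (\<lambda>z. of_real A + (z - of_real a) * of_real B1 + (z - of_real a)\<^sup>2 / 2 * complex_of_real C)"
  define U where "U = ball (complex_of_real t0) h"
  have U: "z \<in> Q" if "z \<in> U" "Im z > 0" for z
    using that abs_Re_le_cmod[of "z - of_real t0"] abs_Im_le_cmod[of "z - of_real t0"]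
    by (auto simp: U_def Q_def dist_norm norm_minus_commute)
  have Ucl: "z \<in> closure Q" if "z \<in> U" "Im z \<ge> 0" for z
  proof (cases "Im z > 0")
    case True then show ?thesis using U[OF that(1)] closure_subset by blast
  next
    case False
    then have z: "z = of_real (Re z)" using that by (simp add: complex_eq_iff)
    have "Re z \<in> T" using that(1) abs_Re_le_cmod[of "z - of_real t0"] by (auto simp: U_def T_def dist_norm norm_minus_commute)
    then show ?thesis by (subst z) (rule clQ)
  qed
  define H where "H = (\<lambda>z. if 0 \<le> Im z then G z - \<i> * P z else cnj (G (cnj z) - \<i> * P (cnj z)))"
  have HU: "H holomorphic_on U"
    unfolding H_def
  proof (rule Schwarz_reflection)
    show "open U" by (simp add: U_def)
    show cnjU: "cnj ` U \<subseteq> U"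
    proof (rule image_subsetI)
      fix z assume "z \<in> U"
      moreover have "dist (of_real t0) (cnj z) = dist (of_real t0) z"
        using complex_mod_cnj[of "of_real t0 - z"] by (simp add: dist_norm)
      ultimately show "cnj z \<in> U" by (simp add: U_def)
    qed
    have "F3 holomorphic_on (U \<inter> {z. 0 < Im z})"
      by (rule holomorphic_on_subset[OF h3]) (auto intro!: Qin(4) U)
    then have "G holomorphic_on (U \<inter> {z. 0 < Im z})"
      by (rule holomorphic_transform) (auto intro!: G U)
    then show "(\<lambda>z. G z - \<i> * P z) holomorphic_on (U \<inter> {z. 0 < Im z})"
      unfolding P_def by (intro holomorphic_intros) auto
    show "continuous_on (U \<inter> {z. 0 \<le> Im z}) (\<lambda>z. G z - \<i> * P z)"
      unfolding P_def by (intro continuous_intros continuous_on_subset[OF contG]) (use Ucl in auto)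
    fix z assume z: "z \<in> U" "z \<in> \<real>"
    then obtain x where x: "z = of_real x" by (auto elim: Reals_cases)
    have xT: "x \<in> T" using z(1) by (auto simp: U_def T_def x dist_norm abs_less_iff simp flip: of_real_diff)
    have "P z = of_real (A + (x - a) * B1 + (x - a)\<^sup>2 / 2 * C)" by (simp add: P_def x)
    then have "Im (G z - \<i> * P z) = 0" using ABC[OF xT] by (simp add: x del: of_real_add of_real_mult of_real_diff of_real_power of_real_divide)
    then show "G z - \<i> * P z \<in> \<real>" by (simp add: complex_is_Real_iff)
  qed
  have oU: "open U" and cU: "cnj ` U \<subseteq> U"
  proof -
    show "open U" by (simp add: U_def)
    show "cnj ` U \<subseteq> U"
    proof (rule image_subsetI)
      fix z assume "z \<in> U"
      moreover have "dist (of_real t0) (cnj z) = dist (of_real t0) z"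
        using complex_mod_cnj[of "of_real t0 - z"] by (simp add: dist_norm)
      ultimately show "cnj z \<in> U" by (simp add: U_def)
    qed
  qed
  have Hsym: "H (cnj z) = cnj (H z)" if "z \<in> U" for z
  proof -
    consider "Im z > 0" | "Im z < 0" | "Im z = 0" by linarith
    then show ?thesis
    proof cases
      case 3
      then have "z = of_real (Re z)" by (simp add: complex_eq_iff)
      then obtain x where x: "z = of_real x" by blast
      have xT: "x \<in> T" using that by (auto simp: U_def T_def x dist_norm abs_less_iff simp flip: of_real_diff)
      have "P z = of_real (A + (x - a) * B1 + (x - a)\<^sup>2 / 2 * C)" by (simp add: P_def x)
      then have "Im (G z - \<i> * P z) = 0" using ABC[OF xT] by (simp add: x del: of_real_add of_real_mult of_real_diff of_real_power of_real_divide)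
      then show ?thesis by (simp add: H_def x complex_eq_iff)
    qed (simp_all add: H_def)
  qed
  \<comment> \<open>Three derivatives undo the three primitives and remove the quadratic
    polynomial.\<close>
  define D1 where "D1 = deriv H"
  define D2 where "D2 = deriv D1"
  define D3 where "D3 = deriv D2"
  have hD: "D1 holomorphic_on U" "D2 holomorphic_on U" "D3 holomorphic_on U"
    unfolding D3_def D2_def D1_def by (intro holomorphic_deriv HU oU)+
  have s1: "D1 (cnj z) = cnj (D1 z)" if "z \<in> U" for z
    unfolding D1_def by (rule deriv_cnj_symmetric[OF oU cU HU Hsym that])
  have s2: "D2 (cnj z) = cnj (D2 z)" if "z \<in> U" for z
    unfolding D2_def by (rule deriv_cnj_symmetric[OF oU cU hD(1) s1 that])
  have s3: "D3 (cnj z) = cnj (D3 z)" if "z \<in> U" for z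
    unfolding D3_def by (rule deriv_cnj_symmetric[OF oU cU hD(2) s2 that])
  define Up where "Up = U \<inter> {z. Im z > 0}"
  have oUp: "open Up" unfolding Up_def by (intro open_Int oU open_halfspace_Im_gt)
  have nhds: "\<forall>\<^sub>F w in nhds z. w \<in> Up" if "z \<in> Up" for z using oUp that eventually_nhds by blast
  have UpS: "z \<in> S" if "z \<in> Up" for z using U Qin(4) that by (auto simp: Up_def)
  have e0: "H z = F3 z - \<i> * P z" if "z \<in> Up" for z using U G that by (auto simp: H_def Up_def)
  have dstep: "deriv g1 z = d" if "z \<in> Up" "\<And>w. w \<in> Up \<Longrightarrow> g1 w = g2 w" "(g2 has_field_derivative d) (at z)" for g1 g2 :: "complex \<Rightarrow> complex" and z d
  proof -
    have "deriv g1 z = deriv g2 z"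
      by (rule deriv_cong_ev[OF _ refl]) (use nhds[OF that(1)] that(2) in \<open>auto elim: eventually_mono\<close>)
    then show ?thesis using that(3) DERIV_imp_deriv by metis
  qed
  have e1: "D1 z = F2 z - \<i> * (of_real B1 + (z - of_real a) * of_real C)" if z: "z \<in> Up" for z
    unfolding D1_def
    by (rule dstep[OF z e0]) (auto simp: P_def intro!: derivative_eq_intros F3 UpS z)
  have e2: "D2 z = F1 z - \<i> * of_real C" if z: "z \<in> Up" for z
    unfolding D2_def
    by (rule dstep[OF z e1]) (auto intro!: derivative_eq_intros F2 UpS z)
  have e3: "D3 z = f z" if z: "z \<in> Up" for z
    unfolding D3_def
    by (rule dstep[OF z e2]) (auto intro!: derivative_eq_intros F1 UpS z)
  show ?thesis
    by (intro exI[of _ D3] exI[of _ h] conjI ballI) (use hh hD s3 e3 in \<open>auto simp: U_def Up_def\<close>)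
qed

section \<open>Cauchy transforms\<close>

text \<open>Cauchy's estimate for the derivative on discs of radius r / 2. It supplies the majorant
  of the difference quotients for differentiation under the integral.\<close>

lemma difference_quotient_bound:
  assumes r: "r > 0" and f: "f holomorphic_on U" and sub: "cball z0 r \<subseteq> U" "open U"
    and bd: "\<And>z. z \<in> cball z0 r \<Longrightarrow> norm (f z) \<le> B" and w: "norm w \<le> r / 2"
  shows "norm (f (z0 + w) - f z0) \<le> (2 * B / r) * norm w"
proof -
  have "norm (f (z0 + w) - f z0) \<le> (2 * B / r) * norm (z0 + w - z0)"
  proof (rule field_differentiable_bound[where S = "cball z0 (r / 2)" and f' = "deriv f"])
    fix z assume z: "z \<in> cball z0 (r / 2)"
    then have zU: "z \<in> U" using sub r by (auto simp: subset_iff)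
    show "(f has_field_derivative deriv f z) (at z within cball z0 (r / 2))"
      by (rule has_field_derivative_at_within[OF holomorphic_derivI[OF f sub(2) zU]])
    have in_cball: "x \<in> cball z0 r" if "x \<in> cball z (r / 2)" for x
      using z that dist_triangle[of z0 x z] by auto
    have "norm ((deriv ^^ 1) f z) \<le> fact 1 * B / (r / 2) ^ 1"
    proof (rule Cauchy_inequality)
      show "f holomorphic_on ball z (r / 2)" using f by (rule holomorphic_on_subset) (use in_cball sub in auto)
      show "continuous_on (cball z (r / 2)) f"
        using holomorphic_on_imp_continuous_on[OF f] by (rule continuous_on_subset) (use in_cball sub in auto)
      show "norm (f x) \<le> B" if "norm (z - x) = r / 2" for x using that by (intro bd in_cball) (simp add: dist_norm)
    qed (use r in simp)
    then show "norm (deriv f z) \<le> 2 * B / r" by (simp add: field_simps)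
  qed (use r w in \<open>auto simp: dist_norm\<close>)
  then show ?thesis by simp
qed

text \<open>Dominated convergence of the difference quotients: a local majorant of the kernel itself
  suffices, since holomorphy converts it into one for the quotients.\<close>

lemma holomorphic_on_integral:
  fixes K :: "complex \<Rightarrow> 'a \<Rightarrow> complex"
  assumes U: "open U"
    and hol: "\<And>t. t \<in> space M \<Longrightarrow> (\<lambda>z. K z t) holomorphic_on U"
    and meas: "\<And>z. z \<in> U \<Longrightarrow> K z \<in> borel_measurable M"
    and bd: "\<And>z0. z0 \<in> U \<Longrightarrow> \<exists>r>0. \<exists>g. integrable M g \<and> cball z0 r \<subseteq> U \<and> (\<forall>z\<in>cball z0 r. \<forall>t\<in>space M. norm (K z t) \<le> g t)"
  shows "(\<lambda>z. LINT t|M. K z t) holomorphic_on U"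
  unfolding holomorphic_on_open[OF U]
proof
  fix z0 assume z0: "z0 \<in> U"
  obtain r g where r: "r > 0" and g: "integrable M g" and sub: "cball z0 r \<subseteq> U"
    and le: "\<And>z t. z \<in> cball z0 r \<Longrightarrow> t \<in> space M \<Longrightarrow> norm (K z t) \<le> g t" using bd[OF z0] by blast
  have Ki: "integrable M (K z)" if "z \<in> cball z0 r" for z
  proof (rule Bochner_Integration.integrable_bound[OF g])
    show "K z \<in> borel_measurable M" using that sub by (intro meas) auto
    show "AE t in M. norm (K z t) \<le> norm (g t)" using le[OF that] by (intro AE_I2) (force intro: order_trans)
  qed
  define D where "D = (\<lambda>t. deriv (\<lambda>z. K z t) z0)"
  have "((\<lambda>h. ((LINT t|M. K (z0 + h) t) - (LINT t|M. K z0 t)) / h) \<longlongrightarrow> (LINT t|M. D t)) (at 0)"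
    unfolding tendsto_at_iff_sequentially comp_def
  proof (intro allI impI)
    fix X :: "nat \<Rightarrow> complex" assume X: "\<forall>i. X i \<in> UNIV - {0}" "X \<longlonglongrightarrow> 0"
    have "\<forall>\<^sub>F i in sequentially. norm (X i) < r / 2"
      using tendstoD[OF X(2), of "r / 2"] r by (simp add: dist_norm)
    then obtain N where N: "\<And>i. i \<ge> N \<Longrightarrow> norm (X i) < r / 2" by (auto simp: eventually_sequentially)
    define Y where "Y = (\<lambda>i. X (i + N))"
    have Y: "Y i \<noteq> 0" "norm (Y i) \<le> r / 2" for i using X(1) N[of "i + N"] by (auto simp: Y_def)
    have Y0: "Y \<longlonglongrightarrow> 0" unfolding Y_def by (rule LIMSEQ_ignore_initial_segment[OF X(2)])
    have Yc: "z0 + Y i \<in> cball z0 r" for i using Y(2)[of i] r by (simp add: dist_norm)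
    define q where "q = (\<lambda>i t. (K (z0 + Y i) t - K z0 t) / Y i)"
    have qm: "q i \<in> borel_measurable M" for i
      unfolding q_def using Ki[OF Yc[of i]] Ki[of z0] r by (intro borel_measurable_divide borel_measurable_diff) auto
    have qlim: "(\<lambda>i. q i t) \<longlonglongrightarrow> D t" if t: "t \<in> space M" for t
    proof -
      have "((\<lambda>z. K z t) has_field_derivative D t) (at z0)"
        unfolding D_def by (rule holomorphic_derivI[OF hol[OF t] U z0])
      then have "((\<lambda>h. (K (z0 + h) t - K z0 t) / h) \<longlongrightarrow> D t) (at 0)" by (simp add: DERIV_def)
      moreover have "filterlim Y (at 0) sequentially" using Y Y0 by (simp add: filterlim_at)
      ultimately show ?thesis unfolding q_def by (rule filterlim_compose)
    qed
    have "(\<lambda>i. LINT t|M. q i t) \<longlonglongrightarrow> (LINT t|M. D t)"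
    proof (rule integral_dominated_convergence[where w = "\<lambda>t. 2 * g t / r"])
      show "D \<in> borel_measurable M" by (rule borel_measurable_LIMSEQ_metric[of q]) (use qm qlim in auto)
      show "q i \<in> borel_measurable M" for i by (rule qm)
      show "integrable M (\<lambda>t. 2 * g t / r)" using g by auto
      show "AE t in M. (\<lambda>i. q i t) \<longlonglongrightarrow> D t" using qlim by auto
      show "AE t in M. norm (q i t) \<le> 2 * g t / r" for i
      proof (rule AE_I2)
        fix t assume t: "t \<in> space M"
        have "norm (K (z0 + Y i) t - K z0 t) \<le> 2 * g t / r * norm (Y i)"
          by (rule difference_quotient_bound[OF r hol[OF t] sub U le[OF _ t] Y(2)])
        then show "norm (q i t) \<le> 2 * g t / r" using Y(1)[of i] by (simp add: q_def norm_divide pos_divide_le_eq)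
      qed
    qed
    moreover have "(LINT t|M. q i t) = ((LINT t|M. K (z0 + Y i) t) - (LINT t|M. K z0 t)) / Y i" for i
      unfolding q_def using Ki[OF Yc[of i]] Ki[of z0] r by simp
    ultimately have "(\<lambda>i. ((LINT t|M. K (z0 + X (i + N)) t) - (LINT t|M. K z0 t)) / X (i + N)) \<longlonglongrightarrow> (LINT t|M. D t)"
      by (simp add: Y_def)
    then show "(\<lambda>i. ((LINT t|M. K (z0 + X i) t) - (LINT t|M. K z0 t)) / X i) \<longlonglongrightarrow> (LINT t|M. D t)"
      by (rule LIMSEQ_offset)
  qed
  then show "\<exists>f'. ((\<lambda>z. LINT t|M. K z t) has_field_derivative f') (at z0)" by (auto simp: DERIV_def)
qed

lemma open_nonreal: "open (- \<real> :: complex set)"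
  using closed_complex_Reals by auto

lemma norm_diff_real_ge: "norm (of_real t - z) \<ge> \<bar>Im z\<bar>"
  using abs_Im_le_cmod[of "of_real t - z"] by simp

lemma nonreal_iff: "z \<in> - \<real> \<longleftrightarrow> Im z \<noteq> 0" for z :: complex
  by (simp add: complex_is_Real_iff)

text \<open>The Cauchy transform of w times the measure. The weight allows infinite measures to be
  handled by truncation, by squares of entire functions on bounded sets, or by a decaying
  density.\<close>

definition cauchy_tr :: "real measure \<Rightarrow> (real \<Rightarrow> real) \<Rightarrow> complex \<Rightarrow> complex" where
  "cauchy_tr \<rho> w z = (LINT t|\<rho>. of_real (w t) / (of_real t - z))"

context
  fixes \<rho> :: "real measure" and w :: "real \<Rightarrow> real"
  assumes sets: "sets \<rho> = sets borel" and w: "integrable \<rho> w"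
begin

lemma continuous_measurable:
  assumes "continuous_on UNIV (g :: real \<Rightarrow> 'b::topological_space)"
  shows "g \<in> borel_measurable \<rho>"
  using borel_measurable_continuous_onI[OF assms] by (simp add: measurable_cong_sets[OF sets refl])

lemma cauchy_tr_measurable: "(\<lambda>t. of_real (w t) / (of_real t - z :: complex)) \<in> borel_measurable \<rho>"
proof -
  have [measurable]: "w \<in> borel_measurable \<rho>" using w by auto
  have [measurable]: "(\<lambda>t::real. of_real t - z :: complex) \<in> borel_measurable \<rho>"
    by (intro continuous_measurable continuous_intros)
  show ?thesis by measurable
qed

lemma cauchy_kernel_le:
  assumes "d > 0" "\<bar>Im z\<bar> \<ge> d"
  shows "norm (of_real (w t) / (of_real t - z :: complex)) \<le> \<bar>w t\<bar> / d"
proof -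
  have "norm (of_real t - z) \<ge> d" using norm_diff_real_ge[of z t] assms by linarith
  then show ?thesis using assms(1) by (simp add: norm_divide frac_le)
qed

lemma cauchy_tr_integrable:
  assumes "z \<in> - \<real>"
  shows "integrable \<rho> (\<lambda>t. of_real (w t) / (of_real t - z :: complex))"
proof (rule Bochner_Integration.integrable_bound[OF _ cauchy_tr_measurable])
  show "integrable \<rho> (\<lambda>t. \<bar>w t\<bar> / \<bar>Im z\<bar>)" using w by auto
  show "AE t in \<rho>. norm (of_real (w t) / (of_real t - z)) \<le> norm (\<bar>w t\<bar> / \<bar>Im z\<bar>)"
    using cauchy_kernel_le[of "\<bar>Im z\<bar>" z] assms unfolding nonreal_iff by (intro AE_I2) simp
qed

lemma cauchy_tr_holomorphic: "cauchy_tr \<rho> w holomorphic_on - \<real>"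
proof -
  have "(\<lambda>z. LINT t|\<rho>. of_real (w t) / (of_real t - z)) holomorphic_on - \<real>"
  proof (rule holomorphic_on_integral[OF open_nonreal _ cauchy_tr_measurable])
    fix t show "(\<lambda>z. of_real (w t) / (of_real t - z)) holomorphic_on - \<real>" by (intro holomorphic_intros) auto
  next
    fix z0 :: complex assume "z0 \<in> - \<real>"
    then have z0: "\<bar>Im z0\<bar> > 0" by (simp add: complex_is_Real_iff)
    define r where "r = \<bar>Im z0\<bar> / 2"
    have r: "r > 0" using z0 by (simp add: r_def)
    have im: "\<bar>Im z\<bar> \<ge> r" if "z \<in> cball z0 r" for z
      using that abs_Im_le_cmod[of "z0 - z"] by (simp add: r_def dist_norm)
    show "\<exists>r>0. \<exists>g. integrable \<rho> g \<and> cball z0 r \<subseteq> - \<real> \<and> (\<forall>z\<in>cball z0 r. \<forall>t\<in>space \<rho>. norm (of_real (w t) / (of_real t - z)) \<le> g t)"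
    proof (rule exI[of _ r], intro conjI r, rule exI[of _ "\<lambda>t. \<bar>w t\<bar> / r"], intro conjI ballI)
      show "cball z0 r \<subseteq> - \<real>"
      proof
        fix z assume "z \<in> cball z0 r"
        then have "Im z \<noteq> 0" using im[of z] r by auto
        then show "z \<in> - \<real>" by (simp add: complex_is_Real_iff)
      qed
    qed (use r w im cauchy_kernel_le in auto)
  qed
  then show ?thesis unfolding cauchy_tr_def[abs_def] .
qed

lemma norm_cauchy_tr_le:
  assumes "d > 0" "\<And>t. w t \<noteq> 0 \<Longrightarrow> d \<le> norm (of_real t - z :: complex)"
  shows "norm (cauchy_tr \<rho> w z) \<le> (LINT t|\<rho>. \<bar>w t\<bar>) / d"
proof -
  have "norm (cauchy_tr \<rho> w z) \<le> (LINT t|\<rho>. \<bar>w t\<bar> / d)"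
    unfolding cauchy_tr_def
  proof (rule Bochner_Integration.integral_norm_bound_integral)
    have le: "norm (of_real (w t) / (of_real t - z :: complex)) \<le> \<bar>w t\<bar> / d" for t
      using assms(2)[of t] assms(1) by (cases "w t = 0") (auto simp: norm_divide intro!: frac_le)
    show "integrable \<rho> (\<lambda>t. of_real (w t) / (of_real t - z :: complex))"
      by (rule Bochner_Integration.integrable_bound[of _ "\<lambda>t. \<bar>w t\<bar> / d", OF _ cauchy_tr_measurable])
        (use w le assms(1) in auto)
    show "norm (of_real (w t) / (of_real t - z :: complex)) \<le> \<bar>w t\<bar> / d" for t by (rule le)
  qed (use w in auto)
  then show ?thesis by simp
qed

lemma norm_cauchy_tr_le_Im:
  assumes "Im z \<noteq> 0"
  shows "norm (cauchy_tr \<rho> w z) \<le> (LINT t|\<rho>. \<bar>w t\<bar>) / \<bar>Im z\<bar>"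
  by (rule norm_cauchy_tr_le) (use assms norm_diff_real_ge in auto)

lemma cauchy_tr_cnj: "cauchy_tr \<rho> w (cnj z) = cnj (cauchy_tr \<rho> w z)"
  unfolding cauchy_tr_def using integral_bounded_linear'[OF bounded_linear_cnj bounded_linear_cnj, of \<rho> "\<lambda>t. of_real (w t) / (of_real t - z)"] by simp

lemma Im_cauchy_tr:
  assumes z: "Im z \<noteq> 0"
  shows "Im (cauchy_tr \<rho> w z) = (LINT t|\<rho>. w t * (Im z / ((t - Re z)\<^sup>2 + (Im z)\<^sup>2)))"
    "integrable \<rho> (\<lambda>t. w t * (Im z / ((t - Re z)\<^sup>2 + (Im z)\<^sup>2)))"
proof -
  have i: "integrable \<rho> (\<lambda>t. of_real (w t) / (of_real t - z :: complex))" using z by (intro cauchy_tr_integrable) (simp add: complex_is_Real_iff)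
  have e: "Im (of_real (w t) / (of_real t - z)) = w t * (Im z / ((t - Re z)\<^sup>2 + (Im z)\<^sup>2))" for t
    by (simp add: Im_divide)
  show "Im (cauchy_tr \<rho> w z) = (LINT t|\<rho>. w t * (Im z / ((t - Re z)\<^sup>2 + (Im z)\<^sup>2)))"
    unfolding cauchy_tr_def integral_Im[OF i, symmetric] e ..
  show "integrable \<rho> (\<lambda>t. w t * (Im z / ((t - Re z)\<^sup>2 + (Im z)\<^sup>2)))"
    using integrable_Im[OF i] unfolding e .
qed

lemma Im_cauchy_tr_nonneg:
  assumes z: "Im z > 0" and w0: "\<And>t. w t \<ge> 0"
  shows "Im (cauchy_tr \<rho> w z) \<ge> 0"
  unfolding Im_cauchy_tr(1)[OF less_imp_neq[OF z, symmetric]] using z w0 by (intro integral_nonneg_AE AE_I2) auto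

text \<open>Multiplication by h commutes with the transform up to the integral of the divided
  difference (h z - h t) / (z - t), which is entire in z. Bounded support of w keeps the divided
  differences bounded.\<close>

lemma cauchy_tr_mult_entire:
  assumes h: "h holomorphic_on UNIV" and R: "\<And>t. \<bar>t\<bar> > R \<Longrightarrow> w t = 0" and hr: "\<And>t. h (of_real t) = of_real (hR t)"
  shows "\<exists>E. E holomorphic_on UNIV \<and> (\<forall>z\<in>-\<real>. h z * cauchy_tr \<rho> w z - cauchy_tr \<rho> (\<lambda>t. hR t * w t) z = E z)"
    "integrable \<rho> (\<lambda>t. hR t * w t)"
proof -
  have contR: "continuous_on UNIV hR"
  proof -
    have "continuous_on UNIV (\<lambda>t. Re (h (of_real t)))"
      by (intro continuous_intros continuous_on_compose2[OF holomorphic_on_imp_continuous_on[OF h]]) auto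
    then show ?thesis by (simp add: hr)
  qed
  have mR [measurable]: "hR \<in> borel_measurable \<rho>"
    by (rule continuous_measurable[OF contR])
  have mw [measurable]: "w \<in> borel_measurable \<rho>" using w by auto
  have "bounded (hR ` {-R..R})" by (intro compact_imp_bounded compact_continuous_image continuous_on_subset[OF contR]) auto
  then obtain L where L': "\<forall>t\<in>{-R..R}. \<bar>hR t\<bar> \<le> L" by (auto simp: bounded_iff)
  then have L: "\<bar>hR t\<bar> \<le> L" if "t \<in> {-R..R}" for t using that by blast
  show hwi: "integrable \<rho> (\<lambda>t. hR t * w t)"
  proof (rule Bochner_Integration.integrable_bound[of _ "\<lambda>t. L * \<bar>w t\<bar>"])
    show "AE t in \<rho>. norm (hR t * w t) \<le> norm (L * \<bar>w t\<bar>)"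
    proof (rule AE_I2)
      fix t
      show "norm (hR t * w t) \<le> norm (L * \<bar>w t\<bar>)"
      proof (cases "\<bar>t\<bar> > R")
        case False
        then have "\<bar>hR t\<bar> \<le> L" by (intro L) auto
        then show ?thesis by (simp add: abs_mult mult_right_mono)
      qed (simp add: R)
    qed
  qed (use w in auto)
  \<comment> \<open>The divided difference, completed by the derivative on the diagonal so that it
    is entire in z for every t.\<close>
  define K where "K = (\<lambda>z t. - of_real (w t) * (if z = of_real t then deriv h (of_real t) else (h z - h (of_real t)) / (z - of_real t)))"
  have KE: "(\<lambda>z. LINT t|\<rho>. K z t) holomorphic_on UNIV"
  proof (rule holomorphic_on_integral)
    fix t
    have "(\<lambda>z. if z = of_real t then deriv h (of_real t) else (h z - h (of_real t)) / (z - of_real t)) holomorphic_on UNIV"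
      by (rule pole_lemma[OF h]) simp
    then show "(\<lambda>z. K z t) holomorphic_on UNIV" unfolding K_def by (intro holomorphic_intros)
  next
    fix z :: complex
    have [measurable]: "(\<lambda>t::real. of_real t :: complex) \<in> borel_measurable \<rho>"
      by (intro continuous_measurable continuous_intros)
    have eq: "K z = (\<lambda>t. - of_real (w t) * (if z = of_real t then deriv h z else (h z - of_real (hR t)) / (z - of_real t)))"
      by (auto simp: K_def hr)
    show "K z \<in> borel_measurable \<rho>" unfolding eq by measurable
  next
    fix z0 :: complex
    define S where "S = cball (0::complex) (\<bar>R\<bar> + norm z0 + 1)"
    have "continuous_on S (deriv h)"
      by (intro holomorphic_on_imp_continuous_on holomorphic_on_subset[OF holomorphic_deriv[OF h]]) auto
    then have "bounded (deriv h ` S)" by (intro compact_imp_bounded compact_continuous_image) (simp_all add: S_def)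
    then obtain L where L: "\<And>z. z \<in> S \<Longrightarrow> norm (deriv h z) \<le> L" by (auto simp: bounded_iff)
    have L0: "L \<ge> 0" using order_trans[OF norm_ge_zero L[of 0]] by (simp add: S_def)
    have le: "norm (K z t) \<le> \<bar>w t\<bar> * L" if z: "z \<in> cball z0 1" for z t
    proof (cases "\<bar>t\<bar> > R")
      case False
      have zS: "z \<in> S" using z norm_triangle_sub[of z z0] by (simp add: S_def dist_norm norm_minus_commute)
      have "\<bar>t\<bar> \<le> \<bar>R\<bar> + norm z0 + 1" using False norm_ge_zero[of z0] by linarith
      then have tS: "of_real t \<in> S" by (simp add: S_def)
      have "norm (h z - h (of_real t)) \<le> L * norm (z - of_real t)"
        by (rule field_differentiable_bound[where S = S and f' = "deriv h"])
          (use zS tS L in \<open>auto simp: S_def intro!: has_field_derivative_at_within[OF holomorphic_derivI[OF h]]\<close>)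
      then have "norm (if z = of_real t then deriv h (of_real t) else (h z - h (of_real t)) / (z - of_real t)) \<le> L"
        using L[OF tS] by (simp add: norm_divide pos_divide_le_eq)
      then show ?thesis unfolding K_def norm_mult norm_minus_cancel norm_of_real by (rule mult_left_mono) simp
    qed (simp add: K_def R L0)
    show "\<exists>r>0. \<exists>g. integrable \<rho> g \<and> cball z0 r \<subseteq> UNIV \<and> (\<forall>z\<in>cball z0 r. \<forall>t\<in>space \<rho>. norm (K z t) \<le> g t)"
      by (rule exI[of _ 1], intro conjI, simp, rule exI[of _ "\<lambda>t. \<bar>w t\<bar> * L"]) (use le w in auto)
  qed auto
  have "h z * cauchy_tr \<rho> w z - cauchy_tr \<rho> (\<lambda>t. hR t * w t) z = (LINT t|\<rho>. K z t)" if z: "z \<in> - \<real>" for z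
  proof -
    have i2: "integrable \<rho> (\<lambda>t. of_real (hR t * w t) / (of_real t - z :: complex))"
    proof (rule Bochner_Integration.integrable_bound[of _ "\<lambda>t. \<bar>hR t * w t\<bar> / \<bar>Im z\<bar>"])
      show "integrable \<rho> (\<lambda>t. \<bar>hR t * w t\<bar> / \<bar>Im z\<bar>)" using hwi by auto
      have "(\<lambda>t. of_real (hR t) * (of_real (w t) / (of_real t - z))) \<in> borel_measurable \<rho>"
        using cauchy_tr_measurable by measurable
      then show "(\<lambda>t. of_real (hR t * w t) / (of_real t - z)) \<in> borel_measurable \<rho>" by simp
      show "AE t in \<rho>. norm (of_real (hR t * w t) / (of_real t - z)) \<le> norm (\<bar>hR t * w t\<bar> / \<bar>Im z\<bar>)"
        using norm_diff_real_ge[of z] z unfolding nonreal_iff by (intro AE_I2) (auto simp: norm_divide norm_mult abs_mult intro!: frac_le)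
    qed
    have "h z * cauchy_tr \<rho> w z - cauchy_tr \<rho> (\<lambda>t. hR t * w t) z =
       (LINT t|\<rho>. h z * (of_real (w t) / (of_real t - z)) - of_real (hR t * w t) / (of_real t - z))"
      unfolding cauchy_tr_def
      by (subst Bochner_Integration.integral_diff[OF integrable_mult_right[OF cauchy_tr_integrable[OF z]] i2])
        (simp only: integral_mult_right_zero)
    also have "\<dots> = (LINT t|\<rho>. K z t)"
    proof (rule Bochner_Integration.integral_cong[OF refl])
      fix t
      have ne: "z \<noteq> of_real t" using z by auto
      have eq: "of_real t - z = - (z - of_real t)" by simp
      have gen: "a * (W / (- d)) - H * W / (- d) = - W * ((a - H) / d)" for a W d H :: complex
        by (simp add: algebra_simps diff_divide_distrib)
      show "h z * (of_real (w t) / (of_real t - z)) - of_real (hR t * w t) / (of_real t - z) = K z t"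
        unfolding eq K_def hr of_real_mult if_not_P[OF ne] by (rule gen)
    qed
    finally show ?thesis .
  qed
  then show "\<exists>E. E holomorphic_on UNIV \<and> (\<forall>z\<in>-\<real>. h z * cauchy_tr \<rho> w z - cauchy_tr \<rho> (\<lambda>t. hR t * w t) z = E z)"
    using KE by blast
qed

text \<open>By Fubini the Poisson kernel e / ((y - x)^2 + e^2) can be integrated over x first; its
  primitive is an arctangent.\<close>

lemma integral_Im_cauchy_tr:
  assumes sf: "sigma_finite_measure \<rho>" and e: "e > 0" and st: "s \<le> t" and w0: "\<And>t. w t \<ge> 0"
  shows "integral {s..t} (\<lambda>x. Im (cauchy_tr \<rho> w (Complex x e))) = (LINT y|\<rho>. w y * (arctan ((t - y) / e) - arctan ((s - y) / e)))"
proof -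
  interpret pair_sigma_finite lborel \<rho>
    by (intro pair_sigma_finite.intro sigma_finite_lborel sf)
  note [measurable_cong] = sets
  have [measurable]: "w \<in> borel_measurable \<rho>" using w by auto
  define f where "f = (\<lambda>x y. indicator {s..t} x * (w y * (e / ((y - x)\<^sup>2 + e\<^sup>2))))"
  have fm: "case_prod f \<in> borel_measurable (lborel \<Otimes>\<^sub>M \<rho>)" unfolding f_def by measurable
  have imc: "Im (cauchy_tr \<rho> w (Complex x e)) = (LINT y|\<rho>. w y * (e / ((y - x)\<^sup>2 + e\<^sup>2)))"
    "integrable \<rho> (\<lambda>y. w y * (e / ((y - x)\<^sup>2 + e\<^sup>2)))" for x
    using Im_cauchy_tr[of "Complex x e"] e by auto
  have cont: "continuous_on {s..t} (\<lambda>x. Im (cauchy_tr \<rho> w (Complex x e)))"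
  proof -
    have eq: "Complex x e = of_real x + \<i> * of_real e" for x by (simp add: complex_eq_iff)
    show ?thesis unfolding eq
      by (intro continuous_intros continuous_on_compose2[OF holomorphic_on_imp_continuous_on[OF cauchy_tr_holomorphic]])
        (use e in \<open>auto simp: complex_is_Real_iff\<close>)
  qed
  have inner: "(LINT y|\<rho>. f x y) = indicator {s..t} x * Im (cauchy_tr \<rho> w (Complex x e))" for x
    unfolding f_def imc by (rule integral_mult_right_zero)
  have seti: "set_integrable lborel {s..t} (\<lambda>x. Im (cauchy_tr \<rho> w (Complex x e)))"
    unfolding set_integrable_def by (rule borel_integrable_compact[OF _ cont]) simp
  have fi: "integrable (lborel \<Otimes>\<^sub>M \<rho>) (case_prod f)"
  proof (rule Fubini_integrable[OF fm])
    have "(\<lambda>x. LINT y|\<rho>. norm (case (x, y) of (x, y) \<Rightarrow> f x y)) = (\<lambda>x. indicator {s..t} x *\<^sub>R Im (cauchy_tr \<rho> w (Complex x e)))"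
    proof
      fix x
      have "norm (f x y) = f x y" for y using w0[of y] e by (auto simp: f_def)
      then show "(LINT y|\<rho>. norm (case (x, y) of (x, y) \<Rightarrow> f x y)) = indicator {s..t} x *\<^sub>R Im (cauchy_tr \<rho> w (Complex x e))"
        using inner[of x] by simp
    qed
    then show "integrable lborel (\<lambda>x. LINT y|\<rho>. norm (case (x, y) of (x, y) \<Rightarrow> f x y))" using seti by (simp add: set_integrable_def)
    show "AE x in lborel. integrable \<rho> (\<lambda>y. case (x, y) of (x, y) \<Rightarrow> f x y)"
      unfolding f_def prod.case by (intro AE_I2 integrable_mult_right imc(2))
  qed
  have "integral {s..t} (\<lambda>x. Im (cauchy_tr \<rho> w (Complex x e))) = (LINT x:{s..t}|lborel. Im (cauchy_tr \<rho> w (Complex x e)))"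
    using set_borel_integral_eq_integral(2)[OF seti] by simp
  also have "\<dots> = (LINT x|lborel. LINT y|\<rho>. f x y)" by (simp add: set_lebesgue_integral_def inner)
  also have "\<dots> = (LINT y|\<rho>. LINT x|lborel. f x y)" by (rule Fubini_integral[OF fi, symmetric])
  also have "\<dots> = (LINT y|\<rho>. w y * (arctan ((t - y) / e) - arctan ((s - y) / e)))"
  proof (rule Bochner_Integration.integral_cong[OF refl])
    fix y
    have "(LINT x|lborel. (e / ((y - x)\<^sup>2 + e\<^sup>2)) * indicator {s..t} x) = arctan ((t - y) / e) - arctan ((s - y) / e)"
    proof (rule integral_FTC_Icc_real[OF st])
      fix x
      have "((\<lambda>x. arctan ((x - y) / e)) has_real_derivative inverse (1 + ((x - y) / e)\<^sup>2) * (1 / e)) (at x)"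
        using e by (auto intro!: derivative_eq_intros)
      moreover have "inverse (1 + ((x - y) / e)\<^sup>2) * (1 / e) = e / ((y - x)\<^sup>2 + e\<^sup>2)"
      proof -
        have "(y - x)\<^sup>2 + e\<^sup>2 > 0" using e by (simp add: add_nonneg_pos)
        moreover have "(x - y)\<^sup>2 = (y - x)\<^sup>2" by (simp add: power2_commute)
        moreover have "1 + ((x - y) / e)\<^sup>2 = ((y - x)\<^sup>2 + e\<^sup>2) / e\<^sup>2" using e by (simp add: power_divide field_simps power2_commute)
        ultimately show ?thesis using e by (simp add: power2_eq_square)
      qed
      ultimately show "((\<lambda>x. arctan ((x - y) / e)) has_real_derivative e / ((y - x)\<^sup>2 + e\<^sup>2)) (at x)" by simp
      show "isCont (\<lambda>x. e / ((y - x)\<^sup>2 + e\<^sup>2)) x"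
        using e by (intro continuous_intros) (simp add: add_nonneg_eq_0_iff)
    qed
    then have "w y * (LINT x|lborel. (e / ((y - x)\<^sup>2 + e\<^sup>2)) * indicator {s..t} x) = w y * (arctan ((t - y) / e) - arctan ((s - y) / e))" by simp
    then show "(LINT x|lborel. f x y) = w y * (arctan ((t - y) / e) - arctan ((s - y) / e))"
      unfolding f_def by (simp add: ac_simps flip: integral_mult_right_zero)
  qed
  finally show ?thesis .
qed

lemma arctan_sgn_lim:
  assumes e: "\<And>n. e n > 0" "e \<longlonglongrightarrow> 0"
  shows "(\<lambda>n. arctan (c / e n)) \<longlonglongrightarrow> pi / 2 * sgn (c :: real)"
proof -
  have ei: "filterlim (\<lambda>n. 1 / e n) at_top sequentially"
    using filterlim_inverse_at_top[OF e(2)] e(1) by (simp add: inverse_eq_divide)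
  consider "c > 0" | "c = 0" | "c < 0" by linarith
  then show ?thesis
  proof cases
    case 1
    have "filterlim (\<lambda>n. c * (1 / e n)) at_top sequentially" by (rule filterlim_tendsto_pos_mult_at_top[OF tendsto_const 1 ei])
    from filterlim_compose[OF tendsto_arctan_at_top this] show ?thesis using 1 by simp
  next
    case 3
    have "filterlim (\<lambda>n. (- c) * (1 / e n)) at_top sequentially" by (rule filterlim_tendsto_pos_mult_at_top[OF tendsto_const _ ei]) (use 3 in simp)
    from tendsto_minus[OF filterlim_compose[OF tendsto_arctan_at_top this]] show ?thesis using 3 by (simp add: arctan_minus)
  qed simp
qed

text \<open>The arctangent differences lie in [0, pi] and tend to pi inside the interval, to pi / 2
  at its ends and to 0 outside, which is pi / 2 times the sum of the indicators of the open and the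
  closed interval. The two-sided bound, uniform in n, is what the continuation argument asks
  for.\<close>

lemma stieltjes_inversion:
  assumes sf: "sigma_finite_measure \<rho>" and e: "\<And>n. e n > 0" "e \<longlonglongrightarrow> 0" and st: "s < t" and w0: "\<And>t. w t \<ge> 0"
  shows "(\<lambda>n. integral {s..t} (\<lambda>x. Im (cauchy_tr \<rho> w (Complex x (e n))))) \<longlonglongrightarrow>
     pi / 2 * (LINT y|\<rho>. w y * (indicator {s<..<t} y + indicator {s..t} y))"
    "0 \<le> integral {s..t} (\<lambda>x. Im (cauchy_tr \<rho> w (Complex x (e n))))"
    "integral {s..t} (\<lambda>x. Im (cauchy_tr \<rho> w (Complex x (e n)))) \<le> pi * (LINT y|\<rho>. w y)"
proof -
  note [measurable_cong] = sets
  have [measurable]: "w \<in> borel_measurable \<rho>" using w by auto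
  have eq: "integral {s..t} (\<lambda>x. Im (cauchy_tr \<rho> w (Complex x (e n)))) = (LINT y|\<rho>. w y * (arctan ((t - y) / e n) - arctan ((s - y) / e n)))" for n
    by (rule integral_Im_cauchy_tr[OF sf e(1) less_imp_le[OF st] w0])
  have ar: "0 \<le> arctan ((t - y) / e n) - arctan ((s - y) / e n)" "arctan ((t - y) / e n) - arctan ((s - y) / e n) \<le> pi" for y n
  proof -
    have "(s - y) / e n \<le> (t - y) / e n" using st e(1)[of n] by (intro divide_right_mono) auto
    then show "0 \<le> arctan ((t - y) / e n) - arctan ((s - y) / e n)" by (simp add: arctan_le_iff)
    show "arctan ((t - y) / e n) - arctan ((s - y) / e n) \<le> pi"
      using arctan_bounded[of "(t - y) / e n"] arctan_bounded[of "(s - y) / e n"] by linarith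
  qed
  have bound: "norm (w y * (arctan ((t - y) / e n) - arctan ((s - y) / e n))) \<le> w y * pi" for y n
    using ar[of y n] w0[of y] by (simp add: abs_mult mult_left_mono)
  have int: "integrable \<rho> (\<lambda>y. w y * (arctan ((t - y) / e n) - arctan ((s - y) / e n)))" for n
    by (rule Bochner_Integration.integrable_bound[of _ "\<lambda>y. w y * pi"]) (use w bound w0 in \<open>auto intro!: AE_I2 order_trans[OF bound]\<close>)
  have "(\<lambda>n. LINT y|\<rho>. w y * (arctan ((t - y) / e n) - arctan ((s - y) / e n))) \<longlonglongrightarrow>
     (LINT y|\<rho>. pi / 2 * (w y * (indicator {s<..<t} y + indicator {s..t} y)))"
  proof (rule integral_dominated_convergence[where w = "\<lambda>y. w y * pi"])
    show "AE y in \<rho>. (\<lambda>n. w y * (arctan ((t - y) / e n) - arctan ((s - y) / e n))) \<longlonglongrightarrow> pi / 2 * (w y * (indicator {s<..<t} y + indicator {s..t} y))"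
    proof (rule AE_I2)
      fix y
      have "(\<lambda>n. w y * (arctan ((t - y) / e n) - arctan ((s - y) / e n))) \<longlonglongrightarrow> w y * (pi / 2 * sgn (t - y) - pi / 2 * sgn (s - y))"
        by (intro tendsto_intros arctan_sgn_lim e)
      moreover have "w y * (pi / 2 * sgn (t - y) - pi / 2 * sgn (s - y)) = pi / 2 * (w y * (indicator {s<..<t} y + indicator {s..t} y))"
        using st by (auto simp: sgn_if indicator_def)
      ultimately show "(\<lambda>n. w y * (arctan ((t - y) / e n) - arctan ((s - y) / e n))) \<longlonglongrightarrow> pi / 2 * (w y * (indicator {s<..<t} y + indicator {s..t} y))" by (simp only:)
    qed
  qed (use w bound in auto)
  then show "(\<lambda>n. integral {s..t} (\<lambda>x. Im (cauchy_tr \<rho> w (Complex x (e n))))) \<longlonglongrightarrow>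
     pi / 2 * (LINT y|\<rho>. w y * (indicator {s<..<t} y + indicator {s..t} y))" unfolding eq by simp
  show "0 \<le> integral {s..t} (\<lambda>x. Im (cauchy_tr \<rho> w (Complex x (e n))))"
    unfolding eq using ar w0 by (intro integral_nonneg_AE AE_I2) auto
  have "(LINT y|\<rho>. w y * (arctan ((t - y) / e n) - arctan ((s - y) / e n))) \<le> (LINT y|\<rho>. w y * pi)"
    using w by (intro integral_mono int) (auto intro: mult_left_mono ar w0)
  then show "integral {s..t} (\<lambda>x. Im (cauchy_tr \<rho> w (Complex x (e n)))) \<le> pi * (LINT y|\<rho>. w y)"
    unfolding eq by (simp add: mult.commute)
qed

end

section \<open>The spectral measure\<close>

lemma bounded_on_compact:
  fixes f :: "complex \<Rightarrow> complex"
  assumes "continuous_on S f" "compact S"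
  obtains L where "L \<ge> 0" "\<And>z. z \<in> S \<Longrightarrow> norm (f z) \<le> L"
proof -
  have "bounded (f ` S)" using assms by (intro compact_imp_bounded compact_continuous_image)
  then obtain L where L: "\<forall>z\<in>S. norm (f z) \<le> L" by (auto simp: bounded_iff)
  show ?thesis by (rule that[of "\<bar>L\<bar>"]) (use L in \<open>auto intro: order_trans\<close>)
qed

lemma vertical_approach: "((\<lambda>y. Complex x y) \<longlongrightarrow> of_real x) (at_right 0)"
proof -
  have "((\<lambda>y. of_real x + \<i> * of_real y) \<longlongrightarrow> of_real x + \<i> * of_real 0) (at_right 0)"
    by (intro tendsto_intros)
  moreover have "of_real x + \<i> * of_real y = Complex x y" for y by (simp add: complex_eq_iff)
  ultimately show ?thesis by simp
qed

text \<open>The value at a real point is a limit both from above and from below, and the symmetry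
  makes the two limits conjugate.\<close>

lemma real_by_symmetry:
  assumes c: "isCont F (of_real x)" and sym: "\<And>z. z \<in> - \<real> \<Longrightarrow> F (cnj z) = cnj (F z)"
  shows "F (of_real x) \<in> \<real>"
proof -
  have l1: "((\<lambda>y. F (Complex x y)) \<longlongrightarrow> F (of_real x)) (at_right 0)"
    by (rule isCont_tendsto_compose[OF c vertical_approach])
  have "((\<lambda>y. cnj (Complex x y)) \<longlongrightarrow> cnj (of_real x)) (at_right 0)" by (intro tendsto_intros vertical_approach)
  then have l2: "((\<lambda>y. F (cnj (Complex x y))) \<longlongrightarrow> F (of_real x)) (at_right 0)"
    by (intro isCont_tendsto_compose[OF c]) simp
  have "\<forall>\<^sub>F y in at_right 0. cnj (F (Complex x y)) = F (cnj (Complex x y))"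
    using eventually_at_right_less[of 0] by eventually_elim (subst sym, auto simp: complex_is_Real_iff)
  then have "((\<lambda>y. F (cnj (Complex x y))) \<longlongrightarrow> cnj (F (of_real x))) (at_right 0)"
    by (rule Lim_transform_eventually[OF tendsto_cnj[OF l1]])
  from tendsto_unique[OF trivial_limit_at_right_real this l2] show ?thesis by (simp add: Reals_cnj_iff)
qed

text \<open>Two local extensions agree at a common real point, because both values are the limit of
  f from above. No connectedness argument on overlapping discs is involved.\<close>

lemma extension_glue:
  fixes f :: "complex \<Rightarrow> complex" and T :: "real set"
  assumes f: "f holomorphic_on - \<real>" and T: "open T"
    and ext: "\<And>t. t \<in> T \<Longrightarrow> \<exists>g. \<exists>d>0. g holomorphic_on ball (of_real t) d \<and>
       (\<forall>z\<in>ball (of_real t) d. z \<notin> \<real> \<longrightarrow> g z = f z)"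
  shows "\<exists>F. F holomorphic_on (- \<real> \<union> of_real ` T) \<and> (\<forall>z\<in>-\<real>. F z = f z) \<and> open (- \<real> \<union> complex_of_real ` T)"
proof -
  have "\<forall>t\<in>T. \<exists>gd. snd gd > 0 \<and> fst gd holomorphic_on ball (of_real t) (snd gd) \<and>
       (\<forall>z\<in>ball (of_real t) (snd gd). z \<notin> \<real> \<longrightarrow> fst gd z = f z)"
  proof
    fix t assume "t \<in> T"
    from ext[OF this] obtain g d where "d > 0" "g holomorphic_on ball (of_real t) d"
       "\<forall>z\<in>ball (of_real t) d. z \<notin> \<real> \<longrightarrow> g z = f z" by blast
    then show "\<exists>gd. snd gd > 0 \<and> fst gd holomorphic_on ball (of_real t) (snd gd) \<and>
       (\<forall>z\<in>ball (of_real t) (snd gd). z \<notin> \<real> \<longrightarrow> fst gd z = f z)"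
      by (intro exI[of _ "(g, d)"]) simp
  qed
  then obtain gd where gd: "\<And>t. t \<in> T \<Longrightarrow> snd (gd t) > 0" "\<And>t. t \<in> T \<Longrightarrow> fst (gd t) holomorphic_on ball (of_real t) (snd (gd t))"
    "\<And>t z. t \<in> T \<Longrightarrow> z \<in> ball (of_real t) (snd (gd t)) \<Longrightarrow> z \<notin> \<real> \<Longrightarrow> fst (gd t) z = f z"
    using bchoice[of T] by metis
  define g d where "g t = fst (gd t)" and "d t = snd (gd t)" for t
  note gd = gd[folded g_def d_def]
  define F where "F = (\<lambda>z. if z \<in> \<real> then g (Re z) z else f z)"
  have lim: "((\<lambda>y. f (Complex x y)) \<longlongrightarrow> g t (of_real x)) (at_right 0)"
    if t: "t \<in> T" and x: "complex_of_real x \<in> ball (of_real t) (d t)" for t x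
  proof -
    have "isCont (g t) (of_real x)"
      using holomorphic_on_imp_continuous_on[OF gd(2)[OF t]] x unfolding continuous_on_eq_continuous_at[OF open_ball] by blast
    then have "((\<lambda>y. g t (Complex x y)) \<longlongrightarrow> g t (of_real x)) (at_right 0)"
      by (rule isCont_tendsto_compose[OF _ vertical_approach])
    moreover have "\<forall>\<^sub>F y in at_right 0. Complex x y \<in> ball (of_real t) (d t)"
      by (rule topological_tendstoD[OF vertical_approach open_ball x])
    then have "\<forall>\<^sub>F y in at_right 0. g t (Complex x y) = f (Complex x y)"
      using eventually_at_right_less[of 0] by eventually_elim (use gd(3)[OF t] in \<open>auto simp: complex_is_Real_iff\<close>)
    ultimately show ?thesis by (rule Lim_transform_eventually)
  qed
  have loc: "F z = g t z" if t: "t \<in> T" and z: "z \<in> ball (of_real t) (d t)" "z \<in> \<real> \<longrightarrow> Re z \<in> T" for t z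
  proof (cases "z \<in> \<real>")
    case False
    then show ?thesis using gd(3)[OF t z(1)] by (simp add: F_def)
  next
    case True
    define x where "x = Re z"
    have x: "z = of_real x" using True by (simp add: x_def complex_eq_iff complex_is_Real_iff)
    have xT: "x \<in> T" using z(2) True by (simp add: x_def)
    have "g x (of_real x) = g t (of_real x)"
      by (rule tendsto_unique[OF _ lim[OF xT] lim[OF t]]) (use gd(1)[OF xT] z(1) x in auto)
    then show ?thesis using True x by (simp add: F_def)
  qed
  have d': "\<exists>e>0. e \<le> d t \<and> (\<forall>z\<in>ball (of_real t) e. Re z \<in> T)" if t: "t \<in> T" for t
  proof -
    obtain e where e: "e > 0" "ball t e \<subseteq> T" using T t open_contains_ball by blast
    have "Re z \<in> T" if "z \<in> ball (of_real t) (min e (d t))" for z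
      using that e(2) abs_Re_le_cmod[of "of_real t - z"] by (auto simp: subset_iff dist_norm)
    then show ?thesis using e(1) gd(1)[OF t] by (intro exI[of _ "min e (d t)"]) auto
  qed
  have op: "open (- \<real> \<union> complex_of_real ` T)"
    unfolding open_contains_ball
  proof
    fix z assume z: "z \<in> - \<real> \<union> complex_of_real ` T"
    show "\<exists>e>0. ball z e \<subseteq> - \<real> \<union> complex_of_real ` T"
    proof (cases "z \<in> - \<real>")
      case True then show ?thesis using open_nonreal open_contains_ball by (metis le_supI1)
    next
      case False
      then obtain t where t: "t \<in> T" "z = of_real t" using z by auto
      obtain e where e: "e > 0" "\<forall>z\<in>ball (of_real t) e. Re z \<in> T" using d'[OF t(1)] by blast
      have "w \<in> - \<real> \<union> complex_of_real ` T" if "w \<in> ball z e" for w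
      proof (cases "w \<in> \<real>")
        case True
        have "Re w \<in> T" using that e(2) t(2) by blast
        moreover have "w = of_real (Re w)" using True by (simp add: complex_eq_iff complex_is_Real_iff)
        ultimately show ?thesis by blast
      qed simp
      then show ?thesis using e(1) by blast
    qed
  qed
  have "F holomorphic_on (- \<real> \<union> of_real ` T)"
    unfolding holomorphic_on_open[OF op]
  proof
    fix z assume z: "z \<in> - \<real> \<union> complex_of_real ` T"
    show "\<exists>f'. (F has_field_derivative f') (at z)"
    proof (cases "z \<in> - \<real>")
      case True
      have "(F has_field_derivative deriv f z) (at z)"
        by (rule has_field_derivative_transform_within_open[OF holomorphic_derivI[OF f open_nonreal True] open_nonreal True])
          (simp add: F_def)
      then show ?thesis by blast
    next
      case False
      then obtain t where t: "t \<in> T" "z = of_real t" using z by auto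
      obtain e where e: "e > 0" "e \<le> d t" "\<forall>z\<in>ball (of_real t) e. Re z \<in> T" using d'[OF t(1)] by blast
      have "(g t has_field_derivative deriv (g t) z) (at z)"
        by (rule holomorphic_derivI[OF gd(2)[OF t(1)]]) (use gd(1)[OF t(1)] t(2) in auto)
      then have "(F has_field_derivative deriv (g t) z) (at z)"
        by (rule has_field_derivative_transform_within_open[of _ _ _ "ball (of_real t) e"])
          (use e t loc[OF t(1)] in auto)
      then show ?thesis by blast
    qed
  qed
  then show ?thesis using op by (intro exI[of _ F]) (auto simp: F_def)
qed

definition real_entire_fun :: "(complex \<Rightarrow> complex) \<Rightarrow> bool" where
  "real_entire_fun A \<longleftrightarrow> A holomorphic_on UNIV \<and> (\<forall>z. A (cnj z) = cnj (A z))"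

lemma real_entire_fun_real: "real_entire_fun A \<Longrightarrow> A (of_real t) = of_real (Re (A (of_real t)))"
proof -
  assume "real_entire_fun A"
  then have "A (cnj (of_real t)) = cnj (A (of_real t))" unfolding real_entire_fun_def by blast
  then show ?thesis by (simp add: complex_eq_iff)
qed

text \<open>The properties of M and the measure that remain after the differential equation is
  forgotten. In \<open>herg\<close> the pair A, B may depend on the point t, since phi may vanish
  there and phi' has to replace it.\<close>

locale weyl_measure =
  fixes \<rho> :: "real measure" and M :: "complex \<Rightarrow> complex"
  assumes sets: "sets \<rho> = sets borel"
    and fin: "\<And>s t. emeasure \<rho> {s..t} < \<infinity>"
    and holM: "M holomorphic_on - \<real>"
    and cnjM: "\<And>z. z \<in> - \<real> \<Longrightarrow> M (cnj z) = cnj (M z)"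
    and herg: "\<And>t. \<exists>A B. real_entire_fun A \<and> real_entire_fun B \<and> B (of_real t) \<noteq> 0 \<and> (\<forall>z. Im z > 0 \<longrightarrow> Im (A z + (B z)\<^sup>2 * M z) \<ge> 0)"
    and inversion: "\<And>s t. s < t \<Longrightarrow> ((\<lambda>\<epsilon>. 1 / pi * integral {s..t} (\<lambda>x. Im (M (Complex x \<epsilon>)))) \<longlongrightarrow>
       1 / 2 * (measure \<rho> {s<..<t} + measure \<rho> {s..t})) (at_right 0)"
begin

lemma sigma_finite: "sigma_finite_measure \<rho>"
proof
  show "\<exists>A. countable A \<and> A \<subseteq> sets \<rho> \<and> \<Union> A = space \<rho> \<and> (\<forall>a\<in>A. emeasure \<rho> a \<noteq> \<infinity>)"
  proof (intro exI[of _ "range (\<lambda>n::nat. {- real n..real n})"] conjI)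
    show "\<Union> (range (\<lambda>n::nat. {- real n..real n})) = space \<rho>"
    proof -
      have "x \<in> \<Union> (range (\<lambda>n::nat. {- real n..real n}))" for x
      proof -
        obtain n :: nat where "\<bar>x\<bar> \<le> real n" using real_arch_simple by blast
        then show ?thesis by (intro UN_I[of n]) auto
      qed
      then show ?thesis using sets_eq_imp_space_eq[OF sets] by auto
    qed
    show "\<forall>a\<in>range (\<lambda>n::nat. {- real n..real n}). emeasure \<rho> a \<noteq> \<infinity>"
      using fin by (metis (no_types, lifting) imageE less_irrefl)
  qed (auto simp: sets)
qed

abbreviation w :: "real \<Rightarrow> real \<Rightarrow> real" where "w R \<equiv> indicator {-R..R}"

lemma w_integrable: "integrable \<rho> (w R)"
  using fin[of "-R" R] by (intro integrable_real_indicator) (auto simp: sets)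

text \<open>With G = A + B^2 M Herglotz, M is (G - A) / B^2. The factor 1 / B^2 is positive on the
  real axis, so its imaginary part is of order Im z and compensates the growth 1 / Im z of G; hence
  Im M is bounded below although M need not be Herglotz.\<close>

lemma local_bounds:
  "\<exists>r K C. 0 < r \<and> r \<le> 1 \<and> C \<ge> 0 \<and> (\<forall>z\<in>rect t0 r. norm (M z) \<le> K / Im z \<and> Im (M z) \<ge> - C)"
proof -
  obtain A B where A: "real_entire_fun A" and B: "real_entire_fun B" and B0: "B (of_real t0) \<noteq> 0"
    and pos: "\<And>z. Im z > 0 \<Longrightarrow> Im (A z + (B z)\<^sup>2 * M z) \<ge> 0" using herg by blast
  note hA = A[unfolded real_entire_fun_def, THEN conjunct1] and hB = B[unfolded real_entire_fun_def, THEN conjunct1]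
  define e where "e = (\<lambda>z. 1 / (B z)\<^sup>2)"
  have contB: "isCont B (of_real t0)" using holomorphic_on_imp_continuous_on[OF hB] by (simp add: continuous_on_eq_continuous_at)
  have "isCont e (of_real t0)" unfolding e_def using B0 contB by (intro continuous_intros) auto
  then have "isCont (\<lambda>z. Re (e z)) (of_real t0)" by (rule isCont_Re)
  moreover have "Re (e (of_real t0)) > 0"
  proof -
    have "e (of_real t0) = of_real (1 / (Re (B (of_real t0)))\<^sup>2)"
      unfolding e_def using real_entire_fun_real[OF B, of t0] by (metis of_real_1 of_real_divide of_real_power)
    moreover have "Re (B (of_real t0)) \<noteq> 0" using B0 real_entire_fun_real[OF B, of t0] by auto
    ultimately show ?thesis by simp
  qed
  ultimately have ev: "\<forall>\<^sub>F z in nhds (of_real t0). Re (e z) > 0"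
    using order_tendstoD(1)[of "\<lambda>z. Re (e z)" "Re (e (of_real t0))" "nhds (of_real t0)" 0] by (simp add: isCont_def tendsto_nhds_iff)
  then obtain d where d: "d > 0" "\<And>z. dist z (of_real t0) < d \<Longrightarrow> Re (e z) > 0"
    unfolding eventually_nhds_metric by blast
  define r where "r = min (1 / 2) (d / 4)"
  have r: "0 < r" "r \<le> 1 / 2" "2 * r < d" using d by (auto simp: r_def)
  define S where "S = cball (complex_of_real t0) (2 * r)"
  have S: "Re (e z) > 0" "B z \<noteq> 0" if "z \<in> S" for z
  proof -
    show 1: "Re (e z) > 0" using that r by (intro d(2)) (simp add: S_def dist_commute)
    show "B z \<noteq> 0" using 1 by (auto simp: e_def)
  qed
  have he: "e holomorphic_on {z. B z \<noteq> 0}" unfolding e_def by (intro holomorphic_intros holomorphic_on_subset[OF hB]) auto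
  have oB: "open {z. B z \<noteq> 0}" using continuous_open_vimage[of "- {0}" B] holomorphic_on_imp_continuous_on[OF hB]
    by (auto simp: vimage_def continuous_on_eq_continuous_at)
  have subB: "S \<subseteq> {z. B z \<noteq> 0}" using S by auto
  have cS: "compact S" by (simp add: S_def)
  obtain E where E: "E \<ge> 0" "\<And>z. z \<in> S \<Longrightarrow> norm (e z) \<le> E"
    using bounded_on_compact[OF continuous_on_subset[OF holomorphic_on_imp_continuous_on[OF he] subB] cS] by blast
  obtain E' where E': "E' \<ge> 0" "\<And>z. z \<in> S \<Longrightarrow> norm (deriv e z) \<le> E'"
    using bounded_on_compact[OF continuous_on_subset[OF holomorphic_on_imp_continuous_on[OF holomorphic_deriv[OF he oB]] subB] cS] by blast
  obtain a where a: "a \<ge> 0" "\<And>z. z \<in> S \<Longrightarrow> norm (A z) \<le> a"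
    using bounded_on_compact[OF continuous_on_subset[OF holomorphic_on_imp_continuous_on[OF hA]] cS] by auto
  define G where "G = (\<lambda>z. A z + (B z)\<^sup>2 * M z)"
  have hG: "G holomorphic_on {z. Im z > 0}" unfolding G_def
    by (intro holomorphic_intros holomorphic_on_subset[OF hA] holomorphic_on_subset[OF hB] holomorphic_on_subset[OF holM]) (auto simp: complex_is_Real_iff)
  define top where "top = (\<lambda>x. Complex x 1) ` {t0 - 1..t0 + 1}"
  have ctop: "compact top" unfolding top_def
  proof (rule compact_continuous_image)
    have eq: "Complex x 1 = of_real x + \<i>" for x by (simp add: complex_eq_iff)
    show "continuous_on {t0 - 1..t0 + 1} (\<lambda>x. Complex x 1)" unfolding eq by (intro continuous_intros)
  qed simp
  have subtop: "top \<subseteq> {z. Im z > 0}" by (auto simp: top_def)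
  obtain L where L: "L \<ge> 0" "\<And>z. z \<in> top \<Longrightarrow> norm (G z) \<le> L"
    using bounded_on_compact[OF continuous_on_subset[OF holomorphic_on_imp_continuous_on[OF hG] subtop] ctop] by blast
  define K1 where "K1 = 2 * (L + 1) + 1"
  have K1: "K1 \<ge> 0" using L by (simp add: K1_def)
  have inS: "z \<in> S" "of_real (Re z) \<in> S" if z: "z \<in> rect t0 r" for z
  proof -
    have "norm (of_real t0 - z) \<le> \<bar>Re (of_real t0 - z)\<bar> + \<bar>Im (of_real t0 - z)\<bar>" by (rule cmod_le)
    then show "z \<in> S" using z by (auto simp: S_def rect_def dist_norm)
    show "of_real (Re z) \<in> S" using z by (auto simp: S_def rect_def dist_norm simp flip: of_real_diff)
  qed
  have Gle: "norm (G z) \<le> K1 / Im z" if z: "z \<in> rect t0 r" for z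
  proof -
    have zi: "0 < Im z" "Im z \<le> 1" using z r by (auto simp: rect_def)
    have "Complex (Re z) 1 \<in> top" unfolding top_def by (rule imageI) (use z r in \<open>auto simp: rect_def abs_less_iff\<close>)
    then have "2 * (norm (G (Complex (Re z) 1)) + 1) / Im z \<le> 2 * (L + 1) / Im z"
      using L(2) zi by (intro divide_right_mono) auto
    moreover have "norm (G z) \<le> 2 * (norm (G (Complex (Re z) 1)) + 1) / Im z + 1"
      by (rule herglotz_growth[OF hG _ zi]) (use pos in \<open>simp add: G_def\<close>)
    moreover have "1 \<le> 1 / Im z" using zi by simp
    moreover have "K1 / Im z = 2 * (L + 1) / Im z + 1 / Im z" by (simp add: K1_def add_divide_distrib)
    ultimately show ?thesis by linarith
  qed
  have Meq: "M z = (G z - A z) * e z" if z: "z \<in> rect t0 r" for z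
    using S(2)[OF inS(1)[OF z]] by (simp add: G_def e_def)
  have "norm (M z) \<le> ((K1 + a) * E) / Im z \<and> Im (M z) \<ge> - (K1 * E' + a * E)" if z: "z \<in> rect t0 r" for z
  proof
    have zi: "0 < Im z" "Im z \<le> 1" using z r by (auto simp: rect_def)
    have "norm (G z - A z) \<le> K1 / Im z + a" using norm_triangle_ineq4[of "G z" "A z"] Gle[OF z] a(2)[OF inS(1)[OF z]] by linarith
    also have "a \<le> a / Im z" using a zi by (simp add: pos_le_divide_eq mult_left_le)
    finally have "norm (G z - A z) \<le> (K1 + a) / Im z" by (simp add: add_divide_distrib)
    then have "norm (M z) \<le> (K1 + a) / Im z * E"
      unfolding Meq[OF z] norm_mult using E(2)[OF inS(1)[OF z]] K1 a zi by (intro mult_mono) auto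
    then show "norm (M z) \<le> ((K1 + a) * E) / Im z" by simp
    \<comment> \<open>Comparison with the real point below z, where e is real.\<close>
    have "norm (e z - e (of_real (Re z))) \<le> E' * norm (z - of_real (Re z))"
      by (rule field_differentiable_bound[where S = S and f' = "deriv e"])
        (use inS[OF z] E' subB in \<open>auto simp: S_def intro!: has_field_derivative_at_within[OF holomorphic_derivI[OF he oB]]\<close>)
    also have "norm (z - of_real (Re z)) = Im z"
    proof -
      have "z - of_real (Re z) = \<i> * of_real (Im z)" by (simp add: complex_eq_iff)
      then show ?thesis using zi by (simp add: norm_mult)
    qed
    finally have "\<bar>Im (e z - e (of_real (Re z)))\<bar> \<le> E' * Im z" using abs_Im_le_cmod order_trans by blast
    moreover have "e (of_real (Re z)) = of_real (1 / (Re (B (of_real (Re z))))\<^sup>2)"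
      unfolding e_def by (subst real_entire_fun_real[OF B, of "Re z"]) simp
    ultimately have Ime: "\<bar>Im (e z)\<bar> \<le> E' * Im z" by simp
    have "Im (G z * e z) \<ge> - (K1 * E')"
    proof -
      have "Im (G z) * Re (e z) \<ge> 0" using pos[OF zi(1)] S(1)[OF inS(1)[OF z]] by (simp add: G_def)
      moreover have "\<bar>Re (G z) * Im (e z)\<bar> \<le> (K1 / Im z) * (E' * Im z)"
        unfolding abs_mult using Ime Gle[OF z] abs_Re_le_cmod[of "G z"] K1 zi by (intro mult_mono) auto
      moreover have "(K1 / Im z) * (E' * Im z) = K1 * E'" using zi by simp
      ultimately show ?thesis by simp
    qed
    moreover have "\<bar>Im (A z * e z)\<bar> \<le> a * E"
      using abs_Im_le_cmod[of "A z * e z"] mult_mono[OF a(2)[OF inS(1)[OF z]] E(2)[OF inS(1)[OF z]] a(1) norm_ge_zero] by (simp add: norm_mult)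
    ultimately show "Im (M z) \<ge> - (K1 * E' + a * E)" unfolding Meq[OF z] left_diff_distrib by simp
  qed
  moreover have "K1 * E' + a * E \<ge> 0" using K1 E' a E by simp
  ultimately show ?thesis using r by (intro exI[of _ r] exI[of _ "(K1 + a) * E"] exI[of _ "K1 * E' + a * E"]) auto
qed

lemma integral_w:
  assumes "-R < s" "s < t" "t < R"
  shows "(LINT y|\<rho>. w R y * (indicator {s<..<t} y + indicator {s..t} y)) = measure \<rho> {s<..<t} + measure \<rho> {s..t}"
proof -
  have eq: "w R y * (indicator {s<..<t} y + indicator {s..t} y) = indicator {s<..<t} y + (indicator {s..t} y :: real)" for y
    using assms by (auto simp: indicator_def)
  have f1: "emeasure \<rho> {s..t} < \<infinity>" by (rule fin)
  have "emeasure \<rho> {s<..<t} \<le> emeasure \<rho> {s..t}" by (rule emeasure_mono) (auto simp: sets)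
  then have f2: "emeasure \<rho> {s<..<t} < \<infinity>" using f1 by (rule le_less_trans)
  have "integrable \<rho> (indicator {s<..<t} :: real \<Rightarrow> real)" "integrable \<rho> (indicator {s..t} :: real \<Rightarrow> real)"
    using f1 f2 by (auto intro!: integrable_real_indicator simp: sets)
  then show ?thesis unfolding eq by (simp add: sets_eq_imp_space_eq[OF sets])
qed

lemma rect_mono: "r \<le> r' \<Longrightarrow> rect t r \<subseteq> rect t r'"
  by (auto simp: rect_def)

text \<open>M and the transform of the truncated measure have equal inversion limits on intervals
  inside (-R, R), and both are bounded by a multiple of 1 / Im z. Only the uniform bound on the
  integrals of Im M takes work: a subinterval is compared with the whole interval after adding C,
  which makes the integrand nonnegative.\<close>

lemma cauchy_difference_extends:
  assumes t0: "\<bar>t0\<bar> < R"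
  shows "\<exists>g. \<exists>d>0. g holomorphic_on ball (of_real t0) d \<and>
    (\<forall>z\<in>ball (of_real t0) d. g (cnj z) = cnj (g z) \<and> (Im z > 0 \<longrightarrow> g z = M z - cauchy_tr \<rho> (w R) z))"
proof -
  obtain r1 K C where r1: "0 < r1" "r1 \<le> 1" "C \<ge> 0" and loc: "\<And>z. z \<in> rect t0 r1 \<Longrightarrow> norm (M z) \<le> K / Im z" "\<And>z. z \<in> rect t0 r1 \<Longrightarrow> Im (M z) \<ge> - C"
    using local_bounds[of t0] by blast
  define h where "h = min (r1 / 2) ((R - \<bar>t0\<bar>) / 2)"
  have h: "0 < h" "h < r1" "h \<le> 1" "h < R - \<bar>t0\<bar>" 
  proof -
    have "h \<le> r1 / 2" "h \<le> (R - \<bar>t0\<bar>) / 2" unfolding h_def by (rule min.cobounded1, rule min.cobounded2)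
    moreover have "(R - \<bar>t0\<bar>) / 2 < R - \<bar>t0\<bar>" using t0 by simp
    ultimately show "h < r1" "h \<le> 1" "h < R - \<bar>t0\<bar>" using r1 by auto
    show "0 < h" using r1 t0 by (simp add: h_def)
  qed
  define a b where "a = t0 - h" and "b = t0 + h"
  have ab: "a < b" "-R < a" "b < R" using h by (auto simp: a_def b_def)
  have "\<forall>\<^sub>F \<epsilon> in at_right 0. 1 / pi * integral {a..b} (\<lambda>x. Im (M (Complex x \<epsilon>))) < 1 / 2 * (measure \<rho> {a<..<b} + measure \<rho> {a..b}) + 1"
    by (rule order_tendstoD(2)[OF inversion[OF ab(1)]]) simp
  then obtain e0 where e0: "e0 > 0" "\<And>\<epsilon>. 0 < \<epsilon> \<Longrightarrow> \<epsilon> < e0 \<Longrightarrow> 1 / pi * integral {a..b} (\<lambda>x. Im (M (Complex x \<epsilon>))) < 1 / 2 * (measure \<rho> {a<..<b} + measure \<rho> {a..b}) + 1"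
    unfolding eventually_at_right_field by auto
  define B0 where "B0 = pi * (1 / 2 * (measure \<rho> {a<..<b} + measure \<rho> {a..b}) + 1)"
  \<comment> \<open>Below \<open>e0\<close> the integral over the whole interval is bounded; below h
    / 2 the heights are admissible for the extension lemma.\<close>
  define k where "k = min e0 (h / 2)"
  have k: "k > 0" "k \<le> e0" "k \<le> h / 2" using e0 h by (auto simp: k_def)
  define e where "e = (\<lambda>n. k / (real n + 2))"
  have e: "0 < e n" "e n < k" for n
  proof -
    show "0 < e n" using k by (simp add: e_def)
    have "k * 1 < k * (real n + 2)" using k by (intro mult_strict_left_mono) auto
    then show "e n < k" by (simp add: e_def divide_less_eq)
  qed
  have e_ne: "e n \<noteq> 0" for n using e(1)[of n] by simp
  have elim: "e \<longlonglongrightarrow> 0" unfolding e_def by real_asymp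
  have e_right: "filterlim e (at_right 0) sequentially"
    using elim e(1) e_ne by (auto simp: filterlim_at intro!: always_eventually)
  define f where "f = (\<lambda>z. M z - cauchy_tr \<rho> (w R) z)"
  note ct_hol = cauchy_tr_holomorphic[OF sets w_integrable, of R]
  have cont: "continuous_on S (\<lambda>x. Im (F (Complex x (e n))))" if "F holomorphic_on - \<real>" for F n S
  proof -
    have eq: "Complex x (e n) = of_real x + \<i> * of_real (e n)" for x by (simp add: complex_eq_iff)
    show ?thesis unfolding eq
      by (intro continuous_intros continuous_on_compose2[OF holomorphic_on_imp_continuous_on[OF that]])
        (use e[of n] in \<open>auto simp: complex_is_Real_iff\<close>)
  qed
  have Mi: "(\<lambda>x. Im (M (Complex x (e n)))) integrable_on {s..t}" for n s t
    by (intro integrable_continuous_real cont holM)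
  have Ci: "(\<lambda>x. Im (cauchy_tr \<rho> (w R) (Complex x (e n)))) integrable_on {s..t}" for n s t
    by (intro integrable_continuous_real cont ct_hol)
  have split: "integral {s..t} (\<lambda>x. Im (f (Complex x (e n)))) =
      integral {s..t} (\<lambda>x. Im (M (Complex x (e n)))) - integral {s..t} (\<lambda>x. Im (cauchy_tr \<rho> (w R) (Complex x (e n))))" for s t n
    unfolding f_def minus_complex.simps by (rule Henstock_Kurzweil_Integration.integral_diff[OF Mi Ci])
  have in_rect: "Complex x (e n) \<in> rect t0 r1" if "x \<in> {a..b}" for x n
    using that e[of n] k h by (auto simp: rect_def a_def b_def abs_less_iff)
  define B where "B = B0 + 2 * C * (b - a) + pi * (LINT y|\<rho>. w R y)"
  define K2 where "K2 = K + (LINT t|\<rho>. \<bar>w R t\<bar>)"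
  have "\<exists>g. \<exists>d>0. g holomorphic_on ball (of_real t0) d \<and> (\<forall>z\<in>ball (of_real t0) d. g (cnj z) = cnj (g z) \<and> (Im z > 0 \<longrightarrow> g z = f z))"
  proof (rule extension_across_real_axis[of h f t0 K2 e B])
    show "f holomorphic_on rect t0 h" unfolding f_def
      by (intro holomorphic_intros holomorphic_on_subset[OF holM] holomorphic_on_subset[OF ct_hol]) (auto simp: rect_def complex_is_Real_iff)
    show "norm (f z) \<le> K2 / Im z" if z: "z \<in> rect t0 h" for z
    proof -
      have zi: "Im z > 0" using z by (simp add: rect_def)
      have "norm (f z) \<le> norm (M z) + norm (cauchy_tr \<rho> (w R) z)" unfolding f_def by (rule norm_triangle_ineq4)
      also have "\<dots> \<le> K / Im z + (LINT t|\<rho>. \<bar>w R t\<bar>) / Im z"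
        using loc(1)[of z] z rect_mono[of h r1 t0] h norm_cauchy_tr_le_Im[OF sets w_integrable, of z R] zi by (intro add_mono) auto
      finally show ?thesis by (simp add: K2_def add_divide_distrib)
    qed
    show "e n < h / 2" for n using e[of n] k by simp
    fix s t assume st: "t0 - h < s" "t < t0 + h"
    { assume "s < t"
      then show "(\<lambda>n. integral {s..t} (\<lambda>x. Im (f (Complex x (e n))))) \<longlonglongrightarrow> 0"
      proof -
        have stR: "-R < s" "s < t" "t < R" using st ab \<open>s < t\<close> by (auto simp: a_def b_def)
        have "(\<lambda>n. pi * (1 / pi * integral {s..t} (\<lambda>x. Im (M (Complex x (e n)))))) \<longlonglongrightarrow> pi * (1 / 2 * (measure \<rho> {s<..<t} + measure \<rho> {s..t}))"
          by (intro tendsto_mult tendsto_const filterlim_compose[OF inversion[OF \<open>s < t\<close>] e_right])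
        moreover have "(\<lambda>n. integral {s..t} (\<lambda>x. Im (cauchy_tr \<rho> (w R) (Complex x (e n))))) \<longlonglongrightarrow> pi / 2 * (measure \<rho> {s<..<t} + measure \<rho> {s..t})"
          using stieltjes_inversion(1)[OF sets w_integrable[of R] sigma_finite e(1) elim \<open>s < t\<close>] integral_w[OF stR] by simp
        ultimately have "(\<lambda>n. pi * (1 / pi * integral {s..t} (\<lambda>x. Im (M (Complex x (e n))))) - integral {s..t} (\<lambda>x. Im (cauchy_tr \<rho> (w R) (Complex x (e n)))))
           \<longlonglongrightarrow> pi * (1 / 2 * (measure \<rho> {s<..<t} + measure \<rho> {s..t})) - pi / 2 * (measure \<rho> {s<..<t} + measure \<rho> {s..t})"
          by (rule tendsto_diff)
        then show ?thesis unfolding split by simp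
      qed
    }
    assume "s \<le> t"
    fix n
    have sub: "{s..t} \<subseteq> {a..b}" using st by (auto simp: a_def b_def)
    have ba: "t - s \<le> b - a" using st by (auto simp: a_def b_def)
    have "integral {s..t} (\<lambda>x. - C) \<le> integral {s..t} (\<lambda>x. Im (M (Complex x (e n))))"
      using loc(2)[OF in_rect] sub by (intro integral_le Mi) auto
    then have lo: "- (C * (b - a)) \<le> integral {s..t} (\<lambda>x. Im (M (Complex x (e n))))"
      using \<open>s \<le> t\<close> mult_left_mono[OF ba r1(3)] by (simp add: mult.commute)
    have "0 \<le> Im (M (Complex x (e n))) + C" if "x \<in> {a..b}" for x using loc(2)[OF in_rect[OF that], of n] by simp
    then have "integral {s..t} (\<lambda>x. Im (M (Complex x (e n))) + C) \<le> integral {a..b} (\<lambda>x. Im (M (Complex x (e n))) + C)"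
      by (intro integral_subset_le[OF sub] integrable_add Mi integrable_const_ivl ballI)
    moreover have "integral {s..t} (\<lambda>x. Im (M (Complex x (e n))) + C) = integral {s..t} (\<lambda>x. Im (M (Complex x (e n)))) + C * (t - s)"
      using \<open>s \<le> t\<close> by (subst Henstock_Kurzweil_Integration.integral_add[OF Mi integrable_const_ivl]) (simp add: mult.commute)
    moreover have "integral {a..b} (\<lambda>x. Im (M (Complex x (e n))) + C) = integral {a..b} (\<lambda>x. Im (M (Complex x (e n)))) + C * (b - a)"
      using ab by (subst Henstock_Kurzweil_Integration.integral_add[OF Mi integrable_const_ivl]) (simp add: mult.commute)
    moreover have "integral {a..b} (\<lambda>x. Im (M (Complex x (e n)))) \<le> B0"
    proof -
      have "1 / pi * integral {a..b} (\<lambda>x. Im (M (Complex x (e n)))) \<le> 1 / 2 * (measure \<rho> {a<..<b} + measure \<rho> {a..b}) + 1"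
        using e0(2)[of "e n"] e[of n] k by simp
      then have "pi * (1 / pi * integral {a..b} (\<lambda>x. Im (M (Complex x (e n))))) \<le> B0"
        unfolding B0_def by (intro mult_left_mono) auto
      then show ?thesis by simp
    qed
    moreover have "C * (t - s) \<ge> 0" using r1 \<open>s \<le> t\<close> by simp
    ultimately have hi: "integral {s..t} (\<lambda>x. Im (M (Complex x (e n)))) \<le> B0 + C * (b - a)" by linarith
    have ct: "0 \<le> integral {s..t} (\<lambda>x. Im (cauchy_tr \<rho> (w R) (Complex x (e n))))"
       "integral {s..t} (\<lambda>x. Im (cauchy_tr \<rho> (w R) (Complex x (e n)))) \<le> pi * (LINT y|\<rho>. w R y)"
    proof -
      have w0: "0 \<le> (LINT y|\<rho>. w R y)" by (intro integral_nonneg_AE AE_I2) simp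
      show "0 \<le> integral {s..t} (\<lambda>x. Im (cauchy_tr \<rho> (w R) (Complex x (e n))))"
        using stieltjes_inversion(2)[OF sets w_integrable[of R] sigma_finite e(1) elim, of s t n] \<open>s \<le> t\<close>
        by (cases "s = t") auto
      show "integral {s..t} (\<lambda>x. Im (cauchy_tr \<rho> (w R) (Complex x (e n)))) \<le> pi * (LINT y|\<rho>. w R y)"
        using stieltjes_inversion(3)[OF sets w_integrable[of R] sigma_finite e(1) elim, of s t n] \<open>s \<le> t\<close> w0
        by (cases "s = t") auto
    qed
    have "B0 \<ge> 0" by (simp add: B0_def)
    moreover have "C * (b - a) \<ge> 0" using r1 ab by simp
    ultimately show "\<bar>integral {s..t} (\<lambda>x. Im (f (Complex x (e n))))\<bar> \<le> B"
      unfolding split B_def using lo hi ct by (simp only: abs_le_iff) linarith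
  qed (use h e elim in auto)
  then show ?thesis by (simp only: f_def)
qed

lemma cauchy_difference_extends':
  assumes t: "\<bar>t\<bar> < R"
  shows "\<exists>g. \<exists>d>0. g holomorphic_on ball (of_real t) d \<and>
    (\<forall>z\<in>ball (of_real t) d. z \<notin> \<real> \<longrightarrow> g z = M z - cauchy_tr \<rho> (w R) z)"
proof -
  define f where "f = (\<lambda>z. M z - cauchy_tr \<rho> (w R) z)"
  obtain g d where d: "d > 0" "g holomorphic_on ball (of_real t) d"
    and g: "\<And>z. z \<in> ball (of_real t) d \<Longrightarrow> g (cnj z) = cnj (g z)"
      "\<And>z. z \<in> ball (of_real t) d \<Longrightarrow> Im z > 0 \<Longrightarrow> g z = f z"
    using cauchy_difference_extends[OF t] unfolding f_def by blast
  have "g z = f z" if z: "z \<in> ball (of_real t) d" "z \<notin> \<real>" for z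
  proof (cases "Im z > 0")
    case False
    then have iz: "Im (cnj z) > 0" using z(2) by (auto simp: complex_is_Real_iff)
    have "dist (of_real t) (cnj z) = dist (of_real t) z"
      using complex_mod_cnj[of "of_real t - z"] by (simp add: dist_norm)
    then have cz: "cnj z \<in> ball (of_real t) d" using z(1) by simp
    have "f (cnj z) = cnj (f z)"
      using cnjM[of z] cauchy_tr_cnj[OF sets w_integrable, of R z] z(2) by (simp add: f_def)
    then show ?thesis using g(1)[OF z(1)] g(2)[OF cz iz] by (metis complex_cnj_cnj)
  qed (rule g(2)[OF z(1)])
  then show ?thesis using d unfolding f_def by blast
qed

lemma cauchy_difference_continuation:
  "\<exists>F. F holomorphic_on (- \<real> \<union> of_real ` {-R<..<R}) \<and> (\<forall>z\<in>-\<real>. F z = M z - cauchy_tr \<rho> (w R) z) \<and>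
     open (- \<real> \<union> complex_of_real ` {-R<..<R})"
proof (rule extension_glue)
  show "(\<lambda>z. M z - cauchy_tr \<rho> (w R) z) holomorphic_on - \<real>"
    by (intro holomorphic_intros holM cauchy_tr_holomorphic[OF sets w_integrable])
  show "\<exists>g. \<exists>d>0. g holomorphic_on ball (of_real t) d \<and>
    (\<forall>z\<in>ball (of_real t) d. z \<notin> \<real> \<longrightarrow> g z = M z - cauchy_tr \<rho> (w R) z)" if "t \<in> {-R<..<R}" for t
    using that by (intro cauchy_difference_extends') auto
qed simp

text \<open>
  The minimum principle for Im (A + B^2 M - D), where D is the Cauchy transform of B^2 restricted to [-R,R],
  in a large half disc.
\<close>

lemma weighted_mass_le:
  assumes A: "real_entire_fun A" and B: "real_entire_fun B"
    and pos: "\<And>z. Im z > 0 \<Longrightarrow> Im (A z + (B z)\<^sup>2 * M z) \<ge> 0" and R: "R > 0"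
  defines "BR \<equiv> \<lambda>t. Re (B (of_real t))"
  shows "integrable \<rho> (\<lambda>t. (BR t)\<^sup>2 * w R t)"
    "(LINT t|\<rho>. ((BR t)\<^sup>2 * w R t) * (1 / (t\<^sup>2 + 1))) \<le> Im (A \<i> + (B \<i>)\<^sup>2 * M \<i>)"
proof -
  note hA = A[unfolded real_entire_fun_def, THEN conjunct1] and hB = B[unfolded real_entire_fun_def, THEN conjunct1]
  define h where "h = (\<lambda>z. (B z)\<^sup>2)"
  have hh: "h holomorphic_on UNIV" unfolding h_def by (intro holomorphic_intros hB)
  have hr: "h (of_real t) = of_real ((BR t)\<^sup>2)" for t
    unfolding h_def BR_def using real_entire_fun_real[OF B, of t] by (metis of_real_power)
  define W where "W = (\<lambda>R t. (BR t)\<^sup>2 * w R t)"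
  have w0: "w R t = 0" if "\<bar>t\<bar> > R" for R t using that by (auto simp: indicator_def)
  have Wi: "integrable \<rho> (W R)" for R
    using cauchy_tr_mult_entire(2)[OF sets w_integrable hh w0 hr] unfolding W_def .
  show "integrable \<rho> (\<lambda>t. (BR t)\<^sup>2 * w R t)" using Wi by (simp add: W_def)
  define D where "D = (\<lambda>R. cauchy_tr \<rho> (W R))"
  define G where "G = (\<lambda>z. A z + h z * M z)"
  have Gpos: "Im (G z) \<ge> 0" if "Im z > 0" for z using pos[OF that] by (simp add: G_def h_def)
  have Dhol: "D R holomorphic_on - \<real>" for R unfolding D_def by (rule cauchy_tr_holomorphic[OF sets Wi])
  have Ghol: "G holomorphic_on - \<real>" unfolding G_def
    by (intro holomorphic_intros holomorphic_on_subset[OF hA] holomorphic_on_subset[OF hh] holM) auto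
  have main: "Im (G \<i> - D R \<i>) \<ge> - d" if d: "d > 0" for d
  proof -
    define L where "L = (LINT t|\<rho>. \<bar>W R t\<bar>)"
    have L: "L \<ge> 0" unfolding L_def by (intro integral_nonneg_AE AE_I2) simp
    \<comment> \<open>On the circle of radius P the transform is at most L / (P - R), hence at most
      d; the summand 1 gives P > R and puts i inside.\<close>
    define P where "P = R + L / d + 1"
    have P: "P > R" "P > 1" "L \<le> d * (P - R)" 
    proof -
      have "L / d \<ge> 0" using L d by simp
      then show "P > R" "P > 1" using R by (auto simp: P_def)
      have "d * (P - R) = L + d" using d by (simp add: P_def distrib_left)
      then show "L \<le> d * (P - R)" using d by simp
    qed
    \<comment> \<open>The measure is truncated farther out than the half disc reaches, so that the
      continuation covers its whole diameter.\<close>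
    define R' where "R' = P + 1"
    obtain F where F: "F holomorphic_on (- \<real> \<union> of_real ` {-R'<..<R'})" "\<And>z. z \<in> - \<real> \<Longrightarrow> F z = M z - cauchy_tr \<rho> (w R') z"
      "open (- \<real> \<union> complex_of_real ` {-R'<..<R'})"
      using cauchy_difference_continuation[of R'] by blast
    obtain E where E: "E holomorphic_on UNIV" "\<And>z. z \<in> - \<real> \<Longrightarrow> h z * cauchy_tr \<rho> (w R') z - D R' z = E z"
      using cauchy_tr_mult_entire(1)[OF sets w_integrable hh w0 hr, of R'] unfolding D_def W_def by blast
    \<comment> \<open>Off the real axis this is \<open>G - D R'\<close>; it continues across (-R',
      R') and is real there, so that its imaginary part is small just above the diameter.\<close>
    define A1 where "A1 = (\<lambda>z. A z + h z * F z + E z)"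
    define O1 where "O1 = - \<real> \<union> complex_of_real ` {-R'<..<R'}"
    have A1hol: "A1 holomorphic_on O1" unfolding A1_def O1_def
      by (intro holomorphic_intros F(1) holomorphic_on_subset[OF hA] holomorphic_on_subset[OF hh] holomorphic_on_subset[OF E(1)]) auto
    have A1eq: "A1 z = G z - D R' z" if "z \<in> - \<real>" for z
    proof -
      have e: "E z = h z * cauchy_tr \<rho> (w R') z - D R' z" using E(2)[OF that] by simp
      have m: "M z = F z + cauchy_tr \<rho> (w R') z" using F(2)[OF that] by simp
      show ?thesis unfolding A1_def G_def e m by (simp add: algebra_simps)
    qed
    have A1sym: "A1 (cnj z) = cnj (A1 z)" if "z \<in> - \<real>" for z
    proof -
      have cz: "cnj z \<in> - \<real>" using that by (simp add: complex_is_Real_iff)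
      have "D R' (cnj z) = cnj (D R' z)" unfolding D_def by (rule cauchy_tr_cnj[OF sets Wi])
      moreover have "G (cnj z) = cnj (G z)"
        using A B cnjM[OF that] by (simp add: G_def h_def real_entire_fun_def)
      ultimately show ?thesis using A1eq[OF that] A1eq[OF cz] by simp
    qed
    have A1cont: "continuous_on O1 A1" by (rule holomorphic_on_imp_continuous_on[OF A1hol])
    have oO1: "open O1" using F(3) by (simp add: O1_def)
    have A1real: "Im (A1 (of_real x)) = 0" if x: "\<bar>x\<bar> < R'" for x
    proof -
      have xO: "of_real x \<in> O1" using x by (auto simp: O1_def abs_less_iff)
      then have c: "isCont A1 (of_real x)" using A1cont oO1 continuous_on_eq_continuous_at by blast
      from real_by_symmetry[OF this A1sym] show ?thesis by (simp add: complex_is_Real_iff)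
    qed
    define Q where "Q = cbox (Complex (-P) 0) (Complex P 1)"
    have QO: "Q \<subseteq> O1"
    proof
      fix z assume z: "z \<in> Q"
      show "z \<in> O1"
      proof (cases "z \<in> \<real>")
        case True
        then have "z = of_real (Re z)" by (simp add: complex_eq_iff complex_is_Real_iff)
        moreover have "Re z \<in> {-R'<..<R'}" using z by (auto simp: Q_def in_cbox_complex_iff R'_def)
        ultimately show ?thesis unfolding O1_def by blast
      qed (simp add: O1_def)
    qed
    have "uniformly_continuous_on Q A1"
      by (intro compact_uniformly_continuous continuous_on_subset[OF A1cont QO]) (simp add: Q_def)
    then obtain \<eta>0 where \<eta>0: "\<eta>0 > 0" "\<And>x y. x \<in> Q \<Longrightarrow> y \<in> Q \<Longrightarrow> dist y x < \<eta>0 \<Longrightarrow> dist (A1 y) (A1 x) < d"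
      using uniformly_continuous_onE[OF _ d] by metis
    define \<eta> where "\<eta> = min (\<eta>0 / 2) (1 / 2)"
    have \<eta>: "0 < \<eta>" "\<eta> < \<eta>0" "\<eta> < 1" using \<eta>0 by (auto simp: \<eta>_def)
    have low: "Im (G z - D R z) \<ge> - d" if z: "\<bar>Re z\<bar> \<le> P" "Im z = \<eta>" for z
    proof -
      have zn: "z \<in> - \<real>" using z \<eta> by (simp add: complex_is_Real_iff)
      have zQ: "z \<in> Q" "of_real (Re z) \<in> Q" using z \<eta> P by (auto simp: Q_def in_cbox_complex_iff abs_le_iff)
      have "z - of_real (Re z) = \<i> * of_real \<eta>" using z by (simp add: complex_eq_iff)
      then have "dist z (of_real (Re z)) < \<eta>0" using \<eta> by (simp add: dist_norm norm_mult)
      then have "dist (A1 z) (A1 (of_real (Re z))) < d" using \<eta>0(2)[OF zQ(2,1)] by simp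
      then have "\<bar>Im (A1 z - A1 (of_real (Re z)))\<bar> < d" using abs_Im_le_cmod le_less_trans unfolding dist_norm by blast
      moreover have "Im (A1 (of_real (Re z))) = 0" using z by (intro A1real) (simp add: R'_def)
      ultimately have 1: "Im (G z - D R' z) > - d" using A1eq[OF zn] by simp
      have iR: "integrable \<rho> (\<lambda>t. W R' t - W R t)" using Wi by auto
      have "D R' z - D R z = cauchy_tr \<rho> (\<lambda>t. W R' t - W R t) z"
      proof -
        have "cauchy_tr \<rho> (\<lambda>t. W R' t - W R t) z = (LINT t|\<rho>. of_real (W R' t) / (of_real t - z) - of_real (W R t) / (of_real t - z))"
          by (simp add: cauchy_tr_def diff_divide_distrib)
        also have "\<dots> = D R' z - D R z" unfolding D_def cauchy_tr_def
          by (rule Bochner_Integration.integral_diff[OF cauchy_tr_integrable[OF sets Wi zn] cauchy_tr_integrable[OF sets Wi zn]])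
        finally show ?thesis by simp
      qed
      \<comment> \<open>Passing from R' back to R removes a nonnegative part of the measure, which
        can only increase the imaginary part of the difference.\<close>
      moreover have "Im (cauchy_tr \<rho> (\<lambda>t. W R' t - W R t) z) \<ge> 0"
      proof (rule Im_cauchy_tr_nonneg[OF sets iR])
        show "Im z > 0" using z \<eta> by simp
        show "0 \<le> W R' t - W R t" for t using P R by (auto simp: W_def indicator_def R'_def)
      qed
      ultimately have "Im (D R' z - D R z) \<ge> 0" by simp
      then show ?thesis using 1 by simp
    qed
    have far: "Im (G z - D R z) \<ge> - d" if z: "norm z = P" "Im z > 0" for z
    proof -
      have "norm (D R z) \<le> L / (P - R)"
        unfolding D_def L_def
      proof (rule norm_cauchy_tr_le[OF sets Wi])
        fix t assume "W R t \<noteq> 0"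
        then have "\<bar>t\<bar> \<le> R" by (auto simp: W_def indicator_def split: if_splits)
        then show "P - R \<le> norm (of_real t - z)" using norm_triangle_ineq2[of z "of_real t"] z by (simp add: norm_minus_commute)
      qed (use P in simp)
      also have "\<dots> \<le> d" using P by (simp add: divide_le_eq)
      finally have "\<bar>Im (D R z)\<bar> \<le> d" using abs_Im_le_cmod order_trans by blast
      then show ?thesis using Gpos[OF z(2)] by simp
    qed
    define S where "S = ball 0 P \<inter> {z. Im z > \<eta>}"
    have oS: "open S" unfolding S_def by (intro open_Int open_ball open_halfspace_Im_gt)
    have clS: "closure S \<subseteq> cball 0 P \<inter> {z. Im z \<ge> \<eta>}"
      by (rule closure_minimal) (auto simp: S_def intro!: closed_Int closed_halfspace_Im_ge)
    have clS': "closure S \<subseteq> - \<real>" using clS \<eta> by (auto simp: complex_is_Real_iff)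
    \<comment> \<open>The exponential turns the lower bound for an imaginary part into an upper
      bound for a modulus, to which the maximum principle applies.\<close>
    define f where "f = (\<lambda>z. exp (\<i> * (G z - D R z)))"
    have nf: "norm (f z) = exp (- Im (G z - D R z))" for z by (simp add: f_def)
    have fhol: "f holomorphic_on - \<real>" unfolding f_def by (intro holomorphic_intros Ghol Dhol)
    have "norm (f \<i>) \<le> exp d"
    proof (rule maximum_modulus_frontier[of f S])
      show "f holomorphic_on interior S" 
      proof (rule holomorphic_on_subset[OF fhol])
        show "interior S \<subseteq> - \<real>" using order_trans[OF interior_subset order_trans[OF closure_subset clS']] .
      qed
      show "continuous_on (closure S) f" by (rule continuous_on_subset[OF holomorphic_on_imp_continuous_on[OF fhol] clS'])
      show "bounded S" unfolding S_def by (rule bounded_Int) simp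
      show "\<i> \<in> S" using P \<eta> by (simp add: S_def)
      fix z assume "z \<in> frontier S"
      then have z: "z \<in> closure S" "z \<notin> S" using oS by (auto simp: frontier_def interior_open)
      have z1: "norm z \<le> P" "Im z \<ge> \<eta>" using clS z(1) by auto
      have "norm z = P \<or> Im z = \<eta>"
      proof (rule ccontr)
        assume "\<not> (norm z = P \<or> Im z = \<eta>)"
        then have "norm z < P" "Im z > \<eta>" using z1 by auto
        then show False using z(2) by (simp add: S_def)
      qed
      then have "Im (G z - D R z) \<ge> - d"
      proof
        assume "norm z = P"
        then show ?thesis using z1 \<eta> by (intro far) auto
      next
        assume "Im z = \<eta>"
        moreover have "\<bar>Re z\<bar> \<le> P" using abs_Re_le_cmod[of z] z1 by linarith
        ultimately show ?thesis by (intro low)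
      qed
      then show "norm (f z) \<le> exp d" unfolding nf by simp
    qed
    then show ?thesis unfolding nf by simp
  qed
  have "Im (G \<i> - D R \<i>) \<ge> 0"
  proof (rule field_le_epsilon)
    fix d :: real assume "d > 0"
    then show "0 \<le> Im (G \<i> - D R \<i>) + d" using main[of d] by simp
  qed
  moreover have "Im (D R \<i>) = (LINT t|\<rho>. ((BR t)\<^sup>2 * w R t) * (1 / (t\<^sup>2 + 1)))"
    unfolding D_def using Im_cauchy_tr(1)[OF sets Wi, of \<i> R] by (simp add: W_def)
  ultimately show "(LINT t|\<rho>. ((BR t)\<^sup>2 * w R t) * (1 / (t\<^sup>2 + 1))) \<le> Im (A \<i> + (B \<i>)\<^sup>2 * M \<i>)"
    by (simp add: G_def h_def)
qed

text \<open>The bound on the truncated masses does not depend on R: it is the imaginary part of A +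
  B^2 M at i. Monotone convergence removes the truncation.\<close>

lemma weighted_integrable:
  assumes A: "real_entire_fun A" and B: "real_entire_fun B"
    and pos: "\<And>z. Im z > 0 \<Longrightarrow> Im (A z + (B z)\<^sup>2 * M z) \<ge> 0"
  defines "BR \<equiv> \<lambda>t. Re (B (of_real t))"
  shows "integrable \<rho> (\<lambda>t. (BR t)\<^sup>2 / (1 + t\<^sup>2))"
proof -
  define f where "f = (\<lambda>n t. ((BR t)\<^sup>2 * w (real (Suc n)) t) * (1 / (t\<^sup>2 + 1)))"
  define K where "K = Im (A \<i> + (B \<i>)\<^sup>2 * M \<i>)"
  have h: "integrable \<rho> (\<lambda>t. (BR t)\<^sup>2 * w R t)" "(LINT t|\<rho>. ((BR t)\<^sup>2 * w R t) * (1 / (t\<^sup>2 + 1))) \<le> K" if "R > 0" for R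
    unfolding BR_def K_def using weighted_mass_le[OF A B pos that] by auto
  have hB: "B holomorphic_on UNIV" using B by (simp add: real_entire_fun_def)
  have "continuous_on UNIV BR" unfolding BR_def
    by (intro continuous_intros continuous_on_compose2[OF holomorphic_on_imp_continuous_on[OF hB]]) auto
  then have [measurable]: "BR \<in> borel_measurable \<rho>" by (rule continuous_measurable[OF sets w_integrable])
  have m2 [measurable]: "(\<lambda>t. 1 / (t\<^sup>2 + 1)) \<in> borel_measurable \<rho>"
    by (rule continuous_measurable[OF sets w_integrable]) (intro continuous_intros, simp add: add_nonneg_eq_0_iff)
  have fi: "integrable \<rho> (f n)" for n
  proof (rule Bochner_Integration.integrable_bound[of _ "\<lambda>t. (BR t)\<^sup>2 * w (real (Suc n)) t"])
    show "integrable \<rho> (\<lambda>t. (BR t)\<^sup>2 * w (real (Suc n)) t)" by (rule h(1)) simp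
    then have [measurable]: "(\<lambda>t. (BR t)\<^sup>2 * w (real (Suc n)) t) \<in> borel_measurable \<rho>" by auto
    show "f n \<in> borel_measurable \<rho>" unfolding f_def by measurable
    have "1 / (t\<^sup>2 + 1) \<le> (1::real)" for t :: real by (simp add: divide_le_eq add_nonneg_pos)
    then have "(BR t)\<^sup>2 * w (real (Suc n)) t * (1 / (t\<^sup>2 + 1)) \<le> (BR t)\<^sup>2 * w (real (Suc n)) t * 1" for t by (intro mult_left_mono) auto
    then show "AE t in \<rho>. norm (f n t) \<le> norm ((BR t)\<^sup>2 * w (real (Suc n)) t)"
      by (intro AE_I2) (simp add: f_def abs_mult)
  qed
  have fle: "(LINT t|\<rho>. f n t) \<le> K" for n unfolding f_def by (rule h(2)) simp
  have fmono: "f n t \<le> f (Suc n) t" for n t by (auto simp: f_def indicator_def)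
  have "incseq (\<lambda>n. LINT t|\<rho>. f n t)"
    by (intro incseq_SucI integral_mono fi fmono)
  then obtain L where L: "(\<lambda>n. LINT t|\<rho>. f n t) \<longlonglongrightarrow> L"
    using incseq_convergent[of "\<lambda>n. LINT t|\<rho>. f n t" K] fle by blast
  have "integrable \<rho> (\<lambda>t. (BR t)\<^sup>2 * (1 / (t\<^sup>2 + 1)))"
  proof (rule integrable_monotone_convergence[OF fi _ _ L])
    show "AE t in \<rho>. mono (\<lambda>n. f n t)" by (intro AE_I2 incseq_SucI fmono)
    show "AE t in \<rho>. (\<lambda>n. f n t) \<longlonglongrightarrow> (BR t)\<^sup>2 * (1 / (t\<^sup>2 + 1))"
    proof (rule AE_I2)
      fix t
      obtain N :: nat where N: "\<bar>t\<bar> \<le> real N" using real_arch_simple by blast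
      show "(\<lambda>n. f n t) \<longlonglongrightarrow> (BR t)\<^sup>2 * (1 / (t\<^sup>2 + 1))"
      proof (rule tendsto_eventually)
        show "\<forall>\<^sub>F n in sequentially. f n t = (BR t)\<^sup>2 * (1 / (t\<^sup>2 + 1))"
          using eventually_ge_at_top[of N] by eventually_elim (use N in \<open>auto simp: f_def indicator_def\<close>)
      qed
    qed
    show "(\<lambda>t. (BR t)\<^sup>2 * (1 / (t\<^sup>2 + 1))) \<in> borel_measurable \<rho>" by measurable
  qed
  then show ?thesis by (simp add: add.commute)
qed

end

section \<open>The modified Cauchy integral\<close>

lemma cauchy_tr_holomorphic_gap:
  assumes sets: "sets \<rho> = sets borel" and w: "integrable \<rho> w" and gap: "\<And>t. \<bar>t\<bar> \<le> R \<Longrightarrow> w t = 0"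
  shows "cauchy_tr \<rho> w holomorphic_on ball 0 R"
proof -
  have "(\<lambda>z. LINT t|\<rho>. of_real (w t) / (of_real t - z)) holomorphic_on ball 0 R"
  proof (rule holomorphic_on_integral[OF open_ball _ cauchy_tr_measurable[OF sets w]])
    fix t
    show "(\<lambda>z. of_real (w t) / (of_real t - z)) holomorphic_on ball 0 R"
    proof (cases "\<bar>t\<bar> \<le> R")
      case True then show ?thesis by (simp add: gap)
    next
      case False then show ?thesis by (intro holomorphic_intros) auto
    qed
  next
    fix z0 :: complex assume z0: "z0 \<in> ball 0 R"
    define r where "r = (R - norm z0) / 2"
    have r: "r > 0" using z0 by (simp add: r_def)
    have le: "norm (of_real (w t) / (of_real t - z)) \<le> \<bar>w t\<bar> / r" if z: "z \<in> cball z0 r" for z t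
    proof (cases "\<bar>t\<bar> \<le> R")
      case False
      have "norm z \<le> norm z0 + r" using z norm_triangle_sub[of z z0] by (simp add: dist_norm norm_minus_commute)
      then have "r \<le> norm (of_real t - z)" using norm_triangle_ineq2[of "of_real t" z] False by (simp add: r_def field_simps)
      then show ?thesis using r by (simp add: norm_divide frac_le)
    qed (simp add: gap)
    have "cball z0 r \<subseteq> ball 0 R"
    proof
      fix z assume z: "z \<in> cball z0 r"
      have "norm z \<le> norm z0 + r" using z norm_triangle_sub[of z z0] by (simp add: dist_norm norm_minus_commute)
      moreover have "norm z0 + r < R" using z0 by (simp add: r_def field_simps)
      ultimately show "z \<in> ball 0 R" by simp
    qed
    then show "\<exists>r>0. \<exists>g. integrable \<rho> g \<and> cball z0 r \<subseteq> ball 0 R \<and> (\<forall>z\<in>cball z0 r. \<forall>t\<in>space \<rho>. norm (of_real (w t) / (of_real t - z)) \<le> g t)"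
      using r le w by (intro exI[of _ r] conjI exI[of _ "\<lambda>t. \<bar>w t\<bar> / r"]) auto
  qed
  then show ?thesis unfolding cauchy_tr_def[abs_def] .
qed

locale weyl_growth = weyl_measure +
  fixes k :: nat
  assumes k: "k \<ge> 1" and mass: "integrable \<rho> (\<lambda>t. 1 / (1 + t\<^sup>2) ^ (k + 1))"
begin

text \<open>The density that makes the measure finite; the kernel of the claim is expressed through
  its Cauchy transform.\<close>

definition g1 :: "real \<Rightarrow> real" where "g1 t = 1 / (1 + t\<^sup>2) ^ (k + 1)"

definition kern :: "complex \<Rightarrow> real \<Rightarrow> complex" where
  "kern z t = (1 / (of_real t - z) - of_real (t / (1 + t\<^sup>2))) / of_real ((1 + t\<^sup>2) ^ k)"

definition N :: "complex \<Rightarrow> complex" where "N z = (LINT t|\<rho>. kern z t)"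

definition M1 :: "complex \<Rightarrow> complex" where "M1 z = (1 + z\<^sup>2) ^ k * N z"

lemma g1_integrable: "integrable \<rho> g1"
  using mass by (simp add: g1_def[abs_def])

lemma one_plus_sq_pos: "1 + t\<^sup>2 > (0::real)"
  by (simp add: add_pos_nonneg)

lemma g1_pos: "g1 t > 0"
  using one_plus_sq_pos[of t] by (simp add: g1_def)

text \<open>From 1 / (t - z) - t / (1 + t^2) = (1 + t z) / ((t - z) (1 + t^2)) and 1 + t z = (1 +
  z^2) + z (t - z). The linear remainder produces the constant \<open>c1\<close>, the total mass of
  the density \<open>g1\<close>.\<close>

lemma kern_eq:
  assumes z: "z \<in> - \<real>"
  shows "kern z t = (1 + z\<^sup>2) * (of_real (g1 t) / (of_real t - z)) + z * of_real (g1 t)"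
proof -
  have ne: "of_real t - z \<noteq> 0" using z by auto
  define a where "a = complex_of_real (1 + t\<^sup>2)"
  have "a \<noteq> 0" unfolding a_def of_real_eq_0_iff using one_plus_sq_pos[of t] by simp
  moreover have "a = 1 + of_real t * of_real t" by (simp add: a_def power2_eq_square)
  ultimately have a: "a \<noteq> 0" "a = 1 + of_real t * of_real t" by auto
  have "1 / (of_real t - z) - of_real (t / (1 + t\<^sup>2)) = 1 / (of_real t - z) - of_real t / a"
    by (simp add: a_def del: of_real_add)
  also have "\<dots> = ((1 + z\<^sup>2) / (of_real t - z) + z) / a"
  proof -
    have "(1 / d - T / a) = ((1 + z\<^sup>2) / d + z) / a" if "d \<noteq> 0" "T = d + z" "a = 1 + T * T" for d T
      using that a(1) by (simp add: field_simps power2_eq_square)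
    from this[OF ne] show ?thesis using a(2) by simp
  qed
  finally have "kern z t = ((1 + z\<^sup>2) / (of_real t - z) + z) / a / a ^ k"
    by (simp add: kern_def a_def del: of_real_add)
  also have "\<dots> = ((1 + z\<^sup>2) / (of_real t - z) + z) * (1 / a ^ (k + 1))" by simp
  also have "1 / a ^ (k + 1) = of_real (g1 t)" by (simp add: a_def g1_def del: of_real_add)
  finally show ?thesis by (simp add: algebra_simps)
qed

definition c1 :: real where "c1 = (LINT t|\<rho>. g1 t)"

lemma kern_integrable: "z \<in> - \<real> \<Longrightarrow> integrable \<rho> (kern z)"
  and N_eq: "z \<in> - \<real> \<Longrightarrow> N z = (1 + z\<^sup>2) * cauchy_tr \<rho> g1 z + z * of_real c1"
proof -
  assume z: "z \<in> - \<real>"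
  have i1: "integrable \<rho> (\<lambda>t. (1 + z\<^sup>2) * (of_real (g1 t) / (of_real t - z)))"
    by (intro integrable_mult_right cauchy_tr_integrable[OF sets g1_integrable z])
  have i2: "integrable \<rho> (\<lambda>t. z * of_real (g1 t))"
    by (intro integrable_mult_right integrable_of_real g1_integrable)
  have eq: "kern z = (\<lambda>t. (1 + z\<^sup>2) * (of_real (g1 t) / (of_real t - z)) + z * of_real (g1 t))"
    using kern_eq[OF z] by auto
  show "integrable \<rho> (kern z)" unfolding eq by (intro Bochner_Integration.integrable_add i1 i2)
  show "N z = (1 + z\<^sup>2) * cauchy_tr \<rho> g1 z + z * of_real c1"
    unfolding N_def eq Bochner_Integration.integral_add[OF i1 i2] integral_mult_right_zero
    by (simp add: cauchy_tr_def c1_def)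
qed

lemma M1_eq: "z \<in> - \<real> \<Longrightarrow> M1 z = (1 + z\<^sup>2) ^ (k + 1) * cauchy_tr \<rho> g1 z + of_real c1 * z * (1 + z\<^sup>2) ^ k"
  by (simp add: M1_def N_eq algebra_simps)

lemma M1_holomorphic: "M1 holomorphic_on - \<real>"
proof -
  have "(\<lambda>z. (1 + z\<^sup>2) ^ (k + 1) * cauchy_tr \<rho> g1 z + of_real c1 * z * (1 + z\<^sup>2) ^ k) holomorphic_on - \<real>"
    by (intro holomorphic_intros cauchy_tr_holomorphic[OF sets g1_integrable])
  then show ?thesis by (rule holomorphic_transform) (simp add: M1_eq)
qed

lemma M1_cnj: "z \<in> - \<real> \<Longrightarrow> M1 (cnj z) = cnj (M1 z)"
  using cauchy_tr_cnj[OF sets g1_integrable, of z] by (simp add: M1_eq complex_is_Real_iff)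

text \<open>The density \<open>g1\<close> is cut at R. The inner part, multiplied by (1 +
  z^2)^(k+1), agrees with the transform of the truncated measure up to an entire function, and the
  outer part is holomorphic in the disc of radius R. What remains is the difference of M and the
  truncated transform, which is known to extend.\<close>

lemma M1_minus_M_extends:
  "\<exists>g. \<exists>d>0. g holomorphic_on ball (of_real t) d \<and> (\<forall>z\<in>ball (of_real t) d. z \<notin> \<real> \<longrightarrow> g z = M1 z - M z)"
proof -
  define R where "R = \<bar>t\<bar> + 1"
  obtain gM d where d: "d > 0" "gM holomorphic_on ball (of_real t) d"
    and gM: "\<And>z. z \<in> ball (of_real t) d \<Longrightarrow> z \<notin> \<real> \<Longrightarrow> gM z = M z - cauchy_tr \<rho> (w R) z"
    using cauchy_difference_extends'[of t R] by (auto simp: R_def)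
  define h where "h = (\<lambda>z::complex. (1 + z\<^sup>2) ^ (k + 1))"
  define wa where "wa = (\<lambda>t. g1 t * w R t)"
  define wb where "wb = (\<lambda>t. g1 t - g1 t * w R t)"
  have hh: "h holomorphic_on UNIV" unfolding h_def by (intro holomorphic_intros)
  have hr: "h (of_real t) = of_real ((1 + t\<^sup>2) ^ (k + 1))" for t by (simp add: h_def)
  have wai: "integrable \<rho> wa" unfolding wa_def by (rule integrable_real_mult_indicator[OF _ g1_integrable]) (simp add: sets)
  have wbi: "integrable \<rho> wb" unfolding wb_def using wai g1_integrable by (intro Bochner_Integration.integrable_diff) (auto simp: wa_def)
  have hwa: "(\<lambda>t. (1 + t\<^sup>2) ^ (k + 1) * wa t) = w R"
  proof
    fix t show "(1 + t\<^sup>2) ^ (k + 1) * wa t = w R t" using one_plus_sq_pos[of t] by (simp add: wa_def g1_def)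
  qed
  have wa0: "wa t = 0" if "\<bar>t\<bar> > R" for t using that by (auto simp: wa_def indicator_def)
  have "\<exists>E. E holomorphic_on UNIV \<and> (\<forall>z\<in>-\<real>. h z * cauchy_tr \<rho> wa z - cauchy_tr \<rho> (w R) z = E z)"
    using cauchy_tr_mult_entire(1)[OF sets wai hh wa0 hr] unfolding hwa .
  then obtain E where E: "E holomorphic_on UNIV" "\<And>z. z \<in> - \<real> \<Longrightarrow> h z * cauchy_tr \<rho> wa z - cauchy_tr \<rho> (w R) z = E z" by blast
  have wbh: "cauchy_tr \<rho> wb holomorphic_on ball 0 R"
    by (rule cauchy_tr_holomorphic_gap[OF sets wbi]) (auto simp: wb_def indicator_def)
  define e where "e = min d 1"
  define g where "g = (\<lambda>z. E z + h z * cauchy_tr \<rho> wb z + of_real c1 * z * (1 + z\<^sup>2) ^ k - gM z)"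
  have sub: "ball (complex_of_real t) e \<subseteq> ball 0 R" "ball (complex_of_real t) e \<subseteq> ball (of_real t) d"
  proof -
    show "ball (complex_of_real t) e \<subseteq> ball 0 R"
    proof
      fix z assume "z \<in> ball (complex_of_real t) e"
      then have "norm (z - of_real t) < 1" by (simp add: e_def dist_norm norm_minus_commute)
      then show "z \<in> ball 0 R" using norm_triangle_sub[of z "of_real t"] by (simp add: R_def)
    qed
  qed (auto simp: e_def)
  have "g holomorphic_on ball (of_real t) e" unfolding g_def
    by (intro holomorphic_intros holomorphic_on_subset[OF E(1)] holomorphic_on_subset[OF hh] holomorphic_on_subset[OF wbh] holomorphic_on_subset[OF d(2)] sub) auto
  moreover have "g z = M1 z - M z" if z: "z \<in> ball (of_real t) e" "z \<notin> \<real>" for z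
  proof -
    have zn: "z \<in> - \<real>" using z by simp
    have "cauchy_tr \<rho> wb z = (LINT t|\<rho>. of_real (g1 t) / (of_real t - z) - of_real (wa t) / (of_real t - z))"
      by (simp add: cauchy_tr_def wb_def wa_def diff_divide_distrib)
    also have "\<dots> = cauchy_tr \<rho> g1 z - cauchy_tr \<rho> wa z" unfolding cauchy_tr_def
      by (rule Bochner_Integration.integral_diff[OF cauchy_tr_integrable[OF sets g1_integrable zn] cauchy_tr_integrable[OF sets wai zn]])
    finally have b: "cauchy_tr \<rho> wb z = cauchy_tr \<rho> g1 z - cauchy_tr \<rho> wa z" .
    have m: "M z = gM z + cauchy_tr \<rho> (w R) z" using gM[of z] z sub by auto
    show ?thesis unfolding g_def M1_eq[OF zn] m E(2)[OF zn, symmetric] b h_def by (simp add: algebra_simps)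
  qed
  moreover have "e > 0" using d by (simp add: e_def)
  ultimately show ?thesis by blast
qed

lemma M1_minus_M_entire:
  "\<exists>F. real_entire_fun F \<and> (\<forall>z\<in>-\<real>. F z = M1 z - M z)"
proof -
  have hol: "(\<lambda>z. M1 z - M z) holomorphic_on - \<real>" by (intro holomorphic_intros M1_holomorphic holM)
  obtain F where F: "F holomorphic_on (- \<real> \<union> of_real ` UNIV)" "\<And>z. z \<in> - \<real> \<Longrightarrow> F z = M1 z - M z"
    using extension_glue[OF hol open_UNIV M1_minus_M_extends] by blast
  have "- \<real> \<union> range complex_of_real = UNIV" by (auto elim: Reals_cases)
  then have FU: "F holomorphic_on UNIV" using F(1) by simp
  have sym: "F (cnj z) = cnj (F z)" if "z \<in> - \<real>" for z
    using F(2)[OF that] F(2)[of "cnj z"] M1_cnj[OF that] cnjM[OF that] that by (simp add: complex_is_Real_iff)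
  have "F (cnj z) = cnj (F z)" for z
  proof (cases "z \<in> \<real>")
    case True
    then obtain x where x: "z = of_real x" by (auto elim: Reals_cases)
    have "isCont F (of_real x)" using holomorphic_on_imp_continuous_on[OF FU] by (simp add: continuous_on_eq_continuous_at)
    from real_by_symmetry[OF this sym] show ?thesis by (simp add: x Reals_cnj_iff)
  qed (simp add: sym)
  then show ?thesis using FU F(2) by (auto simp: real_entire_fun_def)
qed

end

section \<open>Lower bound for the solution on the real axis\<close>

text \<open>The left side equals cosh (2 Im w).\<close>

lemma norm_sin_cos_sq: "(norm (sin w))\<^sup>2 + (norm (cos w))\<^sup>2 \<ge> (exp \<bar>Im w\<bar>)\<^sup>2 / 2" for w :: complex
proof -
  have "(norm (sin w))\<^sup>2 + (norm (cos w))\<^sup>2 = (exp (2 * Im w) + inverse (exp (2 * Im w))) / 2"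
  proof -
    have "(X\<^sup>2 + inverse (X\<^sup>2) - 2 * (2 * c\<^sup>2 - 1)) / 4 + (c\<^sup>2 + (X - inverse X)\<^sup>2 / 4) = (X\<^sup>2 + inverse (X\<^sup>2)) / 2"
      if "X \<noteq> 0" for X c :: real
      using that by (simp add: power2_eq_square field_simps)
    from this[of "exp (Im w)" "cos (Re w)"] show ?thesis
      unfolding norm_sin_squared norm_cos_squared cos_double_cos exp_double by simp
  qed
  moreover have "(exp \<bar>Im w\<bar>)\<^sup>2 = exp (2 * \<bar>Im w\<bar>)" by (simp add: exp_double)
  moreover have "exp (2 * \<bar>Im w\<bar>) \<le> exp (2 * Im w) + inverse (exp (2 * Im w))"
    by (cases "Im w \<ge> 0") (auto simp: exp_minus)
  ultimately show ?thesis by simp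
qed

lemma norm_powr_of_real: "z \<noteq> 0 \<Longrightarrow> norm (z powr of_real a) = norm z powr a" for z :: complex
  by (simp add: powr_def)

text \<open>Both signs of t are covered: for negative t the root is imaginary and the exponential
  scale of the error terms grows, but so does the larger of sine and cosine. The factor z^(-l/2) of
  the derivative is at least as large as that of phi once the modulus of t is at least 1.\<close>

lemma phi_asymptotics_lower_bound:
  assumes as: "phi_asymptotics l b \<phi>" and x: "x \<in> einterval 0 b" and l: "l > -1"
  shows "\<exists>T\<ge>1. \<forall>t::real. \<bar>t\<bar> \<ge> T \<longrightarrow> (norm (\<phi> (of_real t) x))\<^sup>2 + (norm (dx (\<phi> (of_real t)) x))\<^sup>2 \<ge> \<bar>t\<bar> powr (- (l + 1)) / 16"
proof -
  define W where "W = (\<lambda>z. csqrt z * of_real x - of_real (l * pi / 2))"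
  define E where "E = (\<lambda>z. exp (x * \<bar>Im (csqrt z)\<bar>))"
  define p where "p = (\<lambda>z::complex. z powr of_real (- (l + 1) / 2))"
  define p' where "p' = (\<lambda>z::complex. z powr of_real (- l / 2))"
  have x0: "x > 0" using x by (simp add: einterval_def)
  have "(\<lambda>z. \<phi> z x - p z * sin (W z)) \<in> o[at_infinity](\<lambda>z. p z * of_real (E z))"
    and "(\<lambda>z. dx (\<phi> z) x - p' z * cos (W z)) \<in> o[at_infinity](\<lambda>z. p' z * of_real (E z))"
    using as x unfolding phi_asymptotics_def p_def p'_def W_def E_def by blast+
  then have "\<forall>\<^sub>F z in at_infinity. norm (\<phi> z x - p z * sin (W z)) \<le> 1 / 4 * norm (p z * of_real (E z))"
    and "\<forall>\<^sub>F z in at_infinity. norm (dx (\<phi> z) x - p' z * cos (W z)) \<le> 1 / 4 * norm (p' z * of_real (E z))"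
    \<comment> \<open>The error 1/4 is half of the main term, since sine or cosine has modulus at
      least E / 2; this leaves a quarter, and 1/16 after squaring.\<close>
    using landau_o.smallD[of _ at_infinity _ "1/4"] by auto
  then have "\<forall>\<^sub>F z in at_infinity. norm (\<phi> z x - p z * sin (W z)) \<le> 1 / 4 * norm (p z * of_real (E z)) \<and>
     norm (dx (\<phi> z) x - p' z * cos (W z)) \<le> 1 / 4 * norm (p' z * of_real (E z))" by eventually_elim auto
  then obtain T0 where T0: "\<And>z. norm z \<ge> T0 \<Longrightarrow> norm (\<phi> z x - p z * sin (W z)) \<le> 1 / 4 * norm (p z * of_real (E z))"
    "\<And>z. norm z \<ge> T0 \<Longrightarrow> norm (dx (\<phi> z) x - p' z * cos (W z)) \<le> 1 / 4 * norm (p' z * of_real (E z))"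
    unfolding eventually_at_infinity by blast
  have main: "(norm (\<phi> (of_real t) x))\<^sup>2 + (norm (dx (\<phi> (of_real t)) x))\<^sup>2 \<ge> \<bar>t\<bar> powr (- (l + 1)) / 16"
    if t: "\<bar>t\<bar> \<ge> max T0 1" for t
  proof -
    define z where "z = complex_of_real t"
    have z: "norm z \<ge> T0" "norm z \<ge> 1" "z \<noteq> 0" "norm z = \<bar>t\<bar>" using t by (auto simp: z_def)
    have E1: "E z \<ge> 1" using x0 by (simp add: E_def)
    have imW: "\<bar>Im (W z)\<bar> = x * \<bar>Im (csqrt z)\<bar>" using x0 by (simp add: W_def abs_mult)
    have np: "(norm (p z))\<^sup>2 = \<bar>t\<bar> powr (- (l + 1))" "norm (p z) > 0"
      unfolding p_def norm_powr_of_real[OF z(3)] z(4) using z(2,4) by (simp_all add: power2_eq_square flip: powr_add)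
    have np': "(norm (p' z))\<^sup>2 \<ge> \<bar>t\<bar> powr (- (l + 1))" "norm (p' z) > 0"
    proof -
      have "\<bar>t\<bar> powr (- (l + 1)) \<le> \<bar>t\<bar> powr (- l)" using z(2,4) by (intro powr_mono) auto
      then show "(norm (p' z))\<^sup>2 \<ge> \<bar>t\<bar> powr (- (l + 1))" "norm (p' z) > 0"
        unfolding p'_def norm_powr_of_real[OF z(3)] z(4) using z(2,4) by (simp_all add: power2_eq_square flip: powr_add)
    qed
    have step: "(norm u)\<^sup>2 \<ge> (norm P)\<^sup>2 / 16" if "norm (u - P * s) \<le> 1 / 4 * norm (P * of_real (E z))" "norm s \<ge> E z / 2" for u P s :: complex
    proof -
      have "norm (P * s) \<le> norm u + 1 / 4 * norm (P * of_real (E z))" using norm_le_of_diff(2)[OF that(1)] .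
      moreover have "norm (P * s) \<ge> norm P * (E z / 2)" unfolding norm_mult using that(2) by (intro mult_left_mono) auto
      moreover have "norm (P * of_real (E z)) = norm P * E z" using E1 by (simp add: norm_mult)
      ultimately have "norm u \<ge> norm P * E z / 4" by simp
      moreover have "norm P * 1 \<le> norm P * E z" using E1 by (intro mult_left_mono) auto
      ultimately have "norm u \<ge> norm P / 4" by simp
      then have "(norm u)\<^sup>2 \<ge> (norm P / 4)\<^sup>2" by (intro power_mono) auto
      then show ?thesis by (simp add: power_divide)
    qed
    have sc: "norm (sin (W z)) \<ge> E z / 2 \<or> norm (cos (W z)) \<ge> E z / 2"
    proof (rule ccontr)
      assume "\<not> ?thesis"
      then have "(norm (sin (W z)))\<^sup>2 < (E z / 2)\<^sup>2" "(norm (cos (W z)))\<^sup>2 < (E z / 2)\<^sup>2"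
        by (auto intro!: power_strict_mono)
      moreover have "(norm (sin (W z)))\<^sup>2 + (norm (cos (W z)))\<^sup>2 \<ge> (E z)\<^sup>2 / 2"
        using norm_sin_cos_sq[of "W z"] by (simp add: imW E_def)
      ultimately show False by (simp add: power_divide)
    qed
    show ?thesis
    proof (cases "norm (sin (W z)) \<ge> E z / 2")
      case True
      from step[OF T0(1)[OF z(1)] this] show ?thesis using np by (simp add: z_def[symmetric] add_increasing2)
    next
      case False
      with sc have "norm (cos (W z)) \<ge> E z / 2" by blast
      from step[OF T0(2)[OF z(1)] this] have "(norm (dx (\<phi> z) x))\<^sup>2 \<ge> \<bar>t\<bar> powr (- (l + 1)) / 16" using np'(1) by linarith
      then show ?thesis by (simp add: z_def[symmetric] add_increasing)
    qed
  qed
  then show ?thesis by (intro exI[of _ "max T0 1"]) auto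
qed

section \<open>Negative eigenvalues of Hermitian matrices\<close>

lemma order_prod_linear_factors:
  "Polynomial.order (e :: complex) (\<Prod>a\<leftarrow>xs. [:- a, 1:]) = length (filter (\<lambda>a. a = e) xs)"
proof (induction xs)
  case (Cons a xs)
  have "(\<Prod>a\<leftarrow>xs. [:- a, 1:]) \<noteq> 0" unfolding prod_list_zero_iff by auto
  then have "[:- a, 1:] * (\<Prod>a\<leftarrow>xs. [:- a, 1:]) \<noteq> 0" by (simp del: mult_pCons_left)
  then have "Polynomial.order e (\<Prod>a\<leftarrow>a # xs. [:- a, 1:]) = Polynomial.order e ([:- a, 1:] ^ 1) + Polynomial.order e (\<Prod>a\<leftarrow>xs. [:- a, 1:])"
    by (simp add: order_mult del: mult_pCons_left)
  also have "Polynomial.order e ([:- a, 1:] ^ 1) = (if a = e then 1 else 0)"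
    using order_linear_power[of e "- a" 1] by auto
  finally show ?case using Cons by simp
qed (simp add: order_0I)

text \<open>The equations are padded with zero rows to a square system, whose determinant vanishes
  because of such a row.\<close>

lemma homogeneous_system_solution:
  fixes F :: "nat \<Rightarrow> nat \<Rightarrow> complex"
  assumes "k < m"
  shows "\<exists>a. (\<exists>j<m. a j \<noteq> 0) \<and> (\<forall>r<k. (\<Sum>j<m. F r j * a j) = 0)"
proof -
  define A where "A = Matrix.mat m m (\<lambda>(r, j). if r < k then F r j else 0)"
  have A: "A \<in> carrier_mat m m" by (simp add: A_def)
  have "det A = 0" unfolding det_def'[OF A]
  proof (rule sum.neutral, rule ballI)
    fix p assume "p \<in> {p. p permutes {0..<m}}"
    then have "p k < m" using assms permutes_in_image[of p "{0..<m}" k] by auto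
    then have "A $$ (k, p k) = 0" using assms by (simp add: A_def)
    then have "(\<Prod>i = 0..<m. A $$ (i, p i)) = 0" using assms by (intro prod_zero) auto
    then show "signof p * (\<Prod>i = 0..<m. A $$ (i, p i)) = 0" by simp
  qed
  then obtain v where v: "v \<in> carrier_vec m" "v \<noteq> 0\<^sub>v m" "A *\<^sub>v v = 0\<^sub>v m"
    using det_0_iff_vec_prod_zero[OF A] by blast
  define a where "a = (\<lambda>j. Matrix.vec_index v j)"
  have "\<exists>j<m. a j \<noteq> 0"
  proof (rule ccontr)
    assume "\<not> ?thesis"
    then have "v = 0\<^sub>v m" using v(1) by (intro eq_vecI) (auto simp: a_def)
    then show False using v(2) by simp
  qed
  moreover have "(\<Sum>j<m. F r j * a j) = 0" if r: "r < k" for r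
  proof -
    have rm: "r < m" using r assms by simp
    have "Matrix.vec_index (A *\<^sub>v v) r = (\<Sum>j<m. F r j * a j)"
      using rm r v(1) A by (auto simp: mult_mat_vec_def scalar_prod_def A_def a_def atLeast0LessThan intro!: sum.cong)
    then show ?thesis using v(3) rm by simp
  qed
  ultimately show ?thesis by blast
qed

lemma jordan_matrix_shape:
  "i < sum_list (map fst n_as) \<Longrightarrow> j < sum_list (map fst n_as) \<Longrightarrow> i \<noteq> j \<Longrightarrow>
     (jordan_matrix n_as :: complex mat) $$ (i, j) \<noteq> 0 \<Longrightarrow>
     j = Suc i \<and> jordan_matrix n_as $$ (i, j) = 1 \<and> jordan_matrix n_as $$ (i, i) = jordan_matrix n_as $$ (j, j)"
proof (induction n_as arbitrary: i j)
  case (Cons na n_as)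
  obtain n a where na: "na = (n, a)" by force
  define s where "s = sum_list (map fst n_as)"
  have ij: "i < n + s" "j < n + s" using Cons.prems by (auto simp: na s_def)
  have idx: "jordan_matrix (na # n_as) $$ (i, j) =
      (if i < n then if j < n then jordan_block n a $$ (i, j) else 0
       else if j < n then 0 else (jordan_matrix n_as :: complex mat) $$ (i - n, j - n))" if "i < n + s" "j < n + s" for i j
    using that unfolding na jordan_matrix_Cons s_def by (subst index_mat_four_block) auto
  show ?case
  proof (cases "i < n")
    case True
    then have jn: "j < n" using Cons.prems(4) idx[OF ij] by (auto split: if_splits)
    then show ?thesis using Cons.prems(3,4) idx[OF ij] idx[OF ij(1,1)] idx[OF ij(2,2)] True by (auto split: if_splits)
  next
    case False
    then have jn: "\<not> j < n" using Cons.prems(4) idx[OF ij] by (auto split: if_splits)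
    have "j - n = Suc (i - n) \<and> jordan_matrix n_as $$ (i - n, j - n) = 1 \<and>
       jordan_matrix n_as $$ (i - n, i - n) = (jordan_matrix n_as :: complex mat) $$ (j - n, j - n)"
      using False jn ij Cons.prems(3,4) idx[OF ij] by (intro Cons.IH) (auto simp: s_def)
    then show ?thesis using False jn idx[OF ij] idx[OF ij(1,1)] idx[OF ij(2,2)] by auto
  qed
qed simp

text \<open>
  A Jordan block of size at least 2 would give A x = c x and A y = c y + x, which by symmetry forces x = 0.
\<close>

lemma hermitian_diagonalizable:
  fixes A :: "complex mat"
  assumes A: "A \<in> carrier_mat n n" and herm: "\<And>i j. i < n \<Longrightarrow> j < n \<Longrightarrow> A $$ (i, j) = cnj (A $$ (j, i))"
  shows "\<exists>p e. (\<forall>i<n. \<forall>j<n. (\<Sum>s<n. A $$ (i, s) * p j s) = e j * p j i) \<and>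
     (\<forall>a. (\<forall>i<n. (\<Sum>j<n. a j * p j i) = 0) \<longrightarrow> (\<forall>j<n. a j = 0)) \<and>
     char_poly A = (\<Prod>a\<leftarrow>map e [0..<n]. [:- a, 1:])"
proof -
  obtain n_as where "jordan_nf A n_as" using jordan_nf_exists[OF A] char_poly_factorized[OF A] by blast
  then have sim: "similar_mat A (jordan_matrix n_as)" by (simp add: jordan_nf_def)
  define J where "J = (jordan_matrix n_as :: complex mat)"
  obtain P Q where "similar_mat_wit A J P Q" using sim unfolding similar_mat_def J_def by blast
  note w = similar_mat_witD2[OF A this]
  have ns: "sum_list (map fst n_as) = n" using w(5) by (auto simp: J_def)
  define p where "p = (\<lambda>j i. P $$ (i, j))"
  define e where "e = (\<lambda>j. J $$ (j, j))"
  have AP: "A * P = P * J"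
  proof -
    have "A * P = P * J * Q * P" using w(3) by simp
    also have "\<dots> = P * J * (Q * P)" using w by (intro assoc_mult_mat[of _ n n _ n _ n]) auto
    also have "\<dots> = P * J" using w by (simp add: right_mult_one_mat[of _ n n])
    finally show ?thesis .
  qed
  have indep: "\<forall>j<n. a j = 0" if a: "\<forall>i<n. (\<Sum>j<n. a j * p j i) = 0" for a
  proof (intro allI impI)
    fix r assume r: "r < n"
    have QP: "(\<Sum>i<n. Q $$ (r, i) * P $$ (i, j)) = (if r = j then 1 else 0)" if j: "j < n" for j
    proof -
      have "(Q * P) $$ (r, j) = (\<Sum>i<n. Q $$ (r, i) * P $$ (i, j))"
        using r j w(6,7) by (simp add: scalar_prod_def atLeast0LessThan)
      then show ?thesis using w(2) r j by simp
    qed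
    have "(\<Sum>j<n. a j * (if r = j then 1 else 0)) = (\<Sum>j<n. if r = j then a j else 0)" by (intro sum.cong) auto
    also have "\<dots> = a r" using r by simp
    finally have "a r = (\<Sum>j<n. a j * (if r = j then 1 else 0))" by simp
    also have "\<dots> = (\<Sum>j<n. a j * (\<Sum>i<n. Q $$ (r, i) * P $$ (i, j)))" using QP by (intro sum.cong) auto
    also have "\<dots> = (\<Sum>i<n. Q $$ (r, i) * (\<Sum>j<n. a j * p j i))"
      unfolding sum_distrib_left p_def by (subst sum.swap) (simp add: ac_simps)
    also have "\<dots> = 0" using a by simp
    finally show "a r = 0" .
  qed
  have col: "(\<Sum>s<n. A $$ (i, s) * p j s) = (\<Sum>s<n. p s i * J $$ (s, j))" if ij: "i < n" "j < n" for i j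
  proof -
    have "(A * P) $$ (i, j) = (\<Sum>s<n. A $$ (i, s) * p j s)"
      using ij A w(6) by (simp add: scalar_prod_def atLeast0LessThan p_def)
    moreover have "(P * J) $$ (i, j) = (\<Sum>s<n. p s i * J $$ (s, j))"
      using ij w(5,6) by (simp add: scalar_prod_def atLeast0LessThan p_def)
    ultimately show ?thesis using AP by simp
  qed
  have shape: "j = Suc i \<and> J $$ (i, j) = 1 \<and> J $$ (i, i) = J $$ (j, j)" if "i < n" "j < n" "i \<noteq> j" "J $$ (i, j) \<noteq> 0" for i j
    using jordan_matrix_shape[of i n_as j] that unfolding ns J_def by blast
  have diag: "J $$ (i, j) = 0" if ij: "i < n" "j < n" "i \<noteq> j" for i j
  proof (rule ccontr)
    assume ne: "J $$ (i, j) \<noteq> 0"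
    define Pr where "Pr i \<longleftrightarrow> (Suc i < n \<and> J $$ (i, Suc i) \<noteq> 0)" for i
    have "Pr i" using shape[OF ij ne] ij ne by (auto simp: Pr_def)
    \<comment> \<open>For the least such q no entry stands above the diagonal in column q, so this
      column of \<open>P\<close> is a genuine eigenvector.\<close>
    then obtain q where q: "Pr q" "\<And>q'. q' < q \<Longrightarrow> \<not> Pr q'" using exists_least_iff[of Pr] by blast
    define x where "x = p q"
    define y where "y = p (Suc q)"
    have qn: "q < n" "Suc q < n" using q by (auto simp: Pr_def)
    have Jq: "J $$ (q, Suc q) = 1" "J $$ (q, q) = J $$ (Suc q, Suc q)" using shape[OF qn] q by (auto simp: Pr_def)
    define c where "c = J $$ (q, q)"
    have colq: "J $$ (s, q) = (if s = q then c else 0)" if s: "s < n" for s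
    proof (cases "s = q")
      case False
      show ?thesis
      proof (rule ccontr)
        assume "\<not> ?thesis"
        then have "J $$ (s, q) \<noteq> 0" using False by simp
        then have "q = Suc s" using shape[OF s qn(1) False] by blast
        then have "Pr s" using \<open>J $$ (s, q) \<noteq> 0\<close> qn by (simp add: Pr_def)
        then show False using q(2)[of s] \<open>q = Suc s\<close> by simp
      qed
    qed (simp add: c_def)
    have colq': "J $$ (s, Suc q) = (if s = q then 1 else if s = Suc q then c else 0)" if s: "s < n" for s
      using shape[OF s qn(2)] Jq by (auto simp: c_def)
    have Ax: "(\<Sum>s<n. A $$ (i, s) * x s) = c * x i" if i: "i < n" for i
    proof -
      have "(\<Sum>s<n. p s i * J $$ (s, q)) = (\<Sum>s<n. if s = q then c * x i else 0)"
        by (intro sum.cong refl) (auto simp: colq x_def)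
      then show ?thesis using col[OF i qn(1)] qn by (simp add: x_def)
    qed
    have Ay: "(\<Sum>s<n. A $$ (i, s) * y s) = c * y i + x i" if i: "i < n" for i
    proof -
      have "(\<Sum>s<n. p s i * J $$ (s, Suc q)) = (\<Sum>s<n. (if s = q then x i else 0) + (if s = Suc q then c * y i else 0))"
        by (intro sum.cong refl) (auto simp: colq' x_def y_def)
      then show ?thesis using col[OF i qn(2)] qn by (simp add: y_def sum.distrib)
    qed
    have symm: "(\<Sum>i<n. cnj (u i) * (\<Sum>s<n. A $$ (i, s) * v s)) = (\<Sum>s<n. cnj (\<Sum>i<n. A $$ (s, i) * u i) * v s)" for u v
    proof -
      have "(\<Sum>i<n. cnj (u i) * (\<Sum>s<n. A $$ (i, s) * v s)) = (\<Sum>s<n. \<Sum>i<n. cnj (u i) * (A $$ (i, s) * v s))"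
        unfolding sum_distrib_left by (rule sum.swap)
      also have "\<dots> = (\<Sum>s<n. cnj (\<Sum>i<n. A $$ (s, i) * u i) * v s)"
        unfolding cnj_sum sum_distrib_right
        by (intro sum.cong refl) (auto simp: herm[of _ "_::nat", symmetric] intro: herm)
      finally show ?thesis .
    qed
    define X where "X = (\<Sum>i<n. cnj (x i) * x i)"
    define Y where "Y = (\<Sum>i<n. cnj (x i) * y i)"
    have "c * X = cnj c * X"
    proof -
      have "(\<Sum>i<n. cnj (x i) * (\<Sum>s<n. A $$ (i, s) * x s)) = (\<Sum>i<n. cnj (x i) * (c * x i))"
        using Ax by (intro sum.cong refl) auto
      also have "\<dots> = c * X" unfolding X_def sum_distrib_left by (intro sum.cong refl) simp
      finally have "(\<Sum>i<n. cnj (x i) * (\<Sum>s<n. A $$ (i, s) * x s)) = c * X" .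
      moreover have "(\<Sum>s<n. cnj (\<Sum>i<n. A $$ (s, i) * x i) * x s) = cnj c * X"
        unfolding X_def sum_distrib_left using Ax by (intro sum.cong refl) auto
      ultimately show ?thesis using symm[of x x] by simp
    qed
    moreover have "c * Y + X = cnj c * Y"
    proof -
      have "(\<Sum>i<n. cnj (x i) * (\<Sum>s<n. A $$ (i, s) * y s)) = (\<Sum>i<n. cnj (x i) * (c * y i + x i))"
        using Ay by (intro sum.cong refl) auto
      also have "\<dots> = c * Y + X" unfolding X_def Y_def sum_distrib_left sum.distrib[symmetric] by (intro sum.cong refl) (simp add: algebra_simps)
      finally have "(\<Sum>i<n. cnj (x i) * (\<Sum>s<n. A $$ (i, s) * y s)) = c * Y + X" .
      moreover have "(\<Sum>s<n. cnj (\<Sum>i<n. A $$ (s, i) * x i) * y s) = cnj c * Y"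
        unfolding Y_def sum_distrib_left using Ax by (intro sum.cong refl) auto
      ultimately show ?thesis using symm[of x y] by simp
    qed
    \<comment> \<open>If X were nonzero, the first equation would make c real, and then the second
      would give X = 0.\<close>
    ultimately have X0: "X = 0" by (cases "X = 0") auto
    have "X = of_real (\<Sum>i<n. (norm (x i))\<^sup>2)"
      unfolding X_def of_real_sum by (intro sum.cong refl) (metis complex_norm_square mult.commute)
    then have "(\<Sum>i<n. (norm (x i))\<^sup>2) = 0" using X0 by (metis of_real_eq_0_iff)
    then have xz: "x i = 0" if "i < n" for i
      using that by (subst (asm) sum_nonneg_eq_0_iff) auto
    have "\<forall>j<n. (if j = q then 1 else 0 :: complex) = 0"
      by (rule indep) (use xz qn in \<open>auto simp: x_def if_distrib[of "\<lambda>a. a * _"] cong: if_cong\<close>)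
    then have "(if q = q then 1 else 0 :: complex) = 0" using qn(1) by blast
    then show False by simp
  qed
  have "(\<Sum>s<n. A $$ (i, s) * p j s) = e j * p j i" if ij: "i < n" "j < n" for i j
  proof -
    have "(\<Sum>s<n. p s i * J $$ (s, j)) = (\<Sum>s<n. if s = j then e j * p j i else 0)"
      using diag ij by (intro sum.cong refl) (auto simp: e_def)
    then show ?thesis using col[OF ij] ij by simp
  qed
  moreover have "char_poly A = (\<Prod>a\<leftarrow>map e [0..<n]. [:- a, 1:])"
  proof -
    have "upper_triangular J" unfolding upper_triangular_def using diag w(5) by auto
    then have "char_poly J = (\<Prod>a\<leftarrow>diag_mat J. [:- a, 1:])" by (rule char_poly_upper_triangular[OF w(5)])
    moreover have "diag_mat J = map e [0..<n]" using w(5) by (simp add: diag_mat_def e_def)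
    ultimately show ?thesis using char_poly_similar[OF sim] by (simp add: J_def)
  qed
  ultimately show ?thesis using indep by blast
qed

text \<open>More than k independent eigenvectors with negative eigenvalues would have a nontrivial
  combination annihilated by the k functionals \<open>F\<close>, on which the form is negative. The
  eigenvectors are independent but not normalized to be orthogonal within an eigenspace, so
  negativity is shown by writing the form as minus the squared norm of another combination.\<close>

lemma num_neg_eigenvalues_le:
  fixes A :: "complex mat" and F :: "nat \<Rightarrow> nat \<Rightarrow> complex"
  assumes A: "A \<in> carrier_mat n n" and herm: "\<And>i j. i < n \<Longrightarrow> j < n \<Longrightarrow> A $$ (i, j) = cnj (A $$ (j, i))"
    and pos: "\<And>c. (\<And>r. r < k \<Longrightarrow> (\<Sum>j<n. F r j * c j) = 0) \<Longrightarrow> Re (\<Sum>i<n. \<Sum>j<n. cnj (c i) * A $$ (i, j) * c j) \<ge> 0"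
  shows "num_neg_eigenvalues A \<le> k"
proof -
  obtain p e where p: "\<And>i j. i < n \<Longrightarrow> j < n \<Longrightarrow> (\<Sum>s<n. A $$ (i, s) * p j s) = e j * p j i"
    and indep: "\<And>a. (\<forall>i<n. (\<Sum>j<n. a j * p j i) = 0) \<Longrightarrow> \<forall>j<n. a j = 0"
    and cp: "char_poly A = (\<Prod>a\<leftarrow>map e [0..<n]. [:- a, 1:])"
    using hermitian_diagonalizable[OF A herm] by blast
  have ord: "Polynomial.order c (char_poly A) = card {i. i < n \<and> e i = c}" for c
    unfolding cp order_prod_linear_factors length_filter_conv_card
    by (intro arg_cong[of _ _ card]) auto
  define S where "S = {i. i < n \<and> e i \<in> \<real> \<and> Re (e i) < 0}"
  have fS: "finite S" by (simp add: S_def)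
  define Ev where "Ev = {c. eigenvalue A c \<and> c \<in> \<real> \<and> Re c < 0}"
  have ev: "eigenvalue A c \<longleftrightarrow> (\<exists>i<n. e i = c)" for c
  proof -
    have "eigenvalue A c \<longleftrightarrow> poly (char_poly A) c = 0" by (rule eigenvalue_root_char_poly[OF A])
    also have "\<dots> \<longleftrightarrow> (\<exists>i<n. e i = c)"
      unfolding cp poly_prod_list prod_list_zero_iff by auto
    finally show ?thesis .
  qed
  have EvS: "Ev = e ` S" unfolding Ev_def S_def ev by auto
  have "num_neg_eigenvalues A = (\<Sum>c\<in>Ev. card {i \<in> S. e i = c})"
    unfolding num_neg_eigenvalues_def Ev_def[symmetric] ord
    by (intro sum.cong refl arg_cong[of _ _ card]) (auto simp: Ev_def S_def)
  also have "\<dots> = card S"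
    unfolding EvS card_eq_sum using sum.image_gen[OF fS, of "\<lambda>_. 1 :: nat" e] by simp
  finally have num: "num_neg_eigenvalues A = card S" .
  show ?thesis
  proof (rule ccontr)
    assume "\<not> ?thesis"
    then have km: "k < card S" using num by simp
    obtain h where h: "bij_betw h {..<card S} S" using ex_bij_betw_nat_finite[OF fS] by (auto simp: atLeast0LessThan)
    have hS: "h j \<in> S" if "j < card S" for j using h that by (auto simp: bij_betw_def)
    obtain a where a: "\<exists>j<card S. a j \<noteq> 0" "\<And>r. r < k \<Longrightarrow> (\<Sum>j<card S. (\<Sum>i<n. F r i * p (h j) i) * a j) = 0"
      using homogeneous_system_solution[OF km, of "\<lambda>r j. \<Sum>i<n. F r i * p (h j) i"] by blast
    define b where "b = (\<lambda>s. if s \<in> S then a (the_inv_into {..<card S} h s) else 0)"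
    have bh: "b (h j) = a j" if "j < card S" for j
      using that hS[OF that] h by (simp add: b_def bij_betw_def the_inv_into_f_f)
    have sumS: "(\<Sum>j<card S. G (h j) * a j) = (\<Sum>s<n. G s * b s)" for G :: "nat \<Rightarrow> complex"
    proof -
      have "(\<Sum>j<card S. G (h j) * a j) = (\<Sum>j<card S. G (h j) * b (h j))" using bh by (intro sum.cong) auto
      also have "\<dots> = (\<Sum>s\<in>S. G s * b s)" using sum.reindex_bij_betw[OF h, of "\<lambda>s. G s * b s"] by simp
      also have "\<dots> = (\<Sum>s<n. G s * b s)" by (rule sum.mono_neutral_left) (auto simp: S_def b_def)
      finally show ?thesis .
    qed
    define c where "c = (\<lambda>i. \<Sum>s<n. b s * p s i)"
    have "(\<Sum>j<n. F r j * c j) = 0" if r: "r < k" for r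
    proof -
      have "(\<Sum>j<n. F r j * c j) = (\<Sum>s<n. (\<Sum>j<n. F r j * p s j) * b s)"
        unfolding c_def sum_distrib_left sum_distrib_right by (subst sum.swap) (simp add: ac_simps)
      then show ?thesis using a(2)[OF r] sumS[of "\<lambda>s. \<Sum>i<n. F r i * p s i"] by simp
    qed
    then have nonneg: "Re (\<Sum>i<n. \<Sum>j<n. cnj (c i) * A $$ (i, j) * c j) \<ge> 0" by (rule pos)
    \<comment> \<open>The coefficients are rescaled by the square roots of the moduli of the
      eigenvalues, so that the form becomes minus the squared norm of g.\<close>
    define d where "d = (\<lambda>s. complex_of_real (sqrt (- Re (e s))) * b s)"
    define g where "g = (\<lambda>i. \<Sum>s<n. d s * p s i)"
    define ip where "ip s t = (\<Sum>i<n. cnj (p s i) * p t i)" for s t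
    \<comment> \<open>Eigenvectors of different real eigenvalues are orthogonal; hence in every
      surviving term the two rescaling factors agree.\<close>
    have ip_sym: "e t * ip s t = cnj (e s) * ip s t" if st: "s < n" "t < n" for s t
    proof -
      have "(\<Sum>i<n. cnj (p s i) * (\<Sum>j<n. A $$ (i, j) * p t j)) = (\<Sum>j<n. \<Sum>i<n. cnj (p s i) * (A $$ (i, j) * p t j))"
        unfolding sum_distrib_left by (rule sum.swap)
      also have "\<dots> = (\<Sum>j<n. cnj (\<Sum>i<n. A $$ (j, i) * p s i) * p t j)"
        unfolding cnj_sum sum_distrib_right
      proof (intro sum.cong refl)
        fix i j assume "j \<in> {..<n}" "i \<in> {..<n}"
        then have "A $$ (i, j) = cnj (A $$ (j, i))" by (intro herm) auto
        then show "cnj (p s i) * (A $$ (i, j) * p t j) = cnj (A $$ (j, i) * p s i) * p t j" by simp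
      qed
      also have "\<dots> = cnj (e s) * ip s t"
        unfolding ip_def sum_distrib_left using p st by (intro sum.cong refl) auto
      finally have "(\<Sum>i<n. cnj (p s i) * (\<Sum>j<n. A $$ (i, j) * p t j)) = cnj (e s) * ip s t" .
      moreover have "(\<Sum>i<n. cnj (p s i) * (\<Sum>j<n. A $$ (i, j) * p t j)) = (\<Sum>i<n. cnj (p s i) * (e t * p t i))"
        using p st by (intro sum.cong refl) auto
      moreover have "(\<Sum>i<n. cnj (p s i) * (e t * p t i)) = e t * ip s t"
        unfolding ip_def sum_distrib_left by (intro sum.cong refl) simp
      ultimately show ?thesis by simp
    qed
    have Ac: "(\<Sum>j<n. A $$ (i, j) * c j) = (\<Sum>t<n. e t * b t * p t i)" if i: "i < n" for i
    proof -
      have "(\<Sum>j<n. A $$ (i, j) * c j) = (\<Sum>t<n. b t * (\<Sum>j<n. A $$ (i, j) * p t j))"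
        unfolding c_def sum_distrib_left by (subst sum.swap) (simp add: ac_simps)
      then show ?thesis using p[OF i] by (simp add: ac_simps)
    qed
    have "(\<Sum>i<n. \<Sum>j<n. cnj (c i) * A $$ (i, j) * c j) = (\<Sum>i<n. cnj (c i) * (\<Sum>t<n. e t * b t * p t i))"
      by (intro sum.cong refl) (simp add: Ac sum_distrib_left[symmetric] mult.assoc)
    also have "\<dots> = (\<Sum>i<n. \<Sum>s<n. \<Sum>t<n. (cnj (b s) * (e t * b t)) * (cnj (p s i) * p t i))"
      unfolding c_def cnj_sum sum_product by (intro sum.cong refl) (simp add: ac_simps)
    also have "\<dots> = (\<Sum>s<n. \<Sum>t<n. (cnj (b s) * (e t * b t)) * ip s t)"
      unfolding ip_def sum_distrib_left by (rule trans[OF sum.swap], intro sum.cong refl sum.swap)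
    also have "\<dots> = - (\<Sum>s<n. \<Sum>t<n. (cnj (d s) * d t) * ip s t)"
      unfolding sum_negf[symmetric]
    proof (intro sum.cong refl)
      fix s t assume st: "s \<in> {..<n}" "t \<in> {..<n}"
      show "(cnj (b s) * (e t * b t)) * ip s t = - ((cnj (d s) * d t) * ip s t)"
      proof (cases "s \<in> S \<and> t \<in> S")
        case False then show ?thesis by (auto simp: d_def b_def)
      next
        case True
        then have real: "e s = of_real (Re (e s))" "e t = of_real (Re (e t))" and neg: "Re (e s) < 0" "Re (e t) < 0"
          by (auto simp: S_def complex_is_Real_iff complex_eq_iff)
        show ?thesis
        proof (cases "ip s t = 0")
          case False
          then have "e t = cnj (e s)" using ip_sym[of s t] st by auto
          then have eq: "Re (e t) = Re (e s)" by (metis cnj.sel(1))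
          have "cnj (d s) * d t = (of_real (sqrt (- Re (e t))) * of_real (sqrt (- Re (e t)))) * (cnj (b s) * b t)"
            by (simp add: d_def eq ac_simps)
          also have "complex_of_real (sqrt (- Re (e t))) * of_real (sqrt (- Re (e t))) = of_real (- Re (e t))"
            unfolding of_real_mult[symmetric] using neg by simp
          finally have "cnj (d s) * d t = - e t * (cnj (b s) * b t)" using real(2) by simp
          then show ?thesis by (simp add: algebra_simps)
        qed simp
      qed
    qed
    also have "(\<Sum>s<n. \<Sum>t<n. (cnj (d s) * d t) * ip s t) = (\<Sum>i<n. cnj (g i) * g i)"
    proof -
      have "(\<Sum>i<n. cnj (g i) * g i) = (\<Sum>i<n. \<Sum>s<n. \<Sum>t<n. (cnj (d s) * d t) * (cnj (p s i) * p t i))"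
        unfolding g_def cnj_sum sum_product by (intro sum.cong refl) (simp add: ac_simps)
      also have "\<dots> = (\<Sum>s<n. \<Sum>t<n. (cnj (d s) * d t) * ip s t)"
        unfolding ip_def sum_distrib_left by (rule trans[OF sum.swap], intro sum.cong refl sum.swap)
      finally show ?thesis by simp
    qed
    also have "(\<Sum>i<n. cnj (g i) * g i) = of_real (\<Sum>i<n. (norm (g i))\<^sup>2)"
      unfolding of_real_sum by (intro sum.cong refl) (metis complex_norm_square mult.commute)
    finally have "Re (\<Sum>i<n. \<Sum>j<n. cnj (c i) * A $$ (i, j) * c j) = - (\<Sum>i<n. (norm (g i))\<^sup>2)" by simp
    then have "(\<Sum>i<n. (norm (g i))\<^sup>2) \<le> 0" using nonneg by simp
    then have "(\<Sum>i<n. (norm (g i))\<^sup>2) = 0" by (intro antisym sum_nonneg) auto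
    then have "\<forall>i<n. g i = 0" by (subst (asm) sum_nonneg_eq_0_iff) auto
    then have "\<forall>j<n. d j = 0" unfolding g_def by (rule indep)
    moreover obtain j where j: "j < card S" "a j \<noteq> 0" using a(1) by blast
    have hj: "h j \<in> S" "h j < n" using hS[OF j(1)] by (auto simp: S_def)
    have "d (h j) \<noteq> 0" using hj bh[OF j(1)] j(2) by (simp add: d_def S_def)
    ultimately show False using hj by blast
  qed
qed

section \<open>The generalized Nevanlinna class\<close>

text \<open>The difference quotient of z^m is the sum of cnj(w)^(m-1-p) z^p over p < m. For m \<le>
  2 k the exponents add up to at most 2 k - 1, so one of them is below k and its moment of c
  vanishes.\<close>

lemma polynomial_kernel_vanishes:
  fixes d :: "complex poly" and c z :: "nat \<Rightarrow> complex"
  assumes deg: "degree d \<le> 2 * k" and ne: "\<And>i j. i < n \<Longrightarrow> j < n \<Longrightarrow> z i \<noteq> cnj (z j)"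
    and c: "\<And>r. r < k \<Longrightarrow> (\<Sum>j<n. cnj (z j) ^ r * c j) = 0"
  shows "(\<Sum>i<n. \<Sum>j<n. cnj (c i) * ((poly d (z i) - poly d (cnj (z j))) / (z i - cnj (z j))) * c j) = 0"
proof -
  define s where "s = (\<lambda>r. \<Sum>j<n. cnj (z j) ^ r * c j)"
  have s0: "s r = 0" if "r < k" for r using c[OF that] by (simp add: s_def)
  have cs: "(\<Sum>i<n. cnj (c i) * z i ^ r) = cnj (s r)" for r
    by (simp add: s_def mult.commute)
  have "(poly d (z i) - poly d (cnj (z j))) / (z i - cnj (z j)) =
      (\<Sum>m\<le>degree d. coeff d m * (\<Sum>p<m. cnj (z j) ^ (m - Suc p) * z i ^ p))" if ij: "i < n" "j < n" for i j
  proof -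
    have "poly d (z i) - poly d (cnj (z j)) = (\<Sum>m\<le>degree d. coeff d m * (z i ^ m - cnj (z j) ^ m))"
      by (simp add: poly_altdef sum_subtractf right_diff_distrib)
    also have "\<dots> = (z i - cnj (z j)) * (\<Sum>m\<le>degree d. coeff d m * (\<Sum>p<m. cnj (z j) ^ (m - Suc p) * z i ^ p))"
      unfolding power_diff_sumr2 sum_distrib_left[of "z i - cnj (z j)" _ "{..degree d}"] by (intro sum.cong refl) (simp only: mult.left_commute)
    finally show ?thesis using ne[OF ij] by simp
  qed
  then have "(\<Sum>i<n. \<Sum>j<n. cnj (c i) * ((poly d (z i) - poly d (cnj (z j))) / (z i - cnj (z j))) * c j) =
      (\<Sum>i<n. \<Sum>j<n. cnj (c i) * (\<Sum>m\<le>degree d. coeff d m * (\<Sum>p<m. cnj (z j) ^ (m - Suc p) * z i ^ p)) * c j)"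
    by (intro sum.cong refl) auto
  also have "\<dots> = (\<Sum>i<n. \<Sum>j<n. \<Sum>m\<le>degree d. \<Sum>p<m. coeff d m * ((cnj (c i) * z i ^ p) * (cnj (z j) ^ (m - Suc p) * c j)))"
    unfolding sum_distrib_left sum_distrib_right by (intro sum.cong refl) (simp only: ac_simps)
  also have "\<dots> = (\<Sum>m\<le>degree d. \<Sum>i<n. \<Sum>j<n. \<Sum>p<m. coeff d m * ((cnj (c i) * z i ^ p) * (cnj (z j) ^ (m - Suc p) * c j)))"
    by (simp only: sum.swap[of _ "{..degree d}" "{..<n}"])
  also have "\<dots> = (\<Sum>m\<le>degree d. \<Sum>p<m. \<Sum>i<n. \<Sum>j<n. coeff d m * ((cnj (c i) * z i ^ p) * (cnj (z j) ^ (m - Suc p) * c j)))"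
  proof (rule sum.cong[OF refl])
    fix m
    show "(\<Sum>i<n. \<Sum>j<n. \<Sum>p<m. coeff d m * ((cnj (c i) * z i ^ p) * (cnj (z j) ^ (m - Suc p) * c j))) =
       (\<Sum>p<m. \<Sum>i<n. \<Sum>j<n. coeff d m * ((cnj (c i) * z i ^ p) * (cnj (z j) ^ (m - Suc p) * c j)))"
      by (simp only: sum.swap[of _ "{..<m}" "{..<n}"])
  qed
  also have "\<dots> = (\<Sum>m\<le>degree d. \<Sum>p<m. coeff d m * ((\<Sum>i<n. cnj (c i) * z i ^ p) * (\<Sum>j<n. cnj (z j) ^ (m - Suc p) * c j)))"
    unfolding sum_product unfolding sum_distrib_left ..
  also have "\<dots> = (\<Sum>m\<le>degree d. \<Sum>p<m. coeff d m * (cnj (s p) * s (m - Suc p)))"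
    unfolding cs unfolding s_def ..
  also have "\<dots> = 0"
  proof (intro sum.neutral ballI)
    fix m p assume m: "m \<in> {..degree d}" "p \<in> {..<m}"
    then have "p < k \<or> m - Suc p < k" using deg by auto
    then show "coeff d m * (cnj (s p) * s (m - Suc p)) = 0" using s0 by auto
  qed
  finally show ?thesis .
qed

context weyl_growth
begin

text \<open>
  The regularization of the Cauchy kernel is a polynomial of degree at most 2 k. It contributes nothing to the
  quadratic form on vectors orthogonal to the first k powers of the points, which leaves an integral of a
  square and hence at most k negative eigenvalues.
\<close>

lemma kern_decomposition:
  "\<exists>d. degree d \<le> 2 * k \<and> (\<forall>z\<in>-\<real>. (1 + z\<^sup>2) ^ k * kern z t = 1 / (of_real t - z) - of_real (g1 t) * poly d z)"
proof -
  define T where "T = complex_of_real t"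
  \<comment> \<open>Numerator of the regularized kernel: (1 + z^2)^k (1 + T z), which at z = T takes
    the value (1 + T^2)^(k+1), the reciprocal of \<open>g1\<close>.\<close>
  define p where "p = [:1, 0, 1:] ^ k * [:1, T:]"
  have pe: "poly p z = (1 + z\<^sup>2) ^ k * (1 + T * z)" for z by (simp add: p_def poly_power power2_eq_square algebra_simps)
  \<comment> \<open>Division of p by z - T lowers the degree from 2 k + 1 to 2 k, the bound needed
    for the moment argument.\<close>
  define d where "d = synthetic_div p T"
  have eq: "p + Polynomial.smult T d = pCons (poly p T) d" unfolding d_def by (rule synthetic_div_correct)
  have dp: "poly p T - poly p z = (T - z) * poly d z" for z
    using arg_cong[OF eq, of "\<lambda>q. poly q z"] by (simp add: algebra_simps)
  have "degree p \<le> degree ([:1, 0, 1:] ^ k :: complex poly) + degree [:1, T:]" unfolding p_def by (rule degree_mult_le)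
  also have "\<dots> \<le> 2 * k + 1" using degree_power_le[of "[:1, 0, 1:] :: complex poly" k] by (simp split: if_splits)
  finally have deg: "degree d \<le> 2 * k" unfolding d_def degree_synthetic_div by simp
  have "(1 + z\<^sup>2) ^ k * kern z t = 1 / (of_real t - z) - of_real (g1 t) * poly d z" if z: "z \<in> - \<real>" for z
  proof -
    have ne: "T - z \<noteq> 0" using z by (auto simp: T_def)
    define a where "a = complex_of_real (1 + t\<^sup>2)"
    have a0: "a \<noteq> 0" unfolding a_def of_real_eq_0_iff using one_plus_sq_pos[of t] by simp
    have a1: "a = 1 + T * T" by (simp add: a_def T_def power2_eq_square)
    have g1a: "of_real (g1 t) = 1 / a ^ (k + 1)" by (simp add: g1_def a_def)
    have pT: "poly p T = a ^ (k + 1)" by (simp add: pe a1 power2_eq_square)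
    have "1 / (T - z) - of_real (g1 t) * poly d z = 1 / (T - z) - (poly p T - poly p z) / (T - z) / a ^ (k + 1)"
      using dp[of z] ne by (simp add: g1a)
    also have "\<dots> = poly p z / (T - z) / a ^ (k + 1)" using a0 ne unfolding pT by (simp add: diff_divide_distrib)
    also have "\<dots> = (1 + z\<^sup>2) ^ k * ((1 + T * z) / (T - z) / a / a ^ k)" by (simp add: pe)
    also have "(1 + T * z) / (T - z) / a = 1 / (T - z) - T / a" using a0 ne by (simp add: field_simps a1)
    also have "(1 / (T - z) - T / a) / a ^ k = kern z t" by (simp add: kern_def T_def a_def)
    finally show ?thesis by (simp add: T_def)
  qed
  then show ?thesis using deg by blast
qed

lemma holomorphy_domain_M1: "holomorphy_domain M1 = - \<real>"
  using M1_holomorphic open_nonreal by (auto simp: holomorphy_domain_def analytic_on_open[OF open_nonreal, symmetric] intro: analytic_on_subset)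

lemma M1_integral: "z \<in> - \<real> \<Longrightarrow> integrable \<rho> (\<lambda>t. (1 + z\<^sup>2) ^ k * kern z t)"
  "M1 z = (LINT t|\<rho>. (1 + z\<^sup>2) ^ k * kern z t)"
  using kern_integrable by (auto simp: M1_def N_def)

lemma M1_quadratic_form_nonneg:
  fixes c z :: "nat \<Rightarrow> complex"
  assumes z: "\<And>i. i < n \<Longrightarrow> z i \<in> - \<real>" and ne: "\<And>i j. i < n \<Longrightarrow> j < n \<Longrightarrow> z i \<noteq> cnj (z j)"
    and c: "\<And>r. r < k \<Longrightarrow> (\<Sum>j<n. cnj (z j) ^ r * c j) = 0"
  shows "Re (\<Sum>i<n. \<Sum>j<n. cnj (c i) * ((M1 (z i) - cnj (M1 (z j))) / (z i - cnj (z j))) * c j) \<ge> 0"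
proof -
  define f where "f = (\<lambda>i j t. cnj (c i) * (((1 + (z i)\<^sup>2) ^ k * kern (z i) t - (1 + (cnj (z j))\<^sup>2) ^ k * kern (cnj (z j)) t) / (z i - cnj (z j))) * c j)"
  have zc: "cnj (z j) \<in> - \<real>" if "j < n" for j using z[OF that] by (simp add: complex_is_Real_iff)
  have fi: "integrable \<rho> (f i j)" if "i < n" "j < n" for i j
    unfolding f_def using that
    by (intro integrable_mult_left integrable_mult_right integrable_divide_zero Bochner_Integration.integrable_diff M1_integral z zc) auto
  have fI: "(LINT t|\<rho>. f i j t) = cnj (c i) * ((M1 (z i) - cnj (M1 (z j))) / (z i - cnj (z j))) * c j" if "i < n" "j < n" for i j
  proof -
    have "M1 (z i) - cnj (M1 (z j)) = (LINT t|\<rho>. (1 + (z i)\<^sup>2) ^ k * kern (z i) t - (1 + (cnj (z j))\<^sup>2) ^ k * kern (cnj (z j)) t)"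
      unfolding M1_cnj[OF z[OF that(2)], symmetric]
      by (subst Bochner_Integration.integral_diff[OF M1_integral(1)[OF z[OF that(1)]] M1_integral(1)[OF zc[OF that(2)]]])
        (simp only: M1_integral(2))
    then show ?thesis unfolding f_def by simp
  qed
  have pt: "Re (\<Sum>i<n. \<Sum>j<n. f i j t) \<ge> 0" for t
  proof -
    obtain d where d: "degree d \<le> 2 * k" "\<And>z. z \<in> - \<real> \<Longrightarrow> (1 + z\<^sup>2) ^ k * kern z t = 1 / (of_real t - z) - of_real (g1 t) * poly d z"
      using kern_decomposition[of t] by blast
    \<comment> \<open>For fixed t the Cauchy part of the form is the squared modulus of this
      sum.\<close>
    define S where "S = (\<Sum>j<n. c j / (of_real t - cnj (z j)))"
    have "f i j t = cnj (c i / (of_real t - cnj (z i))) * (c j / (of_real t - cnj (z j))) -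
        of_real (g1 t) * (cnj (c i) * ((poly d (z i) - poly d (cnj (z j))) / (z i - cnj (z j))) * c j)" if ij: "i < n" "j < n" for i j
    proof -
      have n1: "of_real t - z i \<noteq> 0" "of_real t - cnj (z j) \<noteq> 0" "z i - cnj (z j) \<noteq> 0"
        using z[OF ij(1)] zc[OF ij(2)] ne[OF ij] by (metis ComplD Reals_of_real eq_iff_diff_eq_0)+
      have *: "((1 / (T - x) - g * X) - (1 / (T - y) - g * Y)) / (x - y) = 1 / (T - x) * (1 / (T - y)) - g * ((X - Y) / (x - y))"
        if "T - x \<noteq> 0" "T - y \<noteq> 0" "x - y \<noteq> 0" for T x y g X Y :: complex
      proof -
        have "(1 / (T - x) - g * X) - (1 / (T - y) - g * Y) = (1 / (T - x) - 1 / (T - y)) - g * (X - Y)" by (simp add: algebra_simps)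
        moreover have "1 / (T - x) - 1 / (T - y) = (x - y) * (1 / (T - x) * (1 / (T - y)))" using that by (simp add: field_simps)
        moreover have "(P * W - g * D) / P = W - g * (D / P)" if "P \<noteq> 0" for P W D :: complex
          using that by (simp add: diff_divide_distrib)
        ultimately show ?thesis using that(3) by (metis (no_types))
      qed
      show ?thesis unfolding f_def d(2)[OF z[OF ij(1)]] d(2)[OF zc[OF ij(2)]] *[OF n1] by (simp add: algebra_simps)
    qed
    then have "(\<Sum>i<n. \<Sum>j<n. f i j t) = (\<Sum>i<n. \<Sum>j<n. cnj (c i / (of_real t - cnj (z i))) * (c j / (of_real t - cnj (z j)))) -
        of_real (g1 t) * (\<Sum>i<n. \<Sum>j<n. cnj (c i) * ((poly d (z i) - poly d (cnj (z j))) / (z i - cnj (z j))) * c j)"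
      by (simp add: sum_subtractf sum_distrib_left)
    also have "(\<Sum>i<n. \<Sum>j<n. cnj (c i) * ((poly d (z i) - poly d (cnj (z j))) / (z i - cnj (z j))) * c j) = 0"
      by (rule polynomial_kernel_vanishes[OF d(1)]) (use ne c in auto)
    also have "(\<Sum>i<n. \<Sum>j<n. cnj (c i / (of_real t - cnj (z i))) * (c j / (of_real t - cnj (z j)))) - of_real (g1 t) * 0 = cnj S * S"
      unfolding S_def cnj_sum sum_product by simp
    finally show ?thesis by (simp add: complex_norm_square[symmetric] mult.commute[of "cnj S"] del: complex_cnj_mult)
  qed
  have "(\<Sum>i<n. \<Sum>j<n. cnj (c i) * ((M1 (z i) - cnj (M1 (z j))) / (z i - cnj (z j))) * c j) = (\<Sum>i<n. \<Sum>j<n. LINT t|\<rho>. f i j t)"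
    using fI by (intro sum.cong refl) auto
  also have "\<dots> = (LINT t|\<rho>. (\<Sum>i<n. \<Sum>j<n. f i j t))"
    using fi by (subst Bochner_Integration.integral_sum, force intro!: Bochner_Integration.integrable_sum)
      (intro sum.cong refl Bochner_Integration.integral_sum[symmetric]; force)
  finally have eq: "(\<Sum>i<n. \<Sum>j<n. cnj (c i) * ((M1 (z i) - cnj (M1 (z j))) / (z i - cnj (z j))) * c j) = (LINT t|\<rho>. (\<Sum>i<n. \<Sum>j<n. f i j t))" .
  have "integrable \<rho> (\<lambda>t. \<Sum>i<n. \<Sum>j<n. f i j t)" using fi by (intro Bochner_Integration.integrable_sum) auto
  from integral_Re[OF this] show ?thesis unfolding eq using pt
    by (metis (no_types, lifting) AE_I2 integral_nonneg_AE)
qed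

text \<open>The number m of conditions is left free: it is k in general, and 0 in the degenerate
  case where \<open>M1\<close> vanishes.\<close>

lemma nevanlinna_matrix_M1:
  assumes adm: "admissible_points M1 zs"
    and pos: "\<And>c. (\<And>r. r < m \<Longrightarrow> (\<Sum>j<length zs. cnj (zs ! j) ^ r * c j) = 0) \<Longrightarrow>
      Re (\<Sum>i<length zs. \<Sum>j<length zs. cnj (c i) * ((M1 (zs ! i) - cnj (M1 (zs ! j))) / (zs ! i - cnj (zs ! j))) * c j) \<ge> 0"
  shows "num_neg_eigenvalues (nevanlinna_matrix M1 zs) \<le> m"
proof (rule num_neg_eigenvalues_le[where n = "length zs" and F = "\<lambda>r j. cnj (zs ! j) ^ r"])
  show "nevanlinna_matrix M1 zs \<in> carrier_mat (length zs) (length zs)" by (simp add: nevanlinna_matrix_def)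
  fix i j assume "i < length zs" "j < length zs"
  moreover have "(a - cnj b) / (x - cnj y) = cnj ((b - cnj a) / (y - cnj x))" for a b x y
    using minus_divide_divide[of "a - cnj b" "x - cnj y"] by simp
  ultimately show "nevanlinna_matrix M1 zs $$ (i, j) = cnj (nevanlinna_matrix M1 zs $$ (j, i))"
    by (simp add: nevanlinna_matrix_def)
next
  fix c :: "nat \<Rightarrow> complex"
  assume "\<And>r. r < m \<Longrightarrow> (\<Sum>j<length zs. cnj (zs ! j) ^ r * c j) = 0"
  from pos[OF this] show "Re (\<Sum>i<length zs. \<Sum>j<length zs. cnj (c i) * nevanlinna_matrix M1 zs $$ (i, j) * c j) \<ge> 0"
    by (simp add: nevanlinna_matrix_def)
qed

lemma admissible_pointsD:
  assumes "admissible_points M1 zs"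
  shows "\<And>i. i < length zs \<Longrightarrow> zs ! i \<in> - \<real>" "\<And>i j. i < length zs \<Longrightarrow> j < length zs \<Longrightarrow> zs ! i \<noteq> cnj (zs ! j)"
  using assms unfolding admissible_points_def holomorphy_domain_M1 by (meson nth_mem subsetD)+

lemma num_neg_eigenvalues_M1: "admissible_points M1 zs \<Longrightarrow> num_neg_eigenvalues (nevanlinna_matrix M1 zs) \<le> k"
  by (intro nevanlinna_matrix_M1 M1_quadratic_form_nonneg admissible_pointsD)

section \<open>Generalized poles of nonpositive type\<close>

lemma Im_N_eq:
  assumes z: "Im z > 0"
  shows "Im (N z) = (LINT t|\<rho>. Im z / ((t - Re z)\<^sup>2 + (Im z)\<^sup>2) / (1 + t\<^sup>2) ^ k)"
    "integrable \<rho> (\<lambda>t. Im z / ((t - Re z)\<^sup>2 + (Im z)\<^sup>2) / (1 + t\<^sup>2) ^ k)"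
proof -
  have i: "integrable \<rho> (kern z)" using z by (intro kern_integrable) (simp add: complex_is_Real_iff)
  have eq: "Im (kern z t) = Im z / ((t - Re z)\<^sup>2 + (Im z)\<^sup>2) / (1 + t\<^sup>2) ^ k" for t
    unfolding kern_def by (simp only: Im_divide_of_real) (simp add: Im_divide)
  show "Im (N z) = (LINT t|\<rho>. Im z / ((t - Re z)\<^sup>2 + (Im z)\<^sup>2) / (1 + t\<^sup>2) ^ k)"
    using integral_Im[OF i] unfolding N_def eq by simp
  show "integrable \<rho> (\<lambda>t. Im z / ((t - Re z)\<^sup>2 + (Im z)\<^sup>2) / (1 + t\<^sup>2) ^ k)"
    using integrable_Im[OF i] unfolding eq .
qed

lemma Im_N_nonneg: "Im z > 0 \<Longrightarrow> Im (N z) \<ge> 0"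
  by (simp add: Im_N_eq integral_nonneg_AE)

text \<open>\<open>M1\<close> is the Herglotz function \<open>N\<close> times (1 + z^2)^k, and this
  factor is positive on the real axis. So at a real point \<open>M1\<close> grows no faster than 1 /
  e, and the limit in question has the sign it has for a Herglotz function.\<close>

lemma no_finite_pole: "\<not> gen_pole_nonpos_type M1 t0"
proof -
  define Z where "Z = (\<lambda>e. Complex t0 e)"
  have c1n: "c1 \<ge> 0" unfolding c1_def using g1_pos by (intro integral_nonneg_AE AE_I2) (simp add: less_imp_le)
  define R where "R = \<bar>t0\<bar> + 1"
  define B where "B = (1 + R\<^sup>2) ^ k * ((1 + R\<^sup>2) * c1 + R * c1)"
  have bd: "e * norm (M1 (Z e)) \<le> B" if e: "e > 0" "e < 1" for e
  proof -
    have nz: "norm (Z e) \<le> R" using cmod_le[of "Z e"] e by (simp add: Z_def R_def)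
    have Im: "Im (Z e) = e" by (simp add: Z_def)
    have "norm (1 + (Z e)\<^sup>2) \<le> 1 + (norm (Z e))\<^sup>2" using norm_triangle_ineq[of 1 "(Z e)\<^sup>2"] by (simp add: norm_power)
    also have "\<dots> \<le> 1 + R\<^sup>2" using nz by (simp add: power_mono)
    finally have n1: "norm (1 + (Z e)\<^sup>2) \<le> 1 + R\<^sup>2" .
    have "norm (cauchy_tr \<rho> g1 (Z e)) \<le> c1 / e"
      using norm_cauchy_tr_le_Im[OF sets g1_integrable, of "Z e"] e g1_pos by (simp add: Im c1_def abs_of_pos)
    then have n2: "e * norm (cauchy_tr \<rho> g1 (Z e)) \<le> c1" using e by (simp add: field_simps)
    have "N (Z e) = (1 + (Z e)\<^sup>2) * cauchy_tr \<rho> g1 (Z e) + Z e * of_real c1"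
      using e Im by (intro N_eq) (simp add: complex_is_Real_iff)
    then have "norm (N (Z e)) \<le> norm (1 + (Z e)\<^sup>2) * norm (cauchy_tr \<rho> g1 (Z e)) + norm (Z e) * c1"
      using norm_triangle_ineq[of "(1 + (Z e)\<^sup>2) * cauchy_tr \<rho> g1 (Z e)" "Z e * of_real c1"] c1n by (simp add: norm_mult)
    then have "e * norm (N (Z e)) \<le> e * (norm (1 + (Z e)\<^sup>2) * norm (cauchy_tr \<rho> g1 (Z e)) + norm (Z e) * c1)"
      using e by (intro mult_left_mono) auto
    also have "\<dots> = norm (1 + (Z e)\<^sup>2) * (e * norm (cauchy_tr \<rho> g1 (Z e))) + e * (norm (Z e) * c1)" by (simp add: algebra_simps)
    also have "\<dots> \<le> (1 + R\<^sup>2) * c1 + 1 * (R * c1)"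
      using n1 n2 nz e c1n by (intro add_mono mult_mono) (auto simp: R_def)
    finally have n3: "e * norm (N (Z e)) \<le> (1 + R\<^sup>2) * c1 + R * c1" by simp
    have "e * norm (M1 (Z e)) = norm (1 + (Z e)\<^sup>2) ^ k * (e * norm (N (Z e)))" by (simp add: M1_def norm_mult norm_power)
    also have "\<dots> \<le> B" unfolding B_def using n1 n3 e by (intro mult_mono power_mono) auto
    finally show ?thesis .
  qed
  have ev: "\<forall>\<^sub>F e in at_right (0::real). e > 0 \<and> e < 1" by (rule eventually_at_rightI[of 0 1]) auto
  have "Limsup (at_right 0) (\<lambda>e::real. ereal (e * norm (M1 (Complex t0 e)))) \<le> ereal B"
    by (rule Limsup_bounded) (use ev bd in \<open>auto elim!: eventually_mono simp: Z_def\<close>)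
  then have "Limsup (at_right 0) (\<lambda>e::real. ereal (e * norm (M1 (Complex t0 e)))) \<noteq> \<infinity>" by auto
  moreover have "c \<ge> 0" if lim: "((\<lambda>e::real. - \<i> * of_real e * M1 (Complex t0 e)) \<longlongrightarrow> of_real c) (at_right 0)" for c :: real
  proof -
    define p0 where "p0 = (1 + t0\<^sup>2) ^ k"
    have p0: "p0 > 0" using one_plus_sq_pos[of t0] by (simp add: p0_def)
    have "((\<lambda>e. Complex t0 e) \<longlongrightarrow> Complex t0 0) (at_right 0)" by (intro tendsto_intros)
    then have "((\<lambda>e. (1 + (Complex t0 e)\<^sup>2) ^ k) \<longlongrightarrow> (1 + (Complex t0 0)\<^sup>2) ^ k) (at_right 0)" by (intro tendsto_intros)
    moreover have "(1 + (Complex t0 0)\<^sup>2) ^ k = of_real p0" by (simp add: p0_def complex_of_real_def[symmetric])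
    ultimately have lp: "((\<lambda>e. (1 + (Complex t0 e)\<^sup>2) ^ k) \<longlongrightarrow> of_real p0) (at_right 0)" by simp
    have p0': "complex_of_real p0 \<noteq> 0" using p0 by simp
    have "((\<lambda>e::real. Re (- \<i> * of_real e * M1 (Complex t0 e) / (1 + (Complex t0 e)\<^sup>2) ^ k)) \<longlongrightarrow> Re (of_real c / of_real p0)) (at_right 0)"
      by (intro tendsto_Re tendsto_divide lim lp p0')
    moreover have "\<forall>\<^sub>F e in at_right (0::real). Re (- \<i> * of_real e * M1 (Complex t0 e) / (1 + (Complex t0 e)\<^sup>2) ^ k) \<ge> 0"
      using tendsto_imp_eventually_ne[OF lp p0'] ev
    proof eventually_elim
      case (elim e)
      then have "(1 + (Complex t0 e)\<^sup>2) ^ k \<noteq> 0" by blast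
      then have "- \<i> * of_real e * M1 (Complex t0 e) / (1 + (Complex t0 e)\<^sup>2) ^ k = - \<i> * of_real e * N (Complex t0 e)"
        unfolding M1_def by (metis nonzero_mult_div_cancel_left mult.left_commute)
      moreover have "Re (- \<i> * of_real e * N (Complex t0 e)) = e * Im (N (Complex t0 e))" by simp
      ultimately show ?case using Im_N_nonneg[of "Complex t0 e"] elim by simp
    qed
    ultimately have "Re (of_real c / of_real p0) \<ge> 0" by (rule tendsto_lowerbound) simp
    then show ?thesis using p0 by (simp add: zero_le_divide_iff)
  qed
  ultimately show ?thesis unfolding gen_pole_nonpos_type_def by fastforce
qed

text \<open>The density \<open>g1\<close> is positive, so zero total mass would make the measure
  null and \<open>M1\<close> zero.\<close>

lemma c1_pos:
  assumes "\<exists>z\<in>-\<real>. M1 z \<noteq> 0"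
  shows "c1 > 0"
proof (rule ccontr)
  assume "\<not> c1 > 0"
  moreover have "c1 \<ge> 0" unfolding c1_def using g1_pos by (intro integral_nonneg_AE AE_I2) (simp add: less_imp_le)
  ultimately have "(LINT t|\<rho>. g1 t) = 0" by (simp add: c1_def)
  then have "AE t in \<rho>. g1 t = 0"
    using integral_nonneg_eq_0_iff_AE[OF g1_integrable] g1_pos by (simp add: less_imp_le)
  then have ae: "AE t in \<rho>. False" by eventually_elim (use g1_pos in \<open>simp add: less_le\<close>)
  have "N z = 0" for z
  proof -
    have "AE t in \<rho>. kern z t = 0" using ae by eventually_elim simp
    then show ?thesis unfolding N_def by (rule integral_eq_zero_AE)
  qed
  then show False using assms by (simp add: M1_def)
qed

text \<open>Pointwise comparison of the Poisson kernel with \<open>g1 / y\<close>, from t^2 + y^2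
  \<le> y^2 (1 + t^2) for y \<ge> 1.\<close>

lemma Im_N_imaginary_ge:
  assumes y: "y \<ge> 1"
  shows "Im (N (\<i> * of_real y)) \<ge> c1 / y"
proof -
  have i: "Im (\<i> * of_real y) > 0" using y by simp
  have "(LINT t|\<rho>. g1 t / y) \<le> (LINT t|\<rho>. y / (t\<^sup>2 + y\<^sup>2) / (1 + t\<^sup>2) ^ k)"
  proof (rule integral_mono)
    show "integrable \<rho> (\<lambda>t. g1 t / y)" using g1_integrable by simp
    show "integrable \<rho> (\<lambda>t. y / (t\<^sup>2 + y\<^sup>2) / (1 + t\<^sup>2) ^ k)" using Im_N_eq(2)[OF i] by simp
    fix t
    have "1 / (1 + t\<^sup>2) / y \<le> y / (t\<^sup>2 + y\<^sup>2)"
    proof -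
      have "1 \<le> y\<^sup>2" using y by (simp add: power2_eq_square mult_ge1_I)
      then have "t\<^sup>2 * 1 \<le> t\<^sup>2 * y\<^sup>2" by (intro mult_left_mono) auto
      then have "t\<^sup>2 + y\<^sup>2 \<le> y * y * (1 + t\<^sup>2)" by (simp add: power2_eq_square algebra_simps)
      moreover have "t\<^sup>2 + y\<^sup>2 > 0" "1 + t\<^sup>2 > 0" using y one_plus_sq_pos by (auto simp: add_nonneg_pos)
      moreover have "0 < y + y * t\<^sup>2" using y by (simp add: add_pos_nonneg)
      ultimately show ?thesis using y by (simp add: divide_le_eq le_divide_eq field_simps)
    qed
    then have "1 / (1 + t\<^sup>2) / y / (1 + t\<^sup>2) ^ k \<le> y / (t\<^sup>2 + y\<^sup>2) / (1 + t\<^sup>2) ^ k"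
      using one_plus_sq_pos[of t] by (intro divide_right_mono) auto
    then show "g1 t / y \<le> y / (t\<^sup>2 + y\<^sup>2) / (1 + t\<^sup>2) ^ k" by (simp add: g1_def mult_ac)
  qed
  moreover have "(LINT t|\<rho>. g1 t / y) = c1 / y" by (simp add: c1_def)
  moreover have "Im (N (\<i> * of_real y)) = (LINT t|\<rho>. y / (t\<^sup>2 + y\<^sup>2) / (1 + t\<^sup>2) ^ k)" using Im_N_eq(1)[OF i] by simp
  ultimately show ?thesis by argo
qed

lemma one_plus_sq_ne: "1 + t\<^sup>2 \<noteq> (0::real)"
  using one_plus_sq_pos[of t] by simp

lemma norm_M1_imaginary:
  assumes "y \<ge> 1"
  shows "norm (M1 (\<i> * of_real y)) = (y\<^sup>2 - 1) ^ k * norm (N (\<i> * of_real y))"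
proof -
  have "1 + (\<i> * of_real y)\<^sup>2 = complex_of_real (1 - y\<^sup>2)" by (simp add: power_mult_distrib)
  then have "norm (1 + (\<i> * of_real y)\<^sup>2) = \<bar>1 - y\<^sup>2\<bar>" by (metis norm_of_real)
  also have "\<dots> = y\<^sup>2 - 1" using assms by (simp add: power2_eq_square mult_ge1_I)
  finally show ?thesis by (simp add: M1_def norm_mult norm_power)
qed

lemma Limsup_infinityI: "filterlim f at_top at_top \<Longrightarrow> Limsup at_top (\<lambda>y::real. ereal (f y)) = \<infinity>"
  by (rule lim_imp_Limsup) (simp_all add: tendsto_PInfty_eq_at_top)

text \<open>The polynomial factor has size at least (y^2 - 1)^2 and N (i y) decays no faster than c1
  / y, so the quotient grows at least like y^2. For k = 1 the same estimate gives only a bounded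
  quantity, whence the separate treatment.\<close>

lemma generalized_pole_at_infinity_ge_2:
  assumes k2: "k \<ge> 2" and c1: "c1 > 0"
  shows "gen_pole_nonpos_type_infinity M1"
proof -
  have "filterlim (\<lambda>y. norm (M1 (\<i> * of_real y)) / y) at_top at_top"
  proof (rule filterlim_at_top_mono)
    show "filterlim (\<lambda>y::real. c1 * ((y\<^sup>2 - 1)\<^sup>2 / y / y)) at_top at_top"
    proof (rule filterlim_tendsto_pos_mult_at_top[OF tendsto_const c1])
      show "filterlim (\<lambda>y::real. (y\<^sup>2 - 1)\<^sup>2 / y / y) at_top at_top" by real_asymp
    qed
    show "\<forall>\<^sub>F y in at_top. c1 * ((y\<^sup>2 - 1)\<^sup>2 / y / y) \<le> norm (M1 (\<i> * of_real y)) / y"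
      using eventually_ge_at_top[of "2::real"]
    proof eventually_elim
      case (elim y)
      have y1: "y \<ge> 1" using elim by simp
      have "y * y \<ge> 2 * 2" using elim by (intro mult_mono) auto
      then have "(y\<^sup>2 - 1)\<^sup>2 \<le> (y\<^sup>2 - 1) ^ k" using k2 by (intro power_increasing) (auto simp: power2_eq_square)
      moreover have "c1 / y \<le> norm (N (\<i> * of_real y))"
        using Im_N_imaginary_ge[of y] abs_Im_le_cmod[of "N (\<i> * of_real y)"] elim by linarith
      ultimately have "(y\<^sup>2 - 1)\<^sup>2 * (c1 / y) \<le> (y\<^sup>2 - 1) ^ k * norm (N (\<i> * of_real y))"
        using c1 elim by (intro mult_mono) (auto intro: order_trans[OF zero_le_power2])
      then have "(y\<^sup>2 - 1)\<^sup>2 * (c1 / y) / y \<le> norm (M1 (\<i> * of_real y)) / y"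
        unfolding norm_M1_imaginary[OF y1] using elim by (intro divide_right_mono) auto
      then show ?case by (simp add: mult_ac)
    qed
  qed
  then show ?thesis unfolding gen_pole_nonpos_type_infinity_def using Limsup_infinityI by blast
qed

text \<open>Boundedness of the quotient bounds y Im N (i y), which is the integral of y^2 / (t^2 +
  y^2) against the measure with density 1 / (1 + t^2). The first factor increases to 1 as y
  grows.\<close>

lemma weight_integrable_of_bounded:
  assumes k1: "k = 1" and bd: "Limsup at_top (\<lambda>y::real. ereal (norm (M1 (\<i> * of_real y)) / y)) \<noteq> \<infinity>"
  shows "integrable \<rho> (\<lambda>t. 1 / (1 + t\<^sup>2))"
proof -
  define L where "L = Limsup at_top (\<lambda>y::real. ereal (norm (M1 (\<i> * of_real y)) / y))"
  obtain B where "L < ereal B" using bd unfolding L_def by (metis ereal_top less_PInf_Ex_of_nat not_less less_ereal.simps(4) neq_iff ereal_infty_less(1))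
  then have "\<forall>\<^sub>F y in at_top. ereal (norm (M1 (\<i> * of_real y)) / y) < ereal B"
    unfolding L_def by (rule Limsup_lessD)
  then obtain Y where Y: "\<And>y. y \<ge> Y \<Longrightarrow> norm (M1 (\<i> * of_real y)) / y < B"
    unfolding eventually_at_top_linorder by auto
  \<comment> \<open>Heights at least 2 give y^2 \<le> 2 (y^2 - 1), which converts the bound on
    \<open>M1\<close> into one on y^2 N; the values beyond Y make that bound available.\<close>
  define h where "h = (\<lambda>(n::nat) t::real. let y = max 2 Y + real n in y\<^sup>2 / (t\<^sup>2 + y\<^sup>2) / (1 + t\<^sup>2))"
  define y where "y = (\<lambda>n::nat. max 2 Y + real n)"
  have h: "h n t = y n * (y n / (t\<^sup>2 + (y n)\<^sup>2) / (1 + t\<^sup>2))" for n t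
    by (simp add: h_def y_def Let_def power2_eq_square)
  have y2: "y n \<ge> 2" "y n \<ge> Y" for n by (auto simp: y_def)
  have ipos: "Im (\<i> * of_real (y n)) > 0" for n using y2(1)[of n] by simp
  have hi: "integrable \<rho> (h n)" for n
    unfolding h using Im_N_eq(2)[OF ipos[of n]] by (intro integrable_mult_right) (simp add: k1)
  have hI: "(LINT t|\<rho>. h n t) = y n * Im (N (\<i> * of_real (y n)))" for n
  proof -
    have "Im (N (\<i> * of_real (y n))) = (LINT t|\<rho>. y n / (t\<^sup>2 + (y n)\<^sup>2) / (1 + t\<^sup>2))"
      unfolding Im_N_eq(1)[OF ipos[of n]] by (simp add: k1)
    then show ?thesis unfolding h by (simp only: integral_mult_right_zero)
  qed
  have hB: "(LINT t|\<rho>. h n t) \<le> 2 * B" for n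
  proof -
    have "y n * y n \<ge> 2 * 2" using y2(1)[of n] by (intro mult_mono) auto
    then have yy: "2 * ((y n)\<^sup>2 - 1) \<ge> (y n)\<^sup>2" by (simp add: power2_eq_square)
    have "(y n)\<^sup>2 * Im (N (\<i> * of_real (y n))) \<le> 2 * ((y n)\<^sup>2 - 1) * norm (N (\<i> * of_real (y n)))"
      using abs_Im_le_cmod[of "N (\<i> * of_real (y n))"] Im_N_nonneg[OF ipos[of n]] yy
      by (intro mult_mono) (auto intro: order_trans[OF zero_le_power2])
    also have "\<dots> = 2 * norm (M1 (\<i> * of_real (y n)))" using y2(1)[of n] by (subst norm_M1_imaginary) (auto simp: k1)
    also have "\<dots> \<le> 2 * (B * y n)" using Y[OF y2(2)[of n]] y2(1)[of n] by (simp add: divide_less_eq less_imp_le)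
    finally have "y n * (y n * Im (N (\<i> * of_real (y n)))) \<le> y n * (2 * B)" by (simp add: power2_eq_square mult_ac)
    then show ?thesis unfolding hI using y2(1)[of n] by (simp only: mult_le_cancel_left_pos)
  qed
  have h_alt: "h n t = (1 - t\<^sup>2 / (t\<^sup>2 + (y n)\<^sup>2)) / (1 + t\<^sup>2)" for n t
  proof -
    have "t\<^sup>2 + (y n)\<^sup>2 > 0" using y2(1)[of n] by (auto intro: add_nonneg_pos)
    then have "t\<^sup>2 + (y n)\<^sup>2 \<noteq> 0" by linarith
    then have "(y n)\<^sup>2 / (t\<^sup>2 + (y n)\<^sup>2) = 1 - t\<^sup>2 / (t\<^sup>2 + (y n)\<^sup>2)" by (simp add: field_simps)
    moreover have "h n t = (y n)\<^sup>2 / (t\<^sup>2 + (y n)\<^sup>2) / (1 + t\<^sup>2)" unfolding h by (simp add: power2_eq_square)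
    ultimately show ?thesis by (simp only:)
  qed
  have mono: "mono (\<lambda>n. h n t)" for t
  proof (rule monoI)
    fix m n :: nat assume "m \<le> n"
    then have "(y m)\<^sup>2 \<le> (y n)\<^sup>2" using y2(1)[of m] by (intro power_mono) (auto simp: y_def)
    moreover have "t\<^sup>2 + (y m)\<^sup>2 > 0" using y2(1)[of m] by (auto intro: add_nonneg_pos)
    ultimately have "t\<^sup>2 / (t\<^sup>2 + (y n)\<^sup>2) \<le> t\<^sup>2 / (t\<^sup>2 + (y m)\<^sup>2)" by (intro divide_left_mono) auto
    then show "h m t \<le> h n t" unfolding h_alt using one_plus_sq_pos[of t] by (intro divide_right_mono) auto
  qed
  have lim: "(\<lambda>n. h n t) \<longlonglongrightarrow> 1 / (1 + t\<^sup>2)" for t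
  proof -
    have "(\<lambda>n::nat. t\<^sup>2 / (t\<^sup>2 + (max 2 Y + real n)\<^sup>2)) \<longlonglongrightarrow> 0" by real_asymp
    then have "(\<lambda>n. (1 - t\<^sup>2 / (t\<^sup>2 + (y n)\<^sup>2)) / (1 + t\<^sup>2)) \<longlonglongrightarrow> (1 - 0) / (1 + t\<^sup>2)"
      unfolding y_def using one_plus_sq_pos[of t] by (intro tendsto_intros) auto
    then show ?thesis by (simp add: h_alt)
  qed
  have inc: "incseq (\<lambda>n. LINT t|\<rho>. h n t)"
    using mono by (intro monoI integral_mono hi) (auto simp: mono_def)
  obtain L' where L': "(\<lambda>n. LINT t|\<rho>. h n t) \<longlonglongrightarrow> L'" using incseq_convergent[OF inc, of "2 * B"] hB by blast
  show ?thesis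
    by (rule integrable_monotone_convergence[OF hi _ _ L'])
      (use mono lim in \<open>auto intro!: continuous_measurable[OF sets g1_integrable] continuous_intros simp: one_plus_sq_ne\<close>)
qed

text \<open>If the quotient is bounded along a tail, the measure with density w is finite and N is
  its Cauchy transform minus the constant A. For A = 0 the quotient M1 (i y) / (i y) tends to minus
  the mass of that measure; for A nonzero its modulus grows like |A| y.\<close>

lemma generalized_pole_at_infinity_1:
  assumes k1: "k = 1" and c1: "c1 > 0"
  shows "gen_pole_nonpos_type_infinity M1"
proof (cases "Limsup at_top (\<lambda>y::real. ereal (norm (M1 (\<i> * of_real y)) / y)) = \<infinity>")
  case False
  define w where "w = (\<lambda>t::real. 1 / (1 + t\<^sup>2))"
  have wi: "integrable \<rho> w" unfolding w_def by (rule weight_integrable_of_bounded[OF k1 False])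
  have wpos: "w t > 0" for t using one_plus_sq_pos[of t] by (simp add: w_def)
  define \<nu> where "\<nu> = (LINT t|\<rho>. w t)"
  define A where "A = (LINT t|\<rho>. complex_of_real (t * (w t)\<^sup>2))"
  have [measurable]: "w \<in> borel_measurable \<rho>" using wi by auto
  have Ai: "integrable \<rho> (\<lambda>t. complex_of_real (t * (w t)\<^sup>2))"
  proof (intro integrable_of_real Bochner_Integration.integrable_bound[OF wi])
    show "(\<lambda>t. t * (w t)\<^sup>2) \<in> borel_measurable \<rho>"
      unfolding w_def by (intro continuous_measurable[OF sets wi] continuous_intros) (simp add: one_plus_sq_ne)
    have "\<bar>t * w t\<bar> \<le> 1" for t
    proof -
      have "\<bar>t\<bar> \<le> 1 + t\<^sup>2" using power2_ge_1_iff[of "\<bar>t\<bar>"] zero_le_power2[of "\<bar>t\<bar> - 1"] by (simp add: power2_eq_square algebra_simps)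
      then show ?thesis using one_plus_sq_pos[of t] by (simp add: w_def abs_mult)
    qed
    then have "\<bar>t * w t\<bar> * w t \<le> 1 * w t" for t using wpos[of t] by (intro mult_right_mono) auto
    then show "AE t in \<rho>. norm (t * (w t)\<^sup>2) \<le> norm (w t)"
      using wpos by (intro AE_I2) (simp add: power2_eq_square abs_mult less_imp_le abs_of_pos mult_ac)
  qed
  have \<nu>: "\<nu> > 0"
  proof -
    have "c1 \<le> \<nu>" unfolding c1_def \<nu>_def
    proof (rule integral_mono[OF g1_integrable wi])
      fix t
      have "w t * w t \<le> w t * 1" using wpos[of t] one_plus_sq_pos[of t] by (intro mult_left_mono) (auto simp: w_def)
      moreover have "g1 t = w t * w t" unfolding g1_def unfolding k1 w_def by (simp add: power2_eq_square)
      ultimately show "g1 t \<le> w t" by simp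
    qed
    then show ?thesis using c1 by simp
  qed
  have N: "N z = cauchy_tr \<rho> w z - A" if z: "z \<in> - \<real>" for z
  proof -
    have eq: "kern z = (\<lambda>t. of_real (w t) / (of_real t - z) - of_real (t * (w t)\<^sup>2))"
      unfolding kern_def by (rule ext) (simp add: w_def k1 diff_divide_distrib power2_eq_square)
    show ?thesis unfolding N_def cauchy_tr_def A_def eq
      by (rule Bochner_Integration.integral_diff[OF cauchy_tr_integrable[OF sets wi z] Ai])
  qed
  have nonreal: "\<i> * of_real y \<in> - \<real>" if "y > 0" for y using that by (simp add: complex_is_Real_iff)
  \<comment> \<open>The leading term of the transform of a finite measure along the imaginary
    axis.\<close>
  have yC: "((\<lambda>y::real. \<i> * of_real y * cauchy_tr \<rho> w (\<i> * of_real y)) \<longlongrightarrow> - of_real \<nu>) at_top"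
  proof -
    have "((\<lambda>y::real. LINT t|\<rho>. \<i> * of_real y * (of_real (w t) / (of_real t - \<i> * of_real y))) \<longlongrightarrow> (LINT t|\<rho>. - of_real (w t))) at_top"
    proof (rule integral_dominated_convergence_at_top[where w = w])
      show "AE t in \<rho>. ((\<lambda>y::real. \<i> * of_real y * (of_real (w t) / (of_real t - \<i> * of_real y))) \<longlongrightarrow> - complex_of_real (w t)) at_top"
      proof (rule AE_I2)
        fix t
        have "((\<lambda>y::real. t / y) \<longlongrightarrow> 0) at_top" by real_asymp
        then have "((\<lambda>y::real. \<i> * (of_real (w t) / (of_real (t / y) - \<i>))) \<longlongrightarrow> \<i> * (of_real (w t) / (of_real 0 - \<i>))) at_top"
          by (intro tendsto_intros) auto
        moreover have "\<i> * (of_real (w t) / (of_real 0 - \<i>)) = - complex_of_real (w t)" by (simp add: field_simps)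
        ultimately have l: "((\<lambda>y::real. \<i> * (of_real (w t) / (of_real (t / y) - \<i>))) \<longlongrightarrow> - complex_of_real (w t)) at_top" by (simp only:)
        have "\<forall>\<^sub>F y in at_top. \<i> * (of_real (w t) / (of_real (t / y) - \<i>)) = \<i> * of_real y * (of_real (w t) / (of_real t - \<i> * of_real y))"
          using eventually_gt_at_top[of 0]
        proof eventually_elim
          case (elim y)
          then have "of_real t - \<i> * of_real y = of_real y * (of_real (t / y) - \<i>)" by (simp add: field_simps)
          then show ?case using elim by simp
        qed
        from Lim_transform_eventually[OF l this]
        show "((\<lambda>y::real. \<i> * of_real y * (of_real (w t) / (of_real t - \<i> * of_real y))) \<longlongrightarrow> - complex_of_real (w t)) at_top" .
      qed
      show "\<forall>\<^sub>F y::real in at_top. AE t in \<rho>. norm (\<i> * of_real y * (of_real (w t) / (of_real t - \<i> * of_real y))) \<le> w t"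
        using eventually_gt_at_top[of 0]
      proof eventually_elim
        case (elim y)
        have "norm (\<i> * of_real y * (of_real (w t) / (of_real t - \<i> * of_real y))) \<le> w t" for t
        proof -
          have "y \<le> norm (of_real t - \<i> * of_real y)" using norm_diff_real_ge[of "\<i> * of_real y" t] elim by simp
          then have "y * (w t / norm (of_real t - \<i> * of_real y)) \<le> w t"
            using wpos[of t] elim by (simp add: divide_le_eq mult.commute mult_left_mono)
          then show ?thesis using wpos[of t] elim by (simp add: norm_mult norm_divide)
        qed
        then show ?case by simp
      qed
      show "(\<lambda>t. \<i> * of_real y * (of_real (w t) / (of_real t - \<i> * of_real y))) \<in> borel_measurable \<rho>" for y
        by (intro borel_measurable_times borel_measurable_const cauchy_tr_measurable[OF sets wi])
    qed (use wi in auto)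
    moreover have "(LINT t|\<rho>. \<i> * of_real y * (of_real (w t) / (of_real t - \<i> * of_real y))) = \<i> * of_real y * cauchy_tr \<rho> w (\<i> * of_real y)" for y
      unfolding cauchy_tr_def by (rule integral_mult_right_zero)
    moreover have "(LINT t|\<rho>. - complex_of_real (w t)) = - of_real \<nu>" by (simp add: \<nu>_def)
    ultimately show ?thesis by (simp only:)
  qed
  show ?thesis
  proof (cases "A = 0")
    case True
    have "((\<lambda>y::real. of_real ((y\<^sup>2 - 1) / y\<^sup>2) * (\<i> * of_real y * cauchy_tr \<rho> w (\<i> * of_real y))) \<longlongrightarrow> of_real 1 * (- of_real \<nu>)) at_top"
    proof (intro tendsto_mult tendsto_of_real yC)
      show "((\<lambda>y::real. (y\<^sup>2 - 1) / y\<^sup>2) \<longlongrightarrow> 1) at_top" by real_asymp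
    qed
    moreover have "\<forall>\<^sub>F y in at_top. of_real ((y\<^sup>2 - 1) / y\<^sup>2) * (\<i> * of_real y * cauchy_tr \<rho> w (\<i> * of_real y)) = M1 (\<i> * of_real y) / (\<i> * of_real y)"
      using eventually_gt_at_top[of 0]
    proof eventually_elim
      case (elim y)
      have "(Y\<^sup>2 - 1) / Y\<^sup>2 * (\<i> * Y * C) = (1 + (\<i> * Y)\<^sup>2) * C / (\<i> * Y)" if "Y \<noteq> 0" for Y C :: complex
        using that by (simp add: field_simps power2_eq_square)
      from this[of "of_real y" "cauchy_tr \<rho> w (\<i> * of_real y)"] elim
      show ?case unfolding M1_def N[OF nonreal[OF elim]] by (simp add: True k1)
    qed
    ultimately have "((\<lambda>y::real. M1 (\<i> * of_real y) / (\<i> * of_real y)) \<longlongrightarrow> of_real (- \<nu>)) at_top"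
      using Lim_transform_eventually[of "\<lambda>y. of_real ((y\<^sup>2 - 1) / y\<^sup>2) * (\<i> * of_real y * cauchy_tr \<rho> w (\<i> * of_real y))"] by simp
    then show ?thesis unfolding gen_pole_nonpos_type_infinity_def using \<nu> by (intro disjI2 exI[of _ "- \<nu>"]) simp
  next
    case A: False
    have "((\<lambda>y::real. of_real (1 / y) * (- \<i>) * (\<i> * of_real y * cauchy_tr \<rho> w (\<i> * of_real y))) \<longlongrightarrow> of_real 0 * (- \<i>) * (- of_real \<nu>)) at_top"
    proof (intro tendsto_mult tendsto_of_real tendsto_const yC)
      show "((\<lambda>y::real. 1 / y) \<longlongrightarrow> 0) at_top" by real_asymp
    qed
    from tendsto_norm[OF tendsto_diff[OF this tendsto_const[of A]]] have lim: "((\<lambda>y::real. norm (of_real (1 / y) * (- \<i>) * (\<i> * of_real y * cauchy_tr \<rho> w (\<i> * of_real y)) - A)) \<longlongrightarrow> norm A) at_top"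
      by simp
    have Apos: "norm A > 0" using A by simp
    have inf: "filterlim (\<lambda>y::real. (y\<^sup>2 - 1) / y) at_top at_top" by real_asymp
    have fl: "filterlim (\<lambda>y::real. norm (of_real (1 / y) * (- \<i>) * (\<i> * of_real y * cauchy_tr \<rho> w (\<i> * of_real y)) - A) * ((y\<^sup>2 - 1) / y)) at_top at_top"
      by (rule filterlim_tendsto_pos_mult_at_top[OF lim Apos inf])
    have ev: "\<forall>\<^sub>F y in at_top. norm (of_real (1 / y) * (- \<i>) * (\<i> * of_real y * cauchy_tr \<rho> w (\<i> * of_real y)) - A) * ((y\<^sup>2 - 1) / y) = norm (M1 (\<i> * of_real y)) / y"
      using eventually_ge_at_top[of 1]
    proof eventually_elim
      case (elim y)
      then have "y > 0" by simp
      have "of_real (1 / y) * (- \<i>) * (\<i> * of_real y * cauchy_tr \<rho> w (\<i> * of_real y)) - A = N (\<i> * of_real y)"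
        unfolding N[OF nonreal[OF \<open>y > 0\<close>]] using \<open>y > 0\<close> by (simp add: field_simps)
      then show ?case unfolding norm_M1_imaginary[OF elim] by (simp add: k1)
    qed
    have "filterlim (\<lambda>y::real. norm (M1 (\<i> * of_real y)) / y) at_top at_top"
      by (rule iffD1[OF filterlim_cong[OF refl refl ev] fl])
    then show ?thesis unfolding gen_pole_nonpos_type_infinity_def using Limsup_infinityI by blast
  qed
qed (simp add: gen_pole_nonpos_type_infinity_def)

text \<open>The index is the largest number of negative eigenvalues over all admissible lists; it is
  attained because these numbers are bounded by k.\<close>

lemma M1_in_N_class_infinity: "\<exists>\<kappa>\<le>k. M1 \<in> N_class_infinity \<kappa>"
proof -
  define V where "V = {num_neg_eigenvalues (nevanlinna_matrix M1 zs) | zs. admissible_points M1 zs}"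
  have Vk: "v \<le> k" if "v \<in> V" for v using that num_neg_eigenvalues_M1 by (auto simp: V_def)
  have fV: "finite V" using Vk by (intro finite_subset[of V "{..k}"]) auto
  have "admissible_points M1 []" by (simp add: admissible_points_def)
  then have neV: "V \<noteq> {}" by (auto simp: V_def)
  define \<kappa> where "\<kappa> = Max V"
  have \<kappa>V: "\<kappa> \<in> V" unfolding \<kappa>_def by (rule Max_in[OF fV neV])
  have mer: "M1 meromorphic_on - \<real>"
    by (intro analytic_on_imp_meromorphic_on) (simp add: analytic_on_open[OF open_nonreal] M1_holomorphic)
  have N: "M1 \<in> N_class \<kappa>"
    unfolding N_class_def
  proof (intro CollectI conjI mer ballI allI impI)
    fix z assume "z \<in> holomorphy_domain M1"
    then show "M1 z = cnj (M1 (cnj z))" by (simp add: holomorphy_domain_M1 M1_cnj)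
  next
    fix zs assume "admissible_points M1 zs"
    then show "num_neg_eigenvalues (nevanlinna_matrix M1 zs) \<le> \<kappa>"
      unfolding \<kappa>_def by (intro Max_ge[OF fV]) (auto simp: V_def)
  next
    show "\<exists>zs. admissible_points M1 zs \<and> num_neg_eigenvalues (nevanlinna_matrix M1 zs) = \<kappa>"
      using \<kappa>V by (auto simp: V_def)
  qed
  have "M1 \<in> N_class_infinity \<kappa>"
  proof (cases "\<kappa> = 0")
    case False
    \<comment> \<open>A positive index excludes the null measure, and with it the only case in which
      \<open>c1\<close> vanishes and infinity is not a generalized pole.\<close>
    have "\<exists>z\<in>-\<real>. M1 z \<noteq> 0"
    proof (rule ccontr)
      assume "\<not> ?thesis"
      then have 0: "M1 z = 0" if "z \<in> - \<real>" for z using that by blast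
      have "num_neg_eigenvalues (nevanlinna_matrix M1 zs) \<le> 0" if "admissible_points M1 zs" for zs
      proof (rule nevanlinna_matrix_M1[OF that])
        fix c :: "nat \<Rightarrow> complex"
        have "(\<Sum>i<length zs. \<Sum>j<length zs. cnj (c i) * ((M1 (zs ! i) - cnj (M1 (zs ! j))) / (zs ! i - cnj (zs ! j))) * c j) = 0"
          using 0 admissible_pointsD(1)[OF that] by (intro sum.neutral ballI) auto
        then show "0 \<le> Re (\<Sum>i<length zs. \<Sum>j<length zs. cnj (c i) * ((M1 (zs ! i) - cnj (M1 (zs ! j))) / (zs ! i - cnj (zs ! j))) * c j)" by simp
      qed
      then show False using \<kappa>V False by (auto simp: V_def)
    qed
    then have "c1 > 0" by (rule c1_pos)
    then have "gen_pole_nonpos_type_infinity M1"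
      using k generalized_pole_at_infinity_1 generalized_pole_at_infinity_ge_2 by (cases "k = 1") auto
    then show ?thesis unfolding N_class_infinity_def
      using False N no_finite_pole not_is_pole_holomorphic[OF open_nonreal _ M1_holomorphic] by auto
  next
    case True
    then show ?thesis using N by (simp add: N_class_infinity_def)
  qed
  then show ?thesis using Vk[OF \<kappa>V] by blast
qed

end

section \<open>Application to the singular Weyl function\<close>

context weyl_setting
begin

text \<open>At a real parameter t the pair comes from phi if phi (t, x) is nonzero; otherwise from
  phi', which is then nonzero because the Wronskian with theta is 1.\<close>

lemma weyl_measureI:
  assumes sets: "sets \<rho> = sets borel" and fin: "\<And>s t. emeasure \<rho> {s..t} < \<infinity>"
    and inversion: "\<And>s t. s < t \<Longrightarrow> ((\<lambda>\<epsilon>. 1 / pi * integral {s..t} (\<lambda>x. Im (M (Complex x \<epsilon>)))) \<longlongrightarrow>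
       1 / 2 * (measure \<rho> {s<..<t} + measure \<rho> {s..t})) (at_right 0)"
  shows "weyl_measure \<rho> M"
proof
  show "M holomorphic_on - \<real>" using M by (simp add: singular_weyl_function_def)
  show "M (cnj z) = cnj (M z)" if "z \<in> - \<real>" for z using M_cnj[of z] that by simp
  fix t
  obtain x where x: "x \<in> I" by (rule I_nonempty)
  note re = real_entire[OF \<phi>_sol x] real_entire[OF \<theta>_entire x]
  have W: "\<theta> (of_real t) x * dx (\<phi> (of_real t)) x - dx (\<theta> (of_real t)) x * \<phi> (of_real t) x = 1"
    using W\<theta>\<phi>[OF x, of "of_real t"] by (simp add: wronskian_def)
  show "\<exists>A B. real_entire_fun A \<and> real_entire_fun B \<and> B (of_real t) \<noteq> 0 \<and> (\<forall>z. Im z > 0 \<longrightarrow> Im (A z + (B z)\<^sup>2 * M z) \<ge> 0)"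
  proof (cases "\<phi> (of_real t) x = 0")
    case False
    show ?thesis
    proof (rule exI[of _ "\<lambda>z. \<theta> z x * \<phi> z x"], rule exI[of _ "\<lambda>z. \<phi> z x"], intro conjI allI impI)
      show "real_entire_fun (\<lambda>z. \<theta> z x * \<phi> z x)" "real_entire_fun (\<lambda>z. \<phi> z x)"
        unfolding real_entire_fun_def using re by (auto intro!: holomorphic_intros)
      fix z :: complex assume "Im z > 0"
      from herglotz(1)[OF x this] show "Im (\<theta> z x * \<phi> z x + (\<phi> z x)\<^sup>2 * M z) \<ge> 0"
        by (simp only: algebra_simps power2_eq_square)
    qed (use False in auto)
  next
    case True
    show ?thesis
    proof (rule exI[of _ "\<lambda>z. dx (\<theta> z) x * dx (\<phi> z) x"], rule exI[of _ "\<lambda>z. dx (\<phi> z) x"], intro conjI allI impI)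
      show "real_entire_fun (\<lambda>z. dx (\<theta> z) x * dx (\<phi> z) x)" "real_entire_fun (\<lambda>z. dx (\<phi> z) x)"
        unfolding real_entire_fun_def using re by (auto intro!: holomorphic_intros)
      fix z :: complex assume "Im z > 0"
      from herglotz(2)[OF x this] show "Im (dx (\<theta> z) x * dx (\<phi> z) x + (dx (\<phi> z) x)\<^sup>2 * M z) \<ge> 0"
        by (simp only: algebra_simps power2_eq_square)
    qed (use W True in auto)
  qed
qed (use assms in auto)

text \<open>Both squares, of phi and of phi', are integrable after division by 1 + t^2; their sum
  decays no faster than a power -(l + 1) of the modulus of t. The condition l + 1 \<le> 2 k lets (1
  + t^2)^k dominate that power, leaving exactly the divisor 1 + t^2.\<close>

lemma weyl_growthI:
  assumes "weyl_measure \<rho> M" and as: "phi_asymptotics l b \<phi>" and k: "l + 1 \<le> 2 * real k" "k \<ge> 1"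
  shows "weyl_growth \<rho> M k"
proof -
  interpret weyl_measure \<rho> M by fact
  obtain x where x: "x \<in> I" by (rule I_nonempty)
  obtain T where T: "T \<ge> 1" "\<And>t::real. \<bar>t\<bar> \<ge> T \<Longrightarrow>
      \<bar>t\<bar> powr (- (l + 1)) / 16 \<le> (norm (\<phi> (of_real t) x))\<^sup>2 + (norm (dx (\<phi> (of_real t)) x))\<^sup>2"
    using phi_asymptotics_lower_bound[OF as x] l by auto
  note re = real_entire[OF \<phi>_sol x] real_entire[OF \<theta>_entire x]
  have ref: "real_entire_fun (\<lambda>z. \<theta> z x * \<phi> z x)" "real_entire_fun (\<lambda>z. \<phi> z x)"
      "real_entire_fun (\<lambda>z. dx (\<theta> z) x * dx (\<phi> z) x)" "real_entire_fun (\<lambda>z. dx (\<phi> z) x)"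
    unfolding real_entire_fun_def using re by (auto intro!: holomorphic_intros)
  have i1: "integrable \<rho> (\<lambda>t. (Re (\<phi> (of_real t) x))\<^sup>2 / (1 + t\<^sup>2))"
  proof (rule weighted_integrable[OF ref(1,2)])
    fix z :: complex assume "Im z > 0"
    from herglotz(1)[OF x this] show "Im (\<theta> z x * \<phi> z x + (\<phi> z x)\<^sup>2 * M z) \<ge> 0"
      by (simp only: algebra_simps power2_eq_square)
  qed
  have i2: "integrable \<rho> (\<lambda>t. (Re (dx (\<phi> (of_real t)) x))\<^sup>2 / (1 + t\<^sup>2))"
  proof (rule weighted_integrable[OF ref(3,4)])
    fix z :: complex assume "Im z > 0"
    from herglotz(2)[OF x this] show "Im (dx (\<theta> z) x * dx (\<phi> z) x + (dx (\<phi> z) x)\<^sup>2 * M z) \<ge> 0"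
      by (simp only: algebra_simps power2_eq_square)
  qed
  define P where "P = (\<lambda>t. (Re (\<phi> (of_real t) x))\<^sup>2)"
  define Q where "Q = (\<lambda>t. (Re (dx (\<phi> (of_real t)) x))\<^sup>2)"
  \<comment> \<open>The indicator covers the bounded set where the asymptotics give no information;
    16 undoes the constant of the lower bound.\<close>
  define h where "h = (\<lambda>t. indicator {- T..T} t + 16 * (P t / (1 + t\<^sup>2) + Q t / (1 + t\<^sup>2)))"
  have hi: "integrable \<rho> h" unfolding h_def P_def Q_def
    by (intro Bochner_Integration.integrable_add integrable_mult_right i1 i2 integrable_real_indicator) (use fin sets in auto)
  have nonneg: "P t / (1 + t\<^sup>2) + Q t / (1 + t\<^sup>2) \<ge> 0" for t by (simp add: P_def Q_def)
  have le: "1 / (1 + t\<^sup>2) ^ (k + 1) \<le> h t" for t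
  proof (cases "\<bar>t\<bar> \<le> T")
    case True
    have "(1 + t\<^sup>2) ^ (k + 1) \<ge> 1" by (rule one_le_power) simp
    then have "1 / (1 + t\<^sup>2) ^ (k + 1) \<le> 1" by simp
    then show ?thesis using True nonneg[of t] by (simp add: h_def indicator_def abs_le_iff)
  next
    case False
    then have t1: "\<bar>t\<bar> \<ge> 1" "\<bar>t\<bar> \<ge> T" using T(1) by auto
    have "\<bar>t\<bar> powr (l + 1) \<le> \<bar>t\<bar> powr real (2 * k)" using t1 k(1) by (intro powr_mono) auto
    also have "\<dots> = (t\<^sup>2) ^ k" using t1 by (subst powr_realpow) (auto simp: power_mult)
    also have "\<dots> \<le> (1 + t\<^sup>2) ^ k" by (intro power_mono) auto
    finally have "1 / (1 + t\<^sup>2) ^ k \<le> \<bar>t\<bar> powr (- (l + 1))"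
      using t1 unfolding powr_minus_divide by (intro divide_left_mono) (auto simp: add_pos_nonneg)
    also have "\<bar>t\<bar> powr (- (l + 1)) \<le> 16 * (P t + Q t)"
    proof -
      have "norm (B (of_real t)) = \<bar>Re (B (of_real t))\<bar>" if "real_entire_fun B" for B
        using real_entire_fun_real[OF that, of t] by (metis norm_of_real)
      from this[OF ref(2)] this[OF ref(4)] show ?thesis using T(2)[OF t1(2)] by (simp add: P_def Q_def)
    qed
    finally have "1 / (1 + t\<^sup>2) ^ k / (1 + t\<^sup>2) \<le> 16 * (P t + Q t) / (1 + t\<^sup>2)" by (intro divide_right_mono) auto
    also have "\<dots> = 16 * (P t / (1 + t\<^sup>2) + Q t / (1 + t\<^sup>2))" by (simp add: add_divide_distrib)
    also have "\<dots> \<le> h t" by (simp add: h_def)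
    finally show ?thesis by (simp add: mult.commute)
  qed
  have "(1 + t\<^sup>2) ^ (k + 1) \<noteq> 0" for t :: real
  proof -
    have "1 + t\<^sup>2 > 0" by (simp add: add_pos_nonneg)
    then show ?thesis by simp
  qed
  then have meas: "(\<lambda>t. 1 / (1 + t\<^sup>2) ^ (k + 1)) \<in> borel_measurable \<rho>"
    by (intro continuous_measurable[OF sets hi] continuous_intros) auto
  show ?thesis
  proof
    show "integrable \<rho> (\<lambda>t. 1 / (1 + t\<^sup>2) ^ (k + 1))"
    proof (rule Bochner_Integration.integrable_bound[OF hi meas], rule AE_I2)
      fix t :: real
      have "1 / (1 + t\<^sup>2) ^ (k + 1) \<ge> 0" by simp
      then show "norm (1 / (1 + t\<^sup>2) ^ (k + 1)) \<le> norm (h t)" using le[of t] by simp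
    qed
  qed fact
qed

lemma shifted_second_solution:
  assumes F: "real_entire_fun F"
  defines "\<theta>' \<equiv> \<lambda>z x. \<theta> z x - F z * \<phi> z x"
  shows "second_solution l b q \<phi> \<theta>'"
proof -
  have lc: "\<theta>' z = (\<lambda>x. 1 * \<theta> z x + (- F z) * \<phi> z x)" for z by (simp add: \<theta>'_def)
  have dx': "dx (\<theta>' z) x = dx (\<theta> z) x - F z * dx (\<phi> z) x" if "x \<in> I" for z x
    using sl_solution_lincomb(2)[OF \<theta>_eig[of z] \<phi>_eig[of z] that, of 1 "- F z"] unfolding lc by simp
  have "eigsol I V z (\<theta>' z)" for z unfolding lc by (rule sl_solution_lincomb(1)[OF \<theta>_eig \<phi>_eig])
  then have "solution l b q z (\<theta>' z)" for z by (simp add: solution_iff_eigsol[OF q])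
  moreover have "(\<lambda>z. \<theta>' z x) holomorphic_on UNIV" if x: "x \<in> I" for x
    unfolding \<theta>'_def using F real_entire(1)[OF \<phi>_sol x] real_entire(1)[OF \<theta>_entire x]
    by (intro holomorphic_intros) (auto simp: real_entire_fun_def)
  moreover have "\<theta>' z x \<in> \<real>" if x: "x \<in> I" and z: "z \<in> \<real>" for z x
  proof -
    have "cnj z = z" using z by (simp add: Reals_cnj_iff)
    then have "cnj (F z) = F z" using F unfolding real_entire_fun_def by metis
    moreover have "\<phi> z x \<in> \<real>" "\<theta> z x \<in> \<real>" using \<phi>_sol \<theta>_entire x z by (auto simp: real_entire_solution_def)
    ultimately show ?thesis unfolding \<theta>'_def by (auto simp: Reals_cnj_iff)
  qed
  moreover have "wronskian (\<theta>' z) (\<phi> z) x = 1" if "x \<in> I" for z x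
    using W\<theta>\<phi>[OF that, of z] unfolding wronskian_def dx'[OF that] by (simp add: \<theta>'_def algebra_simps)
  ultimately show ?thesis by (simp add: second_solution_def real_entire_solution_def)
qed

end

theorem theorem8p2:
  fixes l :: real and b :: ereal and q v :: "real \<Rightarrow> real"
    and \<phi> :: "complex \<Rightarrow> real \<Rightarrow> complex" and \<rho> :: "real measure" and k :: nat
  assumes "l \<ge> -1/2" and "0 < b"
    and "potential_ok l q"
    and "boundary_datum_at_b l b q v"
    and "real_entire_solution l b q \<phi>"
    and "\<And>z. in_domain_near_0 l b (\<phi> z)"
    and "phi_asymptotics l b \<phi>"
    and "spectral_measure l b q v \<phi> \<rho>"
    and "k = nat \<lceil>(l + 1) / 2\<rceil>"
  shows "\<exists>\<theta> M.
      second_solution l b q \<phi> \<theta> \<and>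
      singular_weyl_function l b q v \<phi> \<theta> M \<and>
      (\<forall>z \<in> - \<real>.
         integrable \<rho> (\<lambda>t. (1 / (of_real t - z) - of_real (t / (1 + t\<^sup>2))) / of_real ((1 + t\<^sup>2) ^ k)) \<and>
         M z = (1 + z\<^sup>2) ^ k *
           (LINT t|\<rho>. (1 / (of_real t - z) - of_real (t / (1 + t\<^sup>2))) / of_real ((1 + t\<^sup>2) ^ k))) \<and>
      (\<exists>\<kappa> \<le> k. M \<in> N_class_infinity \<kappa>)"
proof -
  have sm: "sets \<rho> = sets borel" "\<And>s t. emeasure \<rho> {s..t} < \<infinity>"
    using assms(8) unfolding spectral_measure_def by auto
  obtain \<theta> M where \<theta>: "second_solution l b q \<phi> \<theta>" and M: "singular_weyl_function l b q v \<phi> \<theta> M"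
    and inv: "\<And>s t. s < t \<Longrightarrow> ((\<lambda>\<epsilon>. 1 / pi * integral {s..t} (\<lambda>x. Im (M (Complex x \<epsilon>)))) \<longlongrightarrow>
       1 / 2 * (measure \<rho> {s<..<t} + measure \<rho> {s..t})) (at_right 0)"
    using assms(8) unfolding spectral_measure_def by blast
  interpret weyl_setting l b q v \<phi> \<theta> M
    by unfold_locales (use assms \<theta> M in auto)
  have "(l + 1) / 2 > 0" using assms(1) by simp
  then have "k \<ge> 1" unfolding assms(9) by linarith
  moreover have "(l + 1) / 2 \<le> real k" unfolding assms(9) by (rule real_nat_ceiling_ge)
  ultimately have k: "l + 1 \<le> 2 * real k" "k \<ge> 1" by auto
  interpret weyl_growth \<rho> M k
    by (rule weyl_growthI[OF weyl_measureI[OF sm inv] assms(7) k])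
  obtain F where F: "real_entire_fun F" "\<And>z. z \<in> - \<real> \<Longrightarrow> F z = M1 z - M z" using M1_minus_M_entire by blast
  \<comment> \<open>The shift by F phi is compensated by passing from M to \<open>M1\<close>: the
    Weyl solution stays the same function, so the condition at b carries over unchanged.\<close>
  define \<theta>' where "\<theta>' = (\<lambda>z x. \<theta> z x - F z * \<phi> z x)"
  have eq: "\<theta>' z x + M1 z * \<phi> z x = \<theta> z x + M z * \<phi> z x" if "z \<in> - \<real>" for z x
    by (simp add: \<theta>'_def F(2)[OF that] algebra_simps)
  have "singular_weyl_function l b q v \<phi> \<theta>' M1"
    using M M1_holomorphic by (simp add: singular_weyl_function_def eq)
  moreover have "second_solution l b q \<phi> \<theta>'"
    unfolding \<theta>'_def by (rule shifted_second_solution[OF F(1)])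
  moreover have "integrable \<rho> (\<lambda>t. (1 / (of_real t - z) - of_real (t / (1 + t\<^sup>2))) / of_real ((1 + t\<^sup>2) ^ k)) \<and>
      M1 z = (1 + z\<^sup>2) ^ k * (LINT t|\<rho>. (1 / (of_real t - z) - of_real (t / (1 + t\<^sup>2))) / of_real ((1 + t\<^sup>2) ^ k))"
    if "z \<in> - \<real>" for z
    using kern_integrable[OF that] unfolding M1_def N_def kern_def[abs_def] by simp
  ultimately show ?thesis using M1_in_N_class_infinity by blast
qed

end
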